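(* Let $(R,\mathfrak{m})$ be a G-regular local ring and let $S=R/\underline{x}R$, where $\underline{x}=x_1,\dots,x_n\subseteq\mathfrak{m}$ is an $R$-regular sequence. If $M$ is a finitely generated $S$-module, then $$\mathsf{red}\text{-}\mathsf{G}\text{-}\mathsf{dim}_S(M)\le \mathsf{red}\text{-}\mathsf{pd}_S(M)\le \mathsf{red}\text{-}\mathsf{G}\text{-}\mathsf{dim}_S(M)+n.$$ So, for each finitely generated $S$-module $N$, one has $\mathsf{red}\text{-}\mathsf{pd}_S(N)<\infty$ if and only if $\mathsf{red}\text{-}\mathsf{G}\text{-}\mathsf{dim}_S(N)<\infty$.
   Context: All local rings are commutative and Noetherian, and all modules are finitely generated. For a module $M$ over a local ring $R$ and $n\ge 0$, $\Omega_R^nM$ denotes the $n$-th syzygy of $M$ in its minimal free resolution ($\Omega^0_RM=M$). $\mathsf{pd}$ denotes projective dimension and $\mathsf{G}\text{-}\mathsf{dim}$ denotes (Auslander-Bridger) Gorenstein dimension. A local ring $R$ is G-regular if, for each $R$-module $M$, $\mathsf{G}\text{-}\mathsf{dim}_R(M)<\infty$ if and only if $\mathsf{pd}_R(M)<\infty$. Reducing dimensions: let $\mathbb{I}$ be $\mathsf{pd}$ or $\mathsf{G}\text{-}\mathsf{dim}$ and let $M$ be a module over a local ring $R$. A reducing $\mathbb{I}$-sequence of $M$ is a sequence of $R$-modules $\{K_0,\dots,K_r\}$ with $r\ge 1$, $K_0=M$, and $\mathbb{I}_R(K_r)<\infty$, such that for each $i=1,\dots,r$ there are integers $a_i\ge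 1$, $b_i\ge 1$, $n_i\ge 0$ and a short exact sequence of $R$-modules $0\to K_{i-1}^{\oplus a_i}\to K_i\to (\Omega_R^{n_i}K_{i-1})^{\oplus b_i}\to 0$. Set $\mathsf{red}\text{-}\mathbb{I}_R(M)=0$ if and only if $\mathbb{I}_R(M)<\infty$; if $\mathbb{I}_R(M)=\infty$, then $\mathsf{red}\text{-}\mathbb{I}_R(M)$ is the infimum of all $r$ for which a reducing $\mathbb{I}$-sequence $\{K_0,\dots,K_r\}$ of $M$ exists ($\infty$ if none exists). This gives $\mathsf{red}\text{-}\mathsf{pd}$ and $\mathsf{red}\text{-}\mathsf{G}\text{-}\mathsf{dim}$. *)

theory Defs
  imports "HOL-Algebra.Algebra" "HOL-Library.Extended_Nat"
begin

text \<open>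
  Modules are records of type \<open>('a, 'b) module\<close> of which only the fields \<open>carrier\<close>, \<open>zero\<close>, \<open>add\<close>
  and \<open>smult\<close> matter; \<open>mult\<close> and \<open>one\<close> are inherited from the ring record and carry no meaning.

  HOL cannot quantify over types inside a formula.  A finitely generated module over a ring with
  elements of type \<open>'a\<close> is isomorphic to a quotient of some \<open>R\<^sup>n\<close>, whose elements are cosets of
  functions \<open>nat \<Rightarrow> 'a\<close>.  Wherever a definition below quantifies over finitely generated modules,
  they are therefore taken with elements of type \<open>(nat \<Rightarrow> 'a) set\<close>, which reaches every
  isomorphism class.
\<close>

type_synonym 'a fgmod = "('a, (nat \<Rightarrow> 'a) set) module"

definition mod_span :: "('a, 'r) ring_scheme \<Rightarrow> ('a, 'b, 'm) module_scheme \<Rightarrow> 'b set \<Rightarrow> 'b set" where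
  "mod_span R M A = \<Inter>{H. submodule H R M \<and> A \<subseteq> H}"

definition fg_module :: "('a, 'r) ring_scheme \<Rightarrow> ('a, 'b, 'm) module_scheme \<Rightarrow> bool" where
  "fg_module R M \<longleftrightarrow> module R M \<and> (\<exists>A \<subseteq> carrier M. finite A \<and> mod_span R M A = carrier M)"

definition mod_hom ::
  "('a, 'r) ring_scheme \<Rightarrow> ('a, 'b, 'm) module_scheme \<Rightarrow> ('a, 'c, 'n) module_scheme \<Rightarrow> ('b \<Rightarrow> 'c) set"
where
  "mod_hom R M N = {h \<in> carrier M \<rightarrow> carrier N.
     (\<forall>x \<in> carrier M. \<forall>y \<in> carrier M. h (x \<oplus>\<^bsub>M\<^esub> y) = h x \<oplus>\<^bsub>N\<^esub> h y) \<and>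
     (\<forall>r \<in> carrier R. \<forall>x \<in> carrier M. h (r \<odot>\<^bsub>M\<^esub> x) = r \<odot>\<^bsub>N\<^esub> h x)}"

definition mod_iso ::
  "('a, 'r) ring_scheme \<Rightarrow> ('a, 'b, 'm) module_scheme \<Rightarrow> ('a, 'c, 'n) module_scheme \<Rightarrow> ('b \<Rightarrow> 'c) set"
where
  "mod_iso R M N = {h \<in> mod_hom R M N. bij_betw h (carrier M) (carrier N)}"

definition isomorphic_modules ::
  "('a, 'r) ring_scheme \<Rightarrow> ('a, 'b, 'm) module_scheme \<Rightarrow> ('a, 'c, 'n) module_scheme \<Rightarrow> bool"
where
  "isomorphic_modules R M N \<longleftrightarrow> mod_iso R M N \<noteq> {}"

definition short_exact ::
  "('a, 'r) ring_scheme \<Rightarrow> ('a, 'b, 'm) module_scheme \<Rightarrow> ('a, 'c, 'n) module_scheme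
    \<Rightarrow> ('a, 'd, 'o) module_scheme \<Rightarrow> bool"
where
  "short_exact R A B C \<longleftrightarrow> (\<exists>f \<in> mod_hom R A B. \<exists>g \<in> mod_hom R B C.
     inj_on f (carrier A) \<and> f ` carrier A = a_kernel B C g \<and> g ` carrier B = carrier C)"

definition self_module :: "('a, 'r) ring_scheme \<Rightarrow> ('a, 'a) module" where
  "self_module R = \<lparr>carrier = carrier R, monoid.mult = (\<otimes>\<^bsub>R\<^esub>), one = \<one>\<^bsub>R\<^esub>, ring.zero = \<zero>\<^bsub>R\<^esub>, ring.add = (\<oplus>\<^bsub>R\<^esub>),
     smult = (\<otimes>\<^bsub>R\<^esub>)\<rparr>"

definition mod_power :: "('a, 'b, 'm) module_scheme \<Rightarrow> nat \<Rightarrow> ('a, nat \<Rightarrow> 'b) module" where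
  "mod_power M n = \<lparr>carrier = {..<n} \<rightarrow>\<^sub>E carrier M, monoid.mult = undefined, one = undefined,
     ring.zero = (\<lambda>i\<in>{..<n}. \<zero>\<^bsub>M\<^esub>),
     ring.add = (\<lambda>f g. \<lambda>i\<in>{..<n}. f i \<oplus>\<^bsub>M\<^esub> g i),
     smult = (\<lambda>r f. \<lambda>i\<in>{..<n}. r \<odot>\<^bsub>M\<^esub> f i)\<rparr>"

definition free_module :: "('a, 'r) ring_scheme \<Rightarrow> nat \<Rightarrow> ('a, nat \<Rightarrow> 'a) module" where
  "free_module R n = mod_power (self_module R) n"

definition hom_module ::
  "('a, 'r) ring_scheme \<Rightarrow> ('a, 'b, 'm) module_scheme \<Rightarrow> ('a, 'c, 'n) module_scheme
    \<Rightarrow> ('a, 'b \<Rightarrow> 'c) module"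
where
  "hom_module R M N = \<lparr>carrier = mod_hom R M N \<inter> extensional (carrier M),
     monoid.mult = undefined, one = undefined,
     ring.zero = (\<lambda>x\<in>carrier M. \<zero>\<^bsub>N\<^esub>),
     ring.add = (\<lambda>f g. \<lambda>x\<in>carrier M. f x \<oplus>\<^bsub>N\<^esub> g x),
     smult = (\<lambda>r f. \<lambda>x\<in>carrier M. r \<odot>\<^bsub>N\<^esub> f x)\<rparr>"

definition dual_module ::
  "('a, 'r) ring_scheme \<Rightarrow> ('a, 'b, 'm) module_scheme \<Rightarrow> ('a, 'b \<Rightarrow> 'a) module"
where
  "dual_module R M = hom_module R M (self_module R)"

text \<open>Exactness of \<open>\<dots> \<rightarrow> P\<^sub>2 \<rightarrow> P\<^sub>1 \<rightarrow> P\<^sub>0 \<rightarrow> M \<rightarrow> 0\<close>, where \<open>d i\<close> maps \<open>P (i+1)\<close> to \<open>P i\<close> and \<open>e\<close> is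
  the augmentation.\<close>

definition resolution ::
  "('a, 'r) ring_scheme \<Rightarrow> (nat \<Rightarrow> ('a, 'p) module) \<Rightarrow> (nat \<Rightarrow> 'p \<Rightarrow> 'p) \<Rightarrow> ('p \<Rightarrow> 'b)
    \<Rightarrow> ('a, 'b, 'm) module_scheme \<Rightarrow> bool"
where
  "resolution R P d e M \<longleftrightarrow>
     (\<forall>i. module R (P i)) \<and>
     e \<in> mod_hom R (P 0) M \<and>
     (\<forall>i. d i \<in> mod_hom R (P (Suc i)) (P i)) \<and>
     e ` carrier (P 0) = carrier M \<and>
     d 0 ` carrier (P 1) = a_kernel (P 0) M e \<and>
     (\<forall>i. d (Suc i) ` carrier (P (Suc (Suc i))) = a_kernel (P (Suc i)) (P i) (d i))"

definition free_resolution ::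
  "('a, 'r) ring_scheme \<Rightarrow> (nat \<Rightarrow> nat) \<Rightarrow> (nat \<Rightarrow> (nat \<Rightarrow> 'a) \<Rightarrow> (nat \<Rightarrow> 'a)) \<Rightarrow> ((nat \<Rightarrow> 'a) \<Rightarrow> 'b)
    \<Rightarrow> ('a, 'b, 'm) module_scheme \<Rightarrow> bool"
where
  "free_resolution R \<beta> d e M \<longleftrightarrow> resolution R (\<lambda>i. free_module R (\<beta> i)) d e M"

text \<open>The infimum of all \<open>n\<close> for which there is a resolution \<open>0 \<rightarrow> P\<^sub>n \<rightarrow> \<dots> \<rightarrow> P\<^sub>0 \<rightarrow> M \<rightarrow> 0\<close> with all
  \<open>P\<^sub>i\<close> in the class \<open>C\<close>.  In particular the zero module has dimension \<open>0\<close> here, not \<open>-\<infinity>\<close>.\<close>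

definition has_resolution_of_length ::
  "('a, 'r) ring_scheme \<Rightarrow> ('a fgmod \<Rightarrow> bool) \<Rightarrow> nat \<Rightarrow> ('a, 'b, 'm) module_scheme \<Rightarrow> bool"
where
  "has_resolution_of_length R C n M \<longleftrightarrow>
     (\<exists>P d e. resolution R P d e M \<and> (\<forall>i\<le>n. C (P i)) \<and> (\<forall>i>n. carrier (P i) = {\<zero>\<^bsub>P i\<^esub>}))"

definition resolution_dim ::
  "('a, 'r) ring_scheme \<Rightarrow> ('a fgmod \<Rightarrow> bool) \<Rightarrow> ('a, 'b, 'm) module_scheme \<Rightarrow> enat"
where
  "resolution_dim R C M = Inf {enat n | n. has_resolution_of_length R C n M}"

definition projective_module :: "('a, 'r) ring_scheme \<Rightarrow> ('a, 'b, 'm) module_scheme \<Rightarrow> bool" where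
  "projective_module R P \<longleftrightarrow> fg_module R P \<and>
     (\<forall>(A :: 'a fgmod) (B :: 'a fgmod). \<forall>g \<in> mod_hom R A B. \<forall>f \<in> mod_hom R P B.
        fg_module R A \<longrightarrow> fg_module R B \<longrightarrow> g ` carrier A = carrier B \<longrightarrow>
        (\<exists>h \<in> mod_hom R P A. \<forall>x \<in> carrier P. g (h x) = f x))"

definition pd :: "('a, 'r) ring_scheme \<Rightarrow> ('a, 'b, 'm) module_scheme \<Rightarrow> enat" where
  "pd R M = resolution_dim R (projective_module R) M"

text \<open>\<open>Ext\<^sup>k(M, N) = 0\<close> for \<open>k \<ge> 1\<close>: in \<open>Hom(F\<^sub>k\<^sub>-\<^sub>1, N) \<rightarrow> Hom(F\<^sub>k, N) \<rightarrow> Hom(F\<^sub>k\<^sub>+\<^sub>1, N)\<close> every cocycle is a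
  coboundary, for a resolution \<open>F\<close> of \<open>M\<close> by free modules of finite rank.\<close>

definition ext_vanishes ::
  "('a, 'r) ring_scheme \<Rightarrow> nat \<Rightarrow> ('a, 'b, 'm) module_scheme \<Rightarrow> ('a, 'c, 'n) module_scheme \<Rightarrow> bool"
where
  "ext_vanishes R k M N \<longleftrightarrow> (\<exists>\<beta> d e. free_resolution R \<beta> d e M \<and>
     (\<forall>f \<in> mod_hom R (free_module R (\<beta> k)) N.
        (\<forall>x \<in> carrier (free_module R (\<beta> (k + 1))). f (d k x) = \<zero>\<^bsub>N\<^esub>) \<longrightarrow>
        (\<exists>g \<in> mod_hom R (free_module R (\<beta> (k - 1))) N.
           \<forall>x \<in> carrier (free_module R (\<beta> k)). f x = g (d (k - 1) x))))"

definition biduality ::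
  "('a, 'r) ring_scheme \<Rightarrow> ('a, 'b, 'm) module_scheme \<Rightarrow> 'b \<Rightarrow> ('b \<Rightarrow> 'a) \<Rightarrow> 'a"
where
  "biduality R M x = (\<lambda>f \<in> carrier (dual_module R M). f x)"

definition totally_reflexive :: "('a, 'r) ring_scheme \<Rightarrow> ('a, 'b, 'm) module_scheme \<Rightarrow> bool" where
  "totally_reflexive R M \<longleftrightarrow> fg_module R M \<and>
     biduality R M \<in> mod_iso R M (dual_module R (dual_module R M)) \<and>
     (\<forall>k\<ge>1. ext_vanishes R k M (self_module R) \<and>
            ext_vanishes R k (dual_module R M) (self_module R))"

definition G_dim :: "('a, 'r) ring_scheme \<Rightarrow> ('a, 'b, 'm) module_scheme \<Rightarrow> enat" where
  "G_dim R M = resolution_dim R (totally_reflexive R) M"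

definition local_ring :: "('a, 'r) ring_scheme \<Rightarrow> bool" where
  "local_ring R \<longleftrightarrow> cring R \<and> noetherian_ring R \<and> (\<exists>!m. maximalideal m R)"

definition max_ideal :: "('a, 'r) ring_scheme \<Rightarrow> 'a set" where
  "max_ideal R = (THE m. maximalideal m R)"

definition G_regular :: "('a, 'r) ring_scheme \<Rightarrow> bool" where
  "G_regular R \<longleftrightarrow> local_ring R \<and>
     (\<forall>M :: 'a fgmod. fg_module R M \<longrightarrow> (G_dim R M < \<infinity> \<longleftrightarrow> pd R M < \<infinity>))"

definition ideal_times_module ::
  "('a, 'r) ring_scheme \<Rightarrow> 'a set \<Rightarrow> ('a, 'b, 'm) module_scheme \<Rightarrow> 'b set"
where
  "ideal_times_module R I M = mod_span R M {a \<odot>\<^bsub>M\<^esub> x | a x. a \<in> I \<and> x \<in> carrier M}"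

definition minimal_free_resolution ::
  "('a, 'r) ring_scheme \<Rightarrow> (nat \<Rightarrow> nat) \<Rightarrow> (nat \<Rightarrow> (nat \<Rightarrow> 'a) \<Rightarrow> (nat \<Rightarrow> 'a)) \<Rightarrow> ((nat \<Rightarrow> 'a) \<Rightarrow> 'b)
    \<Rightarrow> ('a, 'b, 'm) module_scheme \<Rightarrow> bool"
where
  "minimal_free_resolution R \<beta> d e M \<longleftrightarrow> free_resolution R \<beta> d e M \<and>
     (\<forall>i. d i ` carrier (free_module R (\<beta> (Suc i)))
            \<subseteq> ideal_times_module R (max_ideal R) (free_module R (\<beta> i)))"

text \<open>Syzygies are determined up to isomorphism only, so \<open>\<Omega>\<^sup>n M\<close> is rendered as the isomorphism class of
  \<open>M\<close> for \<open>n = 0\<close>, and of the image of \<open>F\<^sub>n \<rightarrow> F\<^sub>n\<^sub>-\<^sub>1\<close> for \<open>n \<ge> 1\<close>.\<close>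

definition is_syzygy ::
  "('a, 'r) ring_scheme \<Rightarrow> nat \<Rightarrow> ('a, 'b, 'm) module_scheme \<Rightarrow> ('a, 'c, 'n) module_scheme \<Rightarrow> bool"
where
  "is_syzygy R n M L \<longleftrightarrow> fg_module R L \<and>
     (case n of
        0 \<Rightarrow> isomorphic_modules R L M
      | Suc k \<Rightarrow> (\<exists>\<beta> d e. minimal_free_resolution R \<beta> d e M \<and>
          isomorphic_modules R L
            ((free_module R (\<beta> k))\<lparr>carrier := d k ` carrier (free_module R (\<beta> (Suc k)))\<rparr>)))"

definition reducing_sequence ::
  "('a, 'r) ring_scheme \<Rightarrow> ('a fgmod \<Rightarrow> enat) \<Rightarrow> nat \<Rightarrow> (nat \<Rightarrow> 'a fgmod) \<Rightarrow> bool"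
where
  "reducing_sequence R I r K \<longleftrightarrow> 1 \<le> r \<and> (\<forall>i\<le>r. fg_module R (K i)) \<and> I (K r) < \<infinity> \<and>
     (\<forall>i\<in>{1..r}. \<exists>a\<ge>1. \<exists>b\<ge>1. \<exists>n. \<exists>L :: 'a fgmod. is_syzygy R n (K (i - 1)) L \<and>
        short_exact R (mod_power (K (i - 1)) a) (K i) (mod_power L b))"

text \<open>The elements of \<open>M\<close> may have any type, hence \<open>K\<^sub>0 \<cong> M\<close> instead of \<open>K\<^sub>0 = M\<close>.\<close>

definition reducing_length ::
  "('a, 'r) ring_scheme \<Rightarrow> ('a fgmod \<Rightarrow> enat) \<Rightarrow> ('a, 'b, 'm) module_scheme \<Rightarrow> enat"
where
  "reducing_length R I M =
     Inf {enat r | r. \<exists>K. reducing_sequence R I r K \<and> isomorphic_modules R (K 0) M}"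

definition red_pd :: "('a, 'r) ring_scheme \<Rightarrow> ('a, 'b, 'm) module_scheme \<Rightarrow> enat" where
  "red_pd R M = (if pd R M < \<infinity> then 0 else reducing_length R (pd R) M)"

definition red_G_dim :: "('a, 'r) ring_scheme \<Rightarrow> ('a, 'b, 'm) module_scheme \<Rightarrow> enat" where
  "red_G_dim R M = (if G_dim R M < \<infinity> then 0 else reducing_length R (G_dim R) M)"

definition regular_sequence :: "('a, 'r) ring_scheme \<Rightarrow> 'a list \<Rightarrow> bool" where
  "regular_sequence R xs \<longleftrightarrow> set xs \<subseteq> carrier R \<and>
     (\<forall>i < length xs. let I = Idl\<^bsub>R\<^esub> (set (take i xs)); Q = R Quot I in
        \<forall>y \<in> carrier Q. (I +>\<^bsub>R\<^esub> xs ! i) \<otimes>\<^bsub>Q\<^esub> y = \<zero>\<^bsub>Q\<^esub> \<longrightarrow> y = \<zero>\<^bsub>Q\<^esub>) \<and>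
     Idl\<^bsub>R\<^esub> (set xs) \<noteq> carrier R"

end

theory Submission
  imports Defs
begin

text \<open>
  Put \<open>R\<^sub>j = R / (x\<^sub>1, \<dots>, x\<^sub>j)\<close>, so that \<open>S = R\<^sub>N\<close>.  A totally acyclic complex over \<open>R\<^sub>j\<^sub>+\<^sub>1\<close> lifts to free modules
  over \<open>R\<^sub>j\<close>; there the square of the differential is divisible by \<open>x\<^sub>j\<^sub>+\<^sub>1\<close>, and the quotient serves as a block of a totally
  acyclic complex over \<open>R\<^sub>j\<close> (as for matrix factorisations).  Descending to \<open>R\<close>, where the cokernels have
  finite projective dimension by G-regularity, one finds that every \<open>S\<close>-module of finite G-dimension has a finite free
  resolution over \<open>R\<close>.

  Let \<open>K\<close> be a module over \<open>R\<^sub>j\<^sub>+\<^sub>1\<close> and \<open>K'\<close> its first syzygy over \<open>R\<^sub>j\<close>.  Then \<open>x\<^sub>j\<^sub>+\<^sub>1\<close> is regular on \<open>K'\<close> and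
  there is an exact sequence \<open>0 \<rightarrow> K \<rightarrow> K' / x\<^sub>j\<^sub>+\<^sub>1 K' \<rightarrow> \<Omega>K \<rightarrow> 0\<close> over \<open>R\<^sub>j\<^sub>+\<^sub>1\<close>.  If \<open>x\<^sub>j\<^sub>+\<^sub>2, \<dots>, x\<^sub>N\<close> is regular
  on \<open>K\<close>, it stays exact over \<open>S\<close> and is a step of a reducing sequence, and \<open>x\<^sub>j\<^sub>+\<^sub>1, \<dots>, x\<^sub>N\<close> is regular on \<open>K'\<close>.
  Starting from an \<open>S\<close>-module of finite G-dimension one arrives after \<open>N\<close> steps at \<open>L / (x\<^sub>1, \<dots>, x\<^sub>N) L\<close>, where
  \<open>L\<close> has finite projective dimension over \<open>R\<close> and the sequence is regular on \<open>L\<close>; this has finite projective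
  dimension over \<open>S\<close>.
\<close>

text \<open>Forming R_{j+1} as a quotient of R_j would raise the type of the ring elements with
  every j, and an induction on j could not be stated. Hence only R and S occur as rings. A complex
  over R_j is a family of R-linear maps whose exactness is a congruence modulo I_j = (x_1, ...,
  x_j), and a module over R_j is a quotient R^b / V with I_j R^b contained in V; it reaches S
  through the base change, S^b modulo the image of V. Finite free resolutions over R serve as the
  invariant because they make sense for all these quotients at once and obey the two-out-of-three
  rule in short exact sequences. The presentations are kept minimal, that is, V lies in m R^b: then
  the image of V in S^b is the first syzygy of the base change in its minimal resolution. So each
  step of the reducing sequence uses one copy of each module and the first syzygy, and each x_j
  costs exactly one step, which is where the summand N of the bound comes from.\<close>

lemma (in module) smult_lcomm:
  "a \<in> carrier R \<Longrightarrow> b \<in> carrier R \<Longrightarrow> x \<in> carrier M \<Longrightarrow>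
    a \<odot>\<^bsub>M\<^esub> (b \<odot>\<^bsub>M\<^esub> x) = b \<odot>\<^bsub>M\<^esub> (a \<odot>\<^bsub>M\<^esub> x)"
  by (metis smult_assoc1 R.m_comm)

lemma (in module) a_inv_zero: "\<ominus>\<^bsub>M\<^esub> \<zero>\<^bsub>M\<^esub> = \<zero>\<^bsub>M\<^esub>"
  using M.minus_equality[of "\<zero>\<^bsub>M\<^esub>" "\<zero>\<^bsub>M\<^esub>"] by simp

text \<open>Registers the operations of a module with the method \<open>algebra\<close>, which then
  decides the many identities between sums, differences and scalar multiples below.\<close>

lemmas (in module) module_simprules
  [algebra module "ring.zero M" "ring.add M" "a_inv M" "a_minus M" "smult M"] =
  R.a_closed R.zero_closed R.a_inv_closed R.minus_closed R.m_closed R.one_closed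
  M.a_closed M.zero_closed M.a_inv_closed M.minus_closed smult_closed
  M.a_assoc M.l_zero M.l_neg M.a_comm M.minus_eq M.r_zero M.r_neg M.r_neg2 M.r_neg1
  M.minus_add M.minus_minus a_inv_zero M.a_lcomm
  smult_l_distr smult_r_distr smult_l_minus smult_r_minus smult_assoc1 smult_lcomm
  smult_r_null smult_l_null smult_one

lemma (in module) minus_eq_zero_iff:
  "x \<in> carrier M \<Longrightarrow> y \<in> carrier M \<Longrightarrow> x \<ominus>\<^bsub>M\<^esub> y = \<zero>\<^bsub>M\<^esub> \<longleftrightarrow> x = y"
  by (metis M.a_inv_closed M.minus_eq M.minus_equality M.minus_minus M.r_neg)

lemma (in module) add_diff_cancel:
  assumes "x \<in> carrier M" "y \<in> carrier M"
  shows "y \<oplus>\<^bsub>M\<^esub> (x \<ominus>\<^bsub>M\<^esub> y) = x" "(x \<ominus>\<^bsub>M\<^esub> y) \<oplus>\<^bsub>M\<^esub> y = x"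
  using assms by algebra+

lemma module_imp_cring: "module R M \<Longrightarrow> cring R"
  by (simp add: module_def)

text \<open>The module axioms are equations, or solved by the image of a solution, so they pass
  along any surjection that respects the operations. Nothing is presupposed about \<open>Q\<close>;
  this suits quotients, whose operations are defined by choosing representatives.\<close>

lemma module_homomorphic_image:
  fixes R (structure)
  assumes "module R M" and im: "q ` carrier M = carrier Q" and zero: "q \<zero>\<^bsub>M\<^esub> = \<zero>\<^bsub>Q\<^esub>"
    and add: "\<And>x y. x \<in> carrier M \<Longrightarrow> y \<in> carrier M \<Longrightarrow> q (x \<oplus>\<^bsub>M\<^esub> y) = q x \<oplus>\<^bsub>Q\<^esub> q y"
    and smult: "\<And>r x. r \<in> carrier R \<Longrightarrow> x \<in> carrier M \<Longrightarrow> q (r \<odot>\<^bsub>M\<^esub> x) = r \<odot>\<^bsub>Q\<^esub> q x"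
  shows "module R Q"
proof -
  interpret M: module R M by fact
  have mem: "\<exists>x \<in> carrier M. z = q x" if "z \<in> carrier Q" for z using that im by blast
  have cl: "q x \<in> carrier Q" if "x \<in> carrier M" for x using that im by blast
  show ?thesis
  proof (rule moduleI)
    show "cring R" by (rule M.R.cring_axioms)
    show "abelian_group Q"
    proof (rule abelian_groupI)
      show "\<zero>\<^bsub>Q\<^esub> \<in> carrier Q" using cl[OF M.M.zero_closed] zero by simp
    next
      fix x y assume "x \<in> carrier Q" "y \<in> carrier Q"
      then obtain x' y' where "x' \<in> carrier M" "x = q x'" "y' \<in> carrier M" "y = q y'"
        using mem by meson
      then show "x \<oplus>\<^bsub>Q\<^esub> y \<in> carrier Q" "x \<oplus>\<^bsub>Q\<^esub> y = y \<oplus>\<^bsub>Q\<^esub> x"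
        using add[of x' y'] add[of y' x'] cl[of "x' \<oplus>\<^bsub>M\<^esub> y'"] M.M.a_comm[of x' y'] by auto
    next
      fix x y z assume "x \<in> carrier Q" "y \<in> carrier Q" "z \<in> carrier Q"
      then obtain x' y' z' where *: "x' \<in> carrier M" "x = q x'" "y' \<in> carrier M" "y = q y'"
         "z' \<in> carrier M" "z = q z'" using mem by meson
      then show "(x \<oplus>\<^bsub>Q\<^esub> y) \<oplus>\<^bsub>Q\<^esub> z = x \<oplus>\<^bsub>Q\<^esub> (y \<oplus>\<^bsub>Q\<^esub> z)"
        using add[symmetric] M.M.a_assoc[of x' y' z'] by simp
    next
      fix x assume "x \<in> carrier Q"
      then obtain x' where x': "x' \<in> carrier M" "x = q x'" using mem by meson
      show "\<zero>\<^bsub>Q\<^esub> \<oplus>\<^bsub>Q\<^esub> x = x"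
        using add[of "\<zero>\<^bsub>M\<^esub>" x'] zero x' by simp
      show "\<exists>y \<in> carrier Q. y \<oplus>\<^bsub>Q\<^esub> x = \<zero>\<^bsub>Q\<^esub>"
        using x' add[of "\<ominus>\<^bsub>M\<^esub> x'" x'] zero cl[of "\<ominus>\<^bsub>M\<^esub> x'"] by (auto simp: M.M.l_neg)
    qed
  next
    fix a x assume a: "a \<in> carrier R" and "x \<in> carrier Q"
    then obtain x' where x': "x' \<in> carrier M" "x = q x'" using mem by meson
    show "a \<odot>\<^bsub>Q\<^esub> x \<in> carrier Q" using smult[OF a x'(1)] x' a cl by (metis M.smult_closed)
    fix y assume "y \<in> carrier Q"
    then obtain y' where y': "y' \<in> carrier M" "y = q y'" using mem by meson
    show "a \<odot>\<^bsub>Q\<^esub> (x \<oplus>\<^bsub>Q\<^esub> y) = a \<odot>\<^bsub>Q\<^esub> x \<oplus>\<^bsub>Q\<^esub> a \<odot>\<^bsub>Q\<^esub> y"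
      using x' y' a by (simp add: add[symmetric] smult[symmetric] M.smult_r_distr)
  next
    fix a b x assume ab: "a \<in> carrier R" "b \<in> carrier R" and "x \<in> carrier Q"
    then obtain x' where x': "x' \<in> carrier M" "x = q x'" using mem by meson
    show "(a \<oplus> b) \<odot>\<^bsub>Q\<^esub> x = (a \<odot>\<^bsub>Q\<^esub> x) \<oplus>\<^bsub>Q\<^esub> (b \<odot>\<^bsub>Q\<^esub> x)" "(a \<otimes> b) \<odot>\<^bsub>Q\<^esub> x = a \<odot>\<^bsub>Q\<^esub> (b \<odot>\<^bsub>Q\<^esub> x)"
      using x' ab by (simp_all add: add[symmetric] smult[symmetric] M.smult_l_distr M.smult_assoc1)
  next
    fix x assume "x \<in> carrier Q"
    then obtain x' where x': "x' \<in> carrier M" "x = q x'" using mem by meson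
    show "\<one> \<odot>\<^bsub>Q\<^esub> x = x" using x' by (simp add: smult[symmetric])
  qed
qed

subsection \<open>Homomorphisms\<close>

lemma mod_homI:
  assumes "\<And>x. x \<in> carrier M \<Longrightarrow> h x \<in> carrier N"
    and "\<And>x y. x \<in> carrier M \<Longrightarrow> y \<in> carrier M \<Longrightarrow> h (x \<oplus>\<^bsub>M\<^esub> y) = h x \<oplus>\<^bsub>N\<^esub> h y"
    and "\<And>r x. r \<in> carrier R \<Longrightarrow> x \<in> carrier M \<Longrightarrow> h (r \<odot>\<^bsub>M\<^esub> x) = r \<odot>\<^bsub>N\<^esub> h x"
  shows "h \<in> mod_hom R M N" using assms by (auto simp: mod_hom_def)

lemma mod_hom_closed: "h \<in> mod_hom R M N \<Longrightarrow> x \<in> carrier M \<Longrightarrow> h x \<in> carrier N"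
  and mod_hom_add: "h \<in> mod_hom R M N \<Longrightarrow> x \<in> carrier M \<Longrightarrow> y \<in> carrier M \<Longrightarrow>
    h (x \<oplus>\<^bsub>M\<^esub> y) = h x \<oplus>\<^bsub>N\<^esub> h y"
  and mod_hom_smult: "h \<in> mod_hom R M N \<Longrightarrow> r \<in> carrier R \<Longrightarrow> x \<in> carrier M \<Longrightarrow>
    h (r \<odot>\<^bsub>M\<^esub> x) = r \<odot>\<^bsub>N\<^esub> h x" by (auto simp: mod_hom_def)

lemma mod_hom_zero:
  assumes "module R M" "module R N" "h \<in> mod_hom R M N"
  shows "h \<zero>\<^bsub>M\<^esub> = \<zero>\<^bsub>N\<^esub>"
proof -
  interpret M: module R M by fact
  interpret N: module R N by fact
  have "h (\<zero>\<^bsub>R\<^esub> \<odot>\<^bsub>M\<^esub> \<zero>\<^bsub>M\<^esub>) = \<zero>\<^bsub>R\<^esub> \<odot>\<^bsub>N\<^esub> h \<zero>\<^bsub>M\<^esub>"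
    by (rule mod_hom_smult[OF assms(3)]) auto
  then show ?thesis using mod_hom_closed[OF assms(3) M.M.zero_closed] by simp
qed

lemma mod_hom_neg:
  assumes "module R M" "module R N" "h \<in> mod_hom R M N" "x \<in> carrier M"
  shows "h (\<ominus>\<^bsub>M\<^esub> x) = \<ominus>\<^bsub>N\<^esub> h x"
proof -
  interpret M: module R M by fact
  interpret N: module R N by fact
  have "h ((\<ominus>\<^bsub>R\<^esub> \<one>\<^bsub>R\<^esub>) \<odot>\<^bsub>M\<^esub> x) = (\<ominus>\<^bsub>R\<^esub> \<one>\<^bsub>R\<^esub>) \<odot>\<^bsub>N\<^esub> h x"
    using assms(4) by (intro mod_hom_smult[OF assms(3)]) auto
  then show ?thesis using mod_hom_closed[OF assms(3,4)] assms(4)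
    by (simp add: M.smult_l_minus N.smult_l_minus)
qed

lemma mod_hom_minus:
  assumes "module R M" "module R N" "h \<in> mod_hom R M N" "x \<in> carrier M" "y \<in> carrier M"
  shows "h (x \<ominus>\<^bsub>M\<^esub> y) = h x \<ominus>\<^bsub>N\<^esub> h y"
proof -
  interpret M: module R M by fact
  interpret N: module R N by fact
  show ?thesis using assms by (simp add: M.M.minus_eq N.M.minus_eq mod_hom_add[OF assms(3)] mod_hom_neg)
qed

lemma mod_hom_eq_iff:
  assumes "module R M" "module R N" "h \<in> mod_hom R M N" "x \<in> carrier M" "y \<in> carrier M"
  shows "h x = h y \<longleftrightarrow> h (x \<ominus>\<^bsub>M\<^esub> y) = \<zero>\<^bsub>N\<^esub>"
  unfolding mod_hom_minus[OF assms]
  using module.minus_eq_zero_iff[OF assms(2)] mod_hom_closed[OF assms(3)] assms(4,5) by simp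

lemma mod_hom_comp:
  "f \<in> mod_hom R A B \<Longrightarrow> g \<in> mod_hom R B C \<Longrightarrow> (\<lambda>x. g (f x)) \<in> mod_hom R A C"
  by (rule mod_homI) (auto simp: mod_hom_closed mod_hom_add mod_hom_smult)

lemma mod_hom_id: "(\<lambda>x. x) \<in> mod_hom R A A"
  by (rule mod_homI) auto

lemma mod_hom_const_zero:
  assumes "module R N" shows "(\<lambda>x. \<zero>\<^bsub>N\<^esub>) \<in> mod_hom R M N"
proof -
  interpret N: module R N by fact
  show ?thesis by (rule mod_homI) auto
qed

lemma mod_hom_plus:
  assumes "module R N" "f \<in> mod_hom R M N" "g \<in> mod_hom R M N"
  shows "(\<lambda>x. f x \<oplus>\<^bsub>N\<^esub> g x) \<in> mod_hom R M N"
proof -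
  interpret N: module R N by fact
  note fg = mod_hom_closed[OF assms(2)] mod_hom_closed[OF assms(3)]
  show ?thesis by (rule mod_homI)
      (auto simp: mod_hom_add[OF assms(2)] mod_hom_add[OF assms(3)] mod_hom_smult[OF assms(2)]
        mod_hom_smult[OF assms(3)] fg N.smult_r_distr N.M.a_ac)
qed

lemma mod_hom_uminus:
  assumes "module R N" "f \<in> mod_hom R M N"
  shows "(\<lambda>x. \<ominus>\<^bsub>N\<^esub> f x) \<in> mod_hom R M N"
proof -
  interpret N: module R N by fact
  note f = mod_hom_closed[OF assms(2)]
  show ?thesis by (rule mod_homI)
      (auto simp: mod_hom_add[OF assms(2)] mod_hom_smult[OF assms(2)] f N.smult_r_minus N.M.minus_add)
qed

lemma mod_hom_diff:
  assumes "module R N" "f \<in> mod_hom R M N" "g \<in> mod_hom R M N"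
  shows "(\<lambda>x. f x \<ominus>\<^bsub>N\<^esub> g x) \<in> mod_hom R M N"
  using mod_hom_plus[OF assms(1,2) mod_hom_uminus[OF assms(1,3)]] by (simp add: a_minus_def)

lemma mod_hom_scale:
  assumes "module R N" "f \<in> mod_hom R M N" "r \<in> carrier R"
  shows "(\<lambda>x. r \<odot>\<^bsub>N\<^esub> f x) \<in> mod_hom R M N"
proof -
  interpret N: module R N by fact
  note f = mod_hom_closed[OF assms(2)]
  show ?thesis using assms(3)
    by (auto intro!: mod_homI simp: mod_hom_add[OF assms(2)] mod_hom_smult[OF assms(2)] f
       N.smult_r_distr N.smult_lcomm)
qed

lemma mod_hom_restrict:
  "f \<in> mod_hom R A B \<Longrightarrow> (\<forall>x\<in>U. x \<in> carrier A \<and> f x \<in> V) \<Longrightarrow>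
    f \<in> mod_hom R (A\<lparr>carrier := U\<rparr>) (B\<lparr>carrier := V\<rparr>)"
  by (rule mod_homI) (auto simp: mod_hom_add mod_hom_smult)

lemma mod_hom_restrict_dom:
  "f \<in> mod_hom R A B \<Longrightarrow> U \<subseteq> carrier A \<Longrightarrow> f \<in> mod_hom R (A\<lparr>carrier := U\<rparr>) B"
  by (rule mod_homI) (auto simp: mod_hom_add mod_hom_smult mod_hom_closed subset_iff)

lemma mod_hom_restrict_cod:
  "f \<in> mod_hom R A B \<Longrightarrow> f ` carrier A \<subseteq> V \<Longrightarrow> f \<in> mod_hom R A (B\<lparr>carrier := V\<rparr>)"
  by (rule mod_homI) (auto simp: mod_hom_add mod_hom_smult mod_hom_closed)

lemma mod_hom_extend_cod:
  "f \<in> mod_hom R A (B\<lparr>carrier := V\<rparr>) \<Longrightarrow> V \<subseteq> carrier B \<Longrightarrow> f \<in> mod_hom R A B"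
  by (auto simp: mod_hom_def)

subsection \<open>Submodules\<close>

lemma submodule_carrier_module:
  "module R M \<Longrightarrow> submodule U R M \<Longrightarrow> module R (M\<lparr>carrier := U\<rparr>)"
  by (rule submodule.submodule_is_module)

context module begin

lemma submoduleD:
  assumes "submodule H R M"
  shows "H \<subseteq> carrier M" "\<zero>\<^bsub>M\<^esub> \<in> H"
    and "x \<in> H \<Longrightarrow> y \<in> H \<Longrightarrow> x \<oplus>\<^bsub>M\<^esub> y \<in> H"
    and "x \<in> H \<Longrightarrow> y \<in> H \<Longrightarrow> x \<ominus>\<^bsub>M\<^esub> y \<in> H"
    and "x \<in> H \<Longrightarrow> \<ominus>\<^bsub>M\<^esub> x \<in> H"
    and "r \<in> carrier R \<Longrightarrow> x \<in> H \<Longrightarrow> r \<odot>\<^bsub>M\<^esub> x \<in> H"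
proof -
  note E = submoduleE[OF assms]
  show "H \<subseteq> carrier M" "x \<in> H \<Longrightarrow> y \<in> H \<Longrightarrow> x \<oplus>\<^bsub>M\<^esub> y \<in> H"
    "x \<in> H \<Longrightarrow> \<ominus>\<^bsub>M\<^esub> x \<in> H" "r \<in> carrier R \<Longrightarrow> x \<in> H \<Longrightarrow> r \<odot>\<^bsub>M\<^esub> x \<in> H"
    using E by auto
  show "x \<in> H \<Longrightarrow> y \<in> H \<Longrightarrow> x \<ominus>\<^bsub>M\<^esub> y \<in> H" using E by (auto simp: M.minus_eq)
  obtain z where "z \<in> H" using E(2) by auto
  then have "\<zero>\<^bsub>R\<^esub> \<odot>\<^bsub>M\<^esub> z \<in> H" using E by blast
  then show "\<zero>\<^bsub>M\<^esub> \<in> H" using E(1) \<open>z \<in> H\<close> by (simp add: subset_iff)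
qed

text \<open>Closure under negation comes from multiplication by the scalar -1.\<close>

lemma submoduleI_minus:
  assumes "H \<subseteq> carrier M" "\<zero>\<^bsub>M\<^esub> \<in> H"
    and "\<And>x y. x \<in> H \<Longrightarrow> y \<in> H \<Longrightarrow> x \<oplus>\<^bsub>M\<^esub> y \<in> H"
    and "\<And>r x. r \<in> carrier R \<Longrightarrow> x \<in> H \<Longrightarrow> r \<odot>\<^bsub>M\<^esub> x \<in> H"
  shows "submodule H R M"
proof (rule submoduleI)
  fix a assume "a \<in> H"
  then have "(\<ominus>\<^bsub>R\<^esub> \<one>\<^bsub>R\<^esub>) \<odot>\<^bsub>M\<^esub> a \<in> H" using assms(4) by auto
  then show "\<ominus>\<^bsub>M\<^esub> a \<in> H" using \<open>a \<in> H\<close> assms(1) by (auto simp: smult_l_minus subset_iff)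
qed (use assms in auto)

lemma zero_submodule: "submodule {\<zero>\<^bsub>M\<^esub>} R M"
  by (rule submoduleI_minus) auto

lemma submodule_cong:
  assumes "submodule H R M" "x \<ominus>\<^bsub>M\<^esub> y \<in> H" "x \<in> carrier M" "y \<in> carrier M"
  shows "x \<in> H \<longleftrightarrow> y \<in> H"
proof
  assume "x \<in> H"
  then have "x \<ominus>\<^bsub>M\<^esub> (x \<ominus>\<^bsub>M\<^esub> y) \<in> H" using submoduleD[OF assms(1)] assms by auto
  moreover have "x \<ominus>\<^bsub>M\<^esub> (x \<ominus>\<^bsub>M\<^esub> y) = y" using assms by algebra
  ultimately show "y \<in> H" by simp
next
  assume "y \<in> H"
  then have "y \<oplus>\<^bsub>M\<^esub> (x \<ominus>\<^bsub>M\<^esub> y) \<in> H" using submoduleD[OF assms(1)] assms by auto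
  then show "x \<in> H" using assms add_diff_cancel by simp
qed

lemma minus_swap_mem:
  assumes "submodule H R M" "x \<in> carrier M" "y \<in> carrier M" "x \<ominus>\<^bsub>M\<^esub> y \<in> H"
  shows "y \<ominus>\<^bsub>M\<^esub> x \<in> H"
proof -
  have "y \<ominus>\<^bsub>M\<^esub> x = \<ominus>\<^bsub>M\<^esub> (x \<ominus>\<^bsub>M\<^esub> y)" using assms by algebra
  then show ?thesis using assms submoduleD by auto
qed

end

lemma image_submodule:
  assumes "module R A" "module R B" "f \<in> mod_hom R A B" "submodule U R A"
  shows "submodule (f ` U) R B"
proof -
  interpret A: module R A by fact
  interpret B: module R B by fact
  note U = A.submoduleD[OF assms(4)]
  have c: "u \<in> U \<Longrightarrow> u \<in> carrier A" for u using U by auto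
  show ?thesis
  proof (rule B.submoduleI_minus)
    show "f ` U \<subseteq> carrier B" using U mod_hom_closed[OF assms(3)] by auto
    show "\<zero>\<^bsub>B\<^esub> \<in> f ` U" using U(2) mod_hom_zero[OF assms(1-3)] by force
    show "x \<oplus>\<^bsub>B\<^esub> y \<in> f ` U" if "x \<in> f ` U" "y \<in> f ` U" for x y
      using that U(3) mod_hom_add[OF assms(3), symmetric] c by auto
    show "r \<odot>\<^bsub>B\<^esub> x \<in> f ` U" if "r \<in> carrier R" "x \<in> f ` U" for r x
      using that U(6) mod_hom_smult[OF assms(3), symmetric] c by auto
  qed
qed

lemma vimage_submodule:
  assumes "module R A" "module R B" "f \<in> mod_hom R A B" "submodule V R B"
  shows "submodule {x \<in> carrier A. f x \<in> V} R A"
proof -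
  interpret A: module R A by fact
  interpret B: module R B by fact
  note V = B.submoduleD[OF assms(4)]
  show ?thesis by (rule A.submoduleI_minus)
      (auto simp: mod_hom_zero[OF assms(1-3)] mod_hom_add[OF assms(3)] mod_hom_smult[OF assms(3)] V)
qed

lemma a_kernel_eq: "a_kernel A B f = {x \<in> carrier A. f x = \<zero>\<^bsub>B\<^esub>}"
  by (auto simp: a_kernel_def')

lemma kernel_submodule:
  assumes "module R A" "module R B" "f \<in> mod_hom R A B"
  shows "submodule (a_kernel A B f) R A"
proof -
  interpret B: module R B by fact
  show ?thesis using vimage_submodule[OF assms B.zero_submodule] by (simp add: a_kernel_eq)
qed

lemma carrier_image_submodule:
  assumes "module R A" "module R B" "f \<in> mod_hom R A B"
  shows "submodule (f ` carrier A) R B"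
  by (rule image_submodule[OF assms module.carrier_is_submodule[OF assms(1)]])

lemma inj_on_iff_kernel:
  assumes "module R A" "module R B" "f \<in> mod_hom R A B"
  shows "inj_on f (carrier A) \<longleftrightarrow> (\<forall>x \<in> carrier A. f x = \<zero>\<^bsub>B\<^esub> \<longrightarrow> x = \<zero>\<^bsub>A\<^esub>)"
proof -
  interpret A: module R A by fact
  interpret B: module R B by fact
  show ?thesis
  proof
    assume "inj_on f (carrier A)"
    then show "\<forall>x \<in> carrier A. f x = \<zero>\<^bsub>B\<^esub> \<longrightarrow> x = \<zero>\<^bsub>A\<^esub>"
      using mod_hom_zero[OF assms] by (metis inj_onD A.M.zero_closed)
  next
    assume *: "\<forall>x \<in> carrier A. f x = \<zero>\<^bsub>B\<^esub> \<longrightarrow> x = \<zero>\<^bsub>A\<^esub>"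
    show "inj_on f (carrier A)"
    proof (rule inj_onI)
      fix x y assume "x \<in> carrier A" "y \<in> carrier A" "f x = f y"
      then show "x = y" using * mod_hom_eq_iff[OF assms, of x y] A.minus_eq_zero_iff[of x y] by simp
    qed
  qed
qed

subsection \<open>Factorisation of homomorphisms\<close>

text \<open>The value at z is that of \<open>h\<close> at a chosen preimage of z. Two preimages
  differ by an element of the kernel of \<open>q\<close>, which \<open>h\<close> kills, so the
  choice does not matter.\<close>

lemma mod_hom_factor_surj:
  assumes "module R M" "module R Q" "module R N" "q \<in> mod_hom R M Q" "q ` carrier M = carrier Q"
    "h \<in> mod_hom R M N" "\<And>x. x \<in> carrier M \<Longrightarrow> q x = \<zero>\<^bsub>Q\<^esub> \<Longrightarrow> h x = \<zero>\<^bsub>N\<^esub>"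
  obtains k where "k \<in> mod_hom R Q N" "\<And>x. x \<in> carrier M \<Longrightarrow> k (q x) = h x"
proof -
  interpret M: module R M by fact
  interpret Q: module R Q by fact
  interpret N: module R N by fact
  have eq: "h x = h y" if xy: "x \<in> carrier M" "y \<in> carrier M" and q: "q x = q y" for x y
  proof -
    have "q (x \<ominus>\<^bsub>M\<^esub> y) = \<zero>\<^bsub>Q\<^esub>" using q mod_hom_eq_iff[OF assms(1,2,4) xy] by (rule iffD1[rotated])
    then have "h (x \<ominus>\<^bsub>M\<^esub> y) = \<zero>\<^bsub>N\<^esub>" using xy assms(7) by blast
    then show ?thesis using mod_hom_eq_iff[OF assms(1,3,6) xy] by (rule iffD2[rotated])
  qed
  define k where "k z = h (SOME x. x \<in> carrier M \<and> q x = z)" for z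
  have k: "k (q x) = h x" if "x \<in> carrier M" for x
  proof -
    let ?y = "SOME y. y \<in> carrier M \<and> q y = q x"
    have "?y \<in> carrier M \<and> q ?y = q x" by (rule someI[of _ x]) (simp add: that)
    then show ?thesis unfolding k_def using eq[of ?y x] that by blast
  qed
  have "k \<in> mod_hom R Q N"
  proof (rule mod_homI)
    fix x assume "x \<in> carrier Q"
    then obtain x' where "x' \<in> carrier M" "x = q x'" using assms(5) by blast
    then show "k x \<in> carrier N" using k mod_hom_closed[OF assms(6)] by simp
  next
    fix x y assume "x \<in> carrier Q" "y \<in> carrier Q"
    then obtain x' y' where *: "x' \<in> carrier M" "x = q x'" "y' \<in> carrier M" "y = q y'"
      using assms(5) by blast
    then show "k (x \<oplus>\<^bsub>Q\<^esub> y) = k x \<oplus>\<^bsub>N\<^esub> k y"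
      using k[of "x' \<oplus>\<^bsub>M\<^esub> y'"]
      by (simp add: k mod_hom_add[OF assms(4)] mod_hom_add[OF assms(6)])
  next
    fix r x assume "r \<in> carrier R" "x \<in> carrier Q"
    then obtain x' where *: "x' \<in> carrier M" "x = q x'" "r \<in> carrier R" using assms(5) by blast
    then show "k (r \<odot>\<^bsub>Q\<^esub> x) = r \<odot>\<^bsub>N\<^esub> k x" using k[of "r \<odot>\<^bsub>M\<^esub> x'"]
      by (simp add: k mod_hom_smult[OF assms(4)] mod_hom_smult[OF assms(6)])
  qed
  then show thesis using that k by blast
qed

lemma mod_hom_factor_inj:
  assumes "module R A" "module R B" "module R M" "f \<in> mod_hom R A B" "inj_on f (carrier A)"
    "h \<in> mod_hom R M B" "h ` carrier M \<subseteq> f ` carrier A"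
  obtains k where "k \<in> mod_hom R M A" "\<And>x. x \<in> carrier M \<Longrightarrow> f (k x) = h x"
proof -
  interpret A: module R A by fact
  interpret B: module R B by fact
  interpret M: module R M by fact
  define k where "k x = inv_into (carrier A) f (h x)" for x
  have k: "k x \<in> carrier A" "f (k x) = h x" if "x \<in> carrier M" for x
    using that assms(7) unfolding k_def
    by (auto intro!: inv_into_into f_inv_into_f simp: image_subset_iff)
  have "k \<in> mod_hom R M A"
  proof (rule mod_homI)
    fix x y assume xy: "x \<in> carrier M" "y \<in> carrier M"
    show "k (x \<oplus>\<^bsub>M\<^esub> y) = k x \<oplus>\<^bsub>A\<^esub> k y"
      by (rule inj_onD[OF assms(5)])
         (use xy k in \<open>auto simp: mod_hom_add[OF assms(4)] mod_hom_add[OF assms(6)]\<close>)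
  next
    fix r x assume "r \<in> carrier R" "x \<in> carrier M"
    then show "k (r \<odot>\<^bsub>M\<^esub> x) = r \<odot>\<^bsub>A\<^esub> k x"
      by (intro inj_onD[OF assms(5)])
         (use k in \<open>auto simp: mod_hom_smult[OF assms(4)] mod_hom_smult[OF assms(6)]\<close>)
  qed (use k in auto)
  then show thesis using that k by blast
qed

subsection \<open>Quotient modules\<close>

definition mod_coset :: "('a, 'b, 'm) module_scheme \<Rightarrow> 'b set \<Rightarrow> 'b \<Rightarrow> 'b set" where
  "mod_coset M V x = {y \<in> carrier M. y \<ominus>\<^bsub>M\<^esub> x \<in> V}"

text \<open>The operations act on chosen representatives. The elements are sets, so a quotient of
  \<open>Free R n\<close> has exactly the element type required of an
  \<open>'a fgmod\<close>.\<close>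

definition quot_module :: "('a, 'b, 'm) module_scheme \<Rightarrow> 'b set \<Rightarrow> ('a, 'b set) module" where
  "quot_module M V = \<lparr>carrier = mod_coset M V ` carrier M, monoid.mult = undefined, one = undefined,
     ring.zero = mod_coset M V \<zero>\<^bsub>M\<^esub>,
     ring.add = (\<lambda>C D. mod_coset M V ((SOME x. x \<in> C) \<oplus>\<^bsub>M\<^esub> (SOME y. y \<in> D))),
     smult = (\<lambda>r C. mod_coset M V (r \<odot>\<^bsub>M\<^esub> (SOME x. x \<in> C)))\<rparr>"

context
  fixes R :: "('a, 'r) ring_scheme" and M :: "('a, 'b, 'm) module_scheme" and V
  assumes M: "module R M" and V: "submodule V R M"
begin

interpretation M: module R M by (rule M)

lemma mod_coset_eq_iff:
  assumes "x \<in> carrier M" "y \<in> carrier M"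
  shows "mod_coset M V x = mod_coset M V y \<longleftrightarrow> x \<ominus>\<^bsub>M\<^esub> y \<in> V"
proof
  assume *: "mod_coset M V x = mod_coset M V y"
  have "x \<ominus>\<^bsub>M\<^esub> x = \<zero>\<^bsub>M\<^esub>" using assms by algebra
  then have "x \<in> mod_coset M V x" using assms M.submoduleD(2)[OF V] by (simp add: mod_coset_def)
  then show "x \<ominus>\<^bsub>M\<^esub> y \<in> V" unfolding * by (simp add: mod_coset_def)
next
  assume *: "x \<ominus>\<^bsub>M\<^esub> y \<in> V"
  have "z \<ominus>\<^bsub>M\<^esub> x \<in> V \<longleftrightarrow> z \<ominus>\<^bsub>M\<^esub> y \<in> V" if z: "z \<in> carrier M" for z
  proof (rule M.submodule_cong[OF V])
    have "(z \<ominus>\<^bsub>M\<^esub> x) \<ominus>\<^bsub>M\<^esub> (z \<ominus>\<^bsub>M\<^esub> y) = y \<ominus>\<^bsub>M\<^esub> x" using assms z by algebra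
    then show "(z \<ominus>\<^bsub>M\<^esub> x) \<ominus>\<^bsub>M\<^esub> (z \<ominus>\<^bsub>M\<^esub> y) \<in> V" using M.minus_swap_mem[OF V _ _ *] assms by simp
  qed (use assms z in auto)
  then show "mod_coset M V x = mod_coset M V y" by (auto simp: mod_coset_def)
qed

private lemma some_coset:
  assumes "x \<in> carrier M"
  shows "(SOME y. y \<in> mod_coset M V x) \<in> carrier M" "(SOME y. y \<in> mod_coset M V x) \<ominus>\<^bsub>M\<^esub> x \<in> V"
proof -
  have "x \<ominus>\<^bsub>M\<^esub> x = \<zero>\<^bsub>M\<^esub>" using assms by algebra
  then have "x \<in> mod_coset M V x" using assms M.submoduleD(2)[OF V] by (simp add: mod_coset_def)
  then have "(SOME y. y \<in> mod_coset M V x) \<in> mod_coset M V x" by (rule someI)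
  then show "(SOME y. y \<in> mod_coset M V x) \<in> carrier M" "(SOME y. y \<in> mod_coset M V x) \<ominus>\<^bsub>M\<^esub> x \<in> V"
    by (auto simp: mod_coset_def)
qed

private lemma quot_add:
  assumes "x \<in> carrier M" "y \<in> carrier M"
  shows "mod_coset M V (x \<oplus>\<^bsub>M\<^esub> y) = mod_coset M V x \<oplus>\<^bsub>quot_module M V\<^esub> mod_coset M V y"
proof -
  define x' where "x' = (SOME y. y \<in> mod_coset M V x)"
  define y' where "y' = (SOME x. x \<in> mod_coset M V y)"
  note X = some_coset[OF assms(1), folded x'_def] and Y = some_coset[OF assms(2), folded y'_def]
  have "(x' \<oplus>\<^bsub>M\<^esub> y') \<ominus>\<^bsub>M\<^esub> (x \<oplus>\<^bsub>M\<^esub> y) = (x' \<ominus>\<^bsub>M\<^esub> x) \<oplus>\<^bsub>M\<^esub> (y' \<ominus>\<^bsub>M\<^esub> y)"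
    using X(1) Y(1) assms by algebra
  then have "(x' \<oplus>\<^bsub>M\<^esub> y') \<ominus>\<^bsub>M\<^esub> (x \<oplus>\<^bsub>M\<^esub> y) \<in> V" using X(2) Y(2) M.submoduleD(3)[OF V] by simp
  then have "mod_coset M V (x' \<oplus>\<^bsub>M\<^esub> y') = mod_coset M V (x \<oplus>\<^bsub>M\<^esub> y)"
    using X(1) Y(1) assms mod_coset_eq_iff by simp
  then show ?thesis by (simp add: quot_module_def x'_def y'_def)
qed

private lemma quot_smult:
  assumes "r \<in> carrier R" "x \<in> carrier M"
  shows "mod_coset M V (r \<odot>\<^bsub>M\<^esub> x) = r \<odot>\<^bsub>quot_module M V\<^esub> mod_coset M V x"
proof -
  define x' where "x' = (SOME y. y \<in> mod_coset M V x)"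
  note X = some_coset[OF assms(2), folded x'_def]
  have "(r \<odot>\<^bsub>M\<^esub> x') \<ominus>\<^bsub>M\<^esub> (r \<odot>\<^bsub>M\<^esub> x) = r \<odot>\<^bsub>M\<^esub> (x' \<ominus>\<^bsub>M\<^esub> x)"
    using X(1) assms by algebra
  then have "(r \<odot>\<^bsub>M\<^esub> x') \<ominus>\<^bsub>M\<^esub> (r \<odot>\<^bsub>M\<^esub> x) \<in> V" using X(2) assms M.submoduleD(6)[OF V] by simp
  then have "mod_coset M V (r \<odot>\<^bsub>M\<^esub> x') = mod_coset M V (r \<odot>\<^bsub>M\<^esub> x)"
    using X(1) assms mod_coset_eq_iff by simp
  then show ?thesis by (simp add: quot_module_def x'_def)
qed

lemma quot_module: "module R (quot_module M V)"
  by (rule module_homomorphic_image[OF M, of "mod_coset M V"])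
    (auto simp: quot_add quot_smult, auto simp: quot_module_def)

lemma mod_coset_hom: "mod_coset M V \<in> mod_hom R M (quot_module M V)"
  by (rule mod_homI) (auto simp: quot_add quot_smult, auto simp: quot_module_def)

lemma mod_coset_surj: "mod_coset M V ` carrier M = carrier (quot_module M V)"
  by (simp add: quot_module_def)

lemma mod_coset_eq_zero_iff:
  assumes "x \<in> carrier M"
  shows "mod_coset M V x = \<zero>\<^bsub>quot_module M V\<^esub> \<longleftrightarrow> x \<in> V"
proof -
  have "x \<ominus>\<^bsub>M\<^esub> \<zero>\<^bsub>M\<^esub> = x" using assms by algebra
  then show ?thesis using mod_coset_eq_iff[of x "\<zero>\<^bsub>M\<^esub>"] assms by (simp add: quot_module_def)
qed

lemma mod_coset_kernel: "a_kernel M (quot_module M V) (mod_coset M V) = V"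
  using mod_coset_eq_zero_iff M.submoduleD(1)[OF V] by (auto simp: a_kernel_eq)

end

lemma quot_module_hom:
  assumes "module R M" "submodule V R M" "module R N" "submodule W R N"
    "h \<in> mod_hom R M N" "h ` V \<subseteq> W"
  obtains k where "k \<in> mod_hom R (quot_module M V) (quot_module N W)"
    "\<And>x. x \<in> carrier M \<Longrightarrow> k (mod_coset M V x) = mod_coset N W (h x)"
proof (rule mod_hom_factor_surj[OF assms(1) quot_module[OF assms(1,2)] quot_module[OF assms(3,4)]
    mod_coset_hom[OF assms(1,2)] mod_coset_surj[OF assms(1,2)] mod_hom_comp[OF assms(5) mod_coset_hom[OF assms(3,4)]]])
  fix x assume "x \<in> carrier M" "mod_coset M V x = \<zero>\<^bsub>quot_module M V\<^esub>"
  then show "mod_coset N W (h x) = \<zero>\<^bsub>quot_module N W\<^esub>"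
    using assms mod_coset_eq_zero_iff[OF assms(1,2)] mod_coset_eq_zero_iff[OF assms(3,4)]
      mod_hom_closed[OF assms(5)] by auto
qed (use that in blast)

subsection \<open>Isomorphisms and short exact sequences\<close>

lemma mod_isoI:
  "h \<in> mod_hom R M N \<Longrightarrow> inj_on h (carrier M) \<Longrightarrow> h ` carrier M = carrier N \<Longrightarrow> h \<in> mod_iso R M N"
  by (simp add: mod_iso_def bij_betw_def)

lemma mod_isoD:
  "h \<in> mod_iso R M N \<Longrightarrow> h \<in> mod_hom R M N"
  "h \<in> mod_iso R M N \<Longrightarrow> inj_on h (carrier M)"
  "h \<in> mod_iso R M N \<Longrightarrow> h ` carrier M = carrier N"
  by (simp_all add: mod_iso_def bij_betw_def)

lemma mod_iso_inv:
  assumes "h \<in> mod_iso R M N" "module R M" "module R N"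
  shows "inv_into (carrier M) h \<in> mod_iso R N M"
proof -
  interpret M: module R M by fact
  interpret N: module R N by fact
  note h = mod_isoD[OF assms(1)]
  let ?k = "inv_into (carrier M) h"
  have k: "?k y \<in> carrier M" "h (?k y) = y" if "y \<in> carrier N" for y
    using that h(3) by (auto intro: inv_into_into f_inv_into_f)
  have kk: "?k (h x) = x" if "x \<in> carrier M" for x using that h(2) by simp
  show ?thesis
  proof (rule mod_isoI[OF mod_homI])
    fix x y assume xy: "x \<in> carrier N" "y \<in> carrier N"
    show "?k (x \<oplus>\<^bsub>N\<^esub> y) = ?k x \<oplus>\<^bsub>M\<^esub> ?k y"
      using kk[of "?k x \<oplus>\<^bsub>M\<^esub> ?k y"] k[OF xy(1)] k[OF xy(2)] by (simp add: mod_hom_add[OF h(1)])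
  next
    fix r x assume xy: "r \<in> carrier R" "x \<in> carrier N"
    show "?k (r \<odot>\<^bsub>N\<^esub> x) = r \<odot>\<^bsub>M\<^esub> ?k x"
      using kk[of "r \<odot>\<^bsub>M\<^esub> ?k x"] k[OF xy(2)] xy by (simp add: mod_hom_smult[OF h(1)])
  next
    show "inj_on ?k (carrier N)" by (rule inj_onI) (metis k(2))
    show "?k ` carrier N = carrier M"
    proof
      show "?k ` carrier N \<subseteq> carrier M" using k(1) by blast
      show "carrier M \<subseteq> ?k ` carrier N"
      proof
        fix x assume "x \<in> carrier M"
        then show "x \<in> ?k ` carrier N" using mod_hom_closed[OF h(1)] by (intro image_eqI[of _ _ "h x"]) (simp_all only: kk)
      qed
    qed
  qed (use k(1) in blast)
qed

lemma isomorphic_modulesI: "h \<in> mod_iso R M N \<Longrightarrow> isomorphic_modules R M N"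
  by (auto simp: isomorphic_modules_def)

lemma isomorphic_modules_sym:
  "module R M \<Longrightarrow> module R N \<Longrightarrow> isomorphic_modules R M N \<Longrightarrow> isomorphic_modules R N M"
  unfolding isomorphic_modules_def using mod_iso_inv by blast

lemma mod_iso_comp:
  assumes "f \<in> mod_iso R A B" "g \<in> mod_iso R B C"
  shows "(\<lambda>x. g (f x)) \<in> mod_iso R A C"
proof -
  have "bij_betw (g \<circ> f) (carrier A) (carrier C)"
    using assms by (auto simp: mod_iso_def intro: bij_betw_trans)
  then show ?thesis using mod_hom_comp[OF mod_isoD(1)[OF assms(1)] mod_isoD(1)[OF assms(2)]]
    by (simp add: mod_iso_def comp_def)
qed

lemma isomorphic_modules_trans:
  "isomorphic_modules R A B \<Longrightarrow> isomorphic_modules R B C \<Longrightarrow> isomorphic_modules R A C"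
  unfolding isomorphic_modules_def using mod_iso_comp by blast

lemma mod_iso_id: "(\<lambda>x. x) \<in> mod_iso R A A"
  by (rule mod_isoI) (auto intro: mod_hom_id)

text \<open>Two presentations of a module with the same relations are isomorphic; this is how
  quotients of R^b are identified with given modules.\<close>

lemma surj_same_kernel_iso:
  assumes M: "module R M" and P: "module R P" and Q: "module R Q"
    and p: "p \<in> mod_hom R M P" "p ` carrier M = carrier P"
    and q: "q \<in> mod_hom R M Q" "q ` carrier M = carrier Q"
    and eq: "\<And>x. x \<in> carrier M \<Longrightarrow> p x = \<zero>\<^bsub>P\<^esub> \<longleftrightarrow> q x = \<zero>\<^bsub>Q\<^esub>"
  obtains k where "k \<in> mod_iso R P Q" "\<And>x. x \<in> carrier M \<Longrightarrow> k (p x) = q x"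
proof -
  obtain k where k: "k \<in> mod_hom R P Q" "\<And>x. x \<in> carrier M \<Longrightarrow> k (p x) = q x"
    using mod_hom_factor_surj[OF M P Q p q(1)] eq by metis
  have "inj_on k (carrier P)" unfolding inj_on_iff_kernel[OF P Q k(1)]
  proof (intro ballI impI)
    fix x assume "x \<in> carrier P" "k x = \<zero>\<^bsub>Q\<^esub>"
    then obtain y where "y \<in> carrier M" "x = p y" using p(2) by blast
    then show "x = \<zero>\<^bsub>P\<^esub>" using \<open>k x = _\<close> k(2) eq by simp
  qed
  moreover have "k ` carrier P = carrier Q"
  proof -
    have "k ` carrier P = (\<lambda>x. k (p x)) ` carrier M" using p(2) by (metis image_image)
    also have "\<dots> = q ` carrier M" using k(2) by (rule image_cong[OF refl])
    finally show ?thesis using q(2) by simp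
  qed
  ultimately show thesis using that k mod_isoI by blast
qed

lemma short_exactI:
  assumes "f \<in> mod_hom R A B" "g \<in> mod_hom R B C" "inj_on f (carrier A)"
    "\<And>x. x \<in> carrier A \<Longrightarrow> g (f x) = \<zero>\<^bsub>C\<^esub>"
    "\<And>y. y \<in> carrier B \<Longrightarrow> g y = \<zero>\<^bsub>C\<^esub> \<Longrightarrow> \<exists>x \<in> carrier A. f x = y"
    "\<And>z. z \<in> carrier C \<Longrightarrow> \<exists>y \<in> carrier B. g y = z"
  shows "short_exact R A B C"
proof -
  have "f ` carrier A = a_kernel B C g"
  proof
    show "f ` carrier A \<subseteq> a_kernel B C g"
      using assms(4) mod_hom_closed[OF assms(1)] by (auto simp: a_kernel_eq)
    show "a_kernel B C g \<subseteq> f ` carrier A" using assms(5) by (fastforce simp: a_kernel_eq)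
  qed
  moreover have "g ` carrier B = carrier C"
  proof
    show "g ` carrier B \<subseteq> carrier C" using mod_hom_closed[OF assms(2)] by blast
    show "carrier C \<subseteq> g ` carrier B" using assms(6) by fastforce
  qed
  ultimately show ?thesis unfolding short_exact_def using assms(1-3) by blast
qed

lemma short_exactE:
  assumes "short_exact R A B C"
  obtains f g where "f \<in> mod_hom R A B" "g \<in> mod_hom R B C" "inj_on f (carrier A)"
    "\<And>x. x \<in> carrier A \<Longrightarrow> g (f x) = \<zero>\<^bsub>C\<^esub>"
    "\<And>y. y \<in> carrier B \<Longrightarrow> g y = \<zero>\<^bsub>C\<^esub> \<Longrightarrow> \<exists>x \<in> carrier A. f x = y"
    "\<And>z. z \<in> carrier C \<Longrightarrow> \<exists>y \<in> carrier B. g y = z"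
proof -
  obtain f g where *: "f \<in> mod_hom R A B" "g \<in> mod_hom R B C" "inj_on f (carrier A)"
    "f ` carrier A = a_kernel B C g" "g ` carrier B = carrier C"
    using assms unfolding short_exact_def by blast
  show thesis
  proof (rule that[OF *(1-3)])
    fix x assume "x \<in> carrier A"
    then have "f x \<in> a_kernel B C g" using *(4) by blast
    then show "g (f x) = \<zero>\<^bsub>C\<^esub>" by (simp add: a_kernel_eq)
  next
    fix y assume "y \<in> carrier B" "g y = \<zero>\<^bsub>C\<^esub>"
    then have "y \<in> f ` carrier A" using *(4) by (simp add: a_kernel_eq)
    then show "\<exists>x \<in> carrier A. f x = y" by blast
  next
    fix z assume "z \<in> carrier C"
    then show "\<exists>y \<in> carrier B. g y = z" using *(5) by (metis imageE)
  qed
qed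

lemma short_exact_iso:
  assumes "short_exact R A B C" "isomorphic_modules R A' A" "isomorphic_modules R C C'"
    "module R A" "module R A'" "module R B" "module R C" "module R C'"
  shows "short_exact R A' B C'"
proof -
  from assms(1) obtain f g where fg: "f \<in> mod_hom R A B" "g \<in> mod_hom R B C" "inj_on f (carrier A)"
    "\<And>x. x \<in> carrier A \<Longrightarrow> g (f x) = \<zero>\<^bsub>C\<^esub>"
    "\<And>y. y \<in> carrier B \<Longrightarrow> g y = \<zero>\<^bsub>C\<^esub> \<Longrightarrow> \<exists>x \<in> carrier A. f x = y"
    "\<And>z. z \<in> carrier C \<Longrightarrow> \<exists>y \<in> carrier B. g y = z"
    by (rule short_exactE) blast
  obtain a c where a: "a \<in> mod_iso R A' A" and c: "c \<in> mod_iso R C C'"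
    using assms(2,3) by (auto simp: isomorphic_modules_def)
  note a = mod_isoD[OF a] and c = mod_isoD[OF c]
  have c0: "c z = \<zero>\<^bsub>C'\<^esub> \<Longrightarrow> z \<in> carrier C \<Longrightarrow> z = \<zero>\<^bsub>C\<^esub>" for z
    using inj_on_iff_kernel[OF assms(7,8) c(1)] c(2) by blast
  show ?thesis
  proof (rule short_exactI[of "\<lambda>x. f (a x)" _ _ _ "\<lambda>y. c (g y)"])
    show "inj_on (\<lambda>x. f (a x)) (carrier A')"
      using comp_inj_on[OF a(2), of f] fg(3) a(3) by (simp add: comp_def)
    show "c (g (f (a x))) = \<zero>\<^bsub>C'\<^esub>" if "x \<in> carrier A'" for x
      using fg(4)[OF mod_hom_closed[OF a(1) that]] mod_hom_zero[OF assms(7,8) c(1)] by simp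
    show "\<exists>x \<in> carrier A'. f (a x) = y" if y: "y \<in> carrier B" "c (g y) = \<zero>\<^bsub>C'\<^esub>" for y
    proof -
      have "g y = \<zero>\<^bsub>C\<^esub>" using c0 y mod_hom_closed[OF fg(2)] by blast
      then obtain x where "x \<in> carrier A" "f x = y" using fg(5) y by blast
      then show ?thesis using a(3) by (metis imageE)
    qed
    show "\<exists>y \<in> carrier B. c (g y) = z" if "z \<in> carrier C'" for z
      using that c(3) fg(6) by (metis imageE)
  qed (use a c fg in \<open>auto intro: mod_hom_comp\<close>)
qed

subsection \<open>Powers and free modules\<close>

lemma mod_power_simps:
  "carrier (mod_power M n) = {..<n} \<rightarrow>\<^sub>E carrier M"
  "\<zero>\<^bsub>mod_power M n\<^esub> = (\<lambda>i\<in>{..<n}. \<zero>\<^bsub>M\<^esub>)"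
  "u \<oplus>\<^bsub>mod_power M n\<^esub> v = (\<lambda>i\<in>{..<n}. u i \<oplus>\<^bsub>M\<^esub> v i)"
  "r \<odot>\<^bsub>mod_power M n\<^esub> u = (\<lambda>i\<in>{..<n}. r \<odot>\<^bsub>M\<^esub> u i)"
  by (simp_all add: mod_power_def)

lemma mod_power_module:
  assumes "module R M" shows "module R (mod_power M n)"
proof -
  interpret M: module R M by fact
  show ?thesis
  proof (rule moduleI)
    show "cring R" by (rule M.R.cring_axioms)
    show "abelian_group (mod_power M n)"
    proof (rule abelian_groupI)
      fix x assume x: "x \<in> carrier (mod_power M n)"
      show "\<zero>\<^bsub>mod_power M n\<^esub> \<oplus>\<^bsub>mod_power M n\<^esub> x = x"
        using x by (auto simp: mod_power_simps PiE_iff extensional_def fun_eq_iff)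
      show "\<exists>y \<in> carrier (mod_power M n). y \<oplus>\<^bsub>mod_power M n\<^esub> x = \<zero>\<^bsub>mod_power M n\<^esub>"
        by (rule bexI[of _ "\<lambda>i\<in>{..<n}. \<ominus>\<^bsub>M\<^esub> x i"])
          (use x in \<open>auto simp: mod_power_simps PiE_iff fun_eq_iff M.M.l_neg\<close>)
    qed (auto simp: mod_power_simps PiE_iff fun_eq_iff M.M.a_ac)
  qed (auto simp: mod_power_simps PiE_iff extensional_def fun_eq_iff M.smult_l_distr M.smult_r_distr M.smult_assoc1)
qed

lemma self_module_simps [simp]:
  "carrier (self_module R) = carrier R" "\<zero>\<^bsub>self_module R\<^esub> = \<zero>\<^bsub>R\<^esub>"
  "x \<oplus>\<^bsub>self_module R\<^esub> y = x \<oplus>\<^bsub>R\<^esub> y" "r \<odot>\<^bsub>self_module R\<^esub> x = r \<otimes>\<^bsub>R\<^esub> x"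
  by (simp_all add: self_module_def)

lemma self_module_neg [simp]: "\<ominus>\<^bsub>self_module R\<^esub> x = \<ominus>\<^bsub>R\<^esub> x"
  by (simp add: a_inv_def m_inv_def self_module_def)

lemma self_module_minus [simp]: "x \<ominus>\<^bsub>self_module R\<^esub> y = x \<ominus>\<^bsub>R\<^esub> y"
  by (simp add: a_minus_def)

lemma self_module: "cring R \<Longrightarrow> module R (self_module R)"
proof -
  assume "cring R"
  then interpret cring R .
  show ?thesis
  proof (rule moduleI)
    show "abelian_group (self_module R)"
    proof (rule abelian_groupI)
      fix x assume x: "x \<in> carrier (self_module R)"
      show "\<exists>y \<in> carrier (self_module R). y \<oplus>\<^bsub>self_module R\<^esub> x = \<zero>\<^bsub>self_module R\<^esub>"
        by (rule bexI[of _ "\<ominus>\<^bsub>R\<^esub> x"]) (use x in \<open>auto simp: l_neg\<close>)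
    qed (auto simp: a_ac)
  qed (auto simp: l_distr r_distr m_assoc is_cring)
qed

abbreviation "Free \<equiv> free_module"

abbreviation "vecs R n \<equiv> carrier (Free R n)"

abbreviation "Lin R m n \<equiv> mod_hom R (Free R m) (Free R n)"

lemma free_module_simps:
  "vecs R n = {..<n} \<rightarrow>\<^sub>E carrier R"
  "\<zero>\<^bsub>Free R n\<^esub> = (\<lambda>i\<in>{..<n}. \<zero>\<^bsub>R\<^esub>)"
  "u \<oplus>\<^bsub>Free R n\<^esub> v = (\<lambda>i\<in>{..<n}. u i \<oplus>\<^bsub>R\<^esub> v i)"
  "r \<odot>\<^bsub>Free R n\<^esub> u = (\<lambda>i\<in>{..<n}. r \<otimes>\<^bsub>R\<^esub> u i)"
  by (simp_all add: mod_power_simps free_module_def)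

lemma Free: "cring R \<Longrightarrow> module R (Free R n)"
  unfolding free_module_def by (intro mod_power_module self_module)

lemma free_module_ext:
  "u \<in> vecs R n \<Longrightarrow> v \<in> vecs R n \<Longrightarrow>
    (\<And>i. i < n \<Longrightarrow> u i = v i) \<Longrightarrow> u = v"
  by (auto simp: free_module_simps intro: PiE_ext)

lemma free_module_coord: "u \<in> vecs R n \<Longrightarrow> i < n \<Longrightarrow> u i \<in> carrier R"
  by (auto simp: free_module_simps)

lemma coord_hom: "i < n \<Longrightarrow> (\<lambda>u. u i) \<in> mod_hom R (Free R n) (self_module R)"
  by (rule mod_homI) (auto simp: free_module_simps)

lemma free_module_minus:
  assumes "cring R" "u \<in> vecs R n" "v \<in> vecs R n" "i < n"
  shows "(u \<ominus>\<^bsub>Free R n\<^esub> v) i = u i \<ominus>\<^bsub>R\<^esub> v i"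
  using mod_hom_minus[OF Free[OF assms(1)] self_module[OF assms(1)] coord_hom[OF assms(4)] assms(2,3)]
  by simp

lemma free_module_0: "vecs R 0 = {\<zero>\<^bsub>Free R 0\<^esub>}"
  by (auto simp: free_module_simps)

definition unit_vec :: "('a, 'r) ring_scheme \<Rightarrow> nat \<Rightarrow> nat \<Rightarrow> nat \<Rightarrow> 'a" where
  "unit_vec R n i = (\<lambda>j\<in>{..<n}. if j = i then \<one>\<^bsub>R\<^esub> else \<zero>\<^bsub>R\<^esub>)"

text \<open>\<open>y\<close> holds the vectors and \<open>u\<close> the coefficients. The recursion
  on the length makes partial combinations available to inductions.\<close>

primrec lin_comb :: "('a, 'b, 'm) module_scheme \<Rightarrow> (nat \<Rightarrow> 'b) \<Rightarrow> (nat \<Rightarrow> 'a) \<Rightarrow> nat \<Rightarrow> 'b" where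
  "lin_comb M y u 0 = \<zero>\<^bsub>M\<^esub>"
| "lin_comb M y u (Suc n) = lin_comb M y u n \<oplus>\<^bsub>M\<^esub> u n \<odot>\<^bsub>M\<^esub> y n"

lemma unit_vec_closed: "cring R \<Longrightarrow> unit_vec R n i \<in> vecs R n"
proof -
  assume "cring R" then interpret cring R .
  show ?thesis by (auto simp: unit_vec_def free_module_simps)
qed

context module begin

lemma lin_comb_mem:
  assumes "submodule H R M" "\<And>i. i < n \<Longrightarrow> u i \<odot>\<^bsub>M\<^esub> y i \<in> H"
  shows "lin_comb M y u n \<in> H" using assms(2) by (induction n) (auto simp: submoduleD[OF assms(1)])

lemma lin_comb_closed:
  assumes "\<And>i. i < n \<Longrightarrow> u i \<in> carrier R" "\<And>i. i < n \<Longrightarrow> y i \<in> carrier M"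
  shows "lin_comb M y u n \<in> carrier M" using lin_comb_mem[OF carrier_is_submodule] assms by simp

lemma lin_comb_cong:
  assumes "\<And>i. i < n \<Longrightarrow> u i = v i" "\<And>i. i < n \<Longrightarrow> y i = z i"
  shows "lin_comb M y u n = lin_comb M z v n" using assms by (induction n) auto

lemma lin_comb_add:
  assumes "\<And>i. i < n \<Longrightarrow> u i \<in> carrier R" "\<And>i. i < n \<Longrightarrow> v i \<in> carrier R" "\<And>i. i < n \<Longrightarrow> y i \<in> carrier M"
  shows "lin_comb M y (\<lambda>i. u i \<oplus>\<^bsub>R\<^esub> v i) n = lin_comb M y u n \<oplus>\<^bsub>M\<^esub> lin_comb M y v n"
  using assms
proof (induction n)
  case (Suc n)
  have c: "lin_comb M y u n \<in> carrier M" "lin_comb M y v n \<in> carrier M"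
    using Suc.prems by (auto intro: lin_comb_closed)
  show ?case using Suc c by (simp add: smult_l_distr M.a_ac)
qed auto

lemma lin_comb_smult:
  assumes "\<And>i. i < n \<Longrightarrow> u i \<in> carrier R" "r \<in> carrier R" "\<And>i. i < n \<Longrightarrow> y i \<in> carrier M"
  shows "lin_comb M y (\<lambda>i. r \<otimes>\<^bsub>R\<^esub> u i) n = r \<odot>\<^bsub>M\<^esub> lin_comb M y u n"
  using assms
proof (induction n)
  case (Suc n)
  have c: "lin_comb M y u n \<in> carrier M" using Suc.prems by (auto intro: lin_comb_closed)
  show ?case using Suc c by (simp add: smult_assoc1 smult_r_distr)
qed auto

lemma lin_comb_hom:
  assumes "\<And>i. i < n \<Longrightarrow> y i \<in> carrier M"
  shows "(\<lambda>u. lin_comb M y u n) \<in> mod_hom R (Free R n) M"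
proof (rule mod_homI)
  fix x z assume xz: "x \<in> vecs R n" "z \<in> vecs R n"
  show "lin_comb M y (x \<oplus>\<^bsub>Free R n\<^esub> z) n = lin_comb M y x n \<oplus>\<^bsub>M\<^esub> lin_comb M y z n"
    using lin_comb_add[of n x z y] xz assms
      lin_comb_cong[of n "x \<oplus>\<^bsub>Free R n\<^esub> z" "\<lambda>i. x i \<oplus>\<^bsub>R\<^esub> z i" y y]
    by (auto simp: free_module_simps)
next
  fix r x assume xz: "x \<in> vecs R n" "r \<in> carrier R"
  show "lin_comb M y (r \<odot>\<^bsub>Free R n\<^esub> x) n = r \<odot>\<^bsub>M\<^esub> lin_comb M y x n"
    using lin_comb_smult[of n x r y] xz assms
      lin_comb_cong[of n "r \<odot>\<^bsub>Free R n\<^esub> x" "\<lambda>i. r \<otimes>\<^bsub>R\<^esub> x i" y y]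
    by (auto simp: free_module_simps)
qed (use assms in \<open>auto intro!: lin_comb_closed simp: free_module_simps\<close>)

lemma lin_comb_unit_vec:
  assumes "\<And>i. i < n \<Longrightarrow> y i \<in> carrier M" "i < n"
  shows "lin_comb M y (unit_vec R n i) n = y i"
proof -
  have "lin_comb M y (unit_vec R n i) m = (if i < m then y i else \<zero>\<^bsub>M\<^esub>)" if "m \<le> n" for m
    using that
  proof (induction m)
    case (Suc m)
    then show ?case using assms by (auto simp: unit_vec_def less_Suc_eq)
  qed auto
  then show ?thesis using assms by auto
qed

end

text \<open>A linear map out of R^n is determined by the images of the unit vectors. All later uses
  of matrices go through this fact; maps are kept as functions.\<close>

lemma free_hom_lin_comb:
  assumes M: "module R M" and h: "h \<in> mod_hom R (Free R n) M" and u: "u \<in> vecs R n"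
  shows "h u = lin_comb M (\<lambda>i. h (unit_vec R n i)) u n"
proof -
  interpret M: module R M by fact
  note F = Free[OF M.R.cring_axioms]
  \<comment> \<open>\<open>t m\<close> is \<open>u\<close> cut off after its first m coordinates;
    passing from m to m + 1 adds one multiple of a unit vector.\<close>
  define t where "t m = (\<lambda>j\<in>{..<n}. if j < m then u j else \<zero>\<^bsub>R\<^esub>)" for m
  have tc: "t m \<in> vecs R n" for m
    using free_module_coord[OF u] by (simp add: t_def free_module_simps PiE_iff)
  have "m \<le> n \<Longrightarrow> h (t m) = lin_comb M (\<lambda>i. h (unit_vec R n i)) u m" for m
  proof (induction m)
    case 0
    have "t 0 = \<zero>\<^bsub>Free R n\<^esub>" by (auto simp: t_def free_module_simps)
    then show ?case using mod_hom_zero[OF F M h] by simp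
  next
    case (Suc m)
    have um: "u m \<in> carrier R" using free_module_coord[OF u] Suc.prems by simp
    have "t (Suc m) = t m \<oplus>\<^bsub>Free R n\<^esub> (u m \<odot>\<^bsub>Free R n\<^esub> unit_vec R n m)"
      using free_module_coord[OF u] um
      by (simp add: t_def free_module_simps unit_vec_def fun_eq_iff less_Suc_eq)
    then have "h (t (Suc m)) = h (t m) \<oplus>\<^bsub>M\<^esub> (u m \<odot>\<^bsub>M\<^esub> h (unit_vec R n m))"
      using um tc unit_vec_closed[OF M.R.cring_axioms] module.smult_closed[OF F]
      by (simp add: mod_hom_add[OF h] mod_hom_smult[OF h])
    then show ?case using Suc by simp
  qed
  moreover have "t n = u" by (rule free_module_ext[OF tc u]) (simp add: t_def)
  ultimately show ?thesis by fastforce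
qed

lemma free_hom_eqI:
  assumes "module R M" "g \<in> mod_hom R (Free R n) M" "h \<in> mod_hom R (Free R n) M"
    "\<And>i. i < n \<Longrightarrow> g (unit_vec R n i) = h (unit_vec R n i)" "u \<in> vecs R n"
  shows "g u = h u" using free_hom_lin_comb[OF assms(1,2,5)] free_hom_lin_comb[OF assms(1,3,5)]
    module.lin_comb_cong[OF assms(1), of n u u "\<lambda>i. g (unit_vec R n i)" "\<lambda>i. h (unit_vec R n i)"] assms(4)
  by simp

lemma free_hom_mem:
  assumes "module R M" "h \<in> mod_hom R (Free R n) M" "submodule H R M"
    "\<And>i. i < n \<Longrightarrow> u i \<odot>\<^bsub>M\<^esub> h (unit_vec R n i) \<in> H" "u \<in> vecs R n"
  shows "h u \<in> H"
  using free_hom_lin_comb[OF assms(1,2,5)] module.lin_comb_mem[OF assms(1,3), of n u] assms(4) by simp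

text \<open>Projectivity of R^n: choose preimages of the images of the unit vectors. Asking only
  that the image of \<open>p\<close> lie in that of \<open>q\<close> allows lifting through
  differentials.\<close>

lemma free_lift:
  assumes "module R A" "module R B" "q \<in> mod_hom R A B" "p \<in> mod_hom R (Free R n) B"
    "p ` vecs R n \<subseteq> q ` carrier A"
  obtains h where "h \<in> mod_hom R (Free R n) A" "\<And>u. u \<in> vecs R n \<Longrightarrow> q (h u) = p u"
proof -
  interpret A: module R A by fact
  interpret B: module R B by fact
  have "\<exists>y. y \<in> carrier A \<and> q y = p (unit_vec R n i)" for i
    using subsetD[OF assms(5) imageI[OF unit_vec_closed[OF A.R.cring_axioms, of n i]]]
    unfolding image_iff by metis
  then obtain y where y: "\<And>i. y i \<in> carrier A" "\<And>i. q (y i) = p (unit_vec R n i)" by metis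
  have h: "(\<lambda>u. lin_comb A y u n) \<in> mod_hom R (Free R n) A" using y by (intro A.lin_comb_hom) auto
  show thesis
  proof (rule that[OF h])
    fix u assume u: "u \<in> vecs R n"
    have "q (lin_comb A y (unit_vec R n i) n) = p (unit_vec R n i)" if "i < n" for i
      unfolding A.lin_comb_unit_vec[OF y(1) that] by (rule y(2))
    then show "q (lin_comb A y u n) = p u"
      by (rule free_hom_eqI[OF assms(2) mod_hom_comp[OF h assms(3)] assms(4) _ u])
  qed
qed

lemma free_hom_exists:
  assumes "module R M" "\<And>i. i < n \<Longrightarrow> y i \<in> carrier M"
  obtains h where "h \<in> mod_hom R (Free R n) M" "\<And>i. i < n \<Longrightarrow> h (unit_vec R n i) = y i"
  using module.lin_comb_hom[OF assms(1), of n y] module.lin_comb_unit_vec[OF assms(1), of n y] assms(2)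
  by blast

subsection \<open>Splitting \<open>R\<^bsup>a+b\<^esup>\<close>\<close>

text \<open>R^a + R^b is realised inside R^(a+b), the second summand occupying the positions from a
  on, so that direct sums of free modules are again of the form \<open>Free R n\<close>.\<close>

definition vec_join :: "nat \<Rightarrow> nat \<Rightarrow> (nat \<Rightarrow> 'a) \<Rightarrow> (nat \<Rightarrow> 'a) \<Rightarrow> nat \<Rightarrow> 'a" where
  "vec_join a b u v = (\<lambda>i\<in>{..<a + b}. if i < a then u i else v (i - a))"

definition vec_fst :: "nat \<Rightarrow> (nat \<Rightarrow> 'a) \<Rightarrow> nat \<Rightarrow> 'a" where
  "vec_fst a w = restrict w {..<a}"

definition vec_snd :: "nat \<Rightarrow> nat \<Rightarrow> (nat \<Rightarrow> 'a) \<Rightarrow> nat \<Rightarrow> 'a" where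
  "vec_snd a b w = (\<lambda>i\<in>{..<b}. w (a + i))"

lemma vec_fst_hom: "vec_fst a \<in> Lin R (a + b) a"
  by (rule mod_homI) (auto simp: vec_fst_def free_module_simps fun_eq_iff PiE_iff)

lemma vec_snd_hom: "vec_snd a b \<in> Lin R (a + b) b"
  by (rule mod_homI) (auto simp: vec_snd_def free_module_simps fun_eq_iff PiE_iff)

lemma vec_join_hom:
  assumes "f \<in> mod_hom R M (Free R a)" "g \<in> mod_hom R M (Free R b)"
  shows "(\<lambda>x. vec_join a b (f x) (g x)) \<in> mod_hom R M (Free R (a + b))"
proof (rule mod_homI)
  fix x assume "x \<in> carrier M"
  then show "vec_join a b (f x) (g x) \<in> vecs R (a + b)"
    using mod_hom_closed[OF assms(1)] mod_hom_closed[OF assms(2)]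
    by (fastforce simp: vec_join_def free_module_simps)
qed (auto simp: mod_hom_add[OF assms(1)] mod_hom_add[OF assms(2)] mod_hom_smult[OF assms(1)]
  mod_hom_smult[OF assms(2)] vec_join_def free_module_simps fun_eq_iff)

lemma vec_join_closed:
  "u \<in> vecs R a \<Longrightarrow> v \<in> vecs R b \<Longrightarrow>
    vec_join a b u v \<in> vecs R (a + b)" by (fastforce simp: vec_join_def free_module_simps)

lemma vec_fst_join [simp]: "u \<in> vecs R a \<Longrightarrow> vec_fst a (vec_join a b u v) = u"
  by (auto simp: vec_fst_def vec_join_def free_module_simps fun_eq_iff PiE_iff extensional_def)

lemma vec_snd_join [simp]: "v \<in> vecs R b \<Longrightarrow> vec_snd a b (vec_join a b u v) = v"
  by (auto simp: vec_snd_def vec_join_def free_module_simps fun_eq_iff PiE_iff extensional_def)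

lemma vec_join_fst_snd:
  "w \<in> vecs R (a + b) \<Longrightarrow> vec_join a b (vec_fst a w) (vec_snd a b w) = w"
  by (auto simp: vec_snd_def vec_fst_def vec_join_def free_module_simps fun_eq_iff PiE_iff extensional_def)

lemma vec_join_surj:
  assumes "w \<in> vecs R (a + b)"
  obtains u v where "u \<in> vecs R a" "v \<in> vecs R b" "w = vec_join a b u v"
  using that[OF mod_hom_closed[OF vec_fst_hom assms] mod_hom_closed[OF vec_snd_hom assms]]
    vec_join_fst_snd[OF assms] by metis

subsection \<open>Finitely generated modules\<close>

lemma (in module) mod_span_eq_image:
  assumes "\<And>i. i < n \<Longrightarrow> y i \<in> carrier M"
  shows "mod_span R M (y ` {..<n}) = (\<lambda>u. lin_comb M y u n) ` vecs R n" (is "_ = ?J")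
proof
  have J: "submodule ?J R M"
    by (rule carrier_image_submodule[OF Free[OF R.cring_axioms] module_axioms lin_comb_hom[OF assms]])
  have "y i \<in> ?J" if "i < n" for i using lin_comb_unit_vec[of n y i] assms that
    by (intro image_eqI[where x = "unit_vec R n i"] unit_vec_closed R.cring_axioms) simp
  then show "mod_span R M (y ` {..<n}) \<subseteq> ?J" using J by (auto simp: mod_span_def)
  show "?J \<subseteq> mod_span R M (y ` {..<n})"
  proof (clarsimp simp: mod_span_def)
    fix u H assume u: "u \<in> vecs R n" and H: "submodule H R M" "y ` {..<n} \<subseteq> H"
    show "lin_comb M y u n \<in> H"
      by (rule lin_comb_mem[OF H(1)], rule submoduleD(6)[OF H(1) free_module_coord[OF u]]) (use H(2) in auto)
  qed
qed

text \<open>From here on finite generation is used as the existence of a surjection from some R^n;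
  the generators are the images of the unit vectors.\<close>

lemma fg_moduleI:
  assumes "module R M" "e \<in> mod_hom R (Free R n) M" "e ` vecs R n = carrier M"
  shows "fg_module R M"
proof -
  interpret module R M by fact
  let ?y = "\<lambda>i. e (unit_vec R n i)"
  have y: "?y i \<in> carrier M" for i using mod_hom_closed[OF assms(2) unit_vec_closed[OF R.cring_axioms]] .
  have "mod_span R M (?y ` {..<n}) = (\<lambda>u. lin_comb M ?y u n) ` vecs R n"
    by (rule mod_span_eq_image) (rule y)
  also have "\<dots> = e ` vecs R n"
    by (rule image_cong[OF refl]) (rule free_hom_lin_comb[OF assms(1,2), symmetric])
  finally have "mod_span R M (?y ` {..<n}) = carrier M" using assms(3) by simp
  then show ?thesis unfolding fg_module_def
    using y assms(1) by (intro conjI exI[of _ "?y ` {..<n}"]) auto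
qed

lemma fg_moduleE:
  assumes "fg_module R M"
  obtains n e where "e \<in> mod_hom R (Free R n) M" "e ` vecs R n = carrier M"
proof -
  obtain A where M: "module R M" and A: "A \<subseteq> carrier M" "finite A" "mod_span R M A = carrier M"
    using assms by (auto simp: fg_module_def)
  interpret module R M by fact
  obtain y and n :: nat where y: "A = y ` {i. i < n}" using finite_imp_nat_seg_image_inj_on[OF A(2)] by blast
  then have y: "A = y ` {..<n}" by (simp add: lessThan_def)
  have *: "\<And>i. i < n \<Longrightarrow> y i \<in> carrier M" using A y by auto
  show thesis by (rule that[OF lin_comb_hom[OF *]]) (use mod_span_eq_image[OF *] A(3) y in auto)
qed

lemma fg_module_module: "fg_module R M \<Longrightarrow> module R M"
  by (simp add: fg_module_def)

lemma fg_module_surj: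
  assumes "fg_module R M" "module R N" "h \<in> mod_hom R M N" "h ` carrier M = carrier N"
  shows "fg_module R N"
proof -
  obtain n e where e: "e \<in> mod_hom R (Free R n) M" "e ` vecs R n = carrier M"
    by (rule fg_moduleE[OF assms(1)])
  have "(\<lambda>x. h (e x)) ` vecs R n = carrier N" using e(2) assms(4) by (metis image_image)
  then show ?thesis by (rule fg_moduleI[OF assms(2) mod_hom_comp[OF e(1) assms(3)]])
qed

lemma fg_module_iso: "fg_module R M \<Longrightarrow> module R N \<Longrightarrow> isomorphic_modules R M N \<Longrightarrow> fg_module R N"
  using fg_module_surj mod_isoD unfolding isomorphic_modules_def by blast

lemma fg_free_module: "cring R \<Longrightarrow> fg_module R (Free R n)"
  by (rule fg_moduleI[OF Free mod_hom_id]) auto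

subsection \<open>Vectors with entries in an ideal\<close>

text \<open>For an ideal I this is I R^n, the kernel of the coordinatewise reduction of R^n modulo
  I.\<close>

definition ideal_vecs :: "'a set \<Rightarrow> nat \<Rightarrow> (nat \<Rightarrow> 'a) set" where
  "ideal_vecs I n = {..<n} \<rightarrow>\<^sub>E I"

lemma ideal_vecs_iff:
  assumes "I \<subseteq> carrier R" "u \<in> vecs R n"
  shows "u \<in> ideal_vecs I n \<longleftrightarrow> (\<forall>i<n. u i \<in> I)"
  using assms by (auto simp: ideal_vecs_def free_module_simps PiE_iff)

lemma ideal_facts:
  assumes "ideal I R"
  shows "I \<subseteq> carrier R" "\<zero>\<^bsub>R\<^esub> \<in> I" "a \<in> I \<Longrightarrow> b \<in> I \<Longrightarrow> a \<oplus>\<^bsub>R\<^esub> b \<in> I" "a \<in> I \<Longrightarrow> b \<in> I \<Longrightarrow> a \<ominus>\<^bsub>R\<^esub> b \<in> I"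
    "a \<in> I \<Longrightarrow> \<ominus>\<^bsub>R\<^esub> a \<in> I" "a \<in> I \<Longrightarrow> r \<in> carrier R \<Longrightarrow> r \<otimes>\<^bsub>R\<^esub> a \<in> I" "a \<in> I \<Longrightarrow> r \<in> carrier R \<Longrightarrow> a \<otimes>\<^bsub>R\<^esub> r \<in> I"
proof -
  interpret ideal I R by fact
  show "I \<subseteq> carrier R" "\<zero>\<^bsub>R\<^esub> \<in> I" "a \<in> I \<Longrightarrow> b \<in> I \<Longrightarrow> a \<oplus>\<^bsub>R\<^esub> b \<in> I" "a \<in> I \<Longrightarrow> b \<in> I \<Longrightarrow> a \<ominus>\<^bsub>R\<^esub> b \<in> I"
    "a \<in> I \<Longrightarrow> \<ominus>\<^bsub>R\<^esub> a \<in> I" "a \<in> I \<Longrightarrow> r \<in> carrier R \<Longrightarrow> r \<otimes>\<^bsub>R\<^esub> a \<in> I" "a \<in> I \<Longrightarrow> r \<in> carrier R \<Longrightarrow> a \<otimes>\<^bsub>R\<^esub> r \<in> I"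
    using a_subset I_l_closed I_r_closed by (auto simp: a_minus_def)
qed

text \<open>Lets the lemmas on images, preimages and sums of submodules be applied to
  ideals.\<close>

lemma submodule_self_iff_ideal:
  assumes "cring R" shows "submodule H R (self_module R) \<longleftrightarrow> ideal H R"
proof
  interpret cring R by fact
  interpret S: module R "self_module R" by (rule self_module) fact
  { assume H: "submodule H R (self_module R)"
    note D = S.submoduleD[OF H, simplified]
    have c: "\<And>x. x \<in> H \<Longrightarrow> x \<in> carrier R" using D(1) by auto
    have r: "a \<otimes>\<^bsub>R\<^esub> x \<in> H" if "a \<in> H" "x \<in> carrier R" for a x
      using D(6)[OF that(2,1)] m_comm[OF c[OF that(1)] that(2)] by simp
    show "ideal H R"
    proof (rule idealI)
      show "ring R" by (rule ring_axioms)
      show "subgroup H (add_monoid R)" by (rule add.subgroupI) (use D in auto)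
    qed (use D(6) r in auto) }
  assume H: "ideal H R"
  show "submodule H R (self_module R)" by (rule S.submoduleI_minus) (use ideal_facts[OF H] in auto)
qed

lemma ideal_vecs_submodule:
  assumes "cring R" "ideal I R"
  shows "submodule (ideal_vecs I n) R (Free R n)"
proof -
  interpret F: module R "Free R n" by (rule Free[OF assms(1)])
  note I = ideal_facts[OF assms(2)]
  show ?thesis
  proof (rule F.submoduleI_minus)
    show "ideal_vecs I n \<subseteq> vecs R n"
      using I(1) by (auto simp: ideal_vecs_def free_module_simps PiE_iff)
  qed (use I in \<open>auto simp: ideal_vecs_def free_module_simps PiE_iff\<close>)
qed

lemma ideal_vecs_smult:
  assumes "cring R" "ideal I R" "a \<in> I" "u \<in> vecs R n"
  shows "a \<odot>\<^bsub>Free R n\<^esub> u \<in> ideal_vecs I n"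
  using ideal_facts(7)[OF assms(2,3)] assms(4) by (auto simp: ideal_vecs_def free_module_simps PiE_iff)

text \<open>A vector with entries a_i in I is the sum of the a_i e_i, so its image is the sum of the
  a_i h(e_i); it suffices to test each such term.\<close>

lemma ideal_vecs_hom_mem:
  assumes "module R M" "ideal I R" "h \<in> mod_hom R (Free R n) M" "submodule H R M"
    "\<And>a i. a \<in> I \<Longrightarrow> i < n \<Longrightarrow> a \<odot>\<^bsub>M\<^esub> h (unit_vec R n i) \<in> H" "u \<in> ideal_vecs I n"
  shows "h u \<in> H"
proof (rule free_hom_mem[OF assms(1,3,4)])
  show "u \<in> vecs R n"
    using assms(6) ideal_facts(1)[OF assms(2)] by (auto simp: ideal_vecs_def free_module_simps PiE_iff)
  show "u i \<odot>\<^bsub>M\<^esub> h (unit_vec R n i) \<in> H" if "i < n" for i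
    using assms(5,6) that by (auto simp: ideal_vecs_def PiE_iff)
qed

lemma ideal_vecs_hom:
  assumes "cring R" "ideal I R" "h \<in> Lin R n m" "u \<in> ideal_vecs I n"
  shows "h u \<in> ideal_vecs I m"
  using ideal_vecs_smult[OF assms(1,2)] mod_hom_closed[OF assms(3) unit_vec_closed[OF assms(1)]] assms(4)
  by (intro ideal_vecs_hom_mem[OF Free[OF assms(1)] assms(2,3) ideal_vecs_submodule[OF assms(1,2)]]) auto

lemma ideal_vecs_subset: "ideal I R \<Longrightarrow> ideal_vecs I n \<subseteq> vecs R n"
  using ideal_facts(1) by (fastforce simp: ideal_vecs_def free_module_simps PiE_iff)

lemma ideal_vecs_mono: "I \<subseteq> J \<Longrightarrow> ideal_vecs I n \<subseteq> ideal_vecs J n"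
  by (auto simp: ideal_vecs_def PiE_iff)

lemma ideal_vecs_zero: "ideal_vecs {\<zero>\<^bsub>R\<^esub>} n = {\<zero>\<^bsub>Free R n\<^esub>}"
  by (auto simp: ideal_vecs_def free_module_simps fun_eq_iff PiE_iff extensional_def)

lemma ideal_vecs_join:
  assumes "u \<in> vecs R a" "v \<in> vecs R b"
  shows "vec_join a b u v \<in> ideal_vecs I (a + b) \<longleftrightarrow> u \<in> ideal_vecs I a \<and> v \<in> ideal_vecs I b"
proof
  assume *: "vec_join a b u v \<in> ideal_vecs I (a + b)"
  have "u i \<in> I" if "i < a" for i
    using PiE_mem[OF *[unfolded ideal_vecs_def], of i] that by (auto simp: vec_join_def)
  moreover have "v i \<in> I" if "i < b" for i
    using PiE_mem[OF *[unfolded ideal_vecs_def], of "a + i"] that by (auto simp: vec_join_def)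
  ultimately show "u \<in> ideal_vecs I a \<and> v \<in> ideal_vecs I b"
    using assms by (auto simp: ideal_vecs_def PiE_iff free_module_simps)
qed (auto simp: ideal_vecs_def PiE_iff vec_join_def)

lemma ideal_times_module_free:
  assumes "cring R" "ideal I R"
  shows "ideal_vecs I n \<subseteq> ideal_times_module R I (Free R n)"
proof
  interpret F: module R "Free R n" by (rule Free[OF assms(1)])
  fix u assume u: "u \<in> ideal_vecs I n"
  show "u \<in> ideal_times_module R I (Free R n)" unfolding ideal_times_module_def mod_span_def
  proof (clarify)
    fix H assume H: "submodule H R (Free R n)"
      "{a \<odot>\<^bsub>Free R n\<^esub> x |a x. a \<in> I \<and> x \<in> vecs R n} \<subseteq> H"
    show "u \<in> H" by (rule ideal_vecs_hom_mem[OF F.module_axioms assms(2) mod_hom_id H(1) _ u])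
        (use H(2) unit_vec_closed[OF assms(1)] in blast)
  qed
qed

subsection \<open>Noetherian rings\<close>

lemma noetherian_ideal_generated:
  assumes "cring R" "noetherian_ring R" "submodule I R (self_module R)"
  obtains m e where "e \<in> mod_hom R (Free R m) (self_module R)" "e ` vecs R m = I"
proof -
  interpret cring R by fact
  interpret noetherian_ring R by fact
  interpret S: module R "self_module R" by (rule self_module) fact
  have I: "ideal I R" using assms submodule_self_iff_ideal by blast
  obtain A where A: "A \<subseteq> carrier R" "finite A" "I = Idl\<^bsub>R\<^esub> A" using finetely_gen[OF I] by blast
  obtain y and n :: nat where y: "A = y ` {i. i < n}" using finite_imp_nat_seg_image_inj_on[OF A(2)] by blast
  then have y: "A = y ` {..<n}" by (simp add: lessThan_def)
  have *: "\<And>i. i < n \<Longrightarrow> y i \<in> carrier (self_module R)" using A y by auto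
  have eq: "mod_span R (self_module R) A = (\<lambda>u. lin_comb (self_module R) y u n) ` vecs R n"
    unfolding y by (rule S.mod_span_eq_image) (use A y in auto)
  have "mod_span R (self_module R) A = I"
    unfolding mod_span_def A(3) genideal_def submodule_self_iff_ideal[OF assms(1)] ..
  then show thesis using that[OF S.lin_comb_hom[OF *]] eq by simp
qed

text \<open>Induction on n. The last coordinates of \<open>U\<close> form a finitely generated
  ideal; lifts of its generators to \<open>U\<close>, together with generators of the vectors in
  \<open>U\<close> with last coordinate zero, generate \<open>U\<close>.\<close>

lemma noetherian_submodule_generated:
  assumes "cring R" "noetherian_ring R" "submodule U R (Free R n)"
  obtains m e where "e \<in> Lin R m n" "e ` vecs R m = U"
proof -
  note FM = Free[OF assms(1)]
  interpret cring R by fact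
  have "\<exists>m e. e \<in> Lin R m n \<and> e ` vecs R m = U" using assms(3)
  proof (induction n arbitrary: U)
    case 0
    interpret F: module R "Free R 0" by (rule FM)
    have "U = {\<zero>\<^bsub>Free R 0\<^esub>}" using F.submoduleD(1,2)[OF 0] free_module_0 by blast
    then show ?case using free_module_0 by (intro exI[of _ 0] exI[of _ "\<lambda>x. x"]) (auto intro: mod_hom_id)
  next
    case (Suc n)
    interpret F: module R "Free R (Suc n)" by (rule FM)
    note U = F.submoduleD[OF Suc.prems]
    have UM: "module R ((Free R (Suc n))\<lparr>carrier := U\<rparr>)" (is "module R ?U")
      by (rule submodule_carrier_module[OF FM Suc.prems])
    define q where "q = (\<lambda>u::nat \<Rightarrow> 'a. u n)"
    have q: "q \<in> mod_hom R (Free R (Suc n)) (self_module R)" unfolding q_def by (rule coord_hom) simp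
    have "submodule (q ` U) R (self_module R)"
      by (rule image_submodule[OF FM self_module[OF assms(1)] q Suc.prems])
    then obtain m2 e2 where e2: "e2 \<in> mod_hom R (Free R m2) (self_module R)"
      "e2 ` vecs R m2 = q ` U" by (rule noetherian_ideal_generated[OF assms(1,2)])
    have qU: "q \<in> mod_hom R ?U (self_module R)" by (rule mod_hom_restrict_dom[OF q U(1)])
    have c: "e2 ` vecs R m2 \<subseteq> q ` carrier ?U" using e2(2) by simp
    obtain f where f: "f \<in> mod_hom R (Free R m2) ?U"
      "\<And>w. w \<in> vecs R m2 \<Longrightarrow> q (f w) = e2 w"
      using free_lift[OF UM self_module[OF assms(1)] qU e2(1) c] by blast
    have f': "f \<in> Lin R m2 (Suc n)" by (rule mod_hom_extend_cod[OF f(1) U(1)])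
    define x where "x = (\<lambda>v::nat \<Rightarrow> 'a. \<lambda>i\<in>{..<Suc n}. if i < n then v i else \<zero>\<^bsub>R\<^esub>)"
    have x: "x \<in> Lin R n (Suc n)"
      by (rule mod_homI) (auto simp: x_def free_module_simps fun_eq_iff PiE_iff)
    have "submodule {v \<in> vecs R n. x v \<in> U} R (Free R n)"
      by (rule vimage_submodule[OF FM FM x Suc.prems])
    then obtain m1 e1 where e1: "e1 \<in> Lin R m1 n"
      "e1 ` vecs R m1 = {v \<in> vecs R n. x v \<in> U}" using Suc.IH by blast
    define e where "e w = x (e1 (vec_fst m1 w)) \<oplus>\<^bsub>Free R (Suc n)\<^esub> f (vec_snd m1 m2 w)" for w
    have e: "e \<in> Lin R (m1 + m2) (Suc n)" unfolding e_def
      by (rule mod_hom_plus[OF FM mod_hom_comp[OF mod_hom_comp[OF vec_fst_hom e1(1)] x]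
            mod_hom_comp[OF vec_snd_hom f']])
    have fU: "f w \<in> U" if "w \<in> vecs R m2" for w using mod_hom_closed[OF f(1) that] by simp
    have xU: "x (e1 w) \<in> U" if "w \<in> vecs R m1" for w using e1(2) that by blast
    have "e ` vecs R (m1 + m2) = U"
    proof
      show "e ` vecs R (m1 + m2) \<subseteq> U"
        using fU[OF mod_hom_closed[OF vec_snd_hom]] xU[OF mod_hom_closed[OF vec_fst_hom]] U(3)
        by (auto simp: e_def)
      show "U \<subseteq> e ` vecs R (m1 + m2)"
      proof
        fix u assume u: "u \<in> U"
        then have "q u \<in> e2 ` vecs R m2" using e2(2) by blast
        then obtain w2 where w2: "w2 \<in> vecs R m2" "q u = q (f w2)" using f(2) by fastforce
        \<comment> \<open>\<open>u\<close> and \<open>f w2\<close> have the same last coordinate, so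
          their difference comes from R^n along the embedding \<open>x\<close>.\<close>
        define v where "v = (\<lambda>i\<in>{..<n}. (u \<ominus>\<^bsub>Free R (Suc n)\<^esub> f w2) i)"
        have uc: "u \<in> vecs R (Suc n)" "f w2 \<in> vecs R (Suc n)" using u U(1) fU[OF w2(1)] by auto
        have dc: "u \<ominus>\<^bsub>Free R (Suc n)\<^esub> f w2 \<in> vecs R (Suc n)" using uc by auto
        have vc: "v \<in> vecs R n" using dc by (auto simp: v_def free_module_simps PiE_iff)
        have "x v = u \<ominus>\<^bsub>Free R (Suc n)\<^esub> f w2"
        proof (rule free_module_ext[OF mod_hom_closed[OF x vc] dc])
          fix i assume "i < Suc n"
          show "x v i = (u \<ominus>\<^bsub>Free R (Suc n)\<^esub> f w2) i"
          proof (cases "i < n")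
            case False
            then have "i = n" using \<open>i < Suc n\<close> by simp
            then show ?thesis using free_module_minus[OF assms(1) uc, of n] w2(2) free_module_coord[OF uc(2), of n]
              by (simp add: x_def q_def a_minus_def r_neg)
          qed (simp add: x_def v_def)
        qed
        moreover have "u \<ominus>\<^bsub>Free R (Suc n)\<^esub> f w2 \<in> U" using u fU[OF w2(1)] U(4) by blast
        ultimately have "v \<in> e1 ` vecs R m1" using e1(2) vc by simp
        then obtain w1 where w1: "w1 \<in> vecs R m1" "v = e1 w1" by blast
        have "e (vec_join m1 m2 w1 w2) = x v \<oplus>\<^bsub>Free R (Suc n)\<^esub> f w2"
          using w1 w2 by (simp add: e_def vec_fst_join[OF w1(1)] vec_snd_join[OF w2(1)])
        also have "\<dots> = u" using \<open>x v = _\<close> uc F.add_diff_cancel(2) by simp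
        finally show "u \<in> e ` vecs R (m1 + m2)" using vec_join_closed[OF w1(1) w2(1)] by blast
      qed
    qed
    then show ?case using e by blast
  qed
  then show thesis using that by blast
qed

subsection \<open>Local rings and minimal covers\<close>

lemma local_ring_cring: "local_ring R \<Longrightarrow> cring R"
  and local_ring_noetherian: "local_ring R \<Longrightarrow> noetherian_ring R"
  by (simp_all add: local_ring_def)

lemma max_ideal_maximal:
  assumes "local_ring R" shows "maximalideal (max_ideal R) R"
  unfolding max_ideal_def by (rule theI') (use assms in \<open>simp add: local_ring_def\<close>)

lemma max_ideal_ideal: "local_ring R \<Longrightarrow> ideal (max_ideal R) R"
  using max_ideal_maximal maximalideal.axioms(1) by blast

lemma (in cring) unit_in_ideal:
  assumes "ideal J R" "a \<in> J" "a \<in> Units R"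
  shows "J = carrier R"
proof -
  have "\<one> \<in> J" using ideal_facts(6)[OF assms(1,2), of "inv a"] assms(3) by (simp add: Units_l_inv)
  then show ?thesis using ideal.one_imp_carrier[OF assms(1)] by blast
qed

text \<open>Among the proper ideals containing a there is a maximal one, since chains of ideals in a
  Noetherian ring contain their unions. It is a maximal ideal of the ring, hence the only
  one.\<close>

lemma nonunit_in_max_ideal:
  assumes "local_ring R" "a \<in> carrier R" "a \<notin> Units R"
  shows "a \<in> max_ideal R"
proof -
  interpret cring R by (rule local_ring_cring[OF assms(1)])
  interpret noetherian_ring R by (rule local_ring_noetherian[OF assms(1)])
  define F where "F = {J. ideal J R \<and> a \<in> J \<and> \<one>\<^bsub>R\<^esub> \<notin> J}"
  have "PIdl\<^bsub>R\<^esub> a \<in> F"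
  proof -
    have "\<one>\<^bsub>R\<^esub> \<notin> PIdl\<^bsub>R\<^esub> a"
    proof
      assume "\<one>\<^bsub>R\<^esub> \<in> PIdl\<^bsub>R\<^esub> a"
      then obtain r where r: "r \<in> carrier R" "\<one>\<^bsub>R\<^esub> = r \<otimes>\<^bsub>R\<^esub> a" by (auto simp: cgenideal_def)
      then have "a \<otimes>\<^bsub>R\<^esub> r = \<one>\<^bsub>R\<^esub>" using m_comm[OF assms(2) r(1)] by simp
      then have "a divides\<^bsub>R\<^esub> \<one>\<^bsub>R\<^esub>" using r(1) by (metis dividesI)
      then show False using divides_one[OF assms(2)] assms(3) by blast
    qed
    then show ?thesis using cgenideal_ideal[OF assms(2)] cgenideal_self[OF assms(2)] by (simp add: F_def)
  qed
  then have "F \<noteq> {}" by blast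
  moreover have "\<Union>C \<in> F" if "C \<noteq> {}" "subset.chain F C" for C
  proof -
    have "subset.chain {I. ideal I R} C" using that(2) by (auto simp: subset.chain_def F_def)
    then have "\<Union>C \<in> C" using ideal_chain_is_trivial that(1) by blast
    then show ?thesis using that(2) by (auto simp: subset.chain_def)
  qed
  ultimately obtain J where J: "J \<in> F" "\<And>K. K \<in> F \<Longrightarrow> J \<subseteq> K \<Longrightarrow> K = J"
    using subset_Zorn_nonempty[of F] by blast
  have "maximalideal J R"
  proof (rule maximalidealI)
    show "ideal J R" "carrier R \<noteq> J" using J(1) by (auto simp: F_def)
    fix K assume K: "ideal K R" "J \<subseteq> K" "K \<subseteq> carrier R"
    show "K = J \<or> K = carrier R"
    proof (cases "\<one>\<^bsub>R\<^esub> \<in> K")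
      case True then show ?thesis using ideal.one_imp_carrier[OF K(1)] by blast
    next
      case False then show ?thesis using K J by (auto simp: F_def)
    qed
  qed
  then have "J = max_ideal R" using max_ideal_maximal[OF assms(1)] assms(1) by (auto simp: local_ring_def)
  then show ?thesis using J(1) by (simp add: F_def)
qed

lemma one_notin_max_ideal: "local_ring R \<Longrightarrow> \<one>\<^bsub>R\<^esub> \<notin> max_ideal R"
  using maximalideal.I_notcarr[OF max_ideal_maximal] ideal.one_imp_carrier[OF max_ideal_ideal] by metis

lemma one_minus_max_ideal_unit:
  assumes "local_ring R" "a \<in> max_ideal R"
  shows "\<one>\<^bsub>R\<^esub> \<ominus>\<^bsub>R\<^esub> a \<in> Units R"
proof (rule ccontr)
  interpret cring R by (rule local_ring_cring[OF assms(1)])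
  note I = ideal_facts[OF max_ideal_ideal[OF assms(1)]]
  have a: "a \<in> carrier R" using I(1) assms(2) by auto
  assume "\<one>\<^bsub>R\<^esub> \<ominus>\<^bsub>R\<^esub> a \<notin> Units R"
  then have "\<one>\<^bsub>R\<^esub> \<ominus>\<^bsub>R\<^esub> a \<in> max_ideal R" using nonunit_in_max_ideal[OF assms(1)] a by simp
  then have "(\<one>\<^bsub>R\<^esub> \<ominus>\<^bsub>R\<^esub> a) \<oplus>\<^bsub>R\<^esub> a \<in> max_ideal R" using I(3) assms(2) by blast
  moreover have "(\<one>\<^bsub>R\<^esub> \<ominus>\<^bsub>R\<^esub> a) \<oplus>\<^bsub>R\<^esub> a = \<one>\<^bsub>R\<^esub>" using a by algebra
  ultimately show False using one_notin_max_ideal[OF assms(1)] by simp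
qed

text \<open>A surjection from R^n with least n works: a relation with a unit as its j-th coefficient
  would express the j-th generator by the others, and n - 1 generators would do.\<close>

lemma minimal_cover:
  assumes "fg_module R M"
  obtains n e where "e \<in> mod_hom R (Free R n) M" "e ` vecs R n = carrier M"
    "\<forall>u \<in> a_kernel (Free R n) M e. \<forall>i<n. u i \<notin> Units R"
proof -
  have M: "module R M" by (rule fg_module_module[OF assms])
  interpret M: module R M by (rule M)
  note FM = Free[OF M.R.cring_axioms]
  define P where "P n = (\<exists>e. e \<in> mod_hom R (Free R n) M \<and> e ` vecs R n = carrier M)" for n
  have "\<exists>n. P n" using fg_moduleE[OF assms] unfolding P_def by metis
  then have P: "P (LEAST n. P n)" by (metis LeastI)
  define n where "n = (LEAST n. P n)"
  obtain e where e: "e \<in> mod_hom R (Free R n) M" "e ` vecs R n = carrier M"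
    using P[folded n_def] unfolding P_def by blast
  interpret F: module R "Free R n" by (rule FM)
  have "u j \<notin> Units R" if u: "u \<in> a_kernel (Free R n) M e" and j: "j < n" for u j
  proof
    assume unit: "u j \<in> Units R"
    have uc: "u \<in> vecs R n" and u0: "e u = \<zero>\<^bsub>M\<^esub>" using u by (auto simp: a_kernel_eq)
    obtain m where m: "n = Suc m" using j by (cases n) auto
    define y where "y i = e (unit_vec R n i)" for i
    have y: "y i \<in> carrier M" for i unfolding y_def by (rule mod_hom_closed[OF e(1) unit_vec_closed[OF M.R.cring_axioms]])
    \<comment> \<open>Enumerates the indices other than j by 0, ..., m - 1.\<close>
    define skip where "skip i = (if i < j then i else Suc i)" for i
    obtain e' where e': "e' \<in> mod_hom R (Free R m) M" "\<And>i. i < m \<Longrightarrow> e' (unit_vec R m i) = y (skip i)"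
      using free_hom_exists[OF M, of m "\<lambda>i. y (skip i)"] y by blast
    let ?H = "e' ` vecs R m"
    have H: "submodule ?H R M" by (rule carrier_image_submodule[OF FM M e'(1)])
    have other: "y i \<in> ?H" if "i < n" "i \<noteq> j" for i
    proof -
      define k where "k = (if i < j then i else i - 1)"
      have k: "k < m" "skip k = i" using that m j by (auto simp: k_def skip_def)
      then have "e' (unit_vec R m k) = y i" using e'(2) by simp
      then show ?thesis using unit_vec_closed[OF M.R.cring_axioms] by (metis imageI)
    qed
    have zero_j: "e v \<in> ?H" if v: "v \<in> vecs R n" "v j = \<zero>\<^bsub>R\<^esub>" for v
    proof (rule free_hom_mem[OF M e(1) H _ v(1)])
      fix i assume i: "i < n"
      show "v i \<odot>\<^bsub>M\<^esub> e (unit_vec R n i) \<in> ?H"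
      proof (cases "i = j")
        case True
        then show ?thesis using v(2) y[of i] M.submoduleD(2)[OF H] by (simp add: y_def)
      next
        case False
        then show ?thesis using other[OF i] M.submoduleD(6)[OF H free_module_coord[OF v(1) i]] by (simp add: y_def)
      qed
    qed
    have yj: "y j \<in> ?H"
    proof -
      let ?c = "inv\<^bsub>R\<^esub> (u j)"
      have c: "?c \<in> carrier R" using unit by simp
      \<comment> \<open>Subtracting the normalised relation from the j-th unit vector makes the j-th
        coordinate zero and leaves the image \<open>y j\<close> unchanged, because
        \<open>e u\<close> is zero.\<close>
      define v where "v = unit_vec R n j \<ominus>\<^bsub>Free R n\<^esub> (?c \<odot>\<^bsub>Free R n\<^esub> u)"
      have uv: "unit_vec R n j \<in> vecs R n" by (rule unit_vec_closed[OF M.R.cring_axioms])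
      have cu: "?c \<odot>\<^bsub>Free R n\<^esub> u \<in> vecs R n" using c uc by simp
      have vc: "v \<in> vecs R n" unfolding v_def using uv cu by simp
      have "v j = \<one>\<^bsub>R\<^esub> \<ominus>\<^bsub>R\<^esub> ?c \<otimes>\<^bsub>R\<^esub> u j"
        unfolding v_def using free_module_minus[OF M.R.cring_axioms uv cu j] j
        by (simp add: unit_vec_def free_module_simps)
      then have "v j = \<zero>\<^bsub>R\<^esub>" using unit by (simp add: M.R.Units_l_inv a_minus_def M.R.r_neg)
      then have "e v \<in> ?H" by (rule zero_j[OF vc])
      moreover have "e v = y j \<ominus>\<^bsub>M\<^esub> (?c \<odot>\<^bsub>M\<^esub> e u)"
        unfolding v_def y_def using mod_hom_minus[OF FM M e(1) uv cu] mod_hom_smult[OF e(1) c uc] by simp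
      moreover have "\<dots> = y j" using u0 c y[of j] by (simp add: a_minus_def M.a_inv_zero)
      ultimately show ?thesis by simp
    qed
    have "carrier M \<subseteq> ?H"
    proof
      fix x assume "x \<in> carrier M"
      then obtain w where w: "w \<in> vecs R n" "x = e w" using e(2) by blast
      have "e w \<in> ?H"
      proof (rule free_hom_mem[OF M e(1) H _ w(1)])
        fix i assume i: "i < n"
        then have "y i \<in> ?H" using other yj by blast
        then show "w i \<odot>\<^bsub>M\<^esub> e (unit_vec R n i) \<in> ?H"
          using M.submoduleD(6)[OF H free_module_coord[OF w(1) i]] by (simp add: y_def)
      qed
      then show "x \<in> ?H" using w(2) by simp
    qed
    then have "?H = carrier M" using M.submoduleD(1)[OF H] by blast
    then have "P m" using e'(1) unfolding P_def by blast
    then have "n \<le> m" unfolding n_def by (rule Least_le)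
    then show False using m by simp
  qed
  then show thesis using that[OF e] by blast
qed

lemma minimal_cover_local:
  assumes "local_ring R" "fg_module R M"
  obtains n e where "e \<in> mod_hom R (Free R n) M" "e ` vecs R n = carrier M"
    "a_kernel (Free R n) M e \<subseteq> ideal_vecs (max_ideal R) n"
proof -
  obtain n e where e: "e \<in> mod_hom R (Free R n) M" "e ` vecs R n = carrier M"
    "\<forall>u \<in> a_kernel (Free R n) M e. \<forall>i<n. u i \<notin> Units R"
    by (rule minimal_cover[OF assms(2)])
  have "u \<in> ideal_vecs (max_ideal R) n" if "u \<in> a_kernel (Free R n) M e" for u
  proof -
    have u: "u \<in> vecs R n" using that by (simp add: a_kernel_eq)
    show ?thesis unfolding ideal_vecs_iff[OF ideal_facts(1)[OF max_ideal_ideal[OF assms(1)]] u]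
      using nonunit_in_max_ideal[OF assms(1)] e(3) that free_module_coord[OF u] by blast
  qed
  then show thesis using that[OF e(1,2)] by blast
qed

subsection \<open>Projective modules over a local ring are free\<close>

text \<open>Nakayama's argument. Write K for the kernel of \<open>e\<close> and m for the maximal
  ideal. The map u - s(e u) retracts R^n onto K, so K contained in m R^n gives K = mK. If a minimal
  cover of K had a generator, this generator would lie in mK, and the resulting relation would have
  a unit coefficient of the form 1 - a with a in m.\<close>

lemma split_minimal_cover_inj:
  assumes R: "local_ring R" and P: "module R P" and e: "e \<in> mod_hom R (Free R n) P"
    and ker: "a_kernel (Free R n) P e \<subseteq> ideal_vecs (max_ideal R) n"
    and s: "s \<in> mod_hom R P (Free R n)" "\<And>x. x \<in> carrier P \<Longrightarrow> e (s x) = x"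
  shows "a_kernel (Free R n) P e = {\<zero>\<^bsub>Free R n\<^esub>}"
proof -
  interpret cring R by (rule local_ring_cring[OF R])
  note FM = Free[OF cring_axioms]
  note mI = max_ideal_ideal[OF R]
  interpret F: module R "Free R n" by (rule FM)
  interpret P: module R P by (rule P)
  let ?K = "a_kernel (Free R n) P e" and ?F = "Free R n"
  have K: "submodule ?K R ?F" by (rule kernel_submodule[OF FM P e])
  define h where "h u = u \<ominus>\<^bsub>?F\<^esub> s (e u)" for u
  have h: "h \<in> mod_hom R ?F ?F"
    unfolding h_def by (rule mod_hom_diff[OF FM mod_hom_id mod_hom_comp[OF e s(1)]])
  have hK: "h u \<in> ?K" if u: "u \<in> carrier ?F" for u
  proof -
    have seu: "s (e u) \<in> carrier ?F" using u mod_hom_closed[OF e] mod_hom_closed[OF s(1)] by blast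
    have "e (h u) = e u \<ominus>\<^bsub>P\<^esub> e u" unfolding h_def
      using mod_hom_minus[OF FM P e u seu] s(2)[OF mod_hom_closed[OF e u]] by simp
    then show ?thesis using mod_hom_closed[OF h u] mod_hom_closed[OF e u] by (simp add: a_kernel_eq P.minus_eq_zero_iff)
  qed
  have hid: "h u = u" if u: "u \<in> ?K" for u
    using u mod_hom_zero[OF P FM s(1)] by (simp add: h_def a_kernel_eq a_minus_def F.a_inv_zero)
  let ?KM = "?F\<lparr>carrier := ?K\<rparr>"
  have KM: "module R ?KM" by (rule submodule_carrier_module[OF FM K])
  have hKM: "h \<in> mod_hom R ?F ?KM" by (rule mod_hom_restrict_cod[OF h]) (use hK in blast)
  have him: "h ` carrier ?F = carrier ?KM"
    using hK hid F.submoduleD(1)[OF K] by (auto intro!: image_eqI[OF hid[symmetric]])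
  obtain c g where g: "g \<in> mod_hom R (Free R c) ?KM" "g ` vecs R c = carrier ?KM"
    "\<forall>u \<in> a_kernel (Free R c) ?KM g. \<forall>i<c. u i \<notin> Units R"
    by (rule minimal_cover[OF fg_moduleI[OF KM hKM him]])
  interpret C: module R "Free R c" by (rule FM)
  have "c = 0"
  proof (rule ccontr)
    assume "c \<noteq> 0" then have c: "0 < c" by simp
    let ?u = "unit_vec R c 0"
    have uc: "?u \<in> vecs R c" by (rule unit_vec_closed[OF cring_axioms])
    have gu: "g ?u \<in> ?K" using mod_hom_closed[OF g(1) uc] by simp
    define H where "H = g ` ideal_vecs (max_ideal R) c"
    have H: "submodule H R ?KM" unfolding H_def
      by (rule image_submodule[OF FM KM g(1) ideal_vecs_submodule[OF cring_axioms mI]])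
    \<comment> \<open>\<open>h\<close> fixes the generator, and sends m R^n into mK, the image of m
      R^c under \<open>g\<close>.\<close>
    have "h (g ?u) \<in> H"
    proof (rule ideal_vecs_hom_mem[OF KM mI hKM H])
      show "g ?u \<in> ideal_vecs (max_ideal R) n" using gu ker by blast
      fix a i assume a: "a \<in> max_ideal R"
      have "h (unit_vec R n i) \<in> g ` vecs R c"
        using hK[OF unit_vec_closed[OF cring_axioms]] g(2) by simp
      then obtain w where w: "w \<in> vecs R c" "h (unit_vec R n i) = g w" by blast
      have aR: "a \<in> carrier R" using a ideal_facts(1)[OF mI] by blast
      have "a \<odot>\<^bsub>?KM\<^esub> h (unit_vec R n i) = g (a \<odot>\<^bsub>Free R c\<^esub> w)"
        unfolding w(2) using mod_hom_smult[OF g(1) aR w(1)] by simp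
      then show "a \<odot>\<^bsub>?KM\<^esub> h (unit_vec R n i) \<in> H"
        unfolding H_def using ideal_vecs_smult[OF cring_axioms mI a w(1)] by simp
    qed
    then obtain w where w: "w \<in> ideal_vecs (max_ideal R) c" "g ?u = g w"
      using hid[OF gu] by (auto simp: H_def)
    have wc: "w \<in> vecs R c" using w(1) ideal_vecs_subset[OF mI] by blast
    have "g (?u \<ominus>\<^bsub>Free R c\<^esub> w) = \<zero>\<^bsub>?KM\<^esub>"
      using mod_hom_eq_iff[OF FM KM g(1) uc wc] w(2) by blast
    then have "?u \<ominus>\<^bsub>Free R c\<^esub> w \<in> a_kernel (Free R c) ?KM g"
      using uc wc by (simp add: a_kernel_eq)
    then have "(?u \<ominus>\<^bsub>Free R c\<^esub> w) 0 \<notin> Units R" using g(3) c by blast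
    moreover have "(?u \<ominus>\<^bsub>Free R c\<^esub> w) 0 = \<one>\<^bsub>R\<^esub> \<ominus>\<^bsub>R\<^esub> w 0"
      using free_module_minus[OF cring_axioms uc wc c] c by (simp add: unit_vec_def)
    moreover have "w 0 \<in> max_ideal R" using w(1) c ideal_vecs_iff[OF ideal_facts(1)[OF mI] wc] by blast
    ultimately show False using one_minus_max_ideal_unit[OF R] by simp
  qed
  then have "?K = g ` {\<zero>\<^bsub>Free R 0\<^esub>}" using g(2) free_module_0[of R] by simp
  then show ?thesis using mod_hom_zero[OF FM KM g(1)] \<open>c = 0\<close> by simp
qed

text \<open>Projectivity splits the minimal cover, which is then injective. The test modules in
  \<open>projective_module\<close> have the element type of \<open>'a fgmod\<close>, so R^n is
  replaced by its quotient by the zero submodule.\<close>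

lemma projective_imp_free:
  fixes P :: "'a fgmod"
  assumes R: "local_ring R" and P: "projective_module R P"
  obtains n where "isomorphic_modules R (Free R n) P"
proof -
  interpret cring R by (rule local_ring_cring[OF R])
  note FM = Free[OF cring_axioms]
  have fgP: "fg_module R P" using P by (simp add: projective_module_def)
  have PM: "module R P" by (rule fg_module_module[OF fgP])
  obtain n e where e: "e \<in> mod_hom R (Free R n) P" "e ` vecs R n = carrier P"
    "a_kernel (Free R n) P e \<subseteq> ideal_vecs (max_ideal R) n"
    by (rule minimal_cover_local[OF R fgP])
  let ?F = "Free R n" let ?Z = "{\<zero>\<^bsub>?F\<^esub>}"
  have Z: "submodule ?Z R ?F" by (rule module.zero_submodule[OF FM])
  let ?A = "quot_module ?F ?Z" and ?q = "mod_coset ?F ?Z"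
  have A: "module R ?A" by (rule quot_module[OF FM Z])
  note q = mod_coset_hom[OF FM Z] mod_coset_surj[OF FM Z]
  have fgA: "fg_module R ?A" by (rule fg_module_surj[OF fg_free_module[OF cring_axioms] A q])
  obtain k where k: "k \<in> mod_hom R ?A ?F" "\<And>x. x \<in> carrier ?F \<Longrightarrow> k (?q x) = x"
    using mod_hom_factor_surj[OF FM A FM q mod_hom_id] mod_coset_eq_zero_iff[OF FM Z] by blast
  have ek: "(\<lambda>x. e (k x)) \<in> mod_hom R ?A P" by (rule mod_hom_comp[OF k(1) e(1)])
  have "(\<lambda>x. e (k x)) ` carrier ?A = carrier P"
  proof -
    have "(\<lambda>x. e (k x)) ` carrier ?A = (\<lambda>x. e (k (?q x))) ` carrier ?F" unfolding q(2)[symmetric] image_image ..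
    also have "\<dots> = e ` carrier ?F" using k(2) by (auto intro!: image_cong)
    finally show ?thesis using e(2) by simp
  qed
  from P[unfolded projective_module_def, THEN conjunct2, rule_format, OF ek mod_hom_id fgA fgP this]
  obtain h where h: "h \<in> mod_hom R P ?A" "\<And>x. x \<in> carrier P \<Longrightarrow> e (k (h x)) = x"
    by blast
  have "a_kernel ?F P e = ?Z"
    by (rule split_minimal_cover_inj[OF R PM e(1,3) mod_hom_comp[OF h(1) k(1)] h(2)])
  then have "inj_on e (carrier ?F)" unfolding inj_on_iff_kernel[OF FM PM e(1)] by (auto simp: a_kernel_eq)
  then show thesis using that isomorphic_modulesI[OF mod_isoI[OF e(1) _ e(2)]] by blast
qed

subsection \<open>Finite free resolutions\<close>

text \<open>\<open>ffr_sub R n c W\<close>: the submodule \<open>W\<close> of \<open>R\<^sup>c\<close> has a resolution by free modules of finite rank with at most \<open>n\<close> terms.\<close>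

primrec ffr_sub :: "('a, 'r) ring_scheme \<Rightarrow> nat \<Rightarrow> nat \<Rightarrow> (nat \<Rightarrow> 'a) set \<Rightarrow> bool" where
  "ffr_sub R 0 = (\<lambda>c W. W = {\<zero>\<^bsub>Free R c\<^esub>})"
| "ffr_sub R (Suc n) = (\<lambda>c W. \<exists>d. \<exists>e \<in> Lin R d c.
     e ` vecs R d = W \<and> ffr_sub R n d (a_kernel (Free R d) (Free R c) e))"

text \<open>A recursion over modules would change the type of their elements. It therefore runs over
  submodules of free modules, and \<open>M\<close>, whose element type is arbitrary, occurs only in
  the first step. The resolution has length at most n, that is, at most n + 1 terms.\<close>

definition ffr :: "('a, 'r) ring_scheme \<Rightarrow> nat \<Rightarrow> ('a, 'b, 'm) module_scheme \<Rightarrow> bool" where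
  "ffr R n M \<longleftrightarrow> (\<exists>d. \<exists>e \<in> mod_hom R (Free R d) M.
     e ` vecs R d = carrier M \<and> ffr_sub R n d (a_kernel (Free R d) M e))"

text \<open>The working form of finite projective dimension over a local ring; its behaviour in
  short exact sequences carries the whole descent.\<close>

definition has_ffr :: "('a, 'r) ring_scheme \<Rightarrow> ('a, 'b, 'm) module_scheme \<Rightarrow> bool" where
  "has_ffr R M \<longleftrightarrow> (\<exists>n. ffr R n M)"

lemma a_kernel_restrict_cod: "a_kernel A (B\<lparr>carrier := W\<rparr>) f = a_kernel A B f"
  by (simp add: a_kernel_eq)

lemma ffr_sub_Suc_iff:
  assumes "W \<subseteq> vecs R c"
  shows "ffr_sub R (Suc n) c W \<longleftrightarrow> ffr R n ((Free R c)\<lparr>carrier := W\<rparr>)"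
proof
  assume "ffr_sub R (Suc n) c W"
  then show "ffr R n ((Free R c)\<lparr>carrier := W\<rparr>)"
  proof (simp only: ffr_sub.simps, elim exE bexE conjE)
    fix d e assume e: "e \<in> Lin R d c" "e ` vecs R d = W"
      "ffr_sub R n d (a_kernel (Free R d) (Free R c) e)"
    show ?thesis unfolding ffr_def by (rule exI[of _ d], rule bexI[OF _ mod_hom_restrict_cod[OF e(1)]])
        (use e in \<open>simp_all add: a_kernel_restrict_cod\<close>)
  qed
next
  assume "ffr R n ((Free R c)\<lparr>carrier := W\<rparr>)"
  then obtain d e where e: "e \<in> mod_hom R (Free R d) ((Free R c)\<lparr>carrier := W\<rparr>)"
    "e ` vecs R d = W" "ffr_sub R n d (a_kernel (Free R d) (Free R c) e)"
    unfolding ffr_def a_kernel_restrict_cod by auto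
  then show "ffr_sub R (Suc n) c W"
    unfolding ffr_sub.simps using mod_hom_extend_cod[OF e(1) assms] by blast
qed

lemma ffr_sub_Suc_mono:
  assumes "cring R" "ffr_sub R n c W" shows "ffr_sub R (Suc n) c W" using assms(2)
proof (induction n arbitrary: c W)
  case 0
  note FM = Free[OF assms(1)]
  show ?case unfolding ffr_sub.simps by (rule exI[of _ 0], rule bexI[OF _ mod_hom_const_zero[OF FM]])
      (use 0 free_module_0[of R] in \<open>simp add: a_kernel_eq\<close>)
next
  case (Suc n)
  then show ?case by (subst ffr_sub.simps, subst (asm) ffr_sub.simps) blast
qed

lemma ffr_Suc_mono: "cring R \<Longrightarrow> ffr R n M \<Longrightarrow> ffr R (Suc n) M"
  unfolding ffr_def using ffr_sub_Suc_mono by blast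

lemma ffr_mono: "cring R \<Longrightarrow> ffr R n M \<Longrightarrow> n \<le> m \<Longrightarrow> ffr R m M"
  by (induction m) (auto simp: le_Suc_eq intro: ffr_Suc_mono)

lemma ffr_surj_iso:
  assumes "module R M" "module R N" "h \<in> mod_iso R M N" "ffr R n M"
  shows "ffr R n N"
proof -
  note h = mod_isoD[OF assms(3)]
  obtain d e where e: "e \<in> mod_hom R (Free R d) M" "e ` vecs R d = carrier M"
    "ffr_sub R n d (a_kernel (Free R d) M e)" using assms(4) unfolding ffr_def by blast
  have "h x = \<zero>\<^bsub>N\<^esub> \<longleftrightarrow> x = \<zero>\<^bsub>M\<^esub>" if "x \<in> carrier M" for x
    using inj_on_iff_kernel[OF assms(1,2) h(1)] h(2) mod_hom_zero[OF assms(1,2) h(1)] that by blast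
  then have "a_kernel (Free R d) N (\<lambda>x. h (e x)) = a_kernel (Free R d) M e"
    using mod_hom_closed[OF e(1)] unfolding a_kernel_eq by blast
  moreover have "(\<lambda>x. h (e x)) ` vecs R d = carrier N" using e(2) h(3) by (metis image_image)
  ultimately show ?thesis unfolding ffr_def using e(3) mod_hom_comp[OF e(1) h(1)] by metis
qed

lemma has_ffr_iso:
  "module R M \<Longrightarrow> module R N \<Longrightarrow> isomorphic_modules R M N \<Longrightarrow> has_ffr R M \<Longrightarrow> has_ffr R N"
  unfolding has_ffr_def isomorphic_modules_def using ffr_surj_iso by blast

lemma has_ffr_free:
  assumes "cring R" shows "has_ffr R (Free R n)"
proof -
  interpret F: module R "Free R n" by (rule Free[OF assms])
  have "a_kernel (Free R n) (Free R n) (\<lambda>x. x) = {\<zero>\<^bsub>Free R n\<^esub>}"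
    by (auto simp: a_kernel_eq)
  then show ?thesis unfolding has_ffr_def ffr_def using mod_hom_id
    by (intro exI[of _ 0] exI[of _ n] bexI[of _ "\<lambda>x. x"]) auto
qed

lemma has_ffr_zero:
  assumes "module R M" "carrier M = {\<zero>\<^bsub>M\<^esub>}" shows "has_ffr R M"
proof -
  interpret M: module R M by fact
  note FM = Free[OF M.R.cring_axioms]
  show ?thesis unfolding has_ffr_def ffr_def
    by (rule exI[of _ 0], rule exI[of _ 0], rule bexI[OF _ mod_hom_const_zero[OF assms(1)]])
      (use free_module_0[of R] assms in \<open>simp add: a_kernel_eq\<close>)
qed

lemma has_ffr_cover:
  assumes "module R M" "has_ffr R M"
  obtains d e where "e \<in> mod_hom R (Free R d) M" "e ` vecs R d = carrier M"
    "has_ffr R ((Free R d)\<lparr>carrier := a_kernel (Free R d) M e\<rparr>)"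
proof -
  interpret M: module R M by fact
  obtain n d e where e: "e \<in> mod_hom R (Free R d) M" "e ` vecs R d = carrier M"
    "ffr_sub R n d (a_kernel (Free R d) M e)" using assms(2) unfolding has_ffr_def ffr_def by blast
  have "a_kernel (Free R d) M e \<subseteq> vecs R d" by (auto simp: a_kernel_eq)
  then have "has_ffr R ((Free R d)\<lparr>carrier := a_kernel (Free R d) M e\<rparr>)"
    unfolding has_ffr_def using ffr_sub_Suc_mono[OF M.R.cring_axioms e(3)] ffr_sub_Suc_iff by blast
  then show thesis using that e by blast
qed

lemma has_ffrI_cover:
  assumes "e \<in> mod_hom R (Free R d) M" "e ` vecs R d = carrier M"
    "has_ffr R ((Free R d)\<lparr>carrier := a_kernel (Free R d) M e\<rparr>)"
  shows "has_ffr R M"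
proof -
  have s: "a_kernel (Free R d) M e \<subseteq> vecs R d" by (auto simp: a_kernel_eq)
  show ?thesis using assms ffr_sub_Suc_iff[OF s] unfolding has_ffr_def ffr_def[of R _ M] by blast
qed

text \<open>One step of the horseshoe lemma. The cover of \<open>C\<close> is lifted through
  \<open>g\<close> to a map \<open>t\<close> into \<open>B\<close>; the cover of \<open>B\<close> is
  f(eA u) + t v, and the kernels of the three covers again form a short exact sequence.\<close>

lemma horseshoe_step:
  assumes A: "module R A" and B: "module R B" and C: "module R C" and ex: "short_exact R A B C"
    and eA: "eA \<in> mod_hom R (Free R a) A" "eA ` vecs R a = carrier A"
    and eC: "eC \<in> mod_hom R (Free R c) C" "eC ` vecs R c = carrier C"
  obtains eB where "eB \<in> mod_hom R (Free R (a + c)) B"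
    "eB ` vecs R (a + c) = carrier B"
    "short_exact R ((Free R a)\<lparr>carrier := a_kernel (Free R a) A eA\<rparr>)
      ((Free R (a + c))\<lparr>carrier := a_kernel (Free R (a + c)) B eB\<rparr>)
      ((Free R c)\<lparr>carrier := a_kernel (Free R c) C eC\<rparr>)"
proof -
  interpret A: module R A by fact
  interpret B: module R B by fact
  interpret C: module R C by fact
  note FM = Free[OF A.R.cring_axioms]
  let ?a = "Free R a" and ?c = "Free R c" and ?ac = "Free R (a + c)"
  interpret Fa: module R ?a by (rule FM)
  interpret Fc: module R ?c by (rule FM)
  obtain f g where f: "f \<in> mod_hom R A B" and g: "g \<in> mod_hom R B C" and inj: "inj_on f (carrier A)"
    and gf: "\<And>x. x \<in> carrier A \<Longrightarrow> g (f x) = \<zero>\<^bsub>C\<^esub>"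
    and kg: "\<And>y. y \<in> carrier B \<Longrightarrow> g y = \<zero>\<^bsub>C\<^esub> \<Longrightarrow> \<exists>x \<in> carrier A. f x = y"
    and sg: "\<And>z. z \<in> carrier C \<Longrightarrow> \<exists>y \<in> carrier B. g y = z"
    by (rule short_exactE[OF ex]) (rule that)
  have f0: "x = \<zero>\<^bsub>A\<^esub>" if "x \<in> carrier A" "f x = \<zero>\<^bsub>B\<^esub>" for x
    using inj that unfolding inj_on_iff_kernel[OF A B f] by blast
  have "eC ` carrier ?c \<subseteq> g ` carrier B"
  proof
    fix z assume "z \<in> eC ` carrier ?c"
    then have "z \<in> carrier C" using eC(2) by simp
    then obtain y where "y \<in> carrier B" "g y = z" using sg by blast
    then show "z \<in> g ` carrier B" by blast
  qed
  then obtain t where t: "t \<in> mod_hom R ?c B" "\<And>v. v \<in> carrier ?c \<Longrightarrow> g (t v) = eC v"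
    using free_lift[OF B C g eC(1)] by blast
  define eB where "eB w = f (eA (vec_fst a w)) \<oplus>\<^bsub>B\<^esub> t (vec_snd a c w)" for w
  have eB: "eB \<in> mod_hom R ?ac B" unfolding eB_def
    by (rule mod_hom_plus[OF B mod_hom_comp[OF mod_hom_comp[OF vec_fst_hom eA(1)] f]
          mod_hom_comp[OF vec_snd_hom t(1)]])
  have fe: "f (eA u) \<in> carrier B" if "u \<in> carrier ?a" for u
    using that mod_hom_closed[OF f] mod_hom_closed[OF eA(1)] by blast
  have eBj: "eB (vec_join a c u v) = f (eA u) \<oplus>\<^bsub>B\<^esub> t v" if "u \<in> carrier ?a" "v \<in> carrier ?c" for u v
    unfolding eB_def using that by (simp add: vec_fst_join[OF that(1)] vec_snd_join[OF that(2)])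
  have geB: "g (eB w) = eC (vec_snd a c w)" if w: "w \<in> carrier ?ac" for w
  proof -
    have 1: "vec_fst a w \<in> carrier ?a" "vec_snd a c w \<in> carrier ?c"
      using w mod_hom_closed[OF vec_fst_hom] mod_hom_closed[OF vec_snd_hom] by blast+
    show ?thesis unfolding eB_def
      using mod_hom_add[OF g fe[OF 1(1)] mod_hom_closed[OF t(1) 1(2)]] gf[OF mod_hom_closed[OF eA(1) 1(1)]]
        t(2)[OF 1(2)] mod_hom_closed[OF eC(1) 1(2)] by simp
  qed
  have lift: "\<exists>u \<in> carrier ?a. f (eA u) = b \<ominus>\<^bsub>B\<^esub> t v"
    if b: "b \<in> carrier B" and v: "v \<in> carrier ?c" and eq: "g b = eC v" for b v
  proof -
    have tv: "t v \<in> carrier B" using mod_hom_closed[OF t(1) v] .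
    have "g b = g (t v)" using eq t(2)[OF v] by simp
    then have "g (b \<ominus>\<^bsub>B\<^esub> t v) = \<zero>\<^bsub>C\<^esub>" using mod_hom_eq_iff[OF B C g b tv] by blast
    then obtain x where "x \<in> carrier A" "f x = b \<ominus>\<^bsub>B\<^esub> t v" using kg[of "b \<ominus>\<^bsub>B\<^esub> t v"] b tv by blast
    then show ?thesis using eA(2) by (metis image_iff)
  qed
  have "carrier B \<subseteq> eB ` carrier ?ac"
  proof
    fix b assume b: "b \<in> carrier B"
    have "g b \<in> eC ` carrier ?c" using mod_hom_closed[OF g b] eC(2) by simp
    then obtain v where v: "v \<in> carrier ?c" "g b = eC v" by blast
    obtain u where u: "u \<in> carrier ?a" "f (eA u) = b \<ominus>\<^bsub>B\<^esub> t v" using lift[OF b v] by blast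
    have "eB (vec_join a c u v) = b"
      unfolding eBj[OF u(1) v(1)] u(2) by (rule B.add_diff_cancel(2)[OF b mod_hom_closed[OF t(1) v(1)]])
    then show "b \<in> eB ` carrier ?ac" using vec_join_closed[OF u(1) v(1)] by blast
  qed
  then have sur: "eB ` carrier ?ac = carrier B" using mod_hom_closed[OF eB] by blast
  let ?KA = "a_kernel ?a A eA" and ?KB = "a_kernel ?ac B eB" and ?KC = "a_kernel ?c C eC"
  let ?z = "\<zero>\<^bsub>?c\<^esub>"
  have j: "(\<lambda>u. vec_join a c u ?z) \<in> mod_hom R ?a ?ac"
    by (rule vec_join_hom[OF mod_hom_id mod_hom_const_zero[OF FM]])
  have t0: "t ?z = \<zero>\<^bsub>B\<^esub>" by (rule mod_hom_zero[OF FM B t(1)])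
  have f00: "f \<zero>\<^bsub>A\<^esub> = \<zero>\<^bsub>B\<^esub>" by (rule mod_hom_zero[OF A B f])
  have "short_exact R (?a\<lparr>carrier := ?KA\<rparr>) (?ac\<lparr>carrier := ?KB\<rparr>) (?c\<lparr>carrier := ?KC\<rparr>)"
  proof (rule short_exactI[of "\<lambda>u. vec_join a c u ?z" _ _ _ "vec_snd a c"])
    show "(\<lambda>u. vec_join a c u ?z) \<in> mod_hom R (?a\<lparr>carrier := ?KA\<rparr>) (?ac\<lparr>carrier := ?KB\<rparr>)"
    proof (rule mod_hom_restrict[OF j], intro ballI conjI)
      fix u assume u: "u \<in> ?KA"
      then have uc: "u \<in> carrier ?a" "eA u = \<zero>\<^bsub>A\<^esub>" by (auto simp: a_kernel_eq)
      show "u \<in> carrier ?a" by (rule uc)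
      show "vec_join a c u ?z \<in> ?KB"
        using uc vec_join_closed[OF uc(1) Fc.M.zero_closed] eBj[OF uc(1) Fc.M.zero_closed] t0 f00 by (simp add: a_kernel_eq)
    qed
    show "vec_snd a c \<in> mod_hom R (?ac\<lparr>carrier := ?KB\<rparr>) (?c\<lparr>carrier := ?KC\<rparr>)"
    proof (rule mod_hom_restrict[OF vec_snd_hom], intro ballI conjI)
      fix w assume w: "w \<in> ?KB"
      then have wc: "w \<in> carrier ?ac" "eB w = \<zero>\<^bsub>B\<^esub>" by (auto simp: a_kernel_eq)
      show "w \<in> carrier ?ac" by (rule wc)
      show "vec_snd a c w \<in> ?KC"
        using geB[OF wc(1)] wc mod_hom_zero[OF B C g] mod_hom_closed[OF vec_snd_hom wc(1)] by (simp add: a_kernel_eq)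
    qed
    show "inj_on (\<lambda>u. vec_join a c u ?z) (carrier (?a\<lparr>carrier := ?KA\<rparr>))"
    proof (rule inj_on_inverseI[of _ "vec_fst a"])
      fix u assume "u \<in> carrier (?a\<lparr>carrier := ?KA\<rparr>)"
      then have "u \<in> carrier ?a" by (simp add: a_kernel_eq)
      then show "vec_fst a (vec_join a c u ?z) = u" by (rule vec_fst_join)
    qed
    show "vec_snd a c (vec_join a c u ?z) = \<zero>\<^bsub>?c\<lparr>carrier := ?KC\<rparr>\<^esub>" for u
      using vec_snd_join[OF Fc.M.zero_closed] by simp
  next
    fix w assume "w \<in> carrier (?ac\<lparr>carrier := ?KB\<rparr>)" "vec_snd a c w = \<zero>\<^bsub>?c\<lparr>carrier := ?KC\<rparr>\<^esub>"
    then have w: "w \<in> carrier ?ac" "eB w = \<zero>\<^bsub>B\<^esub>" "vec_snd a c w = ?z" by (auto simp: a_kernel_eq)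
    have u: "vec_fst a w \<in> carrier ?a" by (rule mod_hom_closed[OF vec_fst_hom w(1)])
    have "f (eA (vec_fst a w)) = \<zero>\<^bsub>B\<^esub>" using w(2) unfolding eB_def w(3) t0 using fe[OF u] by simp
    then have "eA (vec_fst a w) = \<zero>\<^bsub>A\<^esub>" by (rule f0[OF mod_hom_closed[OF eA(1) u]])
    then show "\<exists>u \<in> carrier (?a\<lparr>carrier := ?KA\<rparr>). vec_join a c u ?z = w"
      using u vec_join_fst_snd[OF w(1)] w(3) by (intro bexI[of _ "vec_fst a w"]) (simp_all add: a_kernel_eq)
  next
    fix v assume "v \<in> carrier (?c\<lparr>carrier := ?KC\<rparr>)"
    then have v: "v \<in> carrier ?c" "eC v = \<zero>\<^bsub>C\<^esub>" by (auto simp: a_kernel_eq)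
    obtain u where u: "u \<in> carrier ?a" "f (eA u) = \<zero>\<^bsub>B\<^esub> \<ominus>\<^bsub>B\<^esub> t v"
      using lift[OF B.M.zero_closed v(1)] mod_hom_zero[OF B C g] v(2) by auto
    have "eB (vec_join a c u v) = \<zero>\<^bsub>B\<^esub>"
      unfolding eBj[OF u(1) v(1)] u(2) by (rule B.add_diff_cancel(2)[OF B.M.zero_closed mod_hom_closed[OF t(1) v(1)]])
    then show "\<exists>w \<in> carrier (?ac\<lparr>carrier := ?KB\<rparr>). vec_snd a c w = v"
      using vec_join_closed[OF u(1) v(1)] vec_snd_join[OF v(1)]
      by (intro bexI[of _ "vec_join a c u v"]) (simp_all add: a_kernel_eq)
  qed
  then show thesis using that eB sur by blast
qed

lemma kernel_record_module:
  "module R A \<Longrightarrow> module R B \<Longrightarrow> f \<in> mod_hom R A B \<Longrightarrow> module R (A\<lparr>carrier := a_kernel A B f\<rparr>)"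
  using submodule_carrier_module kernel_submodule by blast

text \<open>Iterates the horseshoe. The same n bounds both outer resolutions, so that they shrink
  together; for n = 0 both ends vanish, and with them the middle.\<close>

lemma ffr_sub_extension:
  assumes "cring R" "submodule U R (Free R a)" "submodule V R (Free R b)"
    "submodule W R (Free R c)"
    "short_exact R ((Free R a)\<lparr>carrier := U\<rparr>) ((Free R b)\<lparr>carrier := V\<rparr>)
      ((Free R c)\<lparr>carrier := W\<rparr>)"
    "ffr_sub R n a U" "ffr_sub R n c W"
  shows "ffr_sub R n b V" using assms(2-)
proof (induction n arbitrary: a U b V c W)
  case 0
  note FM = Free[OF assms(1)]
  interpret b: module R "Free R b" by (rule FM)
  note 0
  from 0(4) obtain f g where
    f: "f \<in> mod_hom R ((Free R a)\<lparr>carrier := U\<rparr>) ((Free R b)\<lparr>carrier := V\<rparr>)" and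
    g: "g \<in> mod_hom R ((Free R b)\<lparr>carrier := V\<rparr>) ((Free R c)\<lparr>carrier := W\<rparr>)"
    and kg: "\<And>y. y \<in> V \<Longrightarrow> g y = \<zero>\<^bsub>Free R c\<^esub> \<Longrightarrow> \<exists>x \<in> U. f x = y"
    by (rule short_exactE) auto
  have U: "U = {\<zero>\<^bsub>Free R a\<^esub>}" and W: "W = {\<zero>\<^bsub>Free R c\<^esub>}" using 0(5,6) by simp_all
  have "f \<zero>\<^bsub>Free R a\<^esub> = \<zero>\<^bsub>Free R b\<^esub>"
    using mod_hom_zero[OF submodule_carrier_module[OF FM 0(1)] submodule_carrier_module[OF FM 0(2)] f] by simp
  moreover have "g y = \<zero>\<^bsub>Free R c\<^esub>" if "y \<in> V" for y using mod_hom_closed[OF g, of y] that W by simp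
  ultimately have "V \<subseteq> {\<zero>\<^bsub>Free R b\<^esub>}" using kg U by fastforce
  then show ?case using b.submoduleD(2)[OF 0(2)] by auto
next
  case (Suc n)
  note FM = Free[OF assms(1)]
  have s: "U \<subseteq> vecs R a" "V \<subseteq> vecs R b" "W \<subseteq> vecs R c"
    using Suc.prems(1-3) module.submoduleD(1)[OF FM] by blast+
  let ?A = "(Free R a)\<lparr>carrier := U\<rparr>" and ?B = "(Free R b)\<lparr>carrier := V\<rparr>"
    and ?C = "(Free R c)\<lparr>carrier := W\<rparr>"
  have M: "module R ?A" "module R ?B" "module R ?C"
    using submodule_carrier_module[OF FM] Suc.prems(1-3) by blast+
  obtain p eA where eA: "eA \<in> mod_hom R (Free R p) ?A" "eA ` vecs R p = carrier ?A"
    "ffr_sub R n p (a_kernel (Free R p) ?A eA)"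
    using Suc.prems(5) unfolding ffr_sub_Suc_iff[OF s(1)] ffr_def by blast
  obtain q eC where eC: "eC \<in> mod_hom R (Free R q) ?C" "eC ` vecs R q = carrier ?C"
    "ffr_sub R n q (a_kernel (Free R q) ?C eC)"
    using Suc.prems(6) unfolding ffr_sub_Suc_iff[OF s(3)] ffr_def by blast
  obtain eB where eB: "eB \<in> mod_hom R (Free R (p + q)) ?B" "eB ` vecs R (p + q) = carrier ?B"
    "short_exact R ((Free R p)\<lparr>carrier := a_kernel (Free R p) ?A eA\<rparr>)
      ((Free R (p + q))\<lparr>carrier := a_kernel (Free R (p + q)) ?B eB\<rparr>)
      ((Free R q)\<lparr>carrier := a_kernel (Free R q) ?C eC\<rparr>)"
    by (rule horseshoe_step[OF M Suc.prems(4) eA(1,2) eC(1,2)])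
  have "ffr_sub R n (p + q) (a_kernel (Free R (p + q)) ?B eB)"
    by (rule Suc.IH[OF kernel_submodule[OF FM M(1) eA(1)] kernel_submodule[OF FM M(2) eB(1)]
          kernel_submodule[OF FM M(3) eC(1)] eB(3) eA(3) eC(3)])
  then show ?case unfolding ffr_sub_Suc_iff[OF s(2)] ffr_def using eB(1,2) by blast
qed

lemma has_ffr_extension:
  assumes A: "module R A" and B: "module R B" and C: "module R C" and ex: "short_exact R A B C"
    and "has_ffr R A" "has_ffr R C"
  shows "has_ffr R B"
proof -
  have R: "cring R" by (rule module_imp_cring[OF A])
  note FM = Free[OF R]
  obtain m where m: "ffr R m A" using assms(5) by (auto simp: has_ffr_def)
  obtain k where k: "ffr R k C" using assms(6) by (auto simp: has_ffr_def)
  define n where "n = max m k"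
  have "ffr R n A" "ffr R n C" using ffr_mono[OF R m, of n] ffr_mono[OF R k, of n] by (auto simp: n_def)
  then obtain p eA q eC where eA: "eA \<in> mod_hom R (Free R p) A" "eA ` vecs R p = carrier A"
    "ffr_sub R n p (a_kernel (Free R p) A eA)"
   and eC: "eC \<in> mod_hom R (Free R q) C" "eC ` vecs R q = carrier C"
    "ffr_sub R n q (a_kernel (Free R q) C eC)" unfolding ffr_def by blast
  obtain eB where eB: "eB \<in> mod_hom R (Free R (p + q)) B" "eB ` vecs R (p + q) = carrier B"
    "short_exact R ((Free R p)\<lparr>carrier := a_kernel (Free R p) A eA\<rparr>)
      ((Free R (p + q))\<lparr>carrier := a_kernel (Free R (p + q)) B eB\<rparr>)
      ((Free R q)\<lparr>carrier := a_kernel (Free R q) C eC\<rparr>)"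
    by (rule horseshoe_step[OF A B C ex eA(1,2) eC(1,2)])
  have "ffr_sub R n (p + q) (a_kernel (Free R (p + q)) B eB)"
    by (rule ffr_sub_extension[OF R kernel_submodule[OF FM A eA(1)] kernel_submodule[OF FM B eB(1)]
          kernel_submodule[OF FM C eC(1)] eB(3) eA(3) eC(3)])
  then show ?thesis unfolding has_ffr_def ffr_def using eB(1,2) by blast
qed

text \<open>The kernel of g o e is the preimage under \<open>e\<close> of the image of
  \<open>f\<close>. Composing \<open>e\<close> with the inverse of \<open>f\<close> maps it onto
  \<open>A\<close>, and the kernel of this map is that of \<open>e\<close>.\<close>

lemma short_exact_covers:
  assumes A: "module R A" and B: "module R B" and C: "module R C"
    and f: "f \<in> mod_hom R A B" "inj_on f (carrier A)" and g: "g \<in> mod_hom R B C"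
    and gf: "\<And>x. x \<in> carrier A \<Longrightarrow> g (f x) = \<zero>\<^bsub>C\<^esub>"
    and kg: "\<And>y. y \<in> carrier B \<Longrightarrow> g y = \<zero>\<^bsub>C\<^esub> \<Longrightarrow> \<exists>x \<in> carrier A. f x = y"
    and F: "module R F" and e: "e \<in> mod_hom R F B" "e ` carrier F = carrier B"
  shows "short_exact R (F\<lparr>carrier := a_kernel F B e\<rparr>) (F\<lparr>carrier := a_kernel F C (\<lambda>x. g (e x))\<rparr>) A"
proof -
  let ?Z = "a_kernel F C (\<lambda>x. g (e x))"
  interpret A: module R A by fact
  interpret C: module R C by fact
  have Zm: "module R (F\<lparr>carrier := ?Z\<rparr>)" by (rule kernel_record_module[OF F C mod_hom_comp[OF e(1) g]])
  have Zs: "?Z \<subseteq> carrier F" by (auto simp: a_kernel_eq)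
  have f0: "f x = \<zero>\<^bsub>B\<^esub> \<longleftrightarrow> x = \<zero>\<^bsub>A\<^esub>" if "x \<in> carrier A" for x
    using f(2) that mod_hom_zero[OF A B f(1)] unfolding inj_on_iff_kernel[OF A B f(1)] by blast
  have eZ: "e ` carrier (F\<lparr>carrier := ?Z\<rparr>) \<subseteq> f ` carrier A"
  proof
    fix y assume "y \<in> e ` carrier (F\<lparr>carrier := ?Z\<rparr>)"
    then have "y \<in> carrier B" "g y = \<zero>\<^bsub>C\<^esub>" using mod_hom_closed[OF e(1)] by (auto simp: a_kernel_eq)
    then show "y \<in> f ` carrier A" using kg by blast
  qed
  obtain k where k: "k \<in> mod_hom R (F\<lparr>carrier := ?Z\<rparr>) A" "\<And>z. z \<in> ?Z \<Longrightarrow> f (k z) = e z"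
    using mod_hom_factor_inj[OF A B Zm f mod_hom_restrict_dom[OF e(1) Zs] eZ] by auto
  have kc: "k z \<in> carrier A" if "z \<in> ?Z" for z using mod_hom_closed[OF k(1)] that by simp
  have k0: "k z = \<zero>\<^bsub>A\<^esub> \<longleftrightarrow> e z = \<zero>\<^bsub>B\<^esub>" if "z \<in> ?Z" for z using f0[OF kc[OF that]] k(2)[OF that] by simp
  have sub: "z \<in> ?Z" if "z \<in> a_kernel F B e" for z
    using that mod_hom_zero[OF B C g] by (simp add: a_kernel_eq)
  show ?thesis
  proof (rule short_exactI[OF mod_hom_restrict[OF mod_hom_id] k(1)])
    show "\<forall>x \<in> a_kernel F B e. x \<in> carrier F \<and> x \<in> ?Z" using sub by (simp add: a_kernel_eq)
    show "k x = \<zero>\<^bsub>A\<^esub>" if "x \<in> carrier (F\<lparr>carrier := a_kernel F B e\<rparr>)" for x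
      using that sub[of x] k0[of x] by (simp add: a_kernel_eq)
    show "\<exists>x \<in> carrier (F\<lparr>carrier := a_kernel F B e\<rparr>). x = y"
      if "y \<in> carrier (F\<lparr>carrier := ?Z\<rparr>)" "k y = \<zero>\<^bsub>A\<^esub>" for y
      using that k0[of y] Zs by (auto simp: a_kernel_eq)
    show "\<exists>y \<in> carrier (F\<lparr>carrier := ?Z\<rparr>). k y = x" if x: "x \<in> carrier A" for x
    proof -
      have "f x \<in> e ` carrier F" using mod_hom_closed[OF f(1) x] e(2) by simp
      then obtain y where y: "y \<in> carrier F" "f x = e y" by blast
      have yZ: "y \<in> ?Z" using y gf[OF x] by (simp add: a_kernel_eq)
      have "f (k y) = f x" using k(2)[OF yZ] y(2) by simp
      then have "k y = x" using inj_onD[OF f(2)] kc[OF yZ] x by blast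
      then show ?thesis using yZ by auto
    qed
  qed simp
qed

text \<open>A cover of \<open>B\<close> is also a cover of \<open>C\<close>, and the syzygy of
  \<open>C\<close> for it is an extension of \<open>A\<close> by the syzygy of
  \<open>B\<close>.\<close>

lemma has_ffr_cokernel:
  assumes A: "module R A" and B: "module R B" and C: "module R C" and ex: "short_exact R A B C"
    and "has_ffr R A" "has_ffr R B"
  shows "has_ffr R C"
proof -
  have R: "cring R" by (rule module_imp_cring[OF A])
  note FM = Free[OF R]
  obtain f g where f: "f \<in> mod_hom R A B" and g: "g \<in> mod_hom R B C" and inj: "inj_on f (carrier A)"
    and gf: "\<And>x. x \<in> carrier A \<Longrightarrow> g (f x) = \<zero>\<^bsub>C\<^esub>"
    and kg: "\<And>y. y \<in> carrier B \<Longrightarrow> g y = \<zero>\<^bsub>C\<^esub> \<Longrightarrow> \<exists>x \<in> carrier A. f x = y"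
    and sg: "\<And>z. z \<in> carrier C \<Longrightarrow> \<exists>y \<in> carrier B. g y = z"
    by (rule short_exactE[OF ex]) (rule that)
  obtain b e where e: "e \<in> mod_hom R (Free R b) B" "e ` vecs R b = carrier B"
    "has_ffr R ((Free R b)\<lparr>carrier := a_kernel (Free R b) B e\<rparr>)"
    by (rule has_ffr_cover[OF B assms(6)])
  have ge: "(\<lambda>x. g (e x)) \<in> mod_hom R (Free R b) C" by (rule mod_hom_comp[OF e(1) g])
  have "g ` carrier B = carrier C"
  proof
    show "g ` carrier B \<subseteq> carrier C" using mod_hom_closed[OF g] by blast
    show "carrier C \<subseteq> g ` carrier B"
    proof
      fix z assume "z \<in> carrier C"
      then obtain y where "y \<in> carrier B" "g y = z" using sg by blast
      then show "z \<in> g ` carrier B" by blast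
    qed
  qed
  then have sur: "(\<lambda>x. g (e x)) ` vecs R b = carrier C" using e(2) by (metis image_image)
  have "has_ffr R ((Free R b)\<lparr>carrier := a_kernel (Free R b) C (\<lambda>x. g (e x))\<rparr>)"
    by (rule has_ffr_extension[OF kernel_record_module[OF FM B e(1)] kernel_record_module[OF FM C ge] A
        short_exact_covers[OF A B C f inj g gf kg FM e(1,2)] e(3) assms(5)])
  then show ?thesis by (rule has_ffrI_cover[OF ge sur])
qed

text \<open>Schanuel's argument. \<open>C\<close> has two covers: \<open>p\<close>, which passes
  through \<open>B\<close>, and \<open>h\<close>, the start of a finite resolution. The pullback W
  of the two is an extension of R^b by ker h, and ker p is the cokernel of a map from R^c into W.
  Hence ker p has a finite free resolution, and \<open>A\<close> is the cokernel of ker e in ker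
  p.\<close>

lemma has_ffr_kernel:
  assumes A: "module R A" and B: "module R B" and C: "module R C" and ex: "short_exact R A B C"
    and "has_ffr R B" "has_ffr R C"
  shows "has_ffr R A"
proof -
  have R: "cring R" by (rule module_imp_cring[OF A])
  note FM = Free[OF R]
  obtain f g where f: "f \<in> mod_hom R A B" and g: "g \<in> mod_hom R B C" and inj: "inj_on f (carrier A)"
    and gf: "\<And>x. x \<in> carrier A \<Longrightarrow> g (f x) = \<zero>\<^bsub>C\<^esub>"
    and kg: "\<And>y. y \<in> carrier B \<Longrightarrow> g y = \<zero>\<^bsub>C\<^esub> \<Longrightarrow> \<exists>x \<in> carrier A. f x = y"
    and sg: "\<And>z. z \<in> carrier C \<Longrightarrow> \<exists>y \<in> carrier B. g y = z"
    by (rule short_exactE[OF ex]) (rule that)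
  obtain b e where e: "e \<in> mod_hom R (Free R b) B" "e ` vecs R b = carrier B"
    "has_ffr R ((Free R b)\<lparr>carrier := a_kernel (Free R b) B e\<rparr>)"
    by (rule has_ffr_cover[OF B assms(5)])
  obtain c h where h: "h \<in> mod_hom R (Free R c) C" "h ` vecs R c = carrier C"
    "has_ffr R ((Free R c)\<lparr>carrier := a_kernel (Free R c) C h\<rparr>)"
    by (rule has_ffr_cover[OF C assms(6)])
  let ?b = "Free R b" and ?c = "Free R c" and ?bc = "Free R (b + c)"
  interpret Fb: module R ?b by (rule FM)
  interpret Fc: module R ?c by (rule FM)
  interpret C: module R C by (rule C)
  define p where "p x = g (e x)" for x
  have p: "p \<in> mod_hom R ?b C" unfolding p_def by (rule mod_hom_comp[OF e(1) g])
  have "g ` carrier B = carrier C"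
  proof
    show "g ` carrier B \<subseteq> carrier C" using mod_hom_closed[OF g] by blast
    show "carrier C \<subseteq> g ` carrier B"
    proof
      fix z assume "z \<in> carrier C"
      then obtain y where "y \<in> carrier B" "g y = z" using sg by blast
      then show "z \<in> g ` carrier B" by blast
    qed
  qed
  then have psur: "p ` carrier ?b = carrier C" using e(2) unfolding p_def by (metis image_image)
  \<comment> \<open>The kernel of \<open>r\<close> is the pullback of \<open>p\<close> and
    \<open>h\<close>, the pairs (u, v) with p u = h v.\<close>
  define r where "r w = p (vec_fst b w) \<ominus>\<^bsub>C\<^esub> h (vec_snd b c w)" for w
  have r: "r \<in> mod_hom R ?bc C" unfolding r_def
    by (rule mod_hom_diff[OF C mod_hom_comp[OF vec_fst_hom p] mod_hom_comp[OF vec_snd_hom h(1)]])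
  let ?W = "a_kernel ?bc C r" and ?Z = "a_kernel ?b C p" and ?K = "a_kernel ?c C h"
  have WM: "module R (?bc\<lparr>carrier := ?W\<rparr>)" by (rule kernel_record_module[OF FM C r])
  have ZM: "module R (?b\<lparr>carrier := ?Z\<rparr>)" by (rule kernel_record_module[OF FM C p])
  have KM: "module R (?c\<lparr>carrier := ?K\<rparr>)" by (rule kernel_record_module[OF FM C h(1)])
  have Wj: "vec_join b c u v \<in> ?W \<longleftrightarrow> p u = h v" if "u \<in> carrier ?b" "v \<in> carrier ?c" for u v
    using vec_join_closed[OF that] mod_hom_closed[OF p that(1)] mod_hom_closed[OF h(1) that(2)]
    by (simp add: a_kernel_eq r_def vec_fst_join[OF that(1)] vec_snd_join[OF that(2)] C.minus_eq_zero_iff)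
  have WE: "\<exists>u v. u \<in> carrier ?b \<and> v \<in> carrier ?c \<and> w = vec_join b c u v \<and> p u = h v" if "w \<in> ?W" for w
  proof -
    have "w \<in> carrier ?bc" using that by (simp add: a_kernel_eq)
    then obtain u v where "u \<in> carrier ?b" "v \<in> carrier ?c" "w = vec_join b c u v" by (rule vec_join_surj)
    then show ?thesis using Wj that by blast
  qed
  have p0: "p \<zero>\<^bsub>?b\<^esub> = \<zero>\<^bsub>C\<^esub>" by (rule mod_hom_zero[OF FM C p])
  have h0: "h \<zero>\<^bsub>?c\<^esub> = \<zero>\<^bsub>C\<^esub>" by (rule mod_hom_zero[OF FM C h(1)])
  have "short_exact R (?c\<lparr>carrier := ?K\<rparr>) (?bc\<lparr>carrier := ?W\<rparr>) ?b"
  proof (rule short_exactI[of "\<lambda>v. vec_join b c \<zero>\<^bsub>?b\<^esub> v" _ _ _ "vec_fst b"])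
    show "(\<lambda>v. vec_join b c \<zero>\<^bsub>?b\<^esub> v) \<in> mod_hom R (?c\<lparr>carrier := ?K\<rparr>) (?bc\<lparr>carrier := ?W\<rparr>)"
      by (rule mod_hom_restrict[OF vec_join_hom[OF mod_hom_const_zero[OF FM] mod_hom_id]])
        (use Wj[OF Fb.M.zero_closed] p0 in \<open>simp add: a_kernel_eq[of ?c]\<close>)
    show "vec_fst b \<in> mod_hom R (?bc\<lparr>carrier := ?W\<rparr>) ?b"
      by (rule mod_hom_restrict_dom[OF vec_fst_hom]) (auto simp: a_kernel_eq)
    show "inj_on (\<lambda>v. vec_join b c \<zero>\<^bsub>?b\<^esub> v) (carrier (?c\<lparr>carrier := ?K\<rparr>))"
      by (rule inj_on_inverseI[of _ "vec_snd b c"]) (simp add: a_kernel_eq vec_snd_join[of _ R])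
    show "vec_fst b (vec_join b c \<zero>\<^bsub>?b\<^esub> v) = \<zero>\<^bsub>?b\<^esub>" for v by (rule vec_fst_join[OF Fb.M.zero_closed])
  next
    fix w assume "w \<in> carrier (?bc\<lparr>carrier := ?W\<rparr>)" and 0: "vec_fst b w = \<zero>\<^bsub>?b\<^esub>"
    then obtain u v where uv: "u \<in> carrier ?b" "v \<in> carrier ?c" "w = vec_join b c u v" "p u = h v"
      using WE[of w] by auto
    then have "u = \<zero>\<^bsub>?b\<^esub>" using 0 vec_fst_join[OF uv(1)] by metis
    then show "\<exists>v \<in> carrier (?c\<lparr>carrier := ?K\<rparr>). vec_join b c \<zero>\<^bsub>?b\<^esub> v = w"
      using uv p0 by (intro bexI[of _ v]) (simp_all add: a_kernel_eq)
  next
    fix u assume u: "u \<in> carrier ?b"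
    have "p u \<in> h ` carrier ?c" using mod_hom_closed[OF p u] h(2) by simp
    then obtain v where v: "v \<in> carrier ?c" "p u = h v" by blast
    then show "\<exists>w \<in> carrier (?bc\<lparr>carrier := ?W\<rparr>). vec_fst b w = u"
      using Wj[OF u v(1)] vec_fst_join[OF u] by (intro bexI[of _ "vec_join b c u v"]) simp_all
  qed
  then have fW: "has_ffr R (?bc\<lparr>carrier := ?W\<rparr>)"
    by (rule has_ffr_extension[OF KM WM FM _ h(3) has_ffr_free[OF R]])
  have "h ` carrier ?c \<subseteq> p ` carrier ?b" using h(2) psur by simp
  then obtain s where s: "s \<in> mod_hom R ?c ?b" "\<And>v. v \<in> carrier ?c \<Longrightarrow> p (s v) = h v"
    using free_lift[OF FM C p h(1)] by blast
  have sc: "s v \<in> carrier ?b" if "v \<in> carrier ?c" for v by (rule mod_hom_closed[OF s(1) that])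
  \<comment> \<open>A lift s of \<open>h\<close> through \<open>p\<close> embeds R^c into the
    pullback by v |-> (s v, v); the map (u, v) |-> u - s v has this image as kernel and takes values
    in ker p.\<close>
  define d where "d w = vec_fst b w \<ominus>\<^bsub>?b\<^esub> s (vec_snd b c w)" for w
  have d: "d \<in> mod_hom R ?bc ?b" unfolding d_def
    by (rule mod_hom_diff[OF FM vec_fst_hom mod_hom_comp[OF vec_snd_hom s(1)]])
  have dj: "d (vec_join b c u v) = u \<ominus>\<^bsub>?b\<^esub> s v" if "u \<in> carrier ?b" "v \<in> carrier ?c" for u v
    by (simp add: d_def vec_fst_join[OF that(1)] vec_snd_join[OF that(2)])
  have "short_exact R ?c (?bc\<lparr>carrier := ?W\<rparr>) (?b\<lparr>carrier := ?Z\<rparr>)"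
  proof (rule short_exactI[of "\<lambda>v. vec_join b c (s v) v" _ _ _ d])
    show "(\<lambda>v. vec_join b c (s v) v) \<in> mod_hom R ?c (?bc\<lparr>carrier := ?W\<rparr>)"
      by (rule mod_hom_restrict_cod[OF vec_join_hom[OF s(1) mod_hom_id]]) (use Wj sc s(2) in auto)
    show "d \<in> mod_hom R (?bc\<lparr>carrier := ?W\<rparr>) (?b\<lparr>carrier := ?Z\<rparr>)"
    proof (rule mod_hom_restrict[OF d], intro ballI conjI)
      fix w assume w: "w \<in> ?W"
      then show wc: "w \<in> carrier ?bc" by (simp add: a_kernel_eq)
      obtain u v where uv: "u \<in> carrier ?b" "v \<in> carrier ?c" "w = vec_join b c u v" "p u = h v"
        using WE[OF w] by blast
      have "p u = p (s v)" using uv(4) s(2)[OF uv(2)] by simp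
      then have "p (u \<ominus>\<^bsub>?b\<^esub> s v) = \<zero>\<^bsub>C\<^esub>" using mod_hom_eq_iff[OF FM C p uv(1) sc[OF uv(2)]] by blast
      then show "d w \<in> ?Z" unfolding uv(3) dj[OF uv(1,2)] using uv(1) sc[OF uv(2)] by (simp add: a_kernel_eq)
    qed
    show "inj_on (\<lambda>v. vec_join b c (s v) v) (carrier ?c)"
      by (rule inj_on_inverseI[of _ "vec_snd b c"]) (rule vec_snd_join)
    show "d (vec_join b c (s v) v) = \<zero>\<^bsub>?b\<lparr>carrier := ?Z\<rparr>\<^esub>" if "v \<in> carrier ?c" for v
      unfolding dj[OF sc[OF that] that] using Fb.minus_eq_zero_iff[OF sc[OF that] sc[OF that]] by simp
  next
    fix w assume "w \<in> carrier (?bc\<lparr>carrier := ?W\<rparr>)" and 0: "d w = \<zero>\<^bsub>?b\<lparr>carrier := ?Z\<rparr>\<^esub>"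
    then obtain u v where uv: "u \<in> carrier ?b" "v \<in> carrier ?c" "w = vec_join b c u v" "p u = h v"
      using WE[of w] by auto
    have "u = s v" using 0 Fb.minus_eq_zero_iff[OF uv(1) sc[OF uv(2)]] unfolding uv(3) dj[OF uv(1,2)] by simp
    then show "\<exists>v \<in> carrier ?c. vec_join b c (s v) v = w" using uv by blast
  next
    fix u assume "u \<in> carrier (?b\<lparr>carrier := ?Z\<rparr>)"
    then have u: "u \<in> carrier ?b" "p u = \<zero>\<^bsub>C\<^esub>" by (auto simp: a_kernel_eq)
    have "d (vec_join b c u \<zero>\<^bsub>?c\<^esub>) = u"
      unfolding dj[OF u(1) Fc.M.zero_closed] mod_hom_zero[OF FM FM s(1)]
      using u(1) by (simp add: a_minus_def Fb.a_inv_zero)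
    then show "\<exists>w \<in> carrier (?bc\<lparr>carrier := ?W\<rparr>). d w = u"
      using Wj[OF u(1) Fc.M.zero_closed] u(2) h0 by (intro bexI[of _ "vec_join b c u \<zero>\<^bsub>?c\<^esub>"]) simp_all
  qed
  then have "has_ffr R (?b\<lparr>carrier := ?Z\<rparr>)"
    by (rule has_ffr_cokernel[OF FM WM ZM _ has_ffr_free[OF R] fW])
  then show ?thesis using has_ffr_cokernel[OF kernel_record_module[OF FM B e(1)] ZM A _ e(3)]
      short_exact_covers[OF A B C f inj g gf kg FM e(1,2)] unfolding p_def by blast
qed

subsection \<open>Resolutions of finite length\<close>

lemma short_exact_kernel:
  assumes "module R B" "module R C" "g \<in> mod_hom R B C" "g ` carrier B = carrier C"
  shows "short_exact R (B\<lparr>carrier := a_kernel B C g\<rparr>) B C"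
proof (rule short_exactI[OF mod_hom_restrict_dom[OF mod_hom_id] assms(3)])
  show "\<exists>y \<in> carrier B. g y = z" if "z \<in> carrier C" for z
    using that assms(4) by (metis imageE)
qed (auto simp: a_kernel_eq)

lemma resolution_dim_finite_iff:
  "resolution_dim R C M < \<infinity> \<longleftrightarrow> (\<exists>n. has_resolution_of_length R C n M)"
proof
  assume "resolution_dim R C M < \<infinity>"
  then have "{enat n | n. has_resolution_of_length R C n M} \<noteq> {}"
    unfolding resolution_dim_def by (auto simp: Inf_enat_def split: if_splits)
  then show "\<exists>n. has_resolution_of_length R C n M" by blast
next
  assume "\<exists>n. has_resolution_of_length R C n M"
  then obtain n where "has_resolution_of_length R C n M" by blast
  then have "resolution_dim R C M \<le> enat n" unfolding resolution_dim_def by (intro Inf_lower) blast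
  then show "resolution_dim R C M < \<infinity>" by (meson enat_ord_code(4) le_less_trans)
qed

lemma has_resolution_of_length_iso:
  assumes "module R M" "module R N" "isomorphic_modules R M N" "has_resolution_of_length R C n M"
  shows "has_resolution_of_length R C n N"
proof -
  obtain h where "h \<in> mod_iso R M N" using assms(3) by (auto simp: isomorphic_modules_def)
  note h = mod_isoD[OF this]
  obtain P d e where *: "resolution R P d e M" "\<forall>i\<le>n. C (P i)" "\<forall>i>n. carrier (P i) = {\<zero>\<^bsub>P i\<^esub>}"
    using assms(4) unfolding has_resolution_of_length_def by blast
  have e: "e \<in> mod_hom R (P 0) M" "e ` carrier (P 0) = carrier M" using *(1) by (auto simp: resolution_def)
  have "h x = \<zero>\<^bsub>N\<^esub> \<longleftrightarrow> x = \<zero>\<^bsub>M\<^esub>" if "x \<in> carrier M" for x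
    using inj_on_iff_kernel[OF assms(1,2) h(1)] h(2) mod_hom_zero[OF assms(1,2) h(1)] that by blast
  then have "a_kernel (P 0) N (\<lambda>x. h (e x)) = a_kernel (P 0) M e"
    using mod_hom_closed[OF e(1)] unfolding a_kernel_eq by blast
  moreover have "(\<lambda>x. h (e x)) ` carrier (P 0) = carrier N" using e(2) h(3) by (metis image_image)
  ultimately have "resolution R P d (\<lambda>x. h (e x)) N"
    using *(1) mod_hom_comp[OF e(1) h(1)] unfolding resolution_def by simp
  then show ?thesis using *(2,3) unfolding has_resolution_of_length_def by blast
qed

text \<open>Stated for an arbitrary property \<open>F\<close> that holds for zero modules and passes
  to cokernels, since it is applied both to modules over R and to S-modules viewed over R.\<close>

lemma resolution_kernel_induct:
  fixes P :: "nat \<Rightarrow> ('a, 'p) module" and F :: "('a, 'p) module \<Rightarrow> bool"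
  assumes M: "module R M" and res: "resolution R P d e M" and long: "\<forall>i>n. carrier (P i) = {\<zero>\<^bsub>P i\<^esub>}"
    and FP: "\<forall>i\<le>n. F (P i)"
    and F0: "\<And>A. module R A \<Longrightarrow> carrier A = {\<zero>\<^bsub>A\<^esub>} \<Longrightarrow> F A"
    and F1: "\<And>A B C. module R A \<Longrightarrow> module R B \<Longrightarrow> module R C \<Longrightarrow> short_exact R A B C \<Longrightarrow> F A \<Longrightarrow> F B \<Longrightarrow> F C"
  shows "F (P 0)" "F ((P 0)\<lparr>carrier := a_kernel (P 0) M e\<rparr>)"
proof -
  note r = res[unfolded resolution_def]
  have PM: "module R (P i)" for i using r by blast
  have e: "e \<in> mod_hom R (P 0) M" using r by blast
  have d: "d i \<in> mod_hom R (P (Suc i)) (P i)" for i using r by blast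
  define Z where "Z i = (case i of 0 \<Rightarrow> a_kernel (P 0) M e | Suc j \<Rightarrow> a_kernel (P (Suc j)) (P j) (d j))" for i
  have Zsub: "submodule (Z i) R (P i)" for i
    using kernel_submodule[OF PM M e] kernel_submodule[OF PM PM d] by (cases i) (auto simp: Z_def)
  have ZM: "module R ((P i)\<lparr>carrier := Z i\<rparr>)" for i by (rule submodule_carrier_module[OF PM Zsub])
  have dZ: "d i ` carrier (P (Suc i)) = Z i" for i using r by (cases i) (auto simp: Z_def)
  have ex: "short_exact R ((P (Suc i))\<lparr>carrier := Z (Suc i)\<rparr>) (P (Suc i)) ((P i)\<lparr>carrier := Z i\<rparr>)" for i
  proof -
    have dd: "d i \<in> mod_hom R (P (Suc i)) ((P i)\<lparr>carrier := Z i\<rparr>)"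
      by (rule mod_hom_restrict_cod[OF d]) (simp add: dZ)
    show ?thesis using short_exact_kernel[OF PM ZM dd] dZ[of i] by (simp add: a_kernel_restrict_cod Z_def)
  qed
  have FPi: "F (P i)" for i using FP F0[OF PM[of i]] long by (cases "i \<le> n") auto
  \<comment> \<open>Descending induction from n + 1, where the kernel lies in a zero module; each
    image is the cokernel of the next kernel in its term.\<close>
  have "F ((P i)\<lparr>carrier := Z i\<rparr>)" if "i \<le> Suc n" for i using that
  proof (induction i rule: inc_induct)
    case base
    have "Z (Suc n) = {\<zero>\<^bsub>P (Suc n)\<^esub>}"
      using module.submoduleD(1,2)[OF PM Zsub] long by fastforce
    then show ?case by (intro F0[OF ZM]) simp
  next
    case (step i)
    then show ?case using F1[OF ZM PM ZM ex] FPi by blast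
  qed
  then have "F ((P 0)\<lparr>carrier := Z 0\<rparr>)" by blast
  then show "F (P 0)" "F ((P 0)\<lparr>carrier := a_kernel (P 0) M e\<rparr>)" using FPi by (auto simp: Z_def)
qed

lemma has_ffr_of_finite_pd:
  fixes R :: "('a, 'r) ring_scheme"
  assumes R: "local_ring R" and M: "module R M" and pd: "pd R M < \<infinity>"
  shows "has_ffr R M"
proof -
  have cR: "cring R" by (rule local_ring_cring[OF R])
  obtain n where "has_resolution_of_length R (projective_module R) n M"
    using pd unfolding pd_def resolution_dim_finite_iff by blast
  then obtain P :: "nat \<Rightarrow> 'a fgmod" and d e where res: "resolution R P d e M" and pr: "\<forall>i\<le>n. projective_module R (P i)"
    and z: "\<forall>i>n. carrier (P i) = {\<zero>\<^bsub>P i\<^esub>}"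
    unfolding has_resolution_of_length_def by (elim exE conjE) (rule that)
  have PM: "module R (P i)" for i using res by (simp add: resolution_def)
  have e: "e \<in> mod_hom R (P 0) M" "e ` carrier (P 0) = carrier M" using res by (auto simp: resolution_def)
  have "\<forall>i\<le>n. has_ffr R (P i)"
  proof (intro allI impI)
    fix i assume "i \<le> n"
    then have "projective_module R (P i)" using pr by blast
    then obtain k where "isomorphic_modules R (Free R k) (P i)" by (rule projective_imp_free[OF R])
    then show "has_ffr R (P i)" using has_ffr_iso[OF Free[OF cR] PM _ has_ffr_free[OF cR]] by blast
  qed
  note ind = resolution_kernel_induct[where F = "has_ffr R", OF M res z this has_ffr_zero]
  have "has_ffr R (P 0)" "has_ffr R ((P 0)\<lparr>carrier := a_kernel (P 0) M e\<rparr>)"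
    by (rule ind; (assumption | erule (5) has_ffr_cokernel))+
  then show ?thesis
    using has_ffr_cokernel[OF kernel_record_module[OF PM M e(1)] PM M short_exact_kernel[OF PM M e]] by blast
qed

text \<open>A free module with elements of the type prescribed for \<open>'a fgmod\<close>.\<close>

definition free_fgmod :: "('a, 'r) ring_scheme \<Rightarrow> nat \<Rightarrow> 'a fgmod" where
  "free_fgmod R n = quot_module (Free R n) {\<zero>\<^bsub>Free R n\<^esub>}"

lemma quot_zero_iso:
  assumes "module R M"
  shows "mod_coset M {\<zero>\<^bsub>M\<^esub>} \<in> mod_iso R M (quot_module M {\<zero>\<^bsub>M\<^esub>})"
proof -
  interpret M: module R M by fact
  note Z = M.zero_submodule
  show ?thesis by (rule mod_isoI[OF mod_coset_hom[OF assms Z] _ mod_coset_surj[OF assms Z]])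
      (use inj_on_iff_kernel[OF assms quot_module[OF assms Z] mod_coset_hom[OF assms Z]]
        mod_coset_eq_zero_iff[OF assms Z] in blast)
qed

lemma free_fgmod:
  assumes "cring R"
  shows "module R (free_fgmod R n)" "fg_module R (free_fgmod R n)"
    "isomorphic_modules R (free_fgmod R n) (Free R n)" "projective_module R (free_fgmod R n)"
proof -
  let ?F = "Free R n" let ?Z = "{\<zero>\<^bsub>?F\<^esub>}"
  have FM: "module R ?F" by (rule Free[OF assms])
  have Z: "submodule ?Z R ?F" by (rule module.zero_submodule[OF FM])
  show M: "module R (free_fgmod R n)" unfolding free_fgmod_def by (rule quot_module[OF FM Z])
  have q: "mod_coset ?F ?Z \<in> mod_iso R ?F (free_fgmod R n)" unfolding free_fgmod_def by (rule quot_zero_iso[OF FM])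
  show iso: "isomorphic_modules R (free_fgmod R n) ?F"
    using isomorphic_modulesI[OF mod_iso_inv[OF q FM M]] .
  show fg: "fg_module R (free_fgmod R n)"
    by (rule fg_module_iso[OF fg_free_module[OF assms] M isomorphic_modulesI[OF q]])
  obtain k where "k \<in> mod_iso R (free_fgmod R n) ?F" using iso by (auto simp: isomorphic_modules_def)
  note k = mod_isoD[OF mod_iso_inv[OF this M FM]] mod_isoD(1)[OF this]
    and kk = inv_into_f_f[OF mod_isoD(2)[OF this]]
  show "projective_module R (free_fgmod R n)" unfolding projective_module_def
  proof (intro conjI fg allI ballI impI)
    fix A B :: "'a fgmod" and g f
    assume g: "g \<in> mod_hom R A B" and f: "f \<in> mod_hom R (free_fgmod R n) B" and A: "fg_module R A"
      and B: "fg_module R B" and gs: "g ` carrier A = carrier B"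
    let ?i = "inv_into (carrier (free_fgmod R n)) k"
    have fi: "(\<lambda>x. f (?i x)) \<in> mod_hom R ?F B" by (rule mod_hom_comp[OF k(1) f])
    have "(\<lambda>x. f (?i x)) ` carrier ?F \<subseteq> g ` carrier A" using mod_hom_closed[OF fi] gs by blast
    then obtain h where h: "h \<in> mod_hom R ?F A" "\<And>u. u \<in> carrier ?F \<Longrightarrow> g (h u) = f (?i u)"
      using free_lift[OF fg_module_module[OF A] fg_module_module[OF B] g fi] by blast
    show "\<exists>h \<in> mod_hom R (free_fgmod R n) A. \<forall>x \<in> carrier (free_fgmod R n). g (h x) = f x"
      by (rule bexI[OF _ mod_hom_comp[OF k(4) h(1)]])
        (use h(2) mod_hom_closed[OF k(4)] kk in simp)
  qed
qed

lemma has_resolution_of_length_0: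
  fixes C :: "'a fgmod \<Rightarrow> bool"
  assumes "module R M" "module R F" "C F" "h \<in> mod_iso R F M"
  shows "has_resolution_of_length R C 0 M"
proof -
  interpret F: module R F by fact
  note h = mod_isoD[OF assms(4)]
  \<comment> \<open>All terms of a resolution share one type of elements, so the zero modules that
    fill it up are taken inside \<open>F\<close>.\<close>
  let ?O = "F\<lparr>carrier := {\<zero>\<^bsub>F\<^esub>}\<rparr>"
  have O: "module R ?O" by (rule submodule_carrier_module[OF assms(2) F.zero_submodule])
  have ker: "a_kernel F M h = {\<zero>\<^bsub>F\<^esub>}"
    using inj_on_iff_kernel[OF assms(2,1) h(1)] h(2) mod_hom_zero[OF assms(2,1) h(1)] by (auto simp: a_kernel_eq)
  define P where "P i = (if i = 0 then F else ?O)" for i :: nat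
  have PM: "module R (P i)" for i using O assms(2) by (simp add: P_def)
  have z: "\<zero>\<^bsub>P i\<^esub> = \<zero>\<^bsub>F\<^esub>" for i by (simp add: P_def)
  have d: "(\<lambda>x. \<zero>\<^bsub>F\<^esub>) \<in> mod_hom R (P (Suc i)) (P i)" for i
    using mod_hom_const_zero[OF PM[of i], of "P (Suc i)"] unfolding z .
  have "resolution R P (\<lambda>i x. \<zero>\<^bsub>F\<^esub>) h M"
    unfolding resolution_def using PM d h ker by (auto simp: P_def a_kernel_eq)
  moreover have "\<forall>i\<le>0. C (P i)" "\<forall>i>0. carrier (P i) = {\<zero>\<^bsub>P i\<^esub>}" using assms(3) by (simp_all add: P_def)
  ultimately show ?thesis unfolding has_resolution_of_length_def by blast
qed

lemma has_resolution_of_length_Suc: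
  fixes C :: "'a fgmod \<Rightarrow> bool"
  assumes M: "module R M" and F: "module R F" "C F" and e: "e \<in> mod_hom R F M" "e ` carrier F = carrier M"
    and K: "has_resolution_of_length R C n (F\<lparr>carrier := a_kernel F M e\<rparr>)"
  shows "has_resolution_of_length R C (Suc n) M"
proof -
  obtain P d k where res: "resolution R P d k (F\<lparr>carrier := a_kernel F M e\<rparr>)"
    and P: "\<forall>i\<le>n. C (P i)" "\<forall>i>n. carrier (P i) = {\<zero>\<^bsub>P i\<^esub>}"
    using K unfolding has_resolution_of_length_def by blast
  note r = res[unfolded resolution_def]
  have k: "k \<in> mod_hom R (P 0) (F\<lparr>carrier := a_kernel F M e\<rparr>)" "k ` carrier (P 0) = a_kernel F M e"
    using r by auto
  have k': "k \<in> mod_hom R (P 0) F" by (rule mod_hom_extend_cod[OF k(1)]) (auto simp: a_kernel_eq)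
  have kk: "a_kernel (P 0) F k = d 0 ` carrier (P 1)" using r by (auto simp: a_kernel_restrict_cod)
  define P' where "P' i = (case i of 0 \<Rightarrow> F | Suc j \<Rightarrow> P j)" for i
  define d' where "d' i = (case i of 0 \<Rightarrow> k | Suc j \<Rightarrow> d j)" for i
  have "resolution R P' d' e M" unfolding resolution_def
  proof (intro conjI allI)
    show "module R (P' i)" for i using r F by (cases i) (auto simp: P'_def)
    show "e \<in> mod_hom R (P' 0) M" "e ` carrier (P' 0) = carrier M" using e by (auto simp: P'_def)
    show "d' i \<in> mod_hom R (P' (Suc i)) (P' i)" for i using r k' by (cases i) (auto simp: P'_def d'_def)
    show "d' 0 ` carrier (P' 1) = a_kernel (P' 0) M e" using k(2) by (simp add: P'_def d'_def)
    show "d' (Suc i) ` carrier (P' (Suc (Suc i))) = a_kernel (P' (Suc i)) (P' i) (d' i)" for i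
      using r kk by (cases i) (auto simp: P'_def d'_def)
  qed
  moreover have "\<forall>i\<le>Suc n. C (P' i)" using P F by (auto simp: P'_def split: nat.split)
  moreover have "\<forall>i>Suc n. carrier (P' i) = {\<zero>\<^bsub>P' i\<^esub>}" using P by (auto simp: P'_def split: nat.split)
  ultimately show ?thesis unfolding has_resolution_of_length_def by blast
qed

text \<open>Replaces the cover by \<open>Free R c\<close> with one by \<open>free_fgmod R c\<close>,
  whose elements have the type that \<open>has_resolution_of_length\<close> prescribes.\<close>

lemma resolution_of_cover:
  assumes R: "cring R" and M: "module R M"
    and e: "e \<in> mod_hom R (Free R c) M" "e ` vecs R c = carrier M"
  shows "a_kernel (Free R c) M e = {\<zero>\<^bsub>Free R c\<^esub>} \<Longrightarrow>
      has_resolution_of_length R (projective_module R) 0 M"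
    and "has_resolution_of_length R (projective_module R) n
        ((Free R c)\<lparr>carrier := a_kernel (Free R c) M e\<rparr>) \<Longrightarrow>
      has_resolution_of_length R (projective_module R) (Suc n) M"
proof -
  note F = free_fgmod[OF R, of c] note FM = Free[OF R]
  obtain k where k: "k \<in> mod_iso R (free_fgmod R c) (Free R c)" using F(3) by (auto simp: isomorphic_modules_def)
  note k' = mod_isoD[OF k]
  have ek: "(\<lambda>x. e (k x)) \<in> mod_hom R (free_fgmod R c) M" by (rule mod_hom_comp[OF k'(1) e(1)])
  have eks: "(\<lambda>x. e (k x)) ` carrier (free_fgmod R c) = carrier M" using k'(3) e(2) by (metis image_image)
  { assume ker: "a_kernel (Free R c) M e = {\<zero>\<^bsub>Free R c\<^esub>}"
    then have "inj_on e (vecs R c)" unfolding inj_on_iff_kernel[OF FM M e(1)] by (auto simp: a_kernel_eq)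
    then have "e \<in> mod_iso R (Free R c) M" using mod_isoI e by blast
    from mod_iso_comp[OF k this] show "has_resolution_of_length R (projective_module R) 0 M"
      by (rule has_resolution_of_length_0[where C = "projective_module R", OF M F(1,4)]) }
  assume K: "has_resolution_of_length R (projective_module R) n
        ((Free R c)\<lparr>carrier := a_kernel (Free R c) M e\<rparr>)"
  let ?K = "(Free R c)\<lparr>carrier := a_kernel (Free R c) M e\<rparr>"
    and ?K' = "(free_fgmod R c)\<lparr>carrier := a_kernel (free_fgmod R c) M (\<lambda>x. e (k x))\<rparr>"
  have KM: "module R ?K" "module R ?K'" using kernel_record_module[OF FM M e(1)] kernel_record_module[OF F(1) M ek] by auto
  have "k \<in> mod_iso R ?K' ?K"
  proof (rule mod_isoI[OF mod_hom_restrict[OF k'(1)]])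
    show "\<forall>x \<in> a_kernel (free_fgmod R c) M (\<lambda>x. e (k x)). x \<in> carrier (free_fgmod R c) \<and>
        k x \<in> a_kernel (Free R c) M e" using mod_hom_closed[OF k'(1)] by (simp add: a_kernel_eq)
    show "inj_on k (carrier ?K')" by (rule inj_on_subset[OF k'(2)]) (auto simp: a_kernel_eq)
    show "k ` carrier ?K' = carrier ?K"
      using k'(3) mod_hom_closed[OF k'(1)] by (auto simp: a_kernel_eq image_iff)
  qed
  then have "isomorphic_modules R ?K ?K'" using isomorphic_modules_sym[OF KM(2,1)] isomorphic_modulesI by blast
  from has_resolution_of_length_iso[OF KM this K]
  show "has_resolution_of_length R (projective_module R) (Suc n) M"
    by (rule has_resolution_of_length_Suc[where C = "projective_module R", OF M F(1,4) ek eks])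
qed

text \<open>\<open>ffr_sub\<close> counts terms while \<open>has_resolution_of_length\<close> counts
  arrows between them; this is why \<open>Suc n\<close> stands against n in the induction.\<close>

lemma finite_pd_of_has_ffr:
  assumes M: "module R M" and "has_ffr R M" shows "pd R M < \<infinity>"
proof -
  have R: "cring R" by (rule module_imp_cring[OF M])
  note FM = Free[OF R]
  have sub: "has_resolution_of_length R (projective_module R) n ((Free R c)\<lparr>carrier := W\<rparr>)"
    if "ffr_sub R (Suc n) c W" "submodule W R (Free R c)" for n c W using that
  proof (induction n arbitrary: c W)
    case 0
    note WM = submodule_carrier_module[OF FM 0(2)]
    have "W \<subseteq> vecs R c" using 0(2) module.submoduleD(1)[OF FM] by blast
    from 0(1)[unfolded ffr_sub_Suc_iff[OF this] ffr_def] show ?case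
      using resolution_of_cover(1)[OF R WM] by auto
  next
    case (Suc n)
    note WM = submodule_carrier_module[OF FM Suc(3)]
    have "W \<subseteq> vecs R c" using Suc(3) module.submoduleD(1)[OF FM] by blast
    from Suc(2)[unfolded ffr_sub_Suc_iff[OF this] ffr_def] obtain p e where
      e: "e \<in> mod_hom R (Free R p) ((Free R c)\<lparr>carrier := W\<rparr>)"
      "e ` vecs R p = carrier ((Free R c)\<lparr>carrier := W\<rparr>)"
      "ffr_sub R (Suc n) p (a_kernel (Free R p) ((Free R c)\<lparr>carrier := W\<rparr>) e)" by blast
    show ?case
      by (rule resolution_of_cover(2)[OF R WM e(1,2) Suc.IH[OF e(3) kernel_submodule[OF FM WM e(1)]]])
  qed
  obtain n d e where e: "e \<in> mod_hom R (Free R d) M" "e ` vecs R d = carrier M"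
    "ffr_sub R (Suc n) d (a_kernel (Free R d) M e)"
    using assms(2) ffr_sub_Suc_mono[OF R] unfolding has_ffr_def ffr_def by blast
  show ?thesis unfolding pd_def resolution_dim_finite_iff
    using resolution_of_cover(2)[OF R M e(1,2) sub[OF e(3) kernel_submodule[OF FM M e(1)]]] by blast
qed

subsection \<open>Duality for free modules\<close>

text \<open>The standard bilinear pairing, through which R^n is its own dual.\<close>

definition vdot :: "('a, 'r) ring_scheme \<Rightarrow> nat \<Rightarrow> (nat \<Rightarrow> 'a) \<Rightarrow> (nat \<Rightarrow> 'a) \<Rightarrow> 'a" where
  "vdot R n c v = lin_comb (self_module R) v c n"

text \<open>The transposed matrix as a function, that is, the adjoint of \<open>h\<close> for
  \<open>vdot\<close>; it represents the dual map.\<close>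

definition transp ::
  "('a, 'r) ring_scheme \<Rightarrow> nat \<Rightarrow> nat \<Rightarrow> ((nat \<Rightarrow> 'a) \<Rightarrow> nat \<Rightarrow> 'a) \<Rightarrow> (nat \<Rightarrow> 'a) \<Rightarrow> nat \<Rightarrow> 'a" where
  "transp R n m h c = (\<lambda>i\<in>{..<n}. vdot R m c (h (unit_vec R n i)))"

context cring begin

lemma self_mod: "module R (self_module R)" by (rule self_module[OF is_cring])

lemma free_mod: "module R (Free R n)" by (rule Free[OF is_cring])

lemma vdot_hom_left:
  "v \<in> vecs R n \<Longrightarrow> (\<lambda>c. vdot R n c v) \<in> mod_hom R (Free R n) (self_module R)"
  unfolding vdot_def by (rule module.lin_comb_hom[OF self_mod]) (simp add: free_module_coord)

lemma vdot_comm: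
  assumes "c \<in> vecs R n" "v \<in> vecs R n"
  shows "vdot R n c v = vdot R n v c"
proof -
  have "m \<le> n \<Longrightarrow> lin_comb (self_module R) v c m = lin_comb (self_module R) c v m" for m
    by (induction m) (simp_all add: m_comm free_module_coord[OF assms(1)] free_module_coord[OF assms(2)])
  then show ?thesis by (simp add: vdot_def)
qed

lemma vdot_closed:
  assumes "c \<in> vecs R n" "v \<in> vecs R n"
  shows "vdot R n c v \<in> carrier R"
  using mod_hom_closed[OF vdot_hom_left[OF assms(2)] assms(1)] by simp

lemma vdot_hom_right:
  assumes c: "c \<in> vecs R n"
  shows "vdot R n c \<in> mod_hom R (Free R n) (self_module R)"
proof -
  interpret F: module R "Free R n" by (rule free_mod)
  show ?thesis
  proof (rule mod_homI)
    fix x y assume x: "x \<in> vecs R n" and y: "y \<in> vecs R n"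
    show "vdot R n c (x \<oplus>\<^bsub>Free R n\<^esub> y) = vdot R n c x \<oplus>\<^bsub>self_module R\<^esub> vdot R n c y"
      using mod_hom_add[OF vdot_hom_left[OF c] x y] vdot_comm[OF c] x y by simp
  next
    fix r x assume r: "r \<in> carrier R" and x: "x \<in> vecs R n"
    show "vdot R n c (r \<odot>\<^bsub>Free R n\<^esub> x) = r \<odot>\<^bsub>self_module R\<^esub> vdot R n c x"
      using mod_hom_smult[OF vdot_hom_left[OF c] r x] vdot_comm[OF c] r x by simp
  qed (use vdot_closed[OF c] in simp)
qed

lemma vdot_unit_vec: "i < n \<Longrightarrow> v \<in> vecs R n \<Longrightarrow> vdot R n (unit_vec R n i) v = v i"
  unfolding vdot_def by (rule module.lin_comb_unit_vec[OF self_mod]) (simp_all add: free_module_coord)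

lemma vdot_repr:
  assumes "g \<in> mod_hom R (Free R n) (self_module R)"
  obtains c where "c \<in> vecs R n" "\<And>v. v \<in> vecs R n \<Longrightarrow> g v = vdot R n c v"
proof -
  let ?c = "\<lambda>i\<in>{..<n}. g (unit_vec R n i)"
  have c: "?c \<in> vecs R n"
    using mod_hom_closed[OF assms unit_vec_closed[OF is_cring]] by (simp add: free_module_simps)
  have "g v = vdot R n ?c v" if v: "v \<in> vecs R n" for v
  proof -
    have "g v = lin_comb (self_module R) (\<lambda>i. g (unit_vec R n i)) v n"
      by (rule free_hom_lin_comb[OF self_mod assms v])
    also have "\<dots> = vdot R n v ?c"
      unfolding vdot_def by (rule module.lin_comb_cong[OF self_mod]) auto
    finally show ?thesis using vdot_comm[OF c v] by simp
  qed
  then show thesis using that c by blast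
qed

lemma vdot_nondegenerate:
  assumes "u \<in> vecs R n" "\<And>c. c \<in> vecs R n \<Longrightarrow> vdot R n c u = \<zero>"
  shows "u = \<zero>\<^bsub>Free R n\<^esub>"
proof -
  interpret F: module R "Free R n" by (rule free_mod)
  show ?thesis by (rule free_module_ext[OF assms(1) F.M.zero_closed])
      (use vdot_unit_vec[OF _ assms(1)] assms(2)[OF unit_vec_closed[OF is_cring]] in \<open>simp add: free_module_simps\<close>)
qed

lemma transp_hom:
  assumes h: "h \<in> Lin R n m"
  shows "transp R n m h \<in> Lin R m n"
proof -
  note l = vdot_hom_left[OF mod_hom_closed[OF h unit_vec_closed[OF is_cring]]]
  show ?thesis by (rule mod_homI)
      (use mod_hom_closed[OF l] mod_hom_add[OF l] mod_hom_smult[OF l] in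
        \<open>auto simp: transp_def free_module_simps[of _ n] fun_eq_iff\<close>)
qed

lemma vdot_transp:
  assumes h: "h \<in> Lin R n m"
    and c: "c \<in> vecs R m" and u: "u \<in> vecs R n"
  shows "vdot R n (transp R n m h c) u = vdot R m c (h u)"
proof (rule free_hom_eqI[OF self_mod vdot_hom_right mod_hom_comp[OF h vdot_hom_right[OF c]] _ u])
  show t: "transp R n m h c \<in> vecs R n" by (rule mod_hom_closed[OF transp_hom[OF h] c])
  show "vdot R n (transp R n m h c) (unit_vec R n i) = vdot R m c (h (unit_vec R n i))" if "i < n" for i
    using vdot_comm[OF t unit_vec_closed[OF is_cring]] vdot_unit_vec[OF that t] that by (simp add: transp_def)
qed

lemma vdot_eqI:
  assumes "c \<in> vecs R n" "d \<in> vecs R n"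
    "\<And>u. u \<in> vecs R n \<Longrightarrow> vdot R n c u = vdot R n d u"
  shows "c = d"
proof (rule free_module_ext[OF assms(1,2)])
  fix i assume "i < n"
  then show "c i = d i"
    using vdot_unit_vec[of i n] vdot_comm[OF assms(1)] vdot_comm[OF assms(2)] assms unit_vec_closed[OF is_cring, of n i]
    by metis
qed

end

section \<open>Hom modules, duals and biduality\<close>

lemma hom_module_simps:
  "carrier (hom_module R M N) = mod_hom R M N \<inter> extensional (carrier M)"
  "\<zero>\<^bsub>hom_module R M N\<^esub> = (\<lambda>x\<in>carrier M. \<zero>\<^bsub>N\<^esub>)"
  "f \<oplus>\<^bsub>hom_module R M N\<^esub> g = (\<lambda>x\<in>carrier M. f x \<oplus>\<^bsub>N\<^esub> g x)"
  "r \<odot>\<^bsub>hom_module R M N\<^esub> f = (\<lambda>x\<in>carrier M. r \<odot>\<^bsub>N\<^esub> f x)"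
  by (simp_all add: hom_module_def)

text \<open>The elements of a Hom module are extensional functions, so that homomorphisms agreeing
  on the carrier are equal; an arbitrary homomorphism must be restricted to become one.\<close>

lemma mod_hom_restrict_fun:
  assumes "module R M" "f \<in> mod_hom R M N" shows "restrict f (carrier M) \<in> carrier (hom_module R M N)"
proof -
  interpret M: module R M by fact
  have "restrict f (carrier M) \<in> mod_hom R M N"
    by (rule mod_homI) (simp_all add: mod_hom_closed[OF assms(2)] mod_hom_add[OF assms(2)] mod_hom_smult[OF assms(2)])
  then show ?thesis by (simp add: hom_module_simps)
qed

lemma hom_module_eqI:
  "f \<in> carrier (hom_module R M N) \<Longrightarrow> g \<in> carrier (hom_module R M N) \<Longrightarrow>
    (\<And>x. x \<in> carrier M \<Longrightarrow> f x = g x) \<Longrightarrow> f = g"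
  by (auto simp: hom_module_simps intro: extensionalityI)

lemma hom_module:
  assumes M: "module R M" and N: "module R N" shows "module R (hom_module R M N)"
proof -
  interpret M: module R M by fact
  interpret N: module R N by fact
  let ?H = "hom_module R M N"
  have h: "f \<in> mod_hom R M N" if "f \<in> carrier ?H" for f using that by (simp add: hom_module_simps)
  have cl: "f x \<in> carrier N" if "f \<in> carrier ?H" "x \<in> carrier M" for f x
    using mod_hom_closed[OF h[OF that(1)] that(2)] .
  have add: "f \<oplus>\<^bsub>?H\<^esub> g \<in> carrier ?H" if "f \<in> carrier ?H" "g \<in> carrier ?H" for f g
    using mod_hom_restrict_fun[OF M mod_hom_plus[OF N h h]] that by (simp add: hom_module_simps(3))
  have sm: "r \<odot>\<^bsub>?H\<^esub> f \<in> carrier ?H" if "r \<in> carrier R" "f \<in> carrier ?H" for r f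
    using mod_hom_restrict_fun[OF M mod_hom_scale[OF N h]] that by (simp add: hom_module_simps(4))
  have z: "\<zero>\<^bsub>?H\<^esub> \<in> carrier ?H"
    using mod_hom_restrict_fun[OF M mod_hom_const_zero[OF N]] by (simp add: hom_module_simps(2))
  show ?thesis
  proof (rule moduleI)
    show "cring R" by (rule M.R.cring_axioms)
    show "abelian_group ?H"
    proof (rule abelian_groupI)
      fix x assume x: "x \<in> carrier ?H"
      show "\<zero>\<^bsub>?H\<^esub> \<oplus>\<^bsub>?H\<^esub> x = x"
        by (rule hom_module_eqI[OF add[OF z x] x]) (simp add: hom_module_simps cl[OF x])
      have n: "(\<lambda>y\<in>carrier M. \<ominus>\<^bsub>N\<^esub> x y) \<in> carrier ?H"
        by (rule mod_hom_restrict_fun[OF M mod_hom_uminus[OF N h[OF x]]])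
      show "\<exists>y \<in> carrier ?H. y \<oplus>\<^bsub>?H\<^esub> x = \<zero>\<^bsub>?H\<^esub>"
        by (rule bexI[OF _ n], rule hom_module_eqI[OF add[OF n x] z])
          (simp add: hom_module_simps cl[OF x] N.M.l_neg)
    next
      fix x y assume x: "x \<in> carrier ?H" and y: "y \<in> carrier ?H"
      show "x \<oplus>\<^bsub>?H\<^esub> y = y \<oplus>\<^bsub>?H\<^esub> x"
        by (rule hom_module_eqI[OF add[OF x y] add[OF y x]])
          (simp add: hom_module_simps cl[OF x] cl[OF y] N.M.a_comm)
      fix w assume w: "w \<in> carrier ?H"
      show "(x \<oplus>\<^bsub>?H\<^esub> y) \<oplus>\<^bsub>?H\<^esub> w = x \<oplus>\<^bsub>?H\<^esub> (y \<oplus>\<^bsub>?H\<^esub> w)"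
        by (rule hom_module_eqI[OF add[OF add[OF x y] w] add[OF x add[OF y w]]])
          (simp add: hom_module_simps cl[OF x] cl[OF y] cl[OF w] N.M.a_assoc)
    qed (use add z in auto)
  next
    fix a x assume a: "a \<in> carrier R" and x: "x \<in> carrier ?H"
    { fix b assume b: "b \<in> carrier R"
      show "(a \<oplus>\<^bsub>R\<^esub> b) \<odot>\<^bsub>?H\<^esub> x = a \<odot>\<^bsub>?H\<^esub> x \<oplus>\<^bsub>?H\<^esub> b \<odot>\<^bsub>?H\<^esub> x"
        by (rule hom_module_eqI[OF sm[OF _ x] add[OF sm[OF a x] sm[OF b x]]])
          (use a b in \<open>simp_all add: hom_module_simps cl[OF x] N.smult_l_distr\<close>)
      show "(a \<otimes>\<^bsub>R\<^esub> b) \<odot>\<^bsub>?H\<^esub> x = a \<odot>\<^bsub>?H\<^esub> (b \<odot>\<^bsub>?H\<^esub> x)"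
        by (rule hom_module_eqI[OF sm[OF _ x] sm[OF a sm[OF b x]]])
          (use a b in \<open>simp_all add: hom_module_simps cl[OF x] N.smult_assoc1\<close>) }
    fix y assume y: "y \<in> carrier ?H"
    show "a \<odot>\<^bsub>?H\<^esub> (x \<oplus>\<^bsub>?H\<^esub> y) = a \<odot>\<^bsub>?H\<^esub> x \<oplus>\<^bsub>?H\<^esub> a \<odot>\<^bsub>?H\<^esub> y"
      by (rule hom_module_eqI[OF sm[OF a add[OF x y]] add[OF sm[OF a x] sm[OF a y]]])
        (use a in \<open>simp add: hom_module_simps cl[OF x] cl[OF y] N.smult_r_distr\<close>)
  next
    fix x assume x: "x \<in> carrier ?H"
    show "\<one>\<^bsub>R\<^esub> \<odot>\<^bsub>?H\<^esub> x = x"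
      by (rule hom_module_eqI[OF sm[OF _ x] x]) (simp_all add: hom_module_simps cl[OF x])
  qed (use sm in auto)
qed

lemma dual_moduleD:
  assumes "f \<in> carrier (dual_module R Y)"
  shows "f \<in> mod_hom R Y (self_module R)" using assms by (simp add: dual_module_def hom_module_simps)

lemma dual_module: "module R Y \<Longrightarrow> module R (dual_module R Y)"
  unfolding dual_module_def by (rule hom_module[OF _ self_module[OF module_imp_cring]])

lemma dual_module_simps:
  "x \<in> carrier Y \<Longrightarrow> (f \<oplus>\<^bsub>dual_module R Y\<^esub> g) x = f x \<oplus>\<^bsub>R\<^esub> g x"
  "x \<in> carrier Y \<Longrightarrow> (r \<odot>\<^bsub>dual_module R Y\<^esub> f) x = r \<otimes>\<^bsub>R\<^esub> f x"
  "x \<in> carrier Y \<Longrightarrow> \<zero>\<^bsub>dual_module R Y\<^esub> x = \<zero>\<^bsub>R\<^esub>"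
  by (simp_all add: dual_module_def hom_module_simps)

lemma dual_module_eqI:
  "f \<in> carrier (dual_module R Y) \<Longrightarrow> g \<in> carrier (dual_module R Y) \<Longrightarrow>
    (\<And>x. x \<in> carrier Y \<Longrightarrow> f x = g x) \<Longrightarrow> f = g"
  unfolding dual_module_def by (rule hom_module_eqI)

lemma dual_module_restrict:
  "module R Y \<Longrightarrow> f \<in> mod_hom R Y (self_module R) \<Longrightarrow> restrict f (carrier Y) \<in> carrier (dual_module R Y)"
  unfolding dual_module_def by (rule mod_hom_restrict_fun)

lemma biduality_hom:
  assumes "module R Y"
  shows "biduality R Y \<in> mod_hom R Y (dual_module R (dual_module R Y))"
proof -
  interpret Y: module R Y by fact
  note D = dual_module[OF assms] and DD = dual_module[OF dual_module[OF assms]]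
  interpret D: module R "dual_module R Y" by (rule D)
  interpret DD: module R "dual_module R (dual_module R Y)" by (rule DD)
  have mem: "biduality R Y x \<in> carrier (dual_module R (dual_module R Y))" if x: "x \<in> carrier Y" for x
    unfolding biduality_def
  proof (rule dual_module_restrict[OF D])
    show "(\<lambda>f. f x) \<in> mod_hom R (dual_module R Y) (self_module R)"
      using mod_hom_closed[OF dual_moduleD] x by (intro mod_homI) (auto simp: dual_module_simps)
  qed
  show ?thesis
  proof (rule mod_homI[OF mem])
    fix x y assume x: "x \<in> carrier Y" and y: "y \<in> carrier Y"
    show "biduality R Y (x \<oplus>\<^bsub>Y\<^esub> y) =
        biduality R Y x \<oplus>\<^bsub>dual_module R (dual_module R Y)\<^esub> biduality R Y y"
      by (rule dual_module_eqI[OF mem DD.M.a_closed[OF mem mem]])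
        (use x y in \<open>simp_all add: dual_module_simps biduality_def mod_hom_add[OF dual_moduleD]\<close>)
  next
    fix r x assume r: "r \<in> carrier R" and x: "x \<in> carrier Y"
    show "biduality R Y (r \<odot>\<^bsub>Y\<^esub> x) = r \<odot>\<^bsub>dual_module R (dual_module R Y)\<^esub> biduality R Y x"
      by (rule dual_module_eqI[OF mem DD.smult_closed[OF r mem]])
        (use x r in \<open>simp_all add: dual_module_simps biduality_def mod_hom_smult[OF dual_moduleD]\<close>)
  qed
qed

subsection \<open>Totally acyclic complexes\<close>

text \<open>A doubly infinite complex \<open>\<dots> \<rightarrow> R\<^bsup>b(i+1)\<^esup> \<rightarrow> R\<^bsup>b(i)\<^esup> \<rightarrow> \<dots>\<close> of \<open>R\<close>-linear maps \<open>A i\<close> which becomes, modulo the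
  ideal \<open>I\<close>, an exact complex of free \<open>R/I\<close>-modules with exact dual.\<close>

definition totally_acyclic ::
  "('a, 'r) ring_scheme \<Rightarrow> 'a set \<Rightarrow> (int \<Rightarrow> nat) \<Rightarrow> (int \<Rightarrow> (nat \<Rightarrow> 'a) \<Rightarrow> (nat \<Rightarrow> 'a)) \<Rightarrow> bool"
where
  "totally_acyclic R I b A \<longleftrightarrow>
     (\<forall>i. A i \<in> Lin R (b (i + 1)) (b i)) \<and>
     (\<forall>i. \<forall>u \<in> vecs R (b (i + 1)). A i u \<in> ideal_vecs I (b i) \<longleftrightarrow>
        (\<exists>w \<in> vecs R (b (i + 1 + 1)).
           u \<ominus>\<^bsub>Free R (b (i + 1))\<^esub> A (i + 1) w \<in> ideal_vecs I (b (i + 1)))) \<and>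
     (\<forall>i. \<forall>f \<in> mod_hom R (Free R (b (i + 1))) (self_module R).
        (\<forall>w \<in> vecs R (b (i + 1 + 1)). f (A (i + 1) w) \<in> I) \<longrightarrow>
        (\<exists>g \<in> mod_hom R (Free R (b i)) (self_module R).
           \<forall>u \<in> vecs R (b (i + 1)). f u \<ominus>\<^bsub>R\<^esub> g (A i u) \<in> I))"

lemma (in cring) minus_mem_zero: "x \<in> carrier R \<Longrightarrow> y \<in> carrier R \<Longrightarrow> x \<ominus> y \<in> {\<zero>} \<longleftrightarrow> x = y"
  using module.minus_eq_zero_iff[OF self_mod, of x y] by simp

text \<open>For I = 0 the congruences are equations, and one recovers the exact complexes of free
  modules over R itself with exact dual.\<close>

lemma totally_acyclic_zero_iff:
  assumes "cring R"
  shows "totally_acyclic R {\<zero>\<^bsub>R\<^esub>} b A \<longleftrightarrow>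
     (\<forall>i. A i \<in> Lin R (b (i + 1)) (b i)) \<and>
     (\<forall>i. \<forall>u \<in> vecs R (b (i + 1)). A i u = \<zero>\<^bsub>Free R (b i)\<^esub> \<longleftrightarrow>
        (\<exists>w \<in> vecs R (b (i + 1 + 1)). u = A (i + 1) w)) \<and>
     (\<forall>i. \<forall>f \<in> mod_hom R (Free R (b (i + 1))) (self_module R).
        (\<forall>w \<in> vecs R (b (i + 1 + 1)). f (A (i + 1) w) = \<zero>\<^bsub>R\<^esub>) \<longrightarrow>
        (\<exists>g \<in> mod_hom R (Free R (b i)) (self_module R).
           \<forall>u \<in> vecs R (b (i + 1)). f u = g (A i u)))"
    (is "?L \<longleftrightarrow> ?H \<and> ?E \<and> ?D")
proof -
  interpret cring R by fact
  have "?L \<longleftrightarrow> ?E \<and> ?D" if A: ?H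
  proof -
    have Ac: "A i u \<in> vecs R (b i)" if "u \<in> vecs R (b (i + 1))" for i u
      by (rule mod_hom_closed[OF spec[OF A] that])
    have 1: "u \<ominus>\<^bsub>Free R (b (i + 1))\<^esub> A (i + 1) w \<in> ideal_vecs {\<zero>\<^bsub>R\<^esub>} (b (i + 1)) \<longleftrightarrow> u = A (i + 1) w"
      if "u \<in> vecs R (b (i + 1))" "w \<in> vecs R (b (i + 1 + 1))" for u w i
      unfolding ideal_vecs_zero[of R] singleton_iff by (rule module.minus_eq_zero_iff[OF free_mod that(1) Ac[OF that(2)]])
    have 2: "f u \<ominus>\<^bsub>R\<^esub> g (A i u) \<in> {\<zero>\<^bsub>R\<^esub>} \<longleftrightarrow> f u = g (A i u)"
      if "f \<in> mod_hom R (Free R (b (i + 1))) (self_module R)"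
        "g \<in> mod_hom R (Free R (b i)) (self_module R)" "u \<in> vecs R (b (i + 1))" for f g u i
      using minus_mem_zero mod_hom_closed[OF that(1,3)] mod_hom_closed[OF that(2) Ac[OF that(3)]] by simp
    have E: "(A i u \<in> ideal_vecs {\<zero>\<^bsub>R\<^esub>} (b i) \<longleftrightarrow> (\<exists>w \<in> vecs R (b (i + 1 + 1)).
         u \<ominus>\<^bsub>Free R (b (i + 1))\<^esub> A (i + 1) w \<in> ideal_vecs {\<zero>\<^bsub>R\<^esub>} (b (i + 1)))) \<longleftrightarrow>
       (A i u = \<zero>\<^bsub>Free R (b i)\<^esub> \<longleftrightarrow> (\<exists>w \<in> vecs R (b (i + 1 + 1)). u = A (i + 1) w))"
      if "u \<in> vecs R (b (i + 1))" for i u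
    proof -
      have x: "(\<exists>w \<in> vecs R (b (i + 1 + 1)).
           u \<ominus>\<^bsub>Free R (b (i + 1))\<^esub> A (i + 1) w \<in> ideal_vecs {\<zero>\<^bsub>R\<^esub>} (b (i + 1))) \<longleftrightarrow>
         (\<exists>w \<in> vecs R (b (i + 1 + 1)). u = A (i + 1) w)" by (intro bex_cong refl 1 that)
      show ?thesis unfolding x unfolding ideal_vecs_zero[of R] singleton_iff by (rule refl)
    qed
    have D: "(\<exists>g \<in> mod_hom R (Free R (b i)) (self_module R).
         \<forall>u \<in> vecs R (b (i + 1)). f u \<ominus>\<^bsub>R\<^esub> g (A i u) \<in> {\<zero>\<^bsub>R\<^esub>}) \<longleftrightarrow>
       (\<exists>g \<in> mod_hom R (Free R (b i)) (self_module R).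
         \<forall>u \<in> vecs R (b (i + 1)). f u = g (A i u))"
      if "f \<in> mod_hom R (Free R (b (i + 1))) (self_module R)" for f i
      by (intro bex_cong ball_cong refl 2 that)
    have "?L \<longleftrightarrow> ?H \<and> ?E \<and> ?D" unfolding totally_acyclic_def
      by (intro arg_cong2[where f = "(\<and>)"] arg_cong2[where f = "(\<longrightarrow>)"] refl all_cong1 ball_cong E D) simp_all
    then show ?thesis using A by blast
  qed
  moreover have "?L \<Longrightarrow> ?H" by (simp add: totally_acyclic_def)
  ultimately show ?thesis by blast
qed

lemma totally_acyclicD:
  assumes "totally_acyclic R I b A"
  shows "A i \<in> Lin R (b (i + 1)) (b i)"
    and "u \<in> vecs R (b (i + 1)) \<Longrightarrow> A i u \<in> ideal_vecs I (b i) \<Longrightarrow>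
      \<exists>w \<in> vecs R (b (i + 1 + 1)).
         u \<ominus>\<^bsub>Free R (b (i + 1))\<^esub> A (i + 1) w \<in> ideal_vecs I (b (i + 1))"
    and "u \<in> vecs R (b (i + 1)) \<Longrightarrow> w \<in> vecs R (b (i + 1 + 1)) \<Longrightarrow>
      u \<ominus>\<^bsub>Free R (b (i + 1))\<^esub> A (i + 1) w \<in> ideal_vecs I (b (i + 1)) \<Longrightarrow> A i u \<in> ideal_vecs I (b i)"
    and "f \<in> mod_hom R (Free R (b (i + 1))) (self_module R) \<Longrightarrow>
      (\<And>w. w \<in> vecs R (b (i + 1 + 1)) \<Longrightarrow> f (A (i + 1) w) \<in> I) \<Longrightarrow>
      \<exists>g \<in> mod_hom R (Free R (b i)) (self_module R).
         \<forall>u \<in> vecs R (b (i + 1)). f u \<ominus>\<^bsub>R\<^esub> g (A i u) \<in> I"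
  using assms unfolding totally_acyclic_def by blast+

lemma totally_acyclic_zeroD:
  assumes "cring R" "totally_acyclic R {\<zero>\<^bsub>R\<^esub>} b A"
  shows "A i \<in> Lin R (b (i + 1)) (b i)"
    and "u \<in> vecs R (b (i + 1)) \<Longrightarrow> A i u = \<zero>\<^bsub>Free R (b i)\<^esub> \<Longrightarrow>
      \<exists>w \<in> vecs R (b (i + 1 + 1)). u = A (i + 1) w"
    and "w \<in> vecs R (b (i + 1 + 1)) \<Longrightarrow> A i (A (i + 1) w) = \<zero>\<^bsub>Free R (b i)\<^esub>"
    and "f \<in> mod_hom R (Free R (b (i + 1))) (self_module R) \<Longrightarrow>
      (\<And>w. w \<in> vecs R (b (i + 1 + 1)) \<Longrightarrow> f (A (i + 1) w) = \<zero>\<^bsub>R\<^esub>) \<Longrightarrow>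
      \<exists>g \<in> mod_hom R (Free R (b i)) (self_module R).
         \<forall>u \<in> vecs R (b (i + 1)). f u = g (A i u)"
proof -
  note t = assms(2)[unfolded totally_acyclic_zero_iff[OF assms(1)]]
  show A: "A i \<in> Lin R (b (i + 1)) (b i)" for i using t by blast
  show "u \<in> vecs R (b (i + 1)) \<Longrightarrow> A i u = \<zero>\<^bsub>Free R (b i)\<^esub> \<Longrightarrow>
      \<exists>w \<in> vecs R (b (i + 1 + 1)). u = A (i + 1) w" using t by blast
  show "w \<in> vecs R (b (i + 1 + 1)) \<Longrightarrow> A i (A (i + 1) w) = \<zero>\<^bsub>Free R (b i)\<^esub>"
    using t mod_hom_closed[OF A[of "i + 1"], of w] by blast
  show "f \<in> mod_hom R (Free R (b (i + 1))) (self_module R) \<Longrightarrow>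
      (\<And>w. w \<in> vecs R (b (i + 1 + 1)) \<Longrightarrow> f (A (i + 1) w) = \<zero>\<^bsub>R\<^esub>) \<Longrightarrow>
      \<exists>g \<in> mod_hom R (Free R (b i)) (self_module R).
         \<forall>u \<in> vecs R (b (i + 1)). f u = g (A i u)" using t by blast
qed

text \<open>Exactness of the dual complex in coordinates: functionals become vectors via
  \<open>vdot\<close>, and composition with \<open>A i\<close> becomes the transpose.\<close>

lemma transp_exact:
  assumes R: "cring R" and t: "totally_acyclic R {\<zero>\<^bsub>R\<^esub>} b A"
    and c: "c \<in> vecs R (b (i + 1))"
  shows "(\<forall>w \<in> vecs R (b (i + 1 + 1)). vdot R (b (i + 1)) c (A (i + 1) w) = \<zero>\<^bsub>R\<^esub>) \<longleftrightarrow>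
    c \<in> transp R (b (i + 1)) (b i) (A i) ` vecs R (b i)"
proof -
  interpret cring R by fact
  note T = totally_acyclic_zeroD[OF R t]
  show ?thesis
  proof
    assume *: "\<forall>w \<in> vecs R (b (i + 1 + 1)). vdot R (b (i + 1)) c (A (i + 1) w) = \<zero>\<^bsub>R\<^esub>"
    obtain g where g: "g \<in> mod_hom R (Free R (b i)) (self_module R)"
      "\<And>u. u \<in> vecs R (b (i + 1)) \<Longrightarrow> vdot R (b (i + 1)) c u = g (A i u)"
      using T(4)[OF vdot_hom_right[OF c]] * by blast
    obtain d where d: "d \<in> vecs R (b i)"
      "\<And>v. v \<in> vecs R (b i) \<Longrightarrow> g v = vdot R (b i) d v"
      by (rule vdot_repr[OF g(1)]) (rule that)
    have "c = transp R (b (i + 1)) (b i) (A i) d"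
    proof (rule vdot_eqI[OF c mod_hom_closed[OF transp_hom[OF T(1)] d(1)]])
      fix u assume u: "u \<in> vecs R (b (i + 1))"
      show "vdot R (b (i + 1)) c u = vdot R (b (i + 1)) (transp R (b (i + 1)) (b i) (A i) d) u"
        using g(2)[OF u] d(2)[OF mod_hom_closed[OF T(1) u]] vdot_transp[OF T(1) d(1) u] by simp
    qed
    then show "c \<in> transp R (b (i + 1)) (b i) (A i) ` vecs R (b i)" using d(1) by blast
  next
    assume "c \<in> transp R (b (i + 1)) (b i) (A i) ` vecs R (b i)"
    then obtain d where d: "d \<in> vecs R (b i)" "c = transp R (b (i + 1)) (b i) (A i) d" by blast
    show "\<forall>w \<in> vecs R (b (i + 1 + 1)). vdot R (b (i + 1)) c (A (i + 1) w) = \<zero>\<^bsub>R\<^esub>"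
    proof
      fix w assume w: "w \<in> vecs R (b (i + 1 + 1))"
      show "vdot R (b (i + 1)) c (A (i + 1) w) = \<zero>\<^bsub>R\<^esub>"
        unfolding d(2) vdot_transp[OF T(1) d(1) mod_hom_closed[OF T(1) w]] T(3)[OF w]
        using mod_hom_zero[OF free_mod self_mod vdot_hom_right[OF d(1)]] by simp
    qed
  qed
qed

text \<open>\<open>Y\<close> is the image of \<open>A 0\<close>. The part of the complex in positive
  degrees resolves \<open>Y\<close>, and the transposes of the maps in negative degrees resolve the
  dual of \<open>Y\<close>. Both families of Ext groups vanish because the complex and its dual are
  exact, and biduality is bijective because transposing twice gives the complex back.\<close>

lemma totally_reflexive_of_totally_acyclic:
  assumes R: "cring R" and t: "totally_acyclic R {\<zero>\<^bsub>R\<^esub>} b A" and Y: "module R Y"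
    and p: "p \<in> mod_hom R (Free R (b 1)) Y" "p ` vecs R (b 1) = carrier Y"
    and j: "j \<in> mod_hom R Y (Free R (b 0))" "inj_on j (carrier Y)"
    and jp: "\<And>u. u \<in> vecs R (b 1) \<Longrightarrow> j (p u) = A 0 u"
  shows "totally_reflexive R Y"
proof -
  interpret cring R by fact
  interpret Y: module R Y by fact
  note T = totally_acyclic_zeroD[OF R t]
  have A0: "A 0 \<in> Lin R (b 1) (b 0)" using T(1)[of 0] by simp
  have pc: "p u \<in> carrier Y" if "u \<in> vecs R (b 1)" for u by (rule mod_hom_closed[OF p(1) that])
  have jc: "j x \<in> vecs R (b 0)" if "x \<in> carrier Y" for x by (rule mod_hom_closed[OF j(1) that])
  have j0: "x = \<zero>\<^bsub>Y\<^esub>" if "x \<in> carrier Y" "j x = \<zero>\<^bsub>Free R (b 0)\<^esub>" for x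
    using j(2) that unfolding inj_on_iff_kernel[OF Y free_mod j(1)] by blast
  have j00: "j \<zero>\<^bsub>Y\<^esub> = \<zero>\<^bsub>Free R (b 0)\<^esub>" by (rule mod_hom_zero[OF Y free_mod j(1)])
  have p0: "p u = \<zero>\<^bsub>Y\<^esub> \<longleftrightarrow> A 0 u = \<zero>\<^bsub>Free R (b 0)\<^esub>" if "u \<in> vecs R (b 1)" for u
    using jp[OF that] j0[OF pc[OF that]] j00 by auto
  have px: "\<exists>u \<in> vecs R (b 1). x = p u" if "x \<in> carrier Y" for x
  proof -
    have "x \<in> p ` vecs R (b 1)" using that p(2) by simp
    then show ?thesis by blast
  qed
  let ?D = "dual_module R Y"
  note DM = dual_module[OF Y]
  interpret D: module R ?D by (rule DM)
  \<comment> \<open>The dual of the inclusion of \<open>Y\<close> in R^(b 0); by dual exactness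
    every functional on \<open>Y\<close> extends to R^(b 0).\<close>
  define th where "th c = (\<lambda>x\<in>carrier Y. vdot R (b 0) c (j x))" for c
  have thc: "th c \<in> carrier ?D" if "c \<in> vecs R (b 0)" for c
    unfolding th_def by (rule dual_module_restrict[OF Y mod_hom_comp[OF j(1) vdot_hom_right[OF that]]])
  have th: "th \<in> mod_hom R (Free R (b 0)) ?D"
  proof -
    interpret F: module R "Free R (b 0)" by (rule free_mod)
    show ?thesis
    proof (rule mod_homI[OF thc])
      fix x y assume x: "x \<in> vecs R (b 0)" and y: "y \<in> vecs R (b 0)"
      show "th (x \<oplus>\<^bsub>Free R (b 0)\<^esub> y) = th x \<oplus>\<^bsub>?D\<^esub> th y"
        by (rule dual_module_eqI[OF thc D.M.a_closed[OF thc thc]])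
          (use x y mod_hom_add[OF vdot_hom_left[OF jc] x y] in \<open>simp_all add: dual_module_simps th_def\<close>)
    next
      fix r x assume r: "r \<in> carrier R" and x: "x \<in> vecs R (b 0)"
      show "th (r \<odot>\<^bsub>Free R (b 0)\<^esub> x) = r \<odot>\<^bsub>?D\<^esub> th x"
        by (rule dual_module_eqI[OF thc D.smult_closed[OF r thc]])
          (use x r mod_hom_smult[OF vdot_hom_left[OF jc] r x] in \<open>simp_all add: dual_module_simps th_def\<close>)
    qed
  qed
  have ths: "th ` vecs R (b 0) = carrier ?D"
  proof
    show "th ` vecs R (b 0) \<subseteq> carrier ?D" using thc by blast
    show "carrier ?D \<subseteq> th ` vecs R (b 0)"
    proof
      fix f assume f: "f \<in> carrier ?D"
      note fh = dual_moduleD[OF f]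
      have "\<exists>g \<in> mod_hom R (Free R (b 0)) (self_module R).
          \<forall>u \<in> vecs R (b (0 + 1)). f (p u) = g (A 0 u)"
      proof (rule T(4))
        show "(\<lambda>u. f (p u)) \<in> mod_hom R (Free R (b (0 + 1))) (self_module R)"
          using mod_hom_comp[OF p(1) fh] by simp
        fix w assume w: "w \<in> vecs R (b (0 + 1 + 1))"
        have "A (0 + 1) w \<in> vecs R (b 1)" using mod_hom_closed[OF T(1) w] by simp
        then have "p (A (0 + 1) w) = \<zero>\<^bsub>Y\<^esub>" using T(3)[OF w] p0 by blast
        then show "f (p (A (0 + 1) w)) = \<zero>\<^bsub>R\<^esub>" using mod_hom_zero[OF Y self_mod fh] by simp
      qed
      then obtain g where g: "g \<in> mod_hom R (Free R (b 0)) (self_module R)"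
        "\<And>u. u \<in> vecs R (b 1) \<Longrightarrow> f (p u) = g (A 0 u)" by auto
      obtain d where d: "d \<in> vecs R (b 0)"
        "\<And>v. v \<in> vecs R (b 0) \<Longrightarrow> g v = vdot R (b 0) d v"
        by (rule vdot_repr[OF g(1)]) (rule that)
      have "f = th d"
      proof (rule dual_module_eqI[OF f thc[OF d(1)]])
        fix x assume x: "x \<in> carrier Y"
        obtain u where u: "u \<in> vecs R (b 1)" "x = p u" using px[OF x] by blast
        then show "f x = th d x" using g(2)[OF u(1)] d(2)[OF jc[OF x]] jp[OF u(1)] x by (simp add: th_def)
      qed
      then show "f \<in> th ` vecs R (b 0)" using d(1) by blast
    qed
  qed
  have thp: "th c (p u) = vdot R (b 0) c (A 0 u)" if "u \<in> vecs R (b 1)" for c u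
    using pc[OF that] jp[OF that] by (simp add: th_def)
  have th0: "th c = \<zero>\<^bsub>?D\<^esub> \<longleftrightarrow> (\<forall>u \<in> vecs R (b 1). vdot R (b 0) c (A 0 u) = \<zero>\<^bsub>R\<^esub>)"
    if c: "c \<in> vecs R (b 0)" for c
  proof
    assume "th c = \<zero>\<^bsub>?D\<^esub>"
    then have "\<forall>x \<in> carrier Y. th c x = \<zero>\<^bsub>R\<^esub>" by (simp add: dual_module_simps)
    then show "\<forall>u \<in> vecs R (b 1). vdot R (b 0) c (A 0 u) = \<zero>\<^bsub>R\<^esub>" using thp pc by force
  next
    assume *: "\<forall>u \<in> vecs R (b 1). vdot R (b 0) c (A 0 u) = \<zero>\<^bsub>R\<^esub>"
    show "th c = \<zero>\<^bsub>?D\<^esub>"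
    proof (rule dual_module_eqI[OF thc[OF c] D.M.zero_closed])
      fix x assume x: "x \<in> carrier Y"
      then obtain u where u: "u \<in> vecs R (b 1)" "x = p u" using px by blast
      then show "th c x = \<zero>\<^bsub>?D\<^esub> x" using thp[OF u(1)] * x by (simp add: dual_module_simps)
    qed
  qed
  define At where "At i = transp R (b (i + 1)) (b i) (A i)" for i
  have At: "At i \<in> Lin R (b i) (b (i + 1))" for i
    unfolding At_def by (rule transp_hom[OF T(1)])
  have At': "At (- 1 - int k) \<in> Lin R (b (- int (Suc k))) (b (- int k))" for k
    using At[of "- 1 - int k"] by simp
  have tex: "(\<forall>w \<in> vecs R (b (i + 1 + 1)). vdot R (b (i + 1)) c (A (i + 1) w) = \<zero>\<^bsub>R\<^esub>) \<longleftrightarrow>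
    c \<in> At i ` vecs R (b i)" if "c \<in> vecs R (b (i + 1))" for c i
    unfolding At_def by (rule transp_exact[OF R t that])
  have fg: "fg_module R Y" by (rule fg_moduleI[OF Y p])
  have bid: "biduality R Y \<in> mod_iso R Y (dual_module R ?D)"
  proof (rule mod_isoI[OF biduality_hom[OF Y]])
    note DD = dual_module[OF DM]
    interpret DD: module R "dual_module R ?D" by (rule DD)
    show "inj_on (biduality R Y) (carrier Y)" unfolding inj_on_iff_kernel[OF Y DD biduality_hom[OF Y]]
    proof (intro ballI impI)
      fix x assume x: "x \<in> carrier Y" and 0: "biduality R Y x = \<zero>\<^bsub>dual_module R ?D\<^esub>"
      have "j x = \<zero>\<^bsub>Free R (b 0)\<^esub>"
      proof (rule vdot_nondegenerate[OF jc[OF x]])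
        fix c assume c: "c \<in> vecs R (b 0)"
        have "biduality R Y x (th c) = \<zero>\<^bsub>R\<^esub>" unfolding 0 using thc[OF c] by (simp add: dual_module_simps)
        then show "vdot R (b 0) c (j x) = \<zero>\<^bsub>R\<^esub>" using thc[OF c] x by (simp add: biduality_def th_def)
      qed
      then show "x = \<zero>\<^bsub>Y\<^esub>" by (rule j0[OF x])
    qed
    show "biduality R Y ` carrier Y = carrier (dual_module R ?D)"
    proof
      show "biduality R Y ` carrier Y \<subseteq> carrier (dual_module R ?D)"
        using mod_hom_closed[OF biduality_hom[OF Y]] by blast
      show "carrier (dual_module R ?D) \<subseteq> biduality R Y ` carrier Y"
      proof
        fix ph assume ph: "ph \<in> carrier (dual_module R ?D)"
        note phh = dual_moduleD[OF ph]
        obtain y where y: "y \<in> vecs R (b 0)"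
          "\<And>c. c \<in> vecs R (b 0) \<Longrightarrow> ph (th c) = vdot R (b 0) y c"
          by (rule vdot_repr[OF mod_hom_comp[OF th phh]]) (rule that)
        \<comment> \<open>A functional on the dual becomes, after composition with
          \<open>th\<close>, the pairing with a vector \<open>y\<close>. It kills the relations of
          the dual, which forces A(-1) y = 0, so y = A 0 u and the functional is evaluation at
          \<open>p u\<close>.\<close>
        have Am: "A (- 1) \<in> Lin R (b 0) (b (- 1))" using T(1)[of "- 1"] by simp
        have "A (- 1) y = \<zero>\<^bsub>Free R (b (- 1))\<^esub>"
        proof (rule vdot_nondegenerate[OF mod_hom_closed[OF Am y(1)]])
          fix c assume c: "c \<in> vecs R (b (- 1))"
          have Ac: "At (- 1) c \<in> vecs R (b 0)" using mod_hom_closed[OF At c] by simp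
          have "th (At (- 1) c) = \<zero>\<^bsub>?D\<^esub>"
            unfolding th0[OF Ac] using tex[of "At (- 1) c" "- 1"] Ac c by simp
          then have "vdot R (b 0) y (At (- 1) c) = \<zero>\<^bsub>R\<^esub>"
            using y(2)[OF Ac] mod_hom_zero[OF DM self_mod phh] by simp
          then have "vdot R (b 0) (At (- 1) c) y = \<zero>\<^bsub>R\<^esub>" using vdot_comm[OF Ac y(1)] by simp
          moreover have "vdot R (b 0) (At (- 1) c) y = vdot R (b (- 1)) c (A (- 1) y)"
            using vdot_transp[OF Am c y(1)] by (simp add: At_def)
          ultimately show "vdot R (b (- 1)) c (A (- 1) y) = \<zero>\<^bsub>R\<^esub>" by simp
        qed
        then obtain u where u: "u \<in> vecs R (b 1)" "y = A 0 u" using T(2)[of y "- 1"] y(1) by auto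
        have "ph = biduality R Y (p u)"
        proof (rule dual_module_eqI[OF ph mod_hom_closed[OF biduality_hom[OF Y] pc[OF u(1)]]])
          fix f assume f: "f \<in> carrier ?D"
          then have "f \<in> th ` vecs R (b 0)" using ths by simp
          then obtain c where c: "c \<in> vecs R (b 0)" "f = th c" by blast
          have "ph f = vdot R (b 0) c (A 0 u)" unfolding c(2) y(2)[OF c(1)] u(2)[symmetric] by (rule vdot_comm[OF y(1) c(1)])
          then show "ph f = biduality R Y (p u) f" using f thp[OF u(1)] c(2) by (simp add: biduality_def)
        qed
        then show "ph \<in> biduality R Y ` carrier Y" using pc[OF u(1)] by blast
      qed
    qed
  qed
  have e1: "ext_vanishes R k Y (self_module R)" if k: "k \<ge> 1" for k
  proof -
    \<comment> \<open>The augmentation \<open>p\<close> starts at R^(b 1), hence the shift by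
      one.\<close>
    let ?b = "\<lambda>i. b (int i + 1)" and ?d = "\<lambda>i. A (int i + 1)"
    have res: "free_resolution R ?b ?d p Y" unfolding free_resolution_def resolution_def
    proof (intro conjI allI)
      show "A (int i + 1) \<in> Lin R (b (int (Suc i) + 1)) (b (int i + 1))" for i
        using T(1)[of "int i + 1"] by (simp add: add.commute)
      show "A (int 0 + 1) ` vecs R (b (int 1 + 1)) = a_kernel (Free R (b (int 0 + 1))) Y p"
      proof -
        have "u \<in> A 1 ` vecs R (b 2) \<longleftrightarrow> u \<in> vecs R (b 1) \<and> p u = \<zero>\<^bsub>Y\<^esub>" for u
          using T(2)[of u 0] T(3)[of _ 0] mod_hom_closed[OF T(1)[of 1]] p0 by auto
        then show ?thesis by (auto simp: a_kernel_eq)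
      qed
      show "A (int (Suc i) + 1) ` carrier (Free R (b (int (Suc (Suc i)) + 1))) =
          a_kernel (Free R (b (int (Suc i) + 1))) (Free R (b (int i + 1))) (A (int i + 1))" for i
      proof -
        have "u \<in> A (int i + 1 + 1) ` vecs R (b (int i + 1 + 1 + 1)) \<longleftrightarrow>
            u \<in> vecs R (b (int i + 1 + 1)) \<and> A (int i + 1) u = \<zero>\<^bsub>Free R (b (int i + 1))\<^esub>" for u
          using T(2)[of u "int i + 1"] T(3)[of _ "int i + 1"] mod_hom_closed[OF T(1)[of "int i + 1 + 1"]] by blast
        then show ?thesis by (auto simp: a_kernel_eq add_ac)
      qed
    qed (use free_mod p in auto)
    show ?thesis unfolding ext_vanishes_def
    proof (intro exI conjI ballI impI)
      show "free_resolution R ?b ?d p Y" by (rule res)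
      obtain m where m: "k = Suc m" using k by (cases k) auto
      fix f assume f: "f \<in> mod_hom R (Free R (b (int k + 1))) (self_module R)"
        and 0: "\<forall>x \<in> carrier (Free R (b (int (k + 1) + 1))). f (A (int k + 1) x) = \<zero>\<^bsub>self_module R\<^esub>"
      have "\<exists>g \<in> mod_hom R (Free R (b (int k))) (self_module R).
         \<forall>u \<in> vecs R (b (int k + 1)). f u = g (A (int k) u)"
        by (rule T(4)[OF f]) (use 0 in \<open>simp add: add_ac\<close>)
      then show "\<exists>g \<in> mod_hom R (Free R (b (int (k - 1) + 1))) (self_module R).
          \<forall>x \<in> vecs R (b (int k + 1)). f x = g (A (int (k - 1) + 1) x)"
        using m by (simp add: add_ac)
    qed
  qed
  have e2: "ext_vanishes R k ?D (self_module R)" if k: "k \<ge> 1" for k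
  proof -
    \<comment> \<open>The dual is covered by R^(b 0), and the transposes run towards the negative
      indices: position i carries R^(b (-i)).\<close>
    let ?b = "\<lambda>i. b (- int i)" and ?d = "\<lambda>i. At (- 1 - int i)"
    have key: "c \<in> At (- 1 - int i) ` carrier (Free R (b (- int (Suc i)))) \<longleftrightarrow>
        c \<in> vecs R (b (- int i)) \<and>
        (\<forall>w \<in> vecs R (b (1 - int i)). vdot R (b (- int i)) c (A (- int i) w) = \<zero>\<^bsub>R\<^esub>)" for c i
      using tex[of c "- 1 - int i"] mod_hom_closed[OF At'[of i]] by auto
    have res: "free_resolution R ?b ?d th ?D" unfolding free_resolution_def resolution_def
    proof (intro conjI allI)
      show "At (- 1 - int i) \<in> Lin R (b (- int (Suc i))) (b (- int i))" for i
        by (rule At')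
      show "At (- 1 - int 0) ` vecs R (b (- int 1)) = a_kernel (Free R (b (- int 0))) ?D th"
      proof (rule Set.set_eqI)
        fix c show "c \<in> At (- 1 - int 0) ` vecs R (b (- int 1)) \<longleftrightarrow>
            c \<in> a_kernel (Free R (b (- int 0))) ?D th"
          using key[of c 0] th0[of c] by (simp add: a_kernel_eq cong: conj_cong)
      qed
      show "At (- 1 - int (Suc i)) ` carrier (Free R (b (- int (Suc (Suc i))))) =
          a_kernel (Free R (b (- int (Suc i)))) (Free R (b (- int i))) (At (- 1 - int i))" for i
      proof -
        have Ai: "A (- 1 - int i) \<in> Lin R (b (- int i)) (b (- int (Suc i)))"
          using T(1)[of "- 1 - int i"] by simp
        have v: "vdot R (b (- int i)) (At (- 1 - int i) c) w = vdot R (b (- int (Suc i))) c (A (- 1 - int i) w)"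
          if "c \<in> carrier (Free R (b (- int (Suc i))))" "w \<in> vecs R (b (- int i))" for c w
          using vdot_transp[OF Ai that] by (simp add: At_def)
        have "At (- 1 - int i) c = \<zero>\<^bsub>Free R (b (- int i))\<^esub> \<longleftrightarrow>
           (\<forall>w \<in> vecs R (b (- int i)). vdot R (b (- int (Suc i))) c (A (- 1 - int i) w) = \<zero>\<^bsub>R\<^esub>)"
          if c: "c \<in> carrier (Free R (b (- int (Suc i))))" for c
        proof -
          have Atc: "At (- 1 - int i) c \<in> vecs R (b (- int i))" by (rule mod_hom_closed[OF At' c])
          have z: "vdot R (b (- int i)) \<zero>\<^bsub>Free R (b (- int i))\<^esub> w = \<zero>\<^bsub>R\<^esub>"
            if "w \<in> vecs R (b (- int i))" for w
            using mod_hom_zero[OF free_mod self_mod vdot_hom_left[OF that]] by simp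
          show ?thesis
          proof
            assume "At (- 1 - int i) c = \<zero>\<^bsub>Free R (b (- int i))\<^esub>"
            then show "\<forall>w \<in> vecs R (b (- int i)). vdot R (b (- int (Suc i))) c (A (- 1 - int i) w) = \<zero>\<^bsub>R\<^esub>"
              using v[OF c] z by simp
          next
            assume *: "\<forall>w \<in> vecs R (b (- int i)). vdot R (b (- int (Suc i))) c (A (- 1 - int i) w) = \<zero>\<^bsub>R\<^esub>"
            show "At (- 1 - int i) c = \<zero>\<^bsub>Free R (b (- int i))\<^esub>"
            proof (rule vdot_nondegenerate[OF Atc])
              fix w assume w: "w \<in> vecs R (b (- int i))"
              show "vdot R (b (- int i)) w (At (- 1 - int i) c) = \<zero>\<^bsub>R\<^esub>"
                using vdot_comm[OF w Atc] v[OF c w] * w by simp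
            qed
          qed
        qed
        then show ?thesis using key[of _ "Suc i"] by (auto simp: a_kernel_eq)
      qed
    qed (use free_mod th ths in auto)
    show ?thesis unfolding ext_vanishes_def
    proof (intro exI conjI ballI impI)
      show "free_resolution R ?b ?d th ?D" by (rule res)
      obtain m where m: "k = Suc m" using k by (cases k) auto
      fix f assume f: "f \<in> mod_hom R (Free R (b (- int k))) (self_module R)"
        and 0: "\<forall>x \<in> carrier (Free R (b (- int (k + 1)))). f (At (- 1 - int k) x) = \<zero>\<^bsub>self_module R\<^esub>"
      \<comment> \<open>A cocycle is the pairing with a vector \<open>y\<close> that the next map of
        the original complex kills; a preimage \<open>w\<close> of \<open>y\<close> yields the
        required coboundary.\<close>
      obtain y where y: "y \<in> vecs R (b (- int k))"
        "\<And>c. c \<in> vecs R (b (- int k)) \<Longrightarrow> f c = vdot R (b (- int k)) y c"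
        by (rule vdot_repr[OF f]) (rule that)
      have Ak: "A (- 1 - int k) \<in> Lin R (b (- int k)) (b (- int (Suc k)))"
        using T(1)[of "- 1 - int k"] by simp
      have "A (- 1 - int k) y = \<zero>\<^bsub>Free R (b (- int (Suc k)))\<^esub>"
      proof (rule vdot_nondegenerate[OF mod_hom_closed[OF Ak y(1)]])
        fix c assume c: "c \<in> carrier (Free R (b (- int (Suc k))))"
        have Ac: "At (- 1 - int k) c \<in> vecs R (b (- int k))" by (rule mod_hom_closed[OF At' c])
        have "vdot R (b (- int k)) y (At (- 1 - int k) c) = \<zero>\<^bsub>R\<^esub>" using 0 c y(2)[OF Ac] by simp
        then show "vdot R (b (- int (Suc k))) c (A (- 1 - int k) y) = \<zero>\<^bsub>R\<^esub>"
          using vdot_transp[OF Ak c y(1)] vdot_comm[OF Ac y(1)] by (simp add: At_def)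
      qed
      then have "\<exists>w \<in> vecs R (b (1 - int k)). y = A (- int k) w"
        using T(2)[of y "- 1 - int k"] y(1) by auto
      then obtain w where w: "w \<in> vecs R (b (1 - int k))" "y = A (- int k) w" by blast
      have A1: "A (- int k) \<in> Lin R (b (1 - int k)) (b (- int k))"
        using T(1)[of "- int k"] by simp
      have At1: "At (- int k) \<in> Lin R (b (- int k)) (b (1 - int k))"
        using At[of "- int k"] by simp
      have "f c = vdot R (b (1 - int k)) w (At (- int k) c)" if c: "c \<in> vecs R (b (- int k))" for c
      proof -
        have "f c = vdot R (b (- int k)) c (A (- int k) w)" using y(2)[OF c] vdot_comm[OF y(1) c] w(2) by simp
        also have "\<dots> = vdot R (b (1 - int k)) (At (- int k) c) w" using vdot_transp[OF A1 c w(1)] by (simp add: At_def)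
        also have "\<dots> = vdot R (b (1 - int k)) w (At (- int k) c)" by (rule vdot_comm[OF mod_hom_closed[OF At1 c] w(1)])
        finally show ?thesis .
      qed
      moreover have "vdot R (b (1 - int k)) w \<in> mod_hom R (Free R (b (1 - int k))) (self_module R)"
        by (rule vdot_hom_right[OF w(1)])
      ultimately show "\<exists>g \<in> mod_hom R (Free R (b (- int (k - 1)))) (self_module R).
          \<forall>x \<in> vecs R (b (- int k)). f x = g (At (- 1 - int (k - 1)) x)" using m by auto
    qed
  qed
  show ?thesis unfolding totally_reflexive_def using fg bid e1 e2 by blast
qed

subsection \<open>Independence of Ext from the resolution\<close>

lemma free_resolutionD:
  assumes R: "cring R" and M: "module R M" and res: "free_resolution R \<beta> d e M"
  shows "e \<in> mod_hom R (Free R (\<beta> 0)) M" "e ` vecs R (\<beta> 0) = carrier M"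
    "d i \<in> Lin R (\<beta> (Suc i)) (\<beta> i)"
    "d 0 ` vecs R (\<beta> (Suc 0)) = a_kernel (Free R (\<beta> 0)) M e"
    "d (Suc i) ` carrier (Free R (\<beta> (Suc (Suc i)))) =
      a_kernel (Free R (\<beta> (Suc i))) (Free R (\<beta> i)) (d i)"
  using res unfolding free_resolution_def resolution_def by auto

text \<open>The comparison theorem: the identity of \<open>M\<close> is lifted degree by degree,
  using that the source is free and the target exact.\<close>

lemma chain_map_exists:
  assumes R: "cring R" and M: "module R M" and res: "free_resolution R \<beta> d e M"
    and res': "free_resolution R \<beta>' d' e' M"
  obtains f where "\<And>i. f i \<in> Lin R (\<beta> i) (\<beta>' i)"
    "\<And>u. u \<in> vecs R (\<beta> 0) \<Longrightarrow> e' (f 0 u) = e u"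
    "\<And>i u. u \<in> vecs R (\<beta> (Suc i)) \<Longrightarrow> d' i (f (Suc i) u) = f i (d i u)"
proof -
  note FM = Free[OF R] and r = free_resolutionD[OF R M res] and r' = free_resolutionD[OF R M res']
  define Z where "Z i = (case i of 0 \<Rightarrow> a_kernel (Free R (\<beta> 0)) M e
     | Suc j \<Rightarrow> a_kernel (Free R (\<beta> (Suc j))) (Free R (\<beta> j)) (d j))" for i
  define Z' where "Z' i = (case i of 0 \<Rightarrow> a_kernel (Free R (\<beta>' 0)) M e'
     | Suc j \<Rightarrow> a_kernel (Free R (\<beta>' (Suc j))) (Free R (\<beta>' j)) (d' j))" for i
  have Z: "d i ` vecs R (\<beta> (Suc i)) = Z i" for i using r(4,5) by (cases i) (auto simp: Z_def)
  have Z': "d' i ` vecs R (\<beta>' (Suc i)) = Z' i" for i using r'(4,5) by (cases i) (auto simp: Z'_def)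
  \<comment> \<open>Besides linearity the invariant records that cycles go to cycles, which is what
    the next lift requires.\<close>
  define P where "P i g \<longleftrightarrow> g \<in> Lin R (\<beta> i) (\<beta>' i) \<and> g ` Z i \<subseteq> Z' i \<and>
    (i = 0 \<longrightarrow> (\<forall>u \<in> vecs R (\<beta> 0). e' (g u) = e u))" for i g
  define Q where "Q i g g' \<longleftrightarrow> (\<forall>u \<in> vecs R (\<beta> (Suc i)). d' i (g' u) = g (d i u))" for i g g'
  have "\<exists>g. P 0 g"
  proof -
    have "e ` vecs R (\<beta> 0) \<subseteq> e' ` vecs R (\<beta>' 0)" using r(2) r'(2) by simp
    then obtain g where g: "g \<in> Lin R (\<beta> 0) (\<beta>' 0)"
      "\<And>u. u \<in> vecs R (\<beta> 0) \<Longrightarrow> e' (g u) = e u"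
      using free_lift[OF FM M r'(1) r(1)] by blast
    have "g ` Z 0 \<subseteq> Z' 0" using g(2) mod_hom_closed[OF g(1)] by (auto simp: Z_def Z'_def a_kernel_eq)
    then show ?thesis using g unfolding P_def by blast
  qed
  moreover have "\<exists>g'. P (Suc i) g' \<and> Q i g g'" if "P i g" for i g
  proof -
    have g: "g \<in> Lin R (\<beta> i) (\<beta>' i)" "g ` Z i \<subseteq> Z' i"
      using that by (auto simp: P_def)
    have gd: "(\<lambda>u. g (d i u)) \<in> Lin R (\<beta> (Suc i)) (\<beta>' i)"
      by (rule mod_hom_comp[OF r(3) g(1)])
    have "(\<lambda>u. g (d i u)) ` vecs R (\<beta> (Suc i)) \<subseteq> d' i ` vecs R (\<beta>' (Suc i))"
      unfolding Z' using Z[of i] g(2) by blast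
    then obtain g' where g': "g' \<in> Lin R (\<beta> (Suc i)) (\<beta>' (Suc i))"
      "\<And>u. u \<in> vecs R (\<beta> (Suc i)) \<Longrightarrow> d' i (g' u) = g (d i u)"
      using free_lift[OF FM FM r'(3) gd] by blast
    have "g' ` Z (Suc i) \<subseteq> Z' (Suc i)"
      using g'(2) mod_hom_closed[OF g'(1)] mod_hom_zero[OF FM FM g(1)] by (auto simp: Z_def Z'_def a_kernel_eq)
    then show ?thesis using g' unfolding P_def Q_def by blast
  qed
  ultimately obtain f where f: "\<And>i. P i (f i) \<and> Q i (f i) (f (Suc i))"
    using dependent_nat_choice[of P Q] by blast
  show thesis
  proof (rule that)
    show "f i \<in> Lin R (\<beta> i) (\<beta>' i)" for i
      using f[of i] by (simp add: P_def)
    show "e' (f 0 u) = e u" if "u \<in> vecs R (\<beta> 0)" for u using f[of 0] that by (simp add: P_def)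
    show "d' i (f (Suc i) u) = f i (d i u)" if "u \<in> vecs R (\<beta> (Suc i))" for i u
      using f[of i] that by (simp add: Q_def)
  qed
qed

text \<open>A chain endomorphism over the zero map of \<open>M\<close> is null-homotopic; the
  homotopy is again obtained by successive lifts.\<close>

lemma chain_homotopy_exists:
  assumes R: "cring R" and M: "module R M" and res: "free_resolution R \<beta> d e M"
    and f: "\<And>i. f i \<in> Lin R (\<beta> i) (\<beta> i)"
    and f0: "\<And>u. u \<in> vecs R (\<beta> 0) \<Longrightarrow> e (f 0 u) = \<zero>\<^bsub>M\<^esub>"
    and fd: "\<And>i u. u \<in> vecs R (\<beta> (Suc i)) \<Longrightarrow> d i (f (Suc i) u) = f i (d i u)"
  obtains s where "\<And>i. s i \<in> Lin R (\<beta> i) (\<beta> (Suc i))"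
    "\<And>i u. u \<in> vecs R (\<beta> (Suc i)) \<Longrightarrow>
      f (Suc i) u = d (Suc i) (s (Suc i) u) \<oplus>\<^bsub>Free R (\<beta> (Suc i))\<^esub> s i (d i u)"
proof -
  note FM = Free[OF R] and r = free_resolutionD[OF R M res]
  define Z where "Z i = (case i of 0 \<Rightarrow> a_kernel (Free R (\<beta> 0)) M e
     | Suc j \<Rightarrow> a_kernel (Free R (\<beta> (Suc j))) (Free R (\<beta> j)) (d j))" for i
  have Z: "d i ` vecs R (\<beta> (Suc i)) = Z i" for i using r(4,5) by (cases i) (auto simp: Z_def)
  \<comment> \<open>On cycles \<open>f i\<close> must already equal \<open>d i\<close> after
    \<open>s\<close>; then \<open>f (Suc i)\<close> minus \<open>s\<close> after \<open>d i\<close>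
    takes values in cycles and can be lifted.\<close>
  define P where "P i s \<longleftrightarrow> s \<in> Lin R (\<beta> i) (\<beta> (Suc i)) \<and>
    (\<forall>v \<in> Z i. f i v = d i (s v))" for i s
  define Q where "Q i s s' \<longleftrightarrow> (\<forall>u \<in> vecs R (\<beta> (Suc i)).
    f (Suc i) u = d (Suc i) (s' u) \<oplus>\<^bsub>Free R (\<beta> (Suc i))\<^esub> s (d i u))" for i s s'
  have "\<exists>s. P 0 s"
  proof -
    have "f 0 ` vecs R (\<beta> 0) \<subseteq> d 0 ` vecs R (\<beta> (Suc 0))"
      unfolding r(4) using f0 mod_hom_closed[OF f[of 0]] by (auto simp: a_kernel_eq)
    then obtain s where s: "s \<in> Lin R (\<beta> 0) (\<beta> (Suc 0))"
      "\<And>u. u \<in> vecs R (\<beta> 0) \<Longrightarrow> d 0 (s u) = f 0 u"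
      using free_lift[OF FM FM r(3) f] by blast
    then show ?thesis unfolding P_def Z_def by (auto simp: a_kernel_eq)
  qed
  moreover have "\<exists>s'. P (Suc i) s' \<and> Q i s s'" if "P i s" for i s
  proof -
    let ?F = "Free R (\<beta> (Suc i))"
    interpret F: module R ?F by (rule FM)
    have s: "s \<in> mod_hom R (Free R (\<beta> i)) ?F" "\<And>v. v \<in> Z i \<Longrightarrow> f i v = d i (s v)"
      using that by (auto simp: P_def)
    note sd = mod_hom_comp[OF r(3) s(1)]
    define p where "p u = f (Suc i) u \<ominus>\<^bsub>?F\<^esub> s (d i u)" for u
    have p: "p \<in> mod_hom R ?F ?F" unfolding p_def by (rule mod_hom_diff[OF FM f sd])
    have "p ` carrier ?F \<subseteq> d (Suc i) ` carrier (Free R (\<beta> (Suc (Suc i))))" unfolding r(5)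
    proof
      fix y assume "y \<in> p ` carrier ?F"
      then obtain u where u: "u \<in> carrier ?F" "y = p u" by blast
      have "d i u \<in> Z i" using u(1) Z by blast
      then have "d i (f (Suc i) u) = d i (s (d i u))" using fd[OF u(1)] s(2) by simp
      then have "d i (p u) = \<zero>\<^bsub>Free R (\<beta> i)\<^esub>"
        unfolding p_def using mod_hom_eq_iff[OF FM FM r(3) mod_hom_closed[OF f u(1)] mod_hom_closed[OF sd u(1)]] by blast
      then show "y \<in> a_kernel ?F (Free R (\<beta> i)) (d i)"
        using u mod_hom_closed[OF p u(1)] by (simp add: a_kernel_eq)
    qed
    then obtain s' where s': "s' \<in> mod_hom R ?F (Free R (\<beta> (Suc (Suc i))))"
      "\<And>u. u \<in> carrier ?F \<Longrightarrow> d (Suc i) (s' u) = p u"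
      using free_lift[OF FM FM r(3) p] by blast
    have eq: "f (Suc i) u = d (Suc i) (s' u) \<oplus>\<^bsub>?F\<^esub> s (d i u)" if u: "u \<in> carrier ?F" for u
      unfolding s'(2)[OF u] p_def
      using F.add_diff_cancel(2)[OF mod_hom_closed[OF f u] mod_hom_closed[OF sd u]] by simp
    have "f (Suc i) v = d (Suc i) (s' v)" if "v \<in> Z (Suc i)" for v
    proof -
      have v: "v \<in> carrier ?F" "d i v = \<zero>\<^bsub>Free R (\<beta> i)\<^esub>" using that by (auto simp: Z_def a_kernel_eq)
      show ?thesis using eq[OF v(1)] mod_hom_zero[OF FM FM s(1)] v(2)
          mod_hom_closed[OF r(3) mod_hom_closed[OF s'(1) v(1)]] by simp
    qed
    then show ?thesis using s'(1) eq unfolding P_def Q_def by blast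
  qed
  ultimately obtain s where "\<And>i. P i (s i) \<and> Q i (s i) (s (Suc i))"
    using dependent_nat_choice[of P Q] by blast
  then show thesis using that unfolding P_def Q_def by blast
qed

text \<open>\<open>ext_vanishes\<close> speaks of some resolution; this transfers it to a given one.
  With comparison maps f and g, the identity is f g plus a null-homotopic map. For a cocycle c the
  composite c f is a coboundary by hypothesis, and c vanishes on one of the two terms of the
  homotopy.\<close>

lemma ext_vanishes_any_resolution:
  assumes R: "cring R" and M: "module R M" and N: "module R N"
    and ext: "ext_vanishes R (Suc k) M N" and res': "free_resolution R \<beta>' d' e' M"
    and c: "c \<in> mod_hom R (Free R (\<beta>' (Suc k))) N"
    and cd: "\<And>x. x \<in> carrier (Free R (\<beta>' (Suc (Suc k)))) \<Longrightarrow> c (d' (Suc k) x) = \<zero>\<^bsub>N\<^esub>"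
  shows "\<exists>g \<in> mod_hom R (Free R (\<beta>' k)) N. \<forall>x \<in> vecs R (\<beta>' (Suc k)). c x = g (d' k x)"
proof -
  interpret N: module R N by fact
  note FM = Free[OF R] and r' = free_resolutionD[OF R M res']
  obtain \<beta> d e where res: "free_resolution R \<beta> d e M"
    and van: "\<And>f. f \<in> mod_hom R (Free R (\<beta> (Suc k))) N \<Longrightarrow>
      (\<forall>x \<in> carrier (Free R (\<beta> (Suc (Suc k)))). f (d (Suc k) x) = \<zero>\<^bsub>N\<^esub>) \<Longrightarrow>
      \<exists>g \<in> mod_hom R (Free R (\<beta> k)) N. \<forall>x \<in> vecs R (\<beta> (Suc k)). f x = g (d k x)"
    using ext unfolding ext_vanishes_def by auto
  note r = free_resolutionD[OF R M res]
  obtain f where f: "\<And>i. f i \<in> Lin R (\<beta> i) (\<beta>' i)"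
    "\<And>u. u \<in> vecs R (\<beta> 0) \<Longrightarrow> e' (f 0 u) = e u"
    "\<And>i u. u \<in> vecs R (\<beta> (Suc i)) \<Longrightarrow> d' i (f (Suc i) u) = f i (d i u)"
    using chain_map_exists[OF R M res res'] by blast
  obtain g where g: "\<And>i. g i \<in> Lin R (\<beta>' i) (\<beta> i)"
    "\<And>u. u \<in> vecs R (\<beta>' 0) \<Longrightarrow> e (g 0 u) = e' u"
    "\<And>i u. u \<in> vecs R (\<beta>' (Suc i)) \<Longrightarrow> d i (g (Suc i) u) = g i (d' i u)"
    using chain_map_exists[OF R M res' res] by blast
  define h where "h i u = u \<ominus>\<^bsub>Free R (\<beta>' i)\<^esub> f i (g i u)" for i u
  have fg: "(\<lambda>u. f i (g i u)) \<in> Lin R (\<beta>' i) (\<beta>' i)" for i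
    by (rule mod_hom_comp[OF g(1) f(1)])
  have h: "h i \<in> Lin R (\<beta>' i) (\<beta>' i)" for i
    unfolding h_def by (rule mod_hom_diff[OF FM mod_hom_id fg])
  have h0: "e' (h 0 u) = \<zero>\<^bsub>M\<^esub>" if u: "u \<in> vecs R (\<beta>' 0)" for u
    unfolding h_def using mod_hom_eq_iff[OF FM M r'(1) u mod_hom_closed[OF fg u]]
      f(2)[OF mod_hom_closed[OF g(1) u]] g(2)[OF u] by simp
  have hd: "d' i (h (Suc i) u) = h i (d' i u)" if u: "u \<in> vecs R (\<beta>' (Suc i))" for i u
    unfolding h_def mod_hom_minus[OF FM FM r'(3) u mod_hom_closed[OF fg u]]
    using f(3)[OF mod_hom_closed[OF g(1) u]] g(3)[OF u] by simp
  obtain s where s: "\<And>i. s i \<in> Lin R (\<beta>' i) (\<beta>' (Suc i))"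
    "\<And>i u. u \<in> vecs R (\<beta>' (Suc i)) \<Longrightarrow>
      h (Suc i) u = d' (Suc i) (s (Suc i) u) \<oplus>\<^bsub>Free R (\<beta>' (Suc i))\<^esub> s i (d' i u)"
    using chain_homotopy_exists[OF R M res' h h0 hd] by blast
  have "\<exists>w \<in> mod_hom R (Free R (\<beta> k)) N. \<forall>x \<in> vecs R (\<beta> (Suc k)). c (f (Suc k) x) = w (d k x)"
  proof (rule van[OF mod_hom_comp[OF f(1) c]], intro ballI)
    fix x assume x: "x \<in> carrier (Free R (\<beta> (Suc (Suc k))))"
    show "c (f (Suc k) (d (Suc k) x)) = \<zero>\<^bsub>N\<^esub>"
      using f(3)[OF x] cd[OF mod_hom_closed[OF f(1) x]] by simp
  qed
  then obtain w where w: "w \<in> mod_hom R (Free R (\<beta> k)) N"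
    "\<And>x. x \<in> vecs R (\<beta> (Suc k)) \<Longrightarrow> c (f (Suc k) x) = w (d k x)" by blast
  show ?thesis
  proof (rule bexI[OF _ mod_hom_plus[OF N mod_hom_comp[OF g(1) w(1)] mod_hom_comp[OF s(1) c]]], intro ballI)
    fix x assume x: "x \<in> vecs R (\<beta>' (Suc k))"
    let ?F = "Free R (\<beta>' (Suc k))"
    interpret F: module R ?F by (rule FM)
    have fx: "f (Suc k) (g (Suc k) x) \<in> carrier ?F" by (rule mod_hom_closed[OF fg x])
    have dx: "d' k x \<in> vecs R (\<beta>' k)" by (rule mod_hom_closed[OF r'(3) x])
    have sx: "s (Suc k) x \<in> carrier (Free R (\<beta>' (Suc (Suc k))))" by (rule mod_hom_closed[OF s(1) x])
    have "x = f (Suc k) (g (Suc k) x) \<oplus>\<^bsub>?F\<^esub> h (Suc k) x"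
      unfolding h_def using F.add_diff_cancel(1)[OF x fx] by simp
    then have "c x = c (f (Suc k) (g (Suc k) x)) \<oplus>\<^bsub>N\<^esub> c (h (Suc k) x)"
      using mod_hom_add[OF c fx mod_hom_closed[OF h x]] by simp
    also have "c (f (Suc k) (g (Suc k) x)) = w (g k (d' k x))"
      using w(2)[OF mod_hom_closed[OF g(1) x]] g(3)[OF x] by simp
    also have "c (h (Suc k) x) = c (s k (d' k x))"
      unfolding s(2)[OF x] mod_hom_add[OF c mod_hom_closed[OF r'(3) sx] mod_hom_closed[OF s(1) dx]] cd[OF sx]
      using mod_hom_closed[OF c mod_hom_closed[OF s(1) dx]] by simp
    finally show "c x = w (g k (d' k x)) \<oplus>\<^bsub>N\<^esub> c (s k (d' k x))" .
  qed
qed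

text \<open>Splices a resolution of \<open>Y\<close> to the transpose of a resolution of its dual.
  At the joint, injectivity and surjectivity of biduality give exactness; to the left of it the
  complex is a resolution, and to the right exactness is the vanishing of Ext of the dual. For the
  dual complex the roles of \<open>Y\<close> and its dual are interchanged.\<close>

lemma totally_acyclic_of_totally_reflexive:
  assumes R: "cring R" and tr: "totally_reflexive R Y"
  obtains b A p where "totally_acyclic R {\<zero>\<^bsub>R\<^esub>} b A" "p \<in> mod_hom R (Free R (b 1)) Y"
    "p ` vecs R (b 1) = carrier Y"
    "\<And>u. u \<in> vecs R (b 1) \<Longrightarrow> p u = \<zero>\<^bsub>Y\<^esub> \<longleftrightarrow> A 0 u = \<zero>\<^bsub>Free R (b 0)\<^esub>"
proof -
  interpret cring R by fact
  note FM = free_mod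
  have Y: "module R Y" using tr fg_module_module by (auto simp: totally_reflexive_def)
  interpret Y: module R Y by (rule Y)
  let ?D = "dual_module R Y"
  note D = dual_module[OF Y]
  interpret D: module R ?D by (rule D)
  have bid: "biduality R Y \<in> mod_iso R Y (dual_module R ?D)" using tr by (simp add: totally_reflexive_def)
  have e1: "ext_vanishes R (Suc k) Y (self_module R)" "ext_vanishes R (Suc k) ?D (self_module R)" for k
    using tr by (simp_all add: totally_reflexive_def)
  obtain \<beta> d e where F: "free_resolution R \<beta> d e Y" using e1(1)[of 0] unfolding ext_vanishes_def by blast
  obtain \<gamma> c h where G: "free_resolution R \<gamma> c h ?D" using e1(2)[of 0] unfolding ext_vanishes_def by blast
  note f = free_resolutionD[OF R Y F] and g = free_resolutionD[OF R D G]
  have extY: "\<exists>g \<in> mod_hom R (Free R (\<beta> k)) (self_module R). \<forall>x \<in> vecs R (\<beta> (Suc k)). z x = g (d k x)"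
    if "z \<in> mod_hom R (Free R (\<beta> (Suc k))) (self_module R)"
      "\<And>x. x \<in> carrier (Free R (\<beta> (Suc (Suc k)))) \<Longrightarrow> z (d (Suc k) x) = \<zero>\<^bsub>R\<^esub>" for z k
    using ext_vanishes_any_resolution[OF R Y self_mod e1(1) F that(1)] that(2) by simp
  have extD: "\<exists>g \<in> mod_hom R (Free R (\<gamma> k)) (self_module R). \<forall>x \<in> vecs R (\<gamma> (Suc k)). z x = g (c k x)"
    if "z \<in> mod_hom R (Free R (\<gamma> (Suc k))) (self_module R)"
      "\<And>x. x \<in> carrier (Free R (\<gamma> (Suc (Suc k)))) \<Longrightarrow> z (c (Suc k) x) = \<zero>\<^bsub>R\<^esub>" for z k
    using ext_vanishes_any_resolution[OF R D self_mod e1(2) G that(1)] that(2) by simp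
  have ec: "e u \<in> carrier Y" if "u \<in> vecs R (\<beta> 0)" for u by (rule mod_hom_closed[OF f(1) that])
  have ex: "\<exists>u \<in> vecs R (\<beta> 0). x = e u" if "x \<in> carrier Y" for x
  proof -
    have "x \<in> e ` vecs R (\<beta> 0)" using f(2) that by simp
    then show ?thesis by blast
  qed
  have hx: "\<exists>u \<in> vecs R (\<gamma> 0). x = h u" if "x \<in> carrier ?D" for x
  proof -
    have "x \<in> h ` vecs R (\<gamma> 0)" using g(2) that by simp
    then show ?thesis by blast
  qed
  have hc: "h w \<in> carrier ?D" if "w \<in> vecs R (\<gamma> 0)" for w by (rule mod_hom_closed[OF g(1) that])
  \<comment> \<open>The joint: x = e u in \<open>Y\<close> goes to the values at x of the
    functionals that generate the dual. It is the composite of \<open>e\<close>, biduality and the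
    dual of the cover \<open>h\<close>.\<close>
  define A0 where "A0 u = (\<lambda>q\<in>{..<\<gamma> 0}. h (unit_vec R (\<gamma> 0) q) (e u))" for u
  have hh: "h w \<in> mod_hom R Y (self_module R)" if "w \<in> vecs R (\<gamma> 0)" for w
    by (rule dual_moduleD[OF hc[OF that]])
  have hew: "(\<lambda>w. h w x) \<in> mod_hom R (Free R (\<gamma> 0)) (self_module R)" if x: "x \<in> carrier Y" for x
    by (rule mod_homI)
      (use x mod_hom_closed[OF hh x] in \<open>simp_all add: mod_hom_add[OF g(1)] mod_hom_smult[OF g(1)] dual_module_simps\<close>)
  have A0c: "A0 u \<in> vecs R (\<gamma> 0)" if "u \<in> vecs R (\<beta> 0)" for u
    using mod_hom_closed[OF hh[OF unit_vec_closed[OF R]] ec[OF that]] by (simp add: A0_def free_module_simps)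
  have vA0: "vdot R (\<gamma> 0) w (A0 u) = h w (e u)"
    if w: "w \<in> vecs R (\<gamma> 0)" and u: "u \<in> vecs R (\<beta> 0)" for w u
    by (rule free_hom_eqI[OF self_mod vdot_hom_left[OF A0c[OF u]] hew[OF ec[OF u]] _ w])
      (simp add: vdot_unit_vec[OF _ A0c[OF u]], simp add: A0_def)
  have A0: "A0 \<in> Lin R (\<beta> 0) (\<gamma> 0)"
  proof (rule mod_homI[OF A0c])
    fix x y assume x: "x \<in> vecs R (\<beta> 0)" and y: "y \<in> vecs R (\<beta> 0)"
    show "A0 (x \<oplus>\<^bsub>Free R (\<beta> 0)\<^esub> y) = A0 x \<oplus>\<^bsub>Free R (\<gamma> 0)\<^esub> A0 y"
      using mod_hom_add[OF hh[OF unit_vec_closed[OF R]] ec[OF x] ec[OF y]]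
      unfolding A0_def mod_hom_add[OF f(1) x y] by (auto simp: free_module_simps fun_eq_iff)
  next
    fix r x assume r: "r \<in> carrier R" and x: "x \<in> vecs R (\<beta> 0)"
    show "A0 (r \<odot>\<^bsub>Free R (\<beta> 0)\<^esub> x) = r \<odot>\<^bsub>Free R (\<gamma> 0)\<^esub> A0 x"
      using mod_hom_smult[OF hh[OF unit_vec_closed[OF R]] r ec[OF x]]
      unfolding A0_def mod_hom_smult[OF f(1) r x] by (auto simp: free_module_simps fun_eq_iff)
  qed
  have A00: "A0 u = \<zero>\<^bsub>Free R (\<gamma> 0)\<^esub> \<longleftrightarrow> e u = \<zero>\<^bsub>Y\<^esub>" if u: "u \<in> vecs R (\<beta> 0)" for u
  proof
    assume 0: "A0 u = \<zero>\<^bsub>Free R (\<gamma> 0)\<^esub>"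
    have DD: "module R (dual_module R ?D)" by (rule dual_module[OF D])
    interpret DD: module R "dual_module R ?D" by (rule DD)
    have "biduality R Y (e u) = \<zero>\<^bsub>dual_module R ?D\<^esub>"
    proof (rule dual_module_eqI[OF mod_hom_closed[OF biduality_hom[OF Y] ec[OF u]] DD.M.zero_closed])
      fix x assume x: "x \<in> carrier ?D"
      obtain w where w: "w \<in> vecs R (\<gamma> 0)" "x = h w" using hx[OF x] by blast
      have "x (e u) = \<zero>\<^bsub>R\<^esub>" using vA0[OF w(1) u] 0 w(2) mod_hom_zero[OF FM self_mod vdot_hom_right[OF w(1)]] by simp
      then show "biduality R Y (e u) x = \<zero>\<^bsub>dual_module R ?D\<^esub> x" using x by (simp add: biduality_def dual_module_simps)
    qed
    then show "e u = \<zero>\<^bsub>Y\<^esub>"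
      using mod_isoD(2)[OF bid] ec[OF u] unfolding inj_on_iff_kernel[OF Y DD biduality_hom[OF Y]] by blast
  next
    assume "e u = \<zero>\<^bsub>Y\<^esub>"
    then show "A0 u = \<zero>\<^bsub>Free R (\<gamma> 0)\<^esub>"
      using mod_hom_zero[OF Y self_mod hh[OF unit_vec_closed[OF R]]] by (auto simp: A0_def free_module_simps fun_eq_iff)
  qed
  define B where "B k = transp R (\<gamma> (Suc k)) (\<gamma> k) (c k)" for k
  have B: "B k \<in> Lin R (\<gamma> k) (\<gamma> (Suc k))" for k
    unfolding B_def by (rule transp_hom[OF g(3)])
  have vB: "vdot R (\<gamma> (Suc k)) (B k y) w = vdot R (\<gamma> k) y (c k w)"
    if "y \<in> vecs R (\<gamma> k)" "w \<in> vecs R (\<gamma> (Suc k))" for k y w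
    unfolding B_def by (rule vdot_transp[OF g(3) that])
  have B0: "B k y = \<zero>\<^bsub>Free R (\<gamma> (Suc k))\<^esub> \<longleftrightarrow>
      (\<forall>w \<in> vecs R (\<gamma> (Suc k)). vdot R (\<gamma> k) y (c k w) = \<zero>\<^bsub>R\<^esub>)"
    if y: "y \<in> vecs R (\<gamma> k)" for k y
  proof
    assume "B k y = \<zero>\<^bsub>Free R (\<gamma> (Suc k))\<^esub>"
    then show "\<forall>w \<in> vecs R (\<gamma> (Suc k)). vdot R (\<gamma> k) y (c k w) = \<zero>\<^bsub>R\<^esub>"
      using vB[OF y, symmetric] mod_hom_zero[OF FM self_mod vdot_hom_left] by simp
  next
    assume *: "\<forall>w \<in> vecs R (\<gamma> (Suc k)). vdot R (\<gamma> k) y (c k w) = \<zero>\<^bsub>R\<^esub>"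
    note By = mod_hom_closed[OF B y]
    show "B k y = \<zero>\<^bsub>Free R (\<gamma> (Suc k))\<^esub>"
      by (rule vdot_nondegenerate[OF By]) (use * vdot_comm[OF _ By] vB[OF y] in simp)
  qed
  have vcB: "vdot R (\<gamma> k) (c k w) z = vdot R (\<gamma> (Suc k)) w (B k z)"
    if w: "w \<in> vecs R (\<gamma> (Suc k))" and z: "z \<in> vecs R (\<gamma> k)" for k w z
    using vB[OF z w] vdot_comm[OF z mod_hom_closed[OF g(3) w]] vdot_comm[OF mod_hom_closed[OF B z] w] by simp
  have exF: "u \<in> vecs R (\<beta> (Suc n)) \<Longrightarrow> d n u = \<zero>\<^bsub>Free R (\<beta> n)\<^esub> \<longleftrightarrow>
      (\<exists>w \<in> carrier (Free R (\<beta> (Suc (Suc n)))). u = d (Suc n) w)" for n u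
    using f(5)[of n] by (auto simp: a_kernel_eq set_eq_iff image_iff)
  have exF0: "u \<in> vecs R (\<beta> 0) \<Longrightarrow> e u = \<zero>\<^bsub>Y\<^esub> \<longleftrightarrow>
      (\<exists>w \<in> vecs R (\<beta> (Suc 0)). u = d 0 w)" for u
    using f(4) by (auto simp: a_kernel_eq set_eq_iff image_iff)
  have exG: "u \<in> vecs R (\<gamma> (Suc n)) \<Longrightarrow> c n u = \<zero>\<^bsub>Free R (\<gamma> n)\<^esub> \<longleftrightarrow>
      (\<exists>w \<in> carrier (Free R (\<gamma> (Suc (Suc n)))). u = c (Suc n) w)" for n u
    using g(5)[of n] by (auto simp: a_kernel_eq set_eq_iff image_iff)
  have exG0: "u \<in> vecs R (\<gamma> 0) \<Longrightarrow> h u = \<zero>\<^bsub>?D\<^esub> \<longleftrightarrow>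
      (\<exists>w \<in> vecs R (\<gamma> (Suc 0)). u = c 0 w)" for u
    using g(4) by (auto simp: a_kernel_eq set_eq_iff image_iff)
  \<comment> \<open>R^(b 1) covers \<open>Y\<close>, R^(b 0) is the dual of the cover of the dual,
    and \<open>A 0\<close> is the joint; the two resolutions occupy the indices from 1 up and from 0
    down.\<close>
  define b where "b i = (if i \<ge> 1 then \<beta> (nat (i - 1)) else \<gamma> (nat (- i)))" for i :: int
  define A where "A i = (if i \<ge> 1 then d (nat (i - 1)) else if i = 0 then A0 else B (nat (- i - 1)))" for i :: int
  have cases: "(\<exists>n. i = int n + 1) \<or> i = 0 \<or> i = - 1 \<or> (\<exists>k. i = - int k - 2)" for i :: int
  proof -
    consider "i \<ge> 1" | "i = 0" | "i = - 1" | "i \<le> - 2" by linarith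
    then show ?thesis
    proof cases
      case 1 then have "i = int (nat (i - 1)) + 1" by simp
      then show ?thesis by blast
    next
      case 4 then have "i = - int (nat (- i - 2)) - 2" by simp
      then show ?thesis by blast
    qed auto
  qed
  have n1: "nat (1 + int n) = Suc n" "nat (2 + int n) = Suc (Suc n)" for n by linarith+
  have bs: "b (int n + 1) = \<beta> n" "b (int n + 1 + 1) = \<beta> (Suc n)" "b (int n + 1 + 1 + 1) = \<beta> (Suc (Suc n))"
    "b 0 = \<gamma> 0" "b (0 + 1) = \<beta> 0" "b (0 + 1 + 1) = \<beta> (Suc 0)" "b (- 1) = \<gamma> (Suc 0)" "b (- 1 + 1) = \<gamma> 0" "b (- 1 + 1 + 1) = \<beta> 0"
    "b (- int n - 2) = \<gamma> (Suc (Suc n))" "b (- int n - 2 + 1) = \<gamma> (Suc n)" "b (- int n - 2 + 1 + 1) = \<gamma> n" for n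
    by (auto simp: b_def n1 algebra_simps nat_add_distrib)
  have As: "A (int n + 1) = d n" "A (int n + 1 + 1) = d (Suc n)" "A 0 = A0" "A (0 + 1) = d 0" "A (- 1) = B 0" "A (- 1 + 1) = A0"
    "A (- int n - 2) = B (Suc n)" "A (- int n - 2 + 1) = B n" for n
    by (auto simp: A_def n1 algebra_simps nat_add_distrib)
  \<comment> \<open>Surjectivity of biduality: a vector killed by \<open>B 0\<close> defines a
    functional on the dual, hence evaluation at some element of \<open>Y\<close>.\<close>
  have exm1: "B 0 y = \<zero>\<^bsub>Free R (\<gamma> (Suc 0))\<^esub> \<longleftrightarrow> (\<exists>u \<in> vecs R (\<beta> 0). y = A0 u)"
    if y: "y \<in> vecs R (\<gamma> 0)" for y
  proof
    assume 0: "B 0 y = \<zero>\<^bsub>Free R (\<gamma> (Suc 0))\<^esub>"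
    have k: "vdot R (\<gamma> 0) y w = \<zero>\<^bsub>self_module R\<^esub>" if "w \<in> vecs R (\<gamma> 0)" "h w = \<zero>\<^bsub>?D\<^esub>" for w
      using exG0[OF that(1)] that(2) 0 B0[OF y] by auto
    obtain ph where ph: "ph \<in> mod_hom R ?D (self_module R)"
      "\<And>w. w \<in> vecs R (\<gamma> 0) \<Longrightarrow> ph (h w) = vdot R (\<gamma> 0) y w"
      using mod_hom_factor_surj[OF FM D self_mod g(1,2) vdot_hom_right[OF y] k] by blast
    have "restrict ph (carrier ?D) \<in> biduality R Y ` carrier Y"
      using dual_module_restrict[OF D ph(1)] mod_isoD(3)[OF bid] by simp
    then obtain x where x: "x \<in> carrier Y" "restrict ph (carrier ?D) = biduality R Y x" by blast
    obtain u where u: "u \<in> vecs R (\<beta> 0)" "x = e u" using ex[OF x(1)] by blast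
    have "y = A0 u"
    proof (rule vdot_eqI[OF y A0c[OF u(1)]])
      fix w assume w: "w \<in> vecs R (\<gamma> 0)"
      have "restrict ph (carrier ?D) (h w) = biduality R Y x (h w)" using x(2) by simp
      then have "ph (h w) = h w x" using hc[OF w] by (simp add: biduality_def)
      then show "vdot R (\<gamma> 0) y w = vdot R (\<gamma> 0) (A0 u) w"
        using ph(2)[OF w] vA0[OF w u(1)] u(2) vdot_comm[OF w A0c[OF u(1)]] by simp
    qed
    then show "\<exists>u \<in> vecs R (\<beta> 0). y = A0 u" using u(1) by blast
  next
    assume "\<exists>u \<in> vecs R (\<beta> 0). y = A0 u"
    then obtain u where u: "u \<in> vecs R (\<beta> 0)" "y = A0 u" by blast
    show "B 0 y = \<zero>\<^bsub>Free R (\<gamma> (Suc 0))\<^esub>" unfolding B0[OF y]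
    proof
      fix w assume w: "w \<in> vecs R (\<gamma> (Suc 0))"
      have cw: "c 0 w \<in> vecs R (\<gamma> 0)" by (rule mod_hom_closed[OF g(3) w])
      have "h (c 0 w) = \<zero>\<^bsub>?D\<^esub>" using exG0[OF cw] w by blast
      then have "h (c 0 w) (e u) = \<zero>\<^bsub>R\<^esub>" using ec[OF u(1)] by (simp add: dual_module_simps)
      then show "vdot R (\<gamma> 0) y (c 0 w) = \<zero>\<^bsub>R\<^esub>" using vA0[OF cw u(1)] vdot_comm[OF y cw] u(2) by simp
    qed
  qed
  \<comment> \<open>Vanishing of the Ext groups of the dual, rewritten for transposes.\<close>
  have exm2: "B (Suc k) y = \<zero>\<^bsub>Free R (\<gamma> (Suc (Suc k)))\<^esub> \<longleftrightarrow> (\<exists>z \<in> vecs R (\<gamma> k). y = B k z)"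
    if y: "y \<in> vecs R (\<gamma> (Suc k))" for y k
  proof
    assume "B (Suc k) y = \<zero>\<^bsub>Free R (\<gamma> (Suc (Suc k)))\<^esub>"
    then obtain q where q: "q \<in> mod_hom R (Free R (\<gamma> k)) (self_module R)"
      "\<And>x. x \<in> vecs R (\<gamma> (Suc k)) \<Longrightarrow> vdot R (\<gamma> (Suc k)) y x = q (c k x)"
      using extD[OF vdot_hom_right[OF y]] B0[OF y] by blast
    obtain z where z: "z \<in> vecs R (\<gamma> k)"
      "\<And>v. v \<in> vecs R (\<gamma> k) \<Longrightarrow> q v = vdot R (\<gamma> k) z v"
      by (rule vdot_repr[OF q(1)]) (rule that)
    have "y = B k z" by (rule vdot_eqI[OF y mod_hom_closed[OF B z(1)]])
        (simp add: q(2) z(2) vB[OF z(1)] mod_hom_closed[OF g(3)])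
    then show "\<exists>z \<in> vecs R (\<gamma> k). y = B k z" using z(1) by blast
  next
    assume "\<exists>z \<in> vecs R (\<gamma> k). y = B k z"
    then obtain z where z: "z \<in> vecs R (\<gamma> k)" "y = B k z" by blast
    show "B (Suc k) y = \<zero>\<^bsub>Free R (\<gamma> (Suc (Suc k)))\<^esub>" unfolding B0[OF y]
    proof
      fix w assume w: "w \<in> carrier (Free R (\<gamma> (Suc (Suc k))))"
      have cw: "c (Suc k) w \<in> vecs R (\<gamma> (Suc k))" by (rule mod_hom_closed[OF g(3) w])
      have "c k (c (Suc k) w) = \<zero>\<^bsub>Free R (\<gamma> k)\<^esub>" using exG[OF cw] w by blast
      then show "vdot R (\<gamma> (Suc k)) y (c (Suc k) w) = \<zero>\<^bsub>R\<^esub>"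
        using vB[OF z(1) cw] z(2) mod_hom_zero[OF FM self_mod vdot_hom_right[OF z(1)]] by simp
    qed
  qed
  \<comment> \<open>A functional on R^(b 1) that kills the relations descends to \<open>Y\<close>,
    and \<open>h\<close> reaches every functional on \<open>Y\<close>.\<close>
  have du0: "\<exists>q \<in> mod_hom R (Free R (\<gamma> 0)) (self_module R). \<forall>u \<in> vecs R (\<beta> 0). z u = q (A0 u)"
    if z: "z \<in> mod_hom R (Free R (\<beta> 0)) (self_module R)"
      and zd: "\<And>w. w \<in> vecs R (\<beta> (Suc 0)) \<Longrightarrow> z (d 0 w) = \<zero>\<^bsub>R\<^esub>" for z
  proof -
    have k: "z u = \<zero>\<^bsub>self_module R\<^esub>" if "u \<in> vecs R (\<beta> 0)" "e u = \<zero>\<^bsub>Y\<^esub>" for u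
      using exF0[OF that(1)] that(2) zd by auto
    obtain q where q: "q \<in> mod_hom R Y (self_module R)"
      "\<And>u. u \<in> vecs R (\<beta> 0) \<Longrightarrow> q (e u) = z u"
      using mod_hom_factor_surj[OF FM Y self_mod f(1,2) z k] by blast
    obtain w where w: "w \<in> vecs R (\<gamma> 0)" "restrict q (carrier Y) = h w"
      using hx[OF dual_module_restrict[OF Y q(1)]] by blast
    have "z u = vdot R (\<gamma> 0) w (A0 u)" if u: "u \<in> vecs R (\<beta> 0)" for u
    proof -
      have "h w (e u) = q (e u)" using w(2)[symmetric] ec[OF u] by simp
      then show ?thesis using vA0[OF w(1) u] q(2)[OF u] by simp
    qed
    then show ?thesis using vdot_hom_right[OF w(1)] by blast
  qed
  \<comment> \<open>A functional on R^(b 0) killing the image of \<open>A0\<close> is the pairing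
    with a relation among the generators of the dual; relations come from \<open>c 0\<close>. Below
    this position the exactness of the resolution of the dual is used in the same way.\<close>
  have du1: "\<exists>q \<in> mod_hom R (Free R (\<gamma> (Suc 0))) (self_module R). \<forall>u \<in> vecs R (\<gamma> 0). z u = q (B 0 u)"
    if z: "z \<in> mod_hom R (Free R (\<gamma> 0)) (self_module R)"
      and zd: "\<And>u. u \<in> vecs R (\<beta> 0) \<Longrightarrow> z (A0 u) = \<zero>\<^bsub>R\<^esub>" for z
  proof -
    obtain y where y: "y \<in> vecs R (\<gamma> 0)"
      "\<And>v. v \<in> vecs R (\<gamma> 0) \<Longrightarrow> z v = vdot R (\<gamma> 0) y v"
      by (rule vdot_repr[OF z]) (rule that)
    have "h y = \<zero>\<^bsub>?D\<^esub>"
    proof (rule dual_module_eqI[OF hc[OF y(1)] D.M.zero_closed])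
      fix x assume x: "x \<in> carrier Y"
      obtain u where u: "u \<in> vecs R (\<beta> 0)" "x = e u" using ex[OF x] by blast
      have "h y x = z (A0 u)" using vA0[OF y(1) u(1)] y(2)[OF A0c[OF u(1)]] u(2) by simp
      then show "h y x = \<zero>\<^bsub>?D\<^esub> x" using zd[OF u(1)] x by (simp add: dual_module_simps)
    qed
    then obtain w where w: "w \<in> vecs R (\<gamma> (Suc 0))" "y = c 0 w" using exG0[OF y(1)] by blast
    show ?thesis using vdot_hom_right[OF w(1)] vcB[OF w(1)] y(2) w(2) by auto
  qed
  have du2: "\<exists>q \<in> mod_hom R (Free R (\<gamma> (Suc (Suc k)))) (self_module R).
      \<forall>u \<in> vecs R (\<gamma> (Suc k)). z u = q (B (Suc k) u)"
    if z: "z \<in> mod_hom R (Free R (\<gamma> (Suc k))) (self_module R)"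
      and zd: "\<And>u. u \<in> vecs R (\<gamma> k) \<Longrightarrow> z (B k u) = \<zero>\<^bsub>R\<^esub>" for z k
  proof -
    obtain y where y: "y \<in> vecs R (\<gamma> (Suc k))"
      "\<And>v. v \<in> vecs R (\<gamma> (Suc k)) \<Longrightarrow> z v = vdot R (\<gamma> (Suc k)) y v"
      by (rule vdot_repr[OF z]) (rule that)
    have cy: "c k y \<in> vecs R (\<gamma> k)" by (rule mod_hom_closed[OF g(3) y(1)])
    have "c k y = \<zero>\<^bsub>Free R (\<gamma> k)\<^esub>"
    proof (rule vdot_nondegenerate[OF cy])
      fix u assume u: "u \<in> vecs R (\<gamma> k)"
      have "vdot R (\<gamma> k) u (c k y) = z (B k u)"
        using vcB[OF y(1) u] y(2)[OF mod_hom_closed[OF B u]] vdot_comm[OF u cy] by simp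
      then show "vdot R (\<gamma> k) u (c k y) = \<zero>\<^bsub>R\<^esub>" using zd[OF u] by simp
    qed
    then obtain w where w: "w \<in> carrier (Free R (\<gamma> (Suc (Suc k))))" "y = c (Suc k) w" using exG[OF y(1)] by blast
    show ?thesis using vdot_hom_right[OF w(1)] vcB[OF w(1)] y(2) w(2) by auto
  qed
  have "totally_acyclic R {\<zero>\<^bsub>R\<^esub>} b A" unfolding totally_acyclic_zero_iff[OF R]
  proof (intro conjI allI)
    fix i
    show "A i \<in> Lin R (b (i + 1)) (b i)"
      using cases[of i] by (elim disjE exE; hypsubst; unfold bs As) (rule f(3) A0 B)+
    show "\<forall>u \<in> vecs R (b (i + 1)). A i u = \<zero>\<^bsub>Free R (b i)\<^esub> \<longleftrightarrow>
        (\<exists>w \<in> vecs R (b (i + 1 + 1)). u = A (i + 1) w)"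
    proof (intro ballI)
      fix u assume "u \<in> vecs R (b (i + 1))"
      then show "A i u = \<zero>\<^bsub>Free R (b i)\<^esub> \<longleftrightarrow> (\<exists>w \<in> vecs R (b (i + 1 + 1)). u = A (i + 1) w)"
        using cases[of i]
      proof (elim disjE exE)
        assume "u \<in> vecs R (b (i + 1))" "i = 0"
        then show ?thesis unfolding \<open>i = 0\<close> bs As using A00 exF0 by blast
      next
        fix n assume "u \<in> vecs R (b (i + 1))" "i = int n + 1"
        then show ?thesis unfolding \<open>i = int n + 1\<close> bs As using exF by blast
      next
        assume "u \<in> vecs R (b (i + 1))" "i = - 1"
        then show ?thesis unfolding \<open>i = - 1\<close> bs As using exm1 by blast
      next
        fix k assume "u \<in> vecs R (b (i + 1))" "i = - int k - 2"
        then show ?thesis unfolding \<open>i = - int k - 2\<close> bs As using exm2 by blast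
      qed
    qed
    show "\<forall>z \<in> mod_hom R (Free R (b (i + 1))) (self_module R).
        (\<forall>w \<in> vecs R (b (i + 1 + 1)). z (A (i + 1) w) = \<zero>\<^bsub>R\<^esub>) \<longrightarrow>
        (\<exists>g \<in> mod_hom R (Free R (b i)) (self_module R). \<forall>u \<in> vecs R (b (i + 1)). z u = g (A i u))"
    proof (intro ballI impI)
      fix z assume "z \<in> mod_hom R (Free R (b (i + 1))) (self_module R)"
        "\<forall>w \<in> vecs R (b (i + 1 + 1)). z (A (i + 1) w) = \<zero>\<^bsub>R\<^esub>"
      then show "\<exists>g \<in> mod_hom R (Free R (b i)) (self_module R). \<forall>u \<in> vecs R (b (i + 1)). z u = g (A i u)"
        using cases[of i]
      proof (elim disjE exE)
        assume z: "z \<in> mod_hom R (Free R (b (i + 1))) (self_module R)"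
        "\<forall>w \<in> vecs R (b (i + 1 + 1)). z (A (i + 1) w) = \<zero>\<^bsub>R\<^esub>" and i: "i = 0"
        show ?thesis using z unfolding i bs As using du0 by blast
      next
        fix n assume z: "z \<in> mod_hom R (Free R (b (i + 1))) (self_module R)"
        "\<forall>w \<in> vecs R (b (i + 1 + 1)). z (A (i + 1) w) = \<zero>\<^bsub>R\<^esub>" and i: "i = int n + 1"
        show ?thesis using z unfolding i bs As using extY by blast
      next
        assume z: "z \<in> mod_hom R (Free R (b (i + 1))) (self_module R)"
        "\<forall>w \<in> vecs R (b (i + 1 + 1)). z (A (i + 1) w) = \<zero>\<^bsub>R\<^esub>" and i: "i = - 1"
        show ?thesis using z unfolding i bs As using du1 by blast
      next
        fix k assume z: "z \<in> mod_hom R (Free R (b (i + 1))) (self_module R)"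
        "\<forall>w \<in> vecs R (b (i + 1 + 1)). z (A (i + 1) w) = \<zero>\<^bsub>R\<^esub>" and i: "i = - int k - 2"
        show ?thesis using z unfolding i bs As using du2 by blast
      qed
    qed
  qed
  moreover have "b 1 = \<beta> 0" "b 0 = \<gamma> 0" using bs(5) bs(4) by simp_all
  ultimately show thesis using that[of b A e] f(1,2) A00 As(3) by simp
qed

subsection \<open>Quotient rings and restriction of scalars\<close>

definition vec_class :: "('a, 'r) ring_scheme \<Rightarrow> 'a set \<Rightarrow> nat \<Rightarrow> (nat \<Rightarrow> 'a) \<Rightarrow> nat \<Rightarrow> 'a set" where
  "vec_class R I n u = (\<lambda>i\<in>{..<n}. I +>\<^bsub>R\<^esub> u i)"

text \<open>An R/I-module viewed over R; carrier and addition are untouched, so exactness statements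
  transfer literally.\<close>

definition restrict_scalars ::
  "('a, 'r) ring_scheme \<Rightarrow> 'a set \<Rightarrow> ('a set, 'b, 'm) module_scheme \<Rightarrow> ('a, 'b) module"
where
  "restrict_scalars R I M = \<lparr>carrier = carrier M, monoid.mult = undefined, one = undefined,
     ring.zero = \<zero>\<^bsub>M\<^esub>, ring.add = (\<oplus>\<^bsub>M\<^esub>), smult = (\<lambda>r x. (I +>\<^bsub>R\<^esub> r) \<odot>\<^bsub>M\<^esub> x)\<rparr>"

lemma restrict_scalars_simps [simp]:
  "carrier (restrict_scalars R I M) = carrier M" "\<zero>\<^bsub>restrict_scalars R I M\<^esub> = \<zero>\<^bsub>M\<^esub>"
  "x \<oplus>\<^bsub>restrict_scalars R I M\<^esub> y = x \<oplus>\<^bsub>M\<^esub> y"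
  "r \<odot>\<^bsub>restrict_scalars R I M\<^esub> x = (I +>\<^bsub>R\<^esub> r) \<odot>\<^bsub>M\<^esub> x"
  by (simp_all add: restrict_scalars_def)

lemma restrict_scalars_sub:
  "restrict_scalars R I (M\<lparr>carrier := U\<rparr>) = (restrict_scalars R I M)\<lparr>carrier := U\<rparr>"
  by (simp add: restrict_scalars_def)

locale ring_quotient =
  fixes R :: "('a, 'r) ring_scheme" and I :: "'a set" and S :: "'a set ring"
  assumes R: "cring R" and I: "ideal I R" and S_def: "S = R Quot I"
begin

sublocale R: cring R by (rule R)
sublocale I: ideal I R by (rule I)

lemma S: "cring S" unfolding S_def by (rule I.quotient_is_cring[OF R])

sublocale S: cring S by (rule S)

abbreviation cl :: "'a \<Rightarrow> 'a set" where "cl x \<equiv> I +>\<^bsub>R\<^esub> x"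
abbreviation "vc \<equiv> vec_class R I"
abbreviation "rs \<equiv> restrict_scalars R I"

lemma cl_hom: "cl \<in> ring_hom R S" unfolding S_def by (rule I.rcos_ring_hom)

lemma cl_closed: "x \<in> carrier R \<Longrightarrow> cl x \<in> carrier S"
  and cl_add: "x \<in> carrier R \<Longrightarrow> y \<in> carrier R \<Longrightarrow> cl (x \<oplus>\<^bsub>R\<^esub> y) = cl x \<oplus>\<^bsub>S\<^esub> cl y"
  and cl_mult: "x \<in> carrier R \<Longrightarrow> y \<in> carrier R \<Longrightarrow> cl (x \<otimes>\<^bsub>R\<^esub> y) = cl x \<otimes>\<^bsub>S\<^esub> cl y"
  and cl_one: "cl \<one>\<^bsub>R\<^esub> = \<one>\<^bsub>S\<^esub>"
  using cl_hom by (auto simp: ring_hom_def)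

lemma cl_surj: "cl ` carrier R = carrier S"
  unfolding S_def by (auto simp: FactRing_def A_RCOSETS_def' a_r_coset_def')

lemma zero_S: "\<zero>\<^bsub>S\<^esub> = I" by (simp add: S_def FactRing_def)

lemma cl_eq_zero_iff: "x \<in> carrier R \<Longrightarrow> cl x = \<zero>\<^bsub>S\<^esub> \<longleftrightarrow> x \<in> I"
  unfolding zero_S using R.a_coset_join1[OF _ _ I.a_subgroup] R.a_coset_join2[OF _ I.a_subgroup] by blast

lemma cl_preimage:
  assumes "s \<in> carrier S" obtains r where "r \<in> carrier R" "s = cl r" using assms cl_surj by blast

lemma restrict_scalars_module:
  assumes "module S M" shows "module R (rs M)"
proof -
  interpret M: module S M by fact
  show ?thesis
  proof (rule moduleI[OF R])
    show "abelian_group (rs M)"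
    proof (rule abelian_groupI)
      fix x assume "x \<in> carrier (rs M)"
      then show "\<exists>y \<in> carrier (rs M). y \<oplus>\<^bsub>rs M\<^esub> x = \<zero>\<^bsub>rs M\<^esub>"
        using M.M.l_neg M.M.a_inv_closed by auto
    qed (auto simp: M.M.a_ac)
  qed (auto simp: cl_closed cl_add cl_mult cl_one M.smult_l_distr M.smult_r_distr M.smult_assoc1)
qed

text \<open>Since R maps onto S, every R-linear map between S-modules is S-linear. The two sets of
  homomorphisms are equal, and nothing has to be converted.\<close>

lemma restrict_scalars_hom: "mod_hom R (rs M) (rs N) = mod_hom S M N"
proof -
  have "(\<forall>r \<in> carrier R. \<forall>x \<in> carrier M. h (cl r \<odot>\<^bsub>M\<^esub> x) = cl r \<odot>\<^bsub>N\<^esub> h x) \<longleftrightarrow>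
      (\<forall>s \<in> carrier S. \<forall>x \<in> carrier M. h (s \<odot>\<^bsub>M\<^esub> x) = s \<odot>\<^bsub>N\<^esub> h x)" for h
    unfolding cl_surj[symmetric] by blast
  then show ?thesis by (simp add: mod_hom_def)
qed

lemma a_kernel_restrict_scalars: "a_kernel (rs A) (rs B) f = a_kernel A B f"
  by (simp add: a_kernel_eq)

lemma short_exact_restrict_scalars: "short_exact S A B C \<Longrightarrow> short_exact R (rs A) (rs B) (rs C)"
  by (simp add: short_exact_def restrict_scalars_hom a_kernel_restrict_scalars)

lemma vec_class_hom: "vc n \<in> mod_hom R (Free R n) (rs (Free S n))"
  by (rule mod_homI)
    (auto simp: vec_class_def free_module_simps fun_eq_iff cl_closed cl_add cl_mult PiE_iff)

lemma vec_class_surj: "vc n ` vecs R n = vecs S n"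
proof
  show "vc n ` vecs R n \<subseteq> vecs S n" using mod_hom_closed[OF vec_class_hom] by auto
  show "vecs S n \<subseteq> vc n ` vecs R n"
  proof
    fix y assume y: "y \<in> vecs S n"
    have "\<forall>i. i < n \<longrightarrow> (\<exists>r. r \<in> carrier R \<and> y i = cl r)"
      using free_module_coord[OF y] cl_preimage by metis
    then obtain u where u: "\<And>i. i < n \<Longrightarrow> u i \<in> carrier R" "\<And>i. i < n \<Longrightarrow> y i = cl (u i)" by metis
    have "restrict u {..<n} \<in> vecs R n" using u by (simp add: free_module_simps)
    moreover have "vc n (restrict u {..<n}) = y"
    proof (rule free_module_ext[OF _ y])
      show "vc n (restrict u {..<n}) \<in> vecs S n"
        using mod_hom_closed[OF vec_class_hom calculation] by simp
    qed (simp add: vec_class_def u)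
    ultimately show "y \<in> vc n ` vecs R n" by blast
  qed
qed

lemma vec_class_closed: "u \<in> vecs R n \<Longrightarrow> vc n u \<in> vecs S n"
  using mod_hom_closed[OF vec_class_hom] by simp

lemma vec_class_preimage:
  assumes "v \<in> vecs S n" obtains u where "u \<in> vecs R n" "v = vc n u"
  using assms vec_class_surj by blast

lemma vec_class_eq_zero_iff:
  assumes u: "u \<in> vecs R n"
  shows "vc n u = \<zero>\<^bsub>Free S n\<^esub> \<longleftrightarrow> u \<in> ideal_vecs I n"
proof -
  interpret F: module S "Free S n" by (rule Free[OF S])
  have "vc n u = \<zero>\<^bsub>Free S n\<^esub> \<longleftrightarrow> (\<forall>i<n. cl (u i) = \<zero>\<^bsub>S\<^esub>)"
    by (auto simp: vec_class_def free_module_simps fun_eq_iff)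
  then show ?thesis
    using cl_eq_zero_iff free_module_coord[OF u] ideal_vecs_iff[OF ideal_facts(1)[OF I] u] by auto
qed

lemma vec_class_eq_iff:
  assumes "u \<in> vecs R n" "v \<in> vecs R n"
  shows "vc n u = vc n v \<longleftrightarrow> u \<ominus>\<^bsub>Free R n\<^esub> v \<in> ideal_vecs I n"
proof -
  interpret F: module R "Free R n" by (rule Free[OF R])
  show ?thesis
    using mod_hom_eq_iff[OF F.module_axioms restrict_scalars_module[OF Free[OF S]] vec_class_hom assms]
      vec_class_eq_zero_iff[of "u \<ominus>\<^bsub>Free R n\<^esub> v" n] assms by simp
qed

lemma cl_mod_hom: "cl \<in> mod_hom R (self_module R) (rs (self_module S))"
  by (rule mod_homI) (auto simp: cl_closed cl_add cl_mult)

lemma cl_eq_iff: "x \<in> carrier R \<Longrightarrow> y \<in> carrier R \<Longrightarrow> cl x = cl y \<longleftrightarrow> x \<ominus>\<^bsub>R\<^esub> y \<in> I"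
  using mod_hom_eq_iff[OF R.self_mod restrict_scalars_module[OF S.self_mod] cl_mod_hom, of x y]
    cl_eq_zero_iff[of "x \<ominus>\<^bsub>R\<^esub> y"] by simp

lemma lift_hom:
  assumes h: "h \<in> mod_hom S (Free S n) N" and A: "module R A" and N: "module S N"
    and q: "q \<in> mod_hom R A (rs N)" "q ` carrier A = carrier N"
  obtains h' where "h' \<in> mod_hom R (Free R n) A"
    "\<And>u. u \<in> vecs R n \<Longrightarrow> q (h' u) = h (vc n u)"
proof -
  have p: "(\<lambda>u. h (vc n u)) \<in> mod_hom R (Free R n) (rs N)"
    by (rule mod_hom_comp[OF vec_class_hom]) (simp add: restrict_scalars_hom h)
  have "(\<lambda>u. h (vc n u)) ` vecs R n \<subseteq> q ` carrier A"
    unfolding q(2) using mod_hom_closed[OF p] by auto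
  then show thesis using free_lift[OF A restrict_scalars_module[OF N] q(1) p] that by blast
qed

text \<open>An R-linear map from R^n to an S-module kills I R^n, because I acts as zero on the
  target.\<close>

lemma descend_hom:
  assumes N: "module S N" and h: "h \<in> mod_hom R (Free R n) (rs N)"
  obtains h' where "h' \<in> mod_hom S (Free S n) N"
    "\<And>u. u \<in> vecs R n \<Longrightarrow> h' (vc n u) = h u"
proof -
  interpret N: module S N by fact
  note FM = Free[OF R] and NM = restrict_scalars_module[OF N]
  interpret NR: module R "rs N" by (rule NM)
  have k: "h u = \<zero>\<^bsub>rs N\<^esub>" if u: "u \<in> vecs R n" "vc n u = \<zero>\<^bsub>rs (Free S n)\<^esub>" for u
  proof -
    have uI: "u \<in> ideal_vecs I n" using vec_class_eq_zero_iff[OF u(1)] u(2) by simp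
    have "h u \<in> {\<zero>\<^bsub>rs N\<^esub>}"
    proof (rule ideal_vecs_hom_mem[OF NM I h NR.zero_submodule _ uI])
      fix a i assume a: "a \<in> I"
      then have "cl a = \<zero>\<^bsub>S\<^esub>" using cl_eq_zero_iff[of a] ideal_facts(1)[OF I] by blast
      then show "a \<odot>\<^bsub>rs N\<^esub> h (unit_vec R n i) \<in> {\<zero>\<^bsub>rs N\<^esub>}"
        using mod_hom_closed[OF h unit_vec_closed[OF R]] by simp
    qed
    then show ?thesis by simp
  qed
  have s: "vc n ` vecs R n = carrier (rs (Free S n))" using vec_class_surj by simp
  obtain h' where "h' \<in> mod_hom R (rs (Free S n)) (rs N)"
    "\<And>u. u \<in> vecs R n \<Longrightarrow> h' (vc n u) = h u"
    using mod_hom_factor_surj[OF FM restrict_scalars_module[OF Free[OF S]] NM vec_class_hom s h k] by blast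
  then show thesis using that by (simp add: restrict_scalars_hom)
qed

text \<open>Lifts the differentials to R one by one. The lifts no longer compose to zero, but each
  clause of \<open>totally_acyclic\<close> for the ideal I is the corresponding statement over S
  read through reduction.\<close>

lemma totally_acyclic_lift:
  assumes t: "totally_acyclic S {\<zero>\<^bsub>S\<^esub>} b A"
  obtains B where "totally_acyclic R I b B"
    "\<And>i u. u \<in> vecs R (b (i + 1)) \<Longrightarrow> vc (b i) (B i u) = A i (vc (b (i + 1)) u)"
proof -
  note T = totally_acyclic_zeroD[OF S t]
  note FM = Free[OF R] and FS = Free[OF S]
  have "\<exists>B. B \<in> Lin R (b (i + 1)) (b i) \<and>
      (\<forall>u \<in> vecs R (b (i + 1)). vc (b i) (B u) = A i (vc (b (i + 1)) u))" for i
  proof -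
    obtain B where "B \<in> Lin R (b (i + 1)) (b i)"
      "\<And>u. u \<in> vecs R (b (i + 1)) \<Longrightarrow> vc (b i) (B u) = A i (vc (b (i + 1)) u)"
      by (rule lift_hom[OF T(1)[of i] FM FS vec_class_hom vec_class_surj]) (rule that)
    then show ?thesis by blast
  qed
  then obtain B where B: "\<And>i. B i \<in> Lin R (b (i + 1)) (b i)"
    and BA: "\<And>i u. u \<in> vecs R (b (i + 1)) \<Longrightarrow> vc (b i) (B i u) = A i (vc (b (i + 1)) u)"
    by metis
  have "totally_acyclic R I b B" unfolding totally_acyclic_def
  proof (intro conjI allI ballI impI)
    show "B i \<in> Lin R (b (i + 1)) (b i)" for i by (rule B)
  next
    fix i u assume u: "u \<in> vecs R (b (i + 1))"
    have "B i u \<in> ideal_vecs I (b i) \<longleftrightarrow> A i (vc (b (i + 1)) u) = \<zero>\<^bsub>Free S (b i)\<^esub>"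
      using vec_class_eq_zero_iff[OF mod_hom_closed[OF B u]] BA[OF u] by simp
    also have "\<dots> \<longleftrightarrow> (\<exists>w \<in> vecs S (b (i + 1 + 1)). vc (b (i + 1)) u = A (i + 1) w)"
      using T(2)[OF vec_class_closed[OF u]] T(3) by metis
    also have "\<dots> \<longleftrightarrow> (\<exists>w \<in> vecs R (b (i + 1 + 1)). vc (b (i + 1)) u = vc (b (i + 1)) (B (i + 1) w))"
      unfolding vec_class_surj[symmetric] using BA[of _ "i + 1"] by auto
    also have "\<dots> \<longleftrightarrow> (\<exists>w \<in> vecs R (b (i + 1 + 1)).
        u \<ominus>\<^bsub>Free R (b (i + 1))\<^esub> B (i + 1) w \<in> ideal_vecs I (b (i + 1)))"
      by (rule bex_cong[OF refl], rule vec_class_eq_iff[OF u mod_hom_closed[OF B]])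
    finally show "B i u \<in> ideal_vecs I (b i) \<longleftrightarrow> (\<exists>w \<in> vecs R (b (i + 1 + 1)).
        u \<ominus>\<^bsub>Free R (b (i + 1))\<^esub> B (i + 1) w \<in> ideal_vecs I (b (i + 1)))" .
  next
    fix i f assume f: "f \<in> mod_hom R (Free R (b (i + 1))) (self_module R)"
      and fB: "\<forall>w \<in> vecs R (b (i + 1 + 1)). f (B (i + 1) w) \<in> I"
    obtain f' where f': "f' \<in> mod_hom S (Free S (b (i + 1))) (self_module S)"
      "\<And>u. u \<in> vecs R (b (i + 1)) \<Longrightarrow> f' (vc (b (i + 1)) u) = cl (f u)"
      using descend_hom[OF S.self_mod mod_hom_comp[OF f cl_mod_hom]] by blast
    have "f' (A (i + 1) w) = \<zero>\<^bsub>S\<^esub>" if w: "w \<in> vecs S (b (i + 1 + 1))" for w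
    proof -
      obtain v where v: "v \<in> vecs R (b (i + 1 + 1))" "w = vc (b (i + 1 + 1)) v"
        by (rule vec_class_preimage[OF w])
      have Bv: "B (i + 1) v \<in> vecs R (b (i + 1))" by (rule mod_hom_closed[OF B v(1)])
      have "f' (A (i + 1) w) = cl (f (B (i + 1) v))" using BA[OF v(1)] f'(2)[OF Bv] v(2) by simp
      then show ?thesis using cl_eq_zero_iff[of "f (B (i + 1) v)"] fB v(1) mod_hom_closed[OF f Bv] by simp
    qed
    then obtain g where g: "g \<in> mod_hom S (Free S (b i)) (self_module S)"
      "\<And>u. u \<in> vecs S (b (i + 1)) \<Longrightarrow> f' u = g (A i u)"
      using T(4)[OF f'(1)] by blast
    obtain g' where g': "g' \<in> mod_hom R (Free R (b i)) (self_module R)"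
      "\<And>u. u \<in> vecs R (b i) \<Longrightarrow> cl (g' u) = g (vc (b i) u)"
      using lift_hom[OF g(1) R.self_mod S.self_mod cl_mod_hom] cl_surj by auto
    show "\<exists>g \<in> mod_hom R (Free R (b i)) (self_module R).
        \<forall>u \<in> vecs R (b (i + 1)). f u \<ominus>\<^bsub>R\<^esub> g (B i u) \<in> I"
    proof (rule bexI[OF _ g'(1)], intro ballI)
      fix u assume u: "u \<in> vecs R (b (i + 1))"
      have Bu: "B i u \<in> vecs R (b i)" by (rule mod_hom_closed[OF B u])
      have "cl (f u) = cl (g' (B i u))"
        using f'(2)[OF u] g(2)[OF vec_class_closed[OF u]] g'(2)[OF Bu] BA[OF u] by simp
      then show "f u \<ominus>\<^bsub>R\<^esub> g' (B i u) \<in> I"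
        using cl_eq_iff[of "f u" "g' (B i u)"] mod_hom_closed[OF f u] mod_hom_closed[OF g'(1) Bu] by simp
    qed
  qed
  then show thesis using that BA by blast
qed

end

subsection \<open>Lifting totally acyclic complexes along a regular element\<close>

lemma vec_split_ideal_vecs:
  assumes "w \<in> vecs R (a + b)"
  shows "w \<in> ideal_vecs I (a + b) \<longleftrightarrow> vec_fst a w \<in> ideal_vecs I a \<and> vec_snd a b w \<in> ideal_vecs I b"
  using ideal_vecs_join[OF mod_hom_closed[OF vec_fst_hom assms] mod_hom_closed[OF vec_snd_hom assms]]
    vec_join_fst_snd[OF assms] by metis

text \<open>With \<open>J = I + xR\<close> and \<open>x\<close> regular modulo \<open>I\<close>, let \<open>F\<^sub>p \<rightarrow> F\<^sub>n \<rightarrow> F\<^sub>m \<rightarrow> F\<^sub>l\<close> be maps \<open>a0, a1, a2\<close> of free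
  modules which form a complex modulo \<open>J\<close>, and write \<open>a1 \<circ> a0 = x s\<close> and \<open>a2 \<circ> a1 = x t\<close> modulo \<open>I\<close>.  Then
  the matrices with rows \<open>(a1, x)\<close> and \<open>(- t, - a2)\<close> form a complex modulo \<open>I\<close>, which is exact whenever the
  given one is exact modulo \<open>J\<close>.\<close>

definition block_map ::
  "('a, 'r) ring_scheme \<Rightarrow> 'a \<Rightarrow> nat \<Rightarrow> nat \<Rightarrow> nat \<Rightarrow> ((nat \<Rightarrow> 'a) \<Rightarrow> nat \<Rightarrow> 'a) \<Rightarrow> ((nat \<Rightarrow> 'a) \<Rightarrow> nat \<Rightarrow> 'a)
    \<Rightarrow> ((nat \<Rightarrow> 'a) \<Rightarrow> nat \<Rightarrow> 'a) \<Rightarrow> (nat \<Rightarrow> 'a) \<Rightarrow> nat \<Rightarrow> 'a"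
where
  "block_map R x n m l a1 a2 t w = vec_join m l
     (a1 (vec_fst n w) \<oplus>\<^bsub>Free R m\<^esub> x \<odot>\<^bsub>Free R m\<^esub> vec_snd n m w)
     (\<ominus>\<^bsub>Free R l\<^esub> (t (vec_fst n w) \<oplus>\<^bsub>Free R l\<^esub> a2 (vec_snd n m w)))"

text \<open>I stands for (x_1, ..., x_j), x for x_{j+1} and J for the next ideal; \<open>IJ\<close>,
  \<open>xJ\<close> and \<open>Jx\<close> together say that J = I + xR.\<close>

locale regular_step =
  fixes R :: "('a, 'r) ring_scheme" and I J :: "'a set" and x :: 'a
  assumes R: "cring R" and I: "ideal I R" and J: "ideal J R" and x: "x \<in> carrier R"
    and IJ: "I \<subseteq> J" and xJ: "x \<in> J"
    and Jx: "r \<in> J \<Longrightarrow> \<exists>y \<in> carrier R. r \<ominus>\<^bsub>R\<^esub> x \<otimes>\<^bsub>R\<^esub> y \<in> I"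
    and reg: "r \<in> carrier R \<Longrightarrow> x \<otimes>\<^bsub>R\<^esub> r \<in> I \<Longrightarrow> r \<in> I"
begin

sublocale R: cring R by (rule R)

abbreviation "F \<equiv> Free R"
text \<open>Congruences modulo I are handled as equations in these quotients, on which
  multiplication by x is injective.\<close>

abbreviation "Q n \<equiv> quot_module (F n) (ideal_vecs I n)"
abbreviation "q n \<equiv> mod_coset (F n) (ideal_vecs I n)"
abbreviation "Qs \<equiv> quot_module (self_module R) I"
abbreviation "qs \<equiv> mod_coset (self_module R) I"

lemma FM: "module R (F n)" by (rule R.free_mod)

lemma IV: "submodule (ideal_vecs I n) R (F n)" by (rule ideal_vecs_submodule[OF R I])

lemma IS: "submodule I R (self_module R)" using submodule_self_iff_ideal[OF R] I by blast

lemma QM: "module R (Q n)" by (rule quot_module[OF FM IV])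

lemma QsM: "module R Qs" by (rule quot_module[OF R.self_mod IS])

lemma q_hom: "q n \<in> mod_hom R (F n) (Q n)" by (rule mod_coset_hom[OF FM IV])

lemma qs_hom: "qs \<in> mod_hom R (self_module R) Qs" by (rule mod_coset_hom[OF R.self_mod IS])

lemma q_zero: "u \<in> vecs R n \<Longrightarrow> q n u = \<zero>\<^bsub>Q n\<^esub> \<longleftrightarrow> u \<in> ideal_vecs I n"
  by (rule mod_coset_eq_zero_iff[OF FM IV])

lemma qs_zero: "r \<in> carrier R \<Longrightarrow> qs r = \<zero>\<^bsub>Qs\<^esub> \<longleftrightarrow> r \<in> I"
  using mod_coset_eq_zero_iff[OF R.self_mod IS] by simp

lemma q_eq: "u \<in> vecs R n \<Longrightarrow> v \<in> vecs R n \<Longrightarrow> q n u = q n v \<longleftrightarrow> u \<ominus>\<^bsub>F n\<^esub> v \<in> ideal_vecs I n"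
  by (rule mod_coset_eq_iff[OF FM IV])

lemma qs_eq: "u \<in> carrier R \<Longrightarrow> v \<in> carrier R \<Longrightarrow> qs u = qs v \<longleftrightarrow> u \<ominus>\<^bsub>R\<^esub> v \<in> I"
  using mod_coset_eq_iff[OF R.self_mod IS, of u v] by simp

lemma q_cong:
  assumes "h \<in> Lin R n m" "u \<in> vecs R n" "v \<in> vecs R n" "q n u = q n v"
  shows "q m (h u) = q m (h v)"
  using assms(4) ideal_vecs_hom[OF R I assms(1)] mod_hom_minus[OF FM FM assms(1-3)]
  unfolding q_eq[OF assms(2,3)] q_eq[OF mod_hom_closed[OF assms(1,2)] mod_hom_closed[OF assms(1,3)]] by metis

lemma qs_cong:
  assumes "h \<in> mod_hom R (F n) (self_module R)" "u \<in> vecs R n" "v \<in> vecs R n" "q n u = q n v"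
  shows "qs (h u) = qs (h v)"
proof -
  have c: "h u \<in> carrier R" "h v \<in> carrier R" using mod_hom_closed[OF assms(1)] assms(2,3) by auto
  have "h (u \<ominus>\<^bsub>F n\<^esub> v) \<in> I"
    by (rule ideal_vecs_hom_mem[OF R.self_mod I assms(1) IS])
      (use ideal_facts(7)[OF I] mod_hom_closed[OF assms(1) unit_vec_closed[OF R]] q_eq[OF assms(2,3)] assms(4) in auto)
  then show ?thesis using qs_eq[OF c] mod_hom_minus[OF FM R.self_mod assms(1-3)] by simp
qed

lemma q_reg:
  assumes "v \<in> vecs R n" "x \<odot>\<^bsub>Q n\<^esub> q n v = \<zero>\<^bsub>Q n\<^esub>"
  shows "q n v = \<zero>\<^bsub>Q n\<^esub>"
proof -
  interpret F: module R "F n" by (rule FM)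
  have "x \<odot>\<^bsub>F n\<^esub> v \<in> ideal_vecs I n"
    using q_zero[of "x \<odot>\<^bsub>F n\<^esub> v" n] assms x mod_hom_smult[OF q_hom x assms(1)] by simp
  then have "\<forall>i<n. x \<otimes>\<^bsub>R\<^esub> v i \<in> I" by (auto simp: ideal_vecs_def free_module_simps PiE_iff)
  then have "v \<in> ideal_vecs I n"
    using reg free_module_coord[OF assms(1)] ideal_vecs_iff[OF ideal_facts(1)[OF I] assms(1)] by blast
  then show ?thesis using q_zero assms(1) by simp
qed

lemma q_reg_eq:
  assumes "u \<in> vecs R n" "v \<in> vecs R n" "x \<odot>\<^bsub>Q n\<^esub> q n u = x \<odot>\<^bsub>Q n\<^esub> q n v"
  shows "q n u = q n v"
proof -
  interpret F: module R "F n" by (rule FM)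
  interpret Q: module R "Q n" by (rule QM)
  note c = mod_hom_closed[OF q_hom assms(1)] mod_hom_closed[OF q_hom assms(2)]
  have "x \<odot>\<^bsub>Q n\<^esub> (q n u \<ominus>\<^bsub>Q n\<^esub> q n v) = x \<odot>\<^bsub>Q n\<^esub> q n u \<ominus>\<^bsub>Q n\<^esub> x \<odot>\<^bsub>Q n\<^esub> q n v"
    using c x by (simp add: a_minus_def Q.smult_r_distr Q.smult_r_minus)
  then have "x \<odot>\<^bsub>Q n\<^esub> q n (u \<ominus>\<^bsub>F n\<^esub> v) = \<zero>\<^bsub>Q n\<^esub>"
    using mod_hom_minus[OF FM QM q_hom assms(1,2)] assms(3) c x Q.minus_eq_zero_iff by simp
  then have "q n (u \<ominus>\<^bsub>F n\<^esub> v) = \<zero>\<^bsub>Q n\<^esub>" using q_reg assms(1,2) by simp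
  then show ?thesis using mod_hom_eq_iff[OF FM QM q_hom assms(1,2)] by blast
qed

lemma qs_reg:
  assumes "v \<in> carrier R" "x \<odot>\<^bsub>Qs\<^esub> qs v = \<zero>\<^bsub>Qs\<^esub>"
  shows "qs v = \<zero>\<^bsub>Qs\<^esub>"
  using qs_zero[of "x \<otimes>\<^bsub>R\<^esub> v"] qs_zero[of v] reg[of v] assms x mod_hom_smult[OF qs_hom x, of v] by simp

text \<open>Membership in J R^n means divisibility by x modulo I; this is how hypotheses modulo J
  are used modulo I.\<close>

lemma q_J_iff:
  assumes u: "u \<in> vecs R n"
  shows "u \<in> ideal_vecs J n \<longleftrightarrow> (\<exists>v \<in> vecs R n. q n u = x \<odot>\<^bsub>Q n\<^esub> q n v)"
proof
  interpret F: module R "F n" by (rule FM)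
  assume *: "u \<in> ideal_vecs J n"
  have "\<forall>i. i < n \<longrightarrow> (\<exists>y. y \<in> carrier R \<and> u i \<ominus>\<^bsub>R\<^esub> x \<otimes>\<^bsub>R\<^esub> y \<in> I)"
    using * Jx by (auto simp: ideal_vecs_def PiE_iff)
  then obtain v where v: "\<And>i. i < n \<Longrightarrow> v i \<in> carrier R" "\<And>i. i < n \<Longrightarrow> u i \<ominus>\<^bsub>R\<^esub> x \<otimes>\<^bsub>R\<^esub> v i \<in> I" by metis
  let ?v = "restrict v {..<n}"
  have vc: "?v \<in> vecs R n" using v(1) by (simp add: free_module_simps)
  have xv: "x \<odot>\<^bsub>F n\<^esub> ?v \<in> vecs R n" using vc x by simp
  have "u \<ominus>\<^bsub>F n\<^esub> x \<odot>\<^bsub>F n\<^esub> ?v \<in> ideal_vecs I n"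
    unfolding ideal_vecs_iff[OF ideal_facts(1)[OF I] F.M.minus_closed[OF u xv]]
    using free_module_minus[OF R u xv] v(2) by (simp add: free_module_simps)
  then have "q n u = x \<odot>\<^bsub>Q n\<^esub> q n ?v" using q_eq[OF u xv] mod_hom_smult[OF q_hom x vc] by simp
  then show "\<exists>v \<in> vecs R n. q n u = x \<odot>\<^bsub>Q n\<^esub> q n v" using vc by blast
next
  interpret F: module R "F n" by (rule FM)
  assume "\<exists>v \<in> vecs R n. q n u = x \<odot>\<^bsub>Q n\<^esub> q n v"
  then obtain v where v: "v \<in> vecs R n" "q n u = x \<odot>\<^bsub>Q n\<^esub> q n v" by blast
  have xv: "x \<odot>\<^bsub>F n\<^esub> v \<in> vecs R n" using v x by simp
  have "u \<ominus>\<^bsub>F n\<^esub> x \<odot>\<^bsub>F n\<^esub> v \<in> ideal_vecs J n"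
    using q_eq[OF u xv] mod_hom_smult[OF q_hom x v(1)] v(2) ideal_vecs_mono[OF IJ] by auto
  moreover have "x \<odot>\<^bsub>F n\<^esub> v \<in> ideal_vecs J n" by (rule ideal_vecs_smult[OF R J xJ v(1)])
  ultimately show "u \<in> ideal_vecs J n" using F.submodule_cong[OF ideal_vecs_submodule[OF R J] _ u xv] by blast
qed

lemma qs_J_iff:
  assumes u: "u \<in> carrier R"
  shows "u \<in> J \<longleftrightarrow> (\<exists>v \<in> carrier R. qs u = x \<odot>\<^bsub>Qs\<^esub> qs v)"
proof
  assume "u \<in> J"
  then obtain y where "y \<in> carrier R" "u \<ominus>\<^bsub>R\<^esub> x \<otimes>\<^bsub>R\<^esub> y \<in> I" using Jx by blast
  then show "\<exists>v \<in> carrier R. qs u = x \<odot>\<^bsub>Qs\<^esub> qs v"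
    using qs_eq[of u "x \<otimes>\<^bsub>R\<^esub> y"] u x mod_hom_smult[OF qs_hom x, of y] by auto
next
  interpret T: module R "self_module R" by (rule R.self_mod)
  assume "\<exists>v \<in> carrier R. qs u = x \<odot>\<^bsub>Qs\<^esub> qs v"
  then obtain v where v: "v \<in> carrier R" "qs u = x \<odot>\<^bsub>Qs\<^esub> qs v" by blast
  then have "u \<ominus>\<^bsub>R\<^esub> x \<otimes>\<^bsub>R\<^esub> v \<in> J"
    using qs_eq[of u "x \<otimes>\<^bsub>R\<^esub> v"] u x mod_hom_smult[OF qs_hom x, of v] IJ by auto
  then have "(u \<ominus>\<^bsub>R\<^esub> x \<otimes>\<^bsub>R\<^esub> v) \<oplus>\<^bsub>R\<^esub> x \<otimes>\<^bsub>R\<^esub> v \<in> J"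
    using ideal_facts(3)[OF J] ideal_facts(7)[OF J xJ v(1)] by blast
  then show "u \<in> J" using T.add_diff_cancel(2)[of u "x \<otimes>\<^bsub>R\<^esub> v"] u v x by simp
qed

text \<open>A matrix with entries in J is x times a matrix modulo I. Quotients of the images of the
  unit vectors by x are chosen by lifting through v |-> x v.\<close>

lemma divide_hom:
  assumes h: "h \<in> Lin R n m" and d: "\<And>u. u \<in> vecs R n \<Longrightarrow> h u \<in> ideal_vecs J m"
  obtains k where "k \<in> Lin R n m" "\<And>u. u \<in> vecs R n \<Longrightarrow> q m (h u) = x \<odot>\<^bsub>Q m\<^esub> q m (k u)"
proof -
  have "(\<lambda>u. q m (h u)) ` vecs R n \<subseteq> (\<lambda>v. x \<odot>\<^bsub>Q m\<^esub> q m v) ` vecs R m"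
  proof
    fix y assume "y \<in> (\<lambda>u. q m (h u)) ` vecs R n"
    then obtain u where u: "u \<in> vecs R n" "y = q m (h u)" by blast
    then show "y \<in> (\<lambda>v. x \<odot>\<^bsub>Q m\<^esub> q m v) ` vecs R m"
      using d[OF u(1)] q_J_iff[OF mod_hom_closed[OF h u(1)]] by blast
  qed
  from free_lift[OF FM QM mod_hom_scale[OF QM q_hom x] mod_hom_comp[OF h q_hom] this]
  obtain k where k: "k \<in> Lin R n m" "\<And>u. u \<in> vecs R n \<Longrightarrow> x \<odot>\<^bsub>Q m\<^esub> q m (k u) = q m (h u)" by blast
  show thesis by (rule that[OF k(1)]) (rule k(2)[symmetric])
qed

lemma divide_hom_self:
  assumes h: "h \<in> mod_hom R (F n) (self_module R)" and d: "\<And>u. u \<in> vecs R n \<Longrightarrow> h u \<in> J"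
  obtains k where "k \<in> mod_hom R (F n) (self_module R)" "\<And>u. u \<in> vecs R n \<Longrightarrow> qs (h u) = x \<odot>\<^bsub>Qs\<^esub> qs (k u)"
proof -
  have "(\<lambda>u. qs (h u)) ` vecs R n \<subseteq> (\<lambda>v. x \<odot>\<^bsub>Qs\<^esub> qs v) ` carrier (self_module R)"
  proof
    fix y assume "y \<in> (\<lambda>u. qs (h u)) ` vecs R n"
    then obtain u where u: "u \<in> vecs R n" "y = qs (h u)" by blast
    then show "y \<in> (\<lambda>v. x \<odot>\<^bsub>Qs\<^esub> qs v) ` carrier (self_module R)"
      using d[OF u(1)] qs_J_iff[of "h u"] mod_hom_closed[OF h u(1)] by auto
  qed
  from free_lift[OF R.self_mod QsM mod_hom_scale[OF QsM qs_hom x] mod_hom_comp[OF h qs_hom] this]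
  obtain k where k: "k \<in> mod_hom R (F n) (self_module R)" "\<And>u. u \<in> vecs R n \<Longrightarrow> x \<odot>\<^bsub>Qs\<^esub> qs (k u) = qs (h u)" by blast
  show thesis by (rule that[OF k(1)]) (rule k(2)[symmetric])
qed

lemma block_map_hom:
  assumes a1: "a1 \<in> Lin R n m" and a2: "a2 \<in> Lin R m l" and t: "t \<in> Lin R n l"
  shows "block_map R x n m l a1 a2 t \<in> Lin R (n + m) (m + l)" unfolding block_map_def
  by (rule vec_join_hom[OF mod_hom_plus[OF FM mod_hom_comp[OF vec_fst_hom a1] mod_hom_scale[OF FM vec_snd_hom x]]
     mod_hom_uminus[OF FM mod_hom_plus[OF FM mod_hom_comp[OF vec_fst_hom t] mod_hom_comp[OF vec_snd_hom a2]]]])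

context
  fixes p n m l :: nat and a0 a1 a2 s t
  assumes a0: "a0 \<in> Lin R p n" and a1: "a1 \<in> Lin R n m" and a2: "a2 \<in> Lin R m l"
    and s: "s \<in> Lin R p m" and t: "t \<in> Lin R n l"
    and qs10: "\<And>u. u \<in> vecs R p \<Longrightarrow> q m (a1 (a0 u)) = x \<odot>\<^bsub>Q m\<^esub> q m (s u)"
    and qt21: "\<And>u. u \<in> vecs R n \<Longrightarrow> q l (a2 (a1 u)) = x \<odot>\<^bsub>Q l\<^esub> q l (t u)"
begin

text \<open>The upper row (a1, x) of \<open>D1\<close>. Modulo I its kernel is already the image of
  \<open>D0\<close>, so exactness is proved for this row alone.\<close>

abbreviation (input) "d w \<equiv> a1 (vec_fst n w) \<oplus>\<^bsub>F m\<^esub> x \<odot>\<^bsub>F m\<^esub> vec_snd n m w"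
abbreviation (input) "D1 \<equiv> block_map R x n m l a1 a2 t"
abbreviation (input) "D0 \<equiv> block_map R x p n m a0 a1 s"

interpretation Fp: module R "F p" by (rule FM)
interpretation Fn: module R "F n" by (rule FM)
interpretation Fm: module R "F m" by (rule FM)
interpretation Fl: module R "F l" by (rule FM)
interpretation Qn: module R "Q n" by (rule QM)
interpretation Qm: module R "Q m" by (rule QM)
interpretation Ql: module R "Q l" by (rule QM)
interpretation Qs: module R "Qs" by (rule QsM)

lemma block_d_hom: "(\<lambda>w. d w) \<in> Lin R (n + m) m"
  by (rule mod_hom_plus[OF FM mod_hom_comp[OF vec_fst_hom a1] mod_hom_scale[OF FM vec_snd_hom x]])

lemma block_D0_parts:
  assumes u: "u \<in> vecs R p" and v: "v \<in> vecs R n"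
  shows "vec_fst n (D0 (vec_join p n u v)) = a0 u \<oplus>\<^bsub>F n\<^esub> x \<odot>\<^bsub>F n\<^esub> v"
    "vec_snd n m (D0 (vec_join p n u v)) = \<ominus>\<^bsub>F m\<^esub> (s u \<oplus>\<^bsub>F m\<^esub> a1 v)"
proof -
  have 1: "a0 u \<oplus>\<^bsub>F n\<^esub> x \<odot>\<^bsub>F n\<^esub> v \<in> vecs R n" using mod_hom_closed[OF a0 u] v x by simp
  have 2: "\<ominus>\<^bsub>F m\<^esub> (s u \<oplus>\<^bsub>F m\<^esub> a1 v) \<in> vecs R m" using mod_hom_closed[OF s u] mod_hom_closed[OF a1 v] by simp
  show "vec_fst n (D0 (vec_join p n u v)) = a0 u \<oplus>\<^bsub>F n\<^esub> x \<odot>\<^bsub>F n\<^esub> v"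
    "vec_snd n m (D0 (vec_join p n u v)) = \<ominus>\<^bsub>F m\<^esub> (s u \<oplus>\<^bsub>F m\<^esub> a1 v)"
    unfolding block_map_def vec_fst_join[OF u] vec_snd_join[OF v] using vec_fst_join[OF 1] vec_snd_join[OF 2] by auto
qed

lemma block_D1_parts:
  assumes w: "w \<in> vecs R (n + m)"
  shows "vec_fst m (D1 w) = d w"
    "vec_snd m l (D1 w) = \<ominus>\<^bsub>F l\<^esub> (t (vec_fst n w) \<oplus>\<^bsub>F l\<^esub> a2 (vec_snd n m w))"
proof -
  have 1: "d w \<in> vecs R m" by (rule mod_hom_closed[OF block_d_hom w])
  have 2: "\<ominus>\<^bsub>F l\<^esub> (t (vec_fst n w) \<oplus>\<^bsub>F l\<^esub> a2 (vec_snd n m w)) \<in> vecs R l"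
    using mod_hom_closed[OF t mod_hom_closed[OF vec_fst_hom w]] mod_hom_closed[OF a2 mod_hom_closed[OF vec_snd_hom w]] by simp
  show "vec_fst m (D1 w) = d w" "vec_snd m l (D1 w) = \<ominus>\<^bsub>F l\<^esub> (t (vec_fst n w) \<oplus>\<^bsub>F l\<^esub> a2 (vec_snd n m w))"
    unfolding block_map_def using vec_fst_join[OF 1] vec_snd_join[OF 2] by auto
qed

text \<open>On (u, v) the terms in v cancel, and a1(a0 u) - x s(u) remains, which lies in I R^m by
  the choice of \<open>s\<close>.\<close>

lemma block_d_D0:
  assumes w: "w \<in> vecs R (p + n)"
  shows "d (D0 w) \<in> ideal_vecs I m"
proof -
  obtain u v where u: "u \<in> vecs R p" and v: "v \<in> vecs R n" and uv: "w = vec_join p n u v"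
    by (rule vec_join_surj[OF w])
  note c = mod_hom_closed[OF a0 u] mod_hom_closed[OF s u] mod_hom_closed[OF a1 v] mod_hom_closed[OF a1 mod_hom_closed[OF a0 u]]
  have xv: "x \<odot>\<^bsub>F n\<^esub> v \<in> vecs R n" using v x by simp
  have e: "d (D0 w) = (a1 (a0 u) \<oplus>\<^bsub>F m\<^esub> x \<odot>\<^bsub>F m\<^esub> a1 v) \<oplus>\<^bsub>F m\<^esub> x \<odot>\<^bsub>F m\<^esub> (\<ominus>\<^bsub>F m\<^esub> (s u \<oplus>\<^bsub>F m\<^esub> a1 v))"
    unfolding uv block_D0_parts[OF u v] mod_hom_add[OF a1 c(1) xv] mod_hom_smult[OF a1 x v] ..
  also have "\<dots> = a1 (a0 u) \<ominus>\<^bsub>F m\<^esub> x \<odot>\<^bsub>F m\<^esub> s u" using c x by algebra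
  finally have e: "d (D0 w) = a1 (a0 u) \<ominus>\<^bsub>F m\<^esub> x \<odot>\<^bsub>F m\<^esub> s u" .
  have xs: "x \<odot>\<^bsub>F m\<^esub> s u \<in> vecs R m" using c x by simp
  show ?thesis unfolding e using q_eq[OF c(4) xs] qs10[OF u] mod_hom_smult[OF q_hom x c(2)] by simp
qed

text \<open>For the lower row, x t and a2 a1 agree modulo I by the choice of \<open>t\<close>.
  Moreover t a0 and a2 s agree modulo I, since x times either of them is a2 a1 a0 and x can be
  cancelled.\<close>

lemma block_D1_D0:
  assumes w: "w \<in> vecs R (p + n)"
  shows "D1 (D0 w) \<in> ideal_vecs I (m + l)"
proof -
  have D0w: "D0 w \<in> vecs R (n + m)" by (rule mod_hom_closed[OF block_map_hom[OF a0 a1 s] w])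
  obtain u v where u: "u \<in> vecs R p" and v: "v \<in> vecs R n" and uv: "w = vec_join p n u v"
    by (rule vec_join_surj[OF w])
  note c = mod_hom_closed[OF a0 u] mod_hom_closed[OF s u] mod_hom_closed[OF a1 v] mod_hom_closed[OF a1 mod_hom_closed[OF a0 u]]
  have xv: "x \<odot>\<^bsub>F n\<^esub> v \<in> vecs R n" using v x by simp
  note c' = mod_hom_closed[OF t c(1)] mod_hom_closed[OF t v] mod_hom_closed[OF a2 c(2)] mod_hom_closed[OF a2 c(3)]
  note qc = mod_hom_closed[OF q_hom c'(1)] mod_hom_closed[OF q_hom c'(2)] mod_hom_closed[OF q_hom c'(3)] mod_hom_closed[OF q_hom c'(4)]
  have xs: "x \<odot>\<^bsub>F m\<^esub> s u \<in> vecs R m" using c x by simp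
  have comm: "q l (t (a0 u)) = q l (a2 (s u))"
  proof (rule q_reg_eq[OF c'(1,3)])
    have "q m (a1 (a0 u)) = q m (x \<odot>\<^bsub>F m\<^esub> s u)" using qs10[OF u] mod_hom_smult[OF q_hom x c(2)] by simp
    then have "q l (a2 (a1 (a0 u))) = q l (a2 (x \<odot>\<^bsub>F m\<^esub> s u))" by (rule q_cong[OF a2 c(4) xs])
    then show "x \<odot>\<^bsub>Q l\<^esub> q l (t (a0 u)) = x \<odot>\<^bsub>Q l\<^esub> q l (a2 (s u))"
      using qt21[OF c(1)] mod_hom_smult[OF a2 x c(2)] mod_hom_smult[OF q_hom x c'(3)] by simp
  qed
  let ?y = "t (a0 u) \<oplus>\<^bsub>F l\<^esub> x \<odot>\<^bsub>F l\<^esub> t v \<oplus>\<^bsub>F l\<^esub> \<ominus>\<^bsub>F l\<^esub> (a2 (s u) \<oplus>\<^bsub>F l\<^esub> a2 (a1 v))"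
  have sa: "s u \<oplus>\<^bsub>F m\<^esub> a1 v \<in> vecs R m" using c by simp
  have e: "vec_snd m l (D1 (D0 w)) = \<ominus>\<^bsub>F l\<^esub> ?y"
    unfolding block_D1_parts[OF D0w] unfolding uv block_D0_parts[OF u v] mod_hom_add[OF t c(1) xv] mod_hom_smult[OF t x v]
      mod_hom_neg[OF FM FM a2 sa] mod_hom_add[OF a2 c(2,3)] ..
  have yc: "?y \<in> vecs R l" using c' x by simp
  have "q l ?y = q l (t (a0 u)) \<oplus>\<^bsub>Q l\<^esub> x \<odot>\<^bsub>Q l\<^esub> q l (t v) \<oplus>\<^bsub>Q l\<^esub> \<ominus>\<^bsub>Q l\<^esub> (q l (a2 (s u)) \<oplus>\<^bsub>Q l\<^esub> q l (a2 (a1 v)))"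
    using c' x by (simp add: mod_hom_add[OF q_hom] mod_hom_smult[OF q_hom] mod_hom_neg[OF FM QM q_hom])
  also have "\<dots> = \<zero>\<^bsub>Q l\<^esub>"
    unfolding comm qt21[OF v] using qc x by (simp add: Ql.M.r_neg)
  finally have "?y \<in> ideal_vecs I l" using q_zero[OF yc] by blast
  then have "vec_snd m l (D1 (D0 w)) \<in> ideal_vecs I l" unfolding e using Fl.submoduleD(5)[OF IV] by blast
  moreover have "vec_fst m (D1 (D0 w)) \<in> ideal_vecs I m"
    unfolding block_D1_parts[OF D0w] by (rule block_d_D0[OF w])
  ultimately show ?thesis
    using vec_split_ideal_vecs[OF mod_hom_closed[OF block_map_hom[OF a1 a2 t] D0w]] by blast
qed

text \<open>If a1 u + x v = 0 modulo I, then a1 u lies in J R^m, so exactness modulo J gives u = a0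
  u1 + x v1 modulo I. The second component of \<open>D0\<close> at (u1, v1) equals v after
  multiplication by x, hence modulo I itself.\<close>

lemma block_exact_d:
  assumes ex: "\<And>u. u \<in> vecs R n \<Longrightarrow> a1 u \<in> ideal_vecs J m \<Longrightarrow> \<exists>v \<in> vecs R p. u \<ominus>\<^bsub>F n\<^esub> a0 v \<in> ideal_vecs J n"
    and w: "w \<in> vecs R (n + m)" and dw: "d w \<in> ideal_vecs I m"
  shows "\<exists>w' \<in> vecs R (p + n). w \<ominus>\<^bsub>F (n + m)\<^esub> D0 w' \<in> ideal_vecs I (n + m)"
proof -
  obtain u v where u: "u \<in> vecs R n" and v: "v \<in> vecs R m" and uv: "w = vec_join n m u v"
    by (rule vec_join_surj[OF w])
  note c = mod_hom_closed[OF a1 u] mod_hom_closed[OF q_hom mod_hom_closed[OF a1 u]] mod_hom_closed[OF q_hom v]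
  have xv: "x \<odot>\<^bsub>F m\<^esub> v \<in> vecs R m" using v x by simp
  have "d w = a1 u \<oplus>\<^bsub>F m\<^esub> x \<odot>\<^bsub>F m\<^esub> v" unfolding uv vec_fst_join[OF u] vec_snd_join[OF v] ..
  then have 0: "q m (a1 u) \<oplus>\<^bsub>Q m\<^esub> x \<odot>\<^bsub>Q m\<^esub> q m v = \<zero>\<^bsub>Q m\<^esub>"
    using q_zero[of "a1 u \<oplus>\<^bsub>F m\<^esub> x \<odot>\<^bsub>F m\<^esub> v" m] dw c(1) xv v x
    by (simp add: mod_hom_add[OF q_hom] mod_hom_smult[OF q_hom])
  have nv: "\<ominus>\<^bsub>F m\<^esub> v \<in> vecs R m" using v by simp
  have "q m (a1 u) = x \<odot>\<^bsub>Q m\<^esub> q m (\<ominus>\<^bsub>F m\<^esub> v)"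
    using 0 c x Qm.M.minus_equality[OF 0] mod_hom_neg[OF FM QM q_hom v]
    by (metis Qm.smult_closed Qm.smult_r_minus Qm.M.minus_equality)
  then have "a1 u \<in> ideal_vecs J m" using q_J_iff[OF c(1)] nv by blast
  then obtain u1 where u1: "u1 \<in> vecs R p" "u \<ominus>\<^bsub>F n\<^esub> a0 u1 \<in> ideal_vecs J n" using ex[OF u] by blast
  note e = mod_hom_closed[OF a0 u1(1)]
  have ue: "u \<ominus>\<^bsub>F n\<^esub> a0 u1 \<in> vecs R n" using u e by simp
  obtain v1 where v1: "v1 \<in> vecs R n" "q n (u \<ominus>\<^bsub>F n\<^esub> a0 u1) = x \<odot>\<^bsub>Q n\<^esub> q n v1"
    using u1(2) q_J_iff[OF ue] by blast
  have xv1: "x \<odot>\<^bsub>F n\<^esub> v1 \<in> vecs R n" using v1 x by simp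
  let ?f = "a0 u1 \<oplus>\<^bsub>F n\<^esub> x \<odot>\<^bsub>F n\<^esub> v1"
  have fc: "?f \<in> vecs R n" using e xv1 by simp
  have qu: "q n u = q n ?f"
  proof -
    have "q n u = q n (a0 u1) \<oplus>\<^bsub>Q n\<^esub> (q n u \<ominus>\<^bsub>Q n\<^esub> q n (a0 u1))"
      using Qn.add_diff_cancel(1)[OF mod_hom_closed[OF q_hom u] mod_hom_closed[OF q_hom e]] by simp
    also have "\<dots> = q n (a0 u1) \<oplus>\<^bsub>Q n\<^esub> x \<odot>\<^bsub>Q n\<^esub> q n v1"
      using v1(2) mod_hom_minus[OF FM QM q_hom u e] by simp
    also have "\<dots> = q n ?f" using mod_hom_add[OF q_hom e xv1] mod_hom_smult[OF q_hom x v1(1)] by simp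
    finally show ?thesis .
  qed
  let ?w = "vec_join p n u1 v1"
  have wc: "?w \<in> vecs R (p + n)" by (rule vec_join_closed[OF u1(1) v1(1)])
  have Dw: "D0 ?w \<in> vecs R (n + m)" by (rule mod_hom_closed[OF block_map_hom[OF a0 a1 s] wc])
  note g = mod_hom_closed[OF s u1(1)] mod_hom_closed[OF a1 v1(1)] mod_hom_closed[OF a1 e]
  note qg = mod_hom_closed[OF q_hom g(1)] mod_hom_closed[OF q_hom g(2)] mod_hom_closed[OF q_hom g(3)]
  let ?z = "v \<ominus>\<^bsub>F m\<^esub> \<ominus>\<^bsub>F m\<^esub> (s u1 \<oplus>\<^bsub>F m\<^esub> a1 v1)"
  have zc: "?z \<in> vecs R m" using v g by simp
  have ng: "\<ominus>\<^bsub>F m\<^esub> (s u1 \<oplus>\<^bsub>F m\<^esub> a1 v1) \<in> vecs R m" using g by simp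
  have sg: "s u1 \<oplus>\<^bsub>F m\<^esub> a1 v1 \<in> vecs R m" using g by simp
  have "x \<odot>\<^bsub>Q m\<^esub> q m ?z = x \<odot>\<^bsub>Q m\<^esub> (q m v \<ominus>\<^bsub>Q m\<^esub> \<ominus>\<^bsub>Q m\<^esub> (q m (s u1) \<oplus>\<^bsub>Q m\<^esub> q m (a1 v1)))"
    unfolding mod_hom_minus[OF FM QM q_hom v ng] mod_hom_neg[OF FM QM q_hom sg] mod_hom_add[OF q_hom g(1,2)] ..
  also have "\<dots> = x \<odot>\<^bsub>Q m\<^esub> q m v \<oplus>\<^bsub>Q m\<^esub> (x \<odot>\<^bsub>Q m\<^esub> q m (s u1) \<oplus>\<^bsub>Q m\<^esub> x \<odot>\<^bsub>Q m\<^esub> q m (a1 v1))"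
    using x c(3) qg by (simp add: a_minus_def Qm.smult_r_distr)
  also have "x \<odot>\<^bsub>Q m\<^esub> q m (s u1) \<oplus>\<^bsub>Q m\<^esub> x \<odot>\<^bsub>Q m\<^esub> q m (a1 v1) = q m (a1 ?f)"
    using qs10[OF u1(1)] mod_hom_add[OF a1 e xv1] mod_hom_smult[OF a1 x v1(1)] g x
    by (simp add: mod_hom_add[OF q_hom] mod_hom_smult[OF q_hom])
  also have "q m (a1 ?f) = q m (a1 u)" using q_cong[OF a1 u fc qu] by simp
  also have "x \<odot>\<^bsub>Q m\<^esub> q m v \<oplus>\<^bsub>Q m\<^esub> q m (a1 u) = \<zero>\<^bsub>Q m\<^esub>" using 0 c x Qm.M.a_comm by simp
  finally have "q m ?z = \<zero>\<^bsub>Q m\<^esub>" by (rule q_reg[OF zc])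
  then have zI: "?z \<in> ideal_vecs I m" using q_zero[OF zc] by blast
  have "u \<ominus>\<^bsub>F n\<^esub> ?f \<in> ideal_vecs I n" using q_eq[OF u fc] qu by blast
  moreover have "vec_fst n (w \<ominus>\<^bsub>F (n + m)\<^esub> D0 ?w) = u \<ominus>\<^bsub>F n\<^esub> ?f"
    unfolding mod_hom_minus[OF FM FM vec_fst_hom w Dw] block_D0_parts[OF u1(1) v1(1)] unfolding uv vec_fst_join[OF u] ..
  moreover have "vec_snd n m (w \<ominus>\<^bsub>F (n + m)\<^esub> D0 ?w) = ?z"
    unfolding mod_hom_minus[OF FM FM vec_snd_hom w Dw] block_D0_parts[OF u1(1) v1(1)] unfolding uv vec_snd_join[OF v] ..
  moreover have mc: "w \<ominus>\<^bsub>F (n + m)\<^esub> D0 ?w \<in> vecs R (n + m)"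
    by (rule abelian_group.minus_closed[OF module.axioms(2)[OF FM] w Dw])
  ultimately have "w \<ominus>\<^bsub>F (n + m)\<^esub> D0 ?w \<in> ideal_vecs I (n + m)"
    unfolding vec_split_ideal_vecs[OF mc] using zI by simp
  then show ?thesis using wc by blast
qed

text \<open>Write f = (f1, f2). Vanishing on the image of \<open>D0\<close> gives x f1 = f2 a1
  modulo I, so f2 a1 takes values in J and dual exactness modulo J yields f2 = g a2 + x h modulo I.
  Then f is (h, -g) after \<open>D1\<close>: the component at f2 is this equation, and the one at f1
  follows after multiplication by x.\<close>

lemma block_dual_exact:
  assumes du: "\<And>f. f \<in> mod_hom R (F m) (self_module R) \<Longrightarrow> (\<And>u. u \<in> vecs R n \<Longrightarrow> f (a1 u) \<in> J) \<Longrightarrow>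
      \<exists>g \<in> mod_hom R (F l) (self_module R). \<forall>v \<in> vecs R m. f v \<ominus>\<^bsub>R\<^esub> g (a2 v) \<in> J"
    and f: "f \<in> mod_hom R (F (n + m)) (self_module R)"
    and fD: "\<And>w. w \<in> vecs R (p + n) \<Longrightarrow> f (D0 w) \<in> I"
  shows "\<exists>g \<in> mod_hom R (F (m + l)) (self_module R). \<forall>w \<in> vecs R (n + m). f w \<ominus>\<^bsub>R\<^esub> g (D1 w) \<in> I"
proof -
  define f1 where "f1 u = f (vec_join n m u \<zero>\<^bsub>F m\<^esub>)" for u
  define f2 where "f2 v = f (vec_join n m \<zero>\<^bsub>F n\<^esub> v)" for v
  have f1: "f1 \<in> mod_hom R (F n) (self_module R)" unfolding f1_def
    by (rule mod_hom_comp[OF vec_join_hom[OF mod_hom_id mod_hom_const_zero[OF FM]] f])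
  have f2: "f2 \<in> mod_hom R (F m) (self_module R)" unfolding f2_def
    by (rule mod_hom_comp[OF vec_join_hom[OF mod_hom_const_zero[OF FM] mod_hom_id] f])
  have f12: "f w = f1 (vec_fst n w) \<oplus>\<^bsub>R\<^esub> f2 (vec_snd n m w)" if w: "w \<in> vecs R (n + m)" for w
  proof -
    note uv = mod_hom_closed[OF vec_fst_hom w] mod_hom_closed[OF vec_snd_hom w]
    have "w = vec_join n m (vec_fst n w) \<zero>\<^bsub>F m\<^esub> \<oplus>\<^bsub>F (n + m)\<^esub> vec_join n m \<zero>\<^bsub>F n\<^esub> (vec_snd n m w)"
      (is "w = ?a \<oplus>\<^bsub>_\<^esub> ?b")
    proof (rule free_module_ext[OF w])
      have ab: "?a \<in> vecs R (n + m)" "?b \<in> vecs R (n + m)" 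
        using vec_join_closed[OF uv(1) Fm.M.zero_closed] vec_join_closed[OF Fn.M.zero_closed uv(2)] by auto
      show "?a \<oplus>\<^bsub>F (n + m)\<^esub> ?b \<in> vecs R (n + m)"
        by (rule abelian_groupE(1)[OF module.axioms(2)[OF FM] ab])
      fix i assume "i < n + m"
      then show "w i = (?a \<oplus>\<^bsub>F (n + m)\<^esub> ?b) i" using free_module_coord[OF w, of i]
        by (cases "i < n") (auto simp: vec_join_def vec_fst_def vec_snd_def free_module_simps(2,3))
    qed
    then have "f w = f (?a \<oplus>\<^bsub>F (n + m)\<^esub> ?b)" by simp
    also have "\<dots> = f ?a \<oplus>\<^bsub>R\<^esub> f ?b"
      using mod_hom_add[OF f vec_join_closed[OF uv(1) Fm.M.zero_closed] vec_join_closed[OF Fn.M.zero_closed uv(2)]] by simp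
    finally show ?thesis unfolding f1_def f2_def .
  qed
  have rel: "x \<odot>\<^bsub>Qs\<^esub> qs (f1 v) = qs (f2 (a1 v))" if v: "v \<in> vecs R n" for v
  proof -
    let ?w = "vec_join p n \<zero>\<^bsub>F p\<^esub> v"
    have w: "?w \<in> vecs R (p + n)" by (rule vec_join_closed[OF Fp.M.zero_closed v])
    have Dw: "D0 ?w \<in> vecs R (n + m)" by (rule mod_hom_closed[OF block_map_hom[OF a0 a1 s] w])
    have z: "a0 \<zero>\<^bsub>F p\<^esub> = \<zero>\<^bsub>F n\<^esub>" "s \<zero>\<^bsub>F p\<^esub> = \<zero>\<^bsub>F m\<^esub>"
      using mod_hom_zero[OF FM FM a0] mod_hom_zero[OF FM FM s] by auto
    note c = mod_hom_closed[OF f1 v] mod_hom_closed[OF a1 v] mod_hom_closed[OF f2 mod_hom_closed[OF a1 v]]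
    have "f (D0 ?w) = x \<otimes>\<^bsub>R\<^esub> f1 v \<ominus>\<^bsub>R\<^esub> f2 (a1 v)"
      unfolding f12[OF Dw] block_D0_parts[OF Fp.M.zero_closed v] z
      using mod_hom_smult[OF f1 x v] mod_hom_neg[OF FM R.self_mod f2 c(2)] v x c(2) by (simp add: a_minus_def)
    then have "x \<otimes>\<^bsub>R\<^esub> f1 v \<ominus>\<^bsub>R\<^esub> f2 (a1 v) \<in> I" using fD[OF w] by simp
    then show ?thesis using qs_eq[of "x \<otimes>\<^bsub>R\<^esub> f1 v" "f2 (a1 v)"] c x mod_hom_smult[OF qs_hom x, of "f1 v"] by simp
  qed
  have "\<exists>g \<in> mod_hom R (F l) (self_module R). \<forall>v \<in> vecs R m. f2 v \<ominus>\<^bsub>R\<^esub> g (a2 v) \<in> J"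
  proof (rule du[OF f2])
    fix u assume u: "u \<in> vecs R n"
    have "f2 (a1 u) \<in> carrier R" "f1 u \<in> carrier R"
      using mod_hom_closed[OF f2 mod_hom_closed[OF a1 u]] mod_hom_closed[OF f1 u] by auto
    then show "f2 (a1 u) \<in> J" using qs_J_iff rel[OF u, symmetric] by blast
  qed
  then obtain g where g: "g \<in> mod_hom R (F l) (self_module R)"
    "\<And>v. v \<in> vecs R m \<Longrightarrow> f2 v \<ominus>\<^bsub>R\<^esub> g (a2 v) \<in> J" by blast
  have ga2: "(\<lambda>v. g (a2 v)) \<in> mod_hom R (F m) (self_module R)" by (rule mod_hom_comp[OF a2 g(1)])
  have "(\<lambda>v. f2 v \<ominus>\<^bsub>self_module R\<^esub> g (a2 v)) \<in> mod_hom R (F m) (self_module R)"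
    by (rule mod_hom_diff[OF R.self_mod f2 ga2])
  then obtain h where h: "h \<in> mod_hom R (F m) (self_module R)"
    "\<And>v. v \<in> vecs R m \<Longrightarrow> qs (f2 v \<ominus>\<^bsub>self_module R\<^esub> g (a2 v)) = x \<odot>\<^bsub>Qs\<^esub> qs (h v)"
    using divide_hom_self g(2) by (metis (no_types, lifting) self_module_minus)
  \<comment> \<open>The minus sign matches the one in the lower row of the block matrix.\<close>
  define G where "G w = h (vec_fst m w) \<ominus>\<^bsub>self_module R\<^esub> g (vec_snd m l w)" for w
  have G: "G \<in> mod_hom R (F (m + l)) (self_module R)" unfolding G_def
    by (rule mod_hom_diff[OF R.self_mod mod_hom_comp[OF vec_fst_hom h(1)] mod_hom_comp[OF vec_snd_hom g(1)]])
  show ?thesis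
  proof (rule bexI[OF _ G], intro ballI)
    fix w assume w: "w \<in> vecs R (n + m)"
    have D1w: "D1 w \<in> vecs R (m + l)" by (rule mod_hom_closed[OF block_map_hom[OF a1 a2 t] w])
    obtain u v where u: "u \<in> vecs R n" and v: "v \<in> vecs R m" and uv: "w = vec_join n m u v"
      by (rule vec_join_surj[OF w])
    note e = mod_hom_closed[OF a1 u] mod_hom_closed[OF t u] mod_hom_closed[OF a2 v] mod_hom_closed[OF a2 mod_hom_closed[OF a1 u]]
    have c: "f1 u \<in> carrier R" "f2 v \<in> carrier R" "h (a1 u) \<in> carrier R" "h v \<in> carrier R" "g (t u) \<in> carrier R" "g (a2 v) \<in> carrier R"
      "f2 (a1 u) \<in> carrier R" "g (a2 (a1 u)) \<in> carrier R"
      using mod_hom_closed[OF f1 u] mod_hom_closed[OF f2 v] mod_hom_closed[OF h(1) e(1)] mod_hom_closed[OF h(1) v]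
        mod_hom_closed[OF g(1) e(2)] mod_hom_closed[OF g(1) e(3)] mod_hom_closed[OF f2 e(1)] mod_hom_closed[OF g(1) e(4)] by auto
    have xv: "x \<odot>\<^bsub>F m\<^esub> v \<in> vecs R m" using v x by simp
    have ta: "t u \<oplus>\<^bsub>F l\<^esub> a2 v \<in> vecs R l" using e by simp
    have fw: "f w = f1 u \<oplus>\<^bsub>R\<^esub> f2 v" unfolding f12[OF w] unfolding uv vec_fst_join[OF u] vec_snd_join[OF v] ..
    have Gw: "G (D1 w) = (h (a1 u) \<oplus>\<^bsub>R\<^esub> x \<otimes>\<^bsub>R\<^esub> h v) \<ominus>\<^bsub>R\<^esub> \<ominus>\<^bsub>R\<^esub> (g (t u) \<oplus>\<^bsub>R\<^esub> g (a2 v))"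
      unfolding G_def block_D1_parts[OF w] unfolding uv vec_fst_join[OF u] vec_snd_join[OF v]
      using mod_hom_add[OF h(1) e(1) xv] mod_hom_smult[OF h(1) x v] mod_hom_neg[OF FM R.self_mod g(1) ta]
        mod_hom_add[OF g(1) e(2,3)] by simp
    let ?k = "f1 u \<ominus>\<^bsub>R\<^esub> (h (a1 u) \<oplus>\<^bsub>R\<^esub> g (t u))"
    let ?k2 = "(f2 v \<ominus>\<^bsub>R\<^esub> g (a2 v)) \<ominus>\<^bsub>R\<^esub> x \<otimes>\<^bsub>R\<^esub> h v"
    have "f w \<ominus>\<^bsub>R\<^esub> G (D1 w) = ?k \<oplus>\<^bsub>R\<^esub> ?k2" unfolding fw Gw using c x by algebra
    moreover have "?k2 \<in> I"
      using h(2)[OF v] qs_eq[of "f2 v \<ominus>\<^bsub>R\<^esub> g (a2 v)" "x \<otimes>\<^bsub>R\<^esub> h v"] c x mod_hom_smult[OF qs_hom x, of "h v"] by simp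
    moreover have "?k \<in> I"
    proof -
      note qc = mod_hom_closed[OF qs_hom, simplified]
      have S: "qs (a \<oplus>\<^bsub>R\<^esub> b) = qs a \<oplus>\<^bsub>Qs\<^esub> qs b" "qs (a \<ominus>\<^bsub>R\<^esub> b) = qs a \<ominus>\<^bsub>Qs\<^esub> qs b"
        if "a \<in> carrier R" "b \<in> carrier R" for a b
        using mod_hom_add[OF qs_hom, of a b] mod_hom_minus[OF R.self_mod QsM qs_hom, of a b] that by simp_all
      have xt: "x \<odot>\<^bsub>F l\<^esub> t u \<in> vecs R l" using e x by simp
      have "q l (a2 (a1 u)) = q l (x \<odot>\<^bsub>F l\<^esub> t u)" using qt21[OF u] mod_hom_smult[OF q_hom x e(2)] by simp
      then have 1: "x \<odot>\<^bsub>Qs\<^esub> qs (g (t u)) = qs (g (a2 (a1 u)))"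
        using qs_cong[OF g(1) e(4) xt] mod_hom_smult[OF g(1) x e(2)] mod_hom_smult[OF qs_hom x, of "g (t u)"] c by simp
      have 2: "x \<odot>\<^bsub>Qs\<^esub> qs (h (a1 u)) = qs (f2 (a1 u)) \<ominus>\<^bsub>Qs\<^esub> qs (g (a2 (a1 u)))"
        using h(2)[OF e(1)] S(2)[OF c(7,8)] by simp
      have "x \<odot>\<^bsub>Qs\<^esub> qs ?k = x \<odot>\<^bsub>Qs\<^esub> (qs (f1 u) \<ominus>\<^bsub>Qs\<^esub> (qs (h (a1 u)) \<oplus>\<^bsub>Qs\<^esub> qs (g (t u))))"
        using S c by simp
      also have "\<dots> = x \<odot>\<^bsub>Qs\<^esub> qs (f1 u) \<ominus>\<^bsub>Qs\<^esub> (x \<odot>\<^bsub>Qs\<^esub> qs (h (a1 u)) \<oplus>\<^bsub>Qs\<^esub> x \<odot>\<^bsub>Qs\<^esub> qs (g (t u)))"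
        using qc c x by (simp add: a_minus_def Qs.smult_r_distr Qs.smult_r_minus)
      also have "\<dots> = \<zero>\<^bsub>Qs\<^esub>" unfolding 1 2 rel[OF u]
        using qc[OF c(7)] qc[OF c(8)] Qs.add_diff_cancel(2)[of "qs (f2 (a1 u))" "qs (g (a2 (a1 u)))"] Qs.minus_eq_zero_iff by simp
      finally have "qs ?k = \<zero>\<^bsub>Qs\<^esub>" using qs_reg[of ?k] c by simp
      then show ?thesis using qs_zero[of ?k] c by simp
    qed
    ultimately show "f w \<ominus>\<^bsub>R\<^esub> G (D1 w) \<in> I" using ideal_facts(3)[OF I] by simp
  qed
qed

end

end

section \<open>The block complex of a totally acyclic complex\<close>

context regular_step begin

text \<open>Assembles the blocks from three consecutive maps each; the ranks are b i + b (i - 1).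
  The second conclusion identifies the kernel of the row (A i, x) modulo I, from which the cokernel
  of \<open>A i\<close> modulo J is computed.\<close>

lemma totally_acyclic_block:
  assumes t: "totally_acyclic R J b A"
  obtains D where "totally_acyclic R I (\<lambda>i. b i + b (i - 1)) D"
    "\<And>i w. w \<in> vecs R (b (i + 1) + b i) \<Longrightarrow>
      (A i (vec_fst (b (i + 1)) w) \<oplus>\<^bsub>F (b i)\<^esub> x \<odot>\<^bsub>F (b i)\<^esub> vec_snd (b (i + 1)) (b i) w \<in> ideal_vecs I (b i)) \<longleftrightarrow>
      (\<exists>w' \<in> vecs R (b (i + 1 + 1) + b (i + 1)). w \<ominus>\<^bsub>F (b (i + 1) + b i)\<^esub> D (i + 1) w' \<in> ideal_vecs I (b (i + 1) + b i))"
proof -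
  note T = totally_acyclicD[OF t]
  have T': "A (i - 1) \<in> Lin R (b i) (b (i - 1))" for i using T(1)[of "i - 1"] by simp
  have zm: "u \<ominus>\<^bsub>F n\<^esub> u \<in> ideal_vecs J n" if "u \<in> vecs R n" for u n
  proof -
    interpret M: module R "F n" by (rule FM)
    show ?thesis using M.minus_eq_zero_iff[OF that that] M.submoduleD(2)[OF ideal_vecs_submodule[OF R J]] by simp
  qed
  have AA: "A (i - 1) (A i u) \<in> ideal_vecs J (b (i - 1))" if u: "u \<in> vecs R (b (i + 1))" for i u
    using T(3)[of "A i u" "i - 1" u] u mod_hom_closed[OF T(1) u] zm by simp
  have "\<exists>s. s \<in> Lin R (b (i + 1)) (b (i - 1)) \<and>
      (\<forall>u \<in> vecs R (b (i + 1)). q (b (i - 1)) (A (i - 1) (A i u)) = x \<odot>\<^bsub>Q (b (i - 1))\<^esub> q (b (i - 1)) (s u))" for i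
  proof -
    obtain k where "k \<in> Lin R (b (i + 1)) (b (i - 1))"
      "\<And>u. u \<in> vecs R (b (i + 1)) \<Longrightarrow> q (b (i - 1)) (A (i - 1) (A i u)) = x \<odot>\<^bsub>Q (b (i - 1))\<^esub> q (b (i - 1)) (k u)"
      by (rule divide_hom[OF mod_hom_comp[OF T(1)[of i] T'[of i]]]) (erule AA, rule that)
    then show ?thesis by blast
  qed
  then obtain s where s: "\<And>i. s i \<in> Lin R (b (i + 1)) (b (i - 1))"
    and qs: "\<And>i u. u \<in> vecs R (b (i + 1)) \<Longrightarrow>
      q (b (i - 1)) (A (i - 1) (A i u)) = x \<odot>\<^bsub>Q (b (i - 1))\<^esub> q (b (i - 1)) (s i u)" by metis
  have s1: "s (i + 1) \<in> Lin R (b (i + 1 + 1)) (b i)" for i using s[of "i + 1"] by simp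
  have qs1: "q (b i) (A i (A (i + 1) u)) = x \<odot>\<^bsub>Q (b i)\<^esub> q (b i) (s (i + 1) u)"
    if "u \<in> vecs R (b (i + 1 + 1))" for i u using qs[of u "i + 1"] that by simp
  define D where "D i = block_map R x (b (i + 1)) (b i) (b (i - 1)) (A i) (A (i - 1)) (s i)" for i
  have D1: "D (i + 1) = block_map R x (b (i + 1 + 1)) (b (i + 1)) (b i) (A (i + 1)) (A i) (s (i + 1))" for i
    by (simp add: D_def)
  \<comment> \<open>The hypotheses of the single-block lemmas with a0, a1, a2 = A (i + 1), A i, A (i
    - 1), in the order in which they are discharged.\<close>
  note ctx = T(1) T(1) T' s1 s qs1 qs
  have Dh: "D i \<in> Lin R (b (i + 1) + b i) (b i + b (i - 1))" for i
    unfolding D_def by (rule block_map_hom[OF T(1) T' s])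
  have Dh1: "D (i + 1) \<in> Lin R (b (i + 1 + 1) + b (i + 1)) (b (i + 1) + b i)" for i
    using Dh[of "i + 1"] by simp
  have dh: "(\<lambda>w. A i (vec_fst (b (i + 1)) w) \<oplus>\<^bsub>F (b i)\<^esub> x \<odot>\<^bsub>F (b i)\<^esub> vec_snd (b (i + 1)) (b i) w)
      \<in> Lin R (b (i + 1) + b i) (b i)" for i by (rule block_d_hom[OF ctx])
  have cong: "h w \<in> ideal_vecs I m" if h: "h \<in> Lin R n m" and w: "w \<in> vecs R n" "v \<in> vecs R n"
    and wv: "w \<ominus>\<^bsub>F n\<^esub> v \<in> ideal_vecs I n" and hv: "h v \<in> ideal_vecs I m" for h w v n m
  proof -
    have "q m (h w) = q m (h v)" using q_cong[OF h w] q_eq[OF w] wv by blast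
    then show ?thesis using q_zero[OF mod_hom_closed[OF h w(1)]] q_zero[OF mod_hom_closed[OF h w(2)]] hv by simp
  qed
  have exd: "(A i (vec_fst (b (i + 1)) w) \<oplus>\<^bsub>F (b i)\<^esub> x \<odot>\<^bsub>F (b i)\<^esub> vec_snd (b (i + 1)) (b i) w \<in> ideal_vecs I (b i)) \<longleftrightarrow>
      (\<exists>w' \<in> vecs R (b (i + 1 + 1) + b (i + 1)). w \<ominus>\<^bsub>F (b (i + 1) + b i)\<^esub> D (i + 1) w' \<in> ideal_vecs I (b (i + 1) + b i))"
    if w: "w \<in> vecs R (b (i + 1) + b i)" for i w
  proof
    assume dw: "A i (vec_fst (b (i + 1)) w) \<oplus>\<^bsub>F (b i)\<^esub> x \<odot>\<^bsub>F (b i)\<^esub> vec_snd (b (i + 1)) (b i) w \<in> ideal_vecs I (b i)"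
    show "\<exists>w' \<in> vecs R (b (i + 1 + 1) + b (i + 1)). w \<ominus>\<^bsub>F (b (i + 1) + b i)\<^esub> D (i + 1) w' \<in> ideal_vecs I (b (i + 1) + b i)"
      unfolding D1 by (rule block_exact_d[OF ctx T(2) w dw])
  next
    assume "\<exists>w' \<in> vecs R (b (i + 1 + 1) + b (i + 1)). w \<ominus>\<^bsub>F (b (i + 1) + b i)\<^esub> D (i + 1) w' \<in> ideal_vecs I (b (i + 1) + b i)"
    then obtain w' where w': "w' \<in> vecs R (b (i + 1 + 1) + b (i + 1))"
      "w \<ominus>\<^bsub>F (b (i + 1) + b i)\<^esub> D (i + 1) w' \<in> ideal_vecs I (b (i + 1) + b i)" by blast
    show "A i (vec_fst (b (i + 1)) w) \<oplus>\<^bsub>F (b i)\<^esub> x \<odot>\<^bsub>F (b i)\<^esub> vec_snd (b (i + 1)) (b i) w \<in> ideal_vecs I (b i)"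
      by (rule cong[OF dh w mod_hom_closed[OF Dh1 w'(1)] w'(2)], unfold D1, rule block_d_D0[OF ctx w'(1)])
  qed
  have "totally_acyclic R I (\<lambda>i. b i + b (i - 1)) D"
    unfolding totally_acyclic_def add_diff_cancel_right'
  proof (intro conjI allI ballI impI)
    show "D i \<in> Lin R (b (i + 1) + b i) (b i + b (i - 1))" for i by (rule Dh)
  next
    fix i w assume w: "w \<in> vecs R (b (i + 1) + b i)"
    have p1: "vec_fst (b i) (D i w) = A i (vec_fst (b (i + 1)) w) \<oplus>\<^bsub>F (b i)\<^esub> x \<odot>\<^bsub>F (b i)\<^esub> vec_snd (b (i + 1)) (b i) w"
      unfolding D_def by (rule block_D1_parts(1)[OF ctx w])
    show "D i w \<in> ideal_vecs I (b i + b (i - 1)) \<longleftrightarrow> (\<exists>w' \<in> vecs R (b (i + 1 + 1) + b (i + 1)).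
        w \<ominus>\<^bsub>F (b (i + 1) + b i)\<^esub> D (i + 1) w' \<in> ideal_vecs I (b (i + 1) + b i))"
    proof
      assume "D i w \<in> ideal_vecs I (b i + b (i - 1))"
      then have "vec_fst (b i) (D i w) \<in> ideal_vecs I (b i)"
        using vec_split_ideal_vecs[OF mod_hom_closed[OF Dh w]] by blast
      then have "A i (vec_fst (b (i + 1)) w) \<oplus>\<^bsub>F (b i)\<^esub> x \<odot>\<^bsub>F (b i)\<^esub> vec_snd (b (i + 1)) (b i) w \<in> ideal_vecs I (b i)"
        unfolding p1 .
      then show "\<exists>w' \<in> vecs R (b (i + 1 + 1) + b (i + 1)). w \<ominus>\<^bsub>F (b (i + 1) + b i)\<^esub> D (i + 1) w' \<in> ideal_vecs I (b (i + 1) + b i)"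
        using exd[OF w] by blast
    next
      assume "\<exists>w' \<in> vecs R (b (i + 1 + 1) + b (i + 1)). w \<ominus>\<^bsub>F (b (i + 1) + b i)\<^esub> D (i + 1) w' \<in> ideal_vecs I (b (i + 1) + b i)"
      then obtain w' where w': "w' \<in> vecs R (b (i + 1 + 1) + b (i + 1))"
        "w \<ominus>\<^bsub>F (b (i + 1) + b i)\<^esub> D (i + 1) w' \<in> ideal_vecs I (b (i + 1) + b i)" by blast
      have "D i (D (i + 1) w') \<in> ideal_vecs I (b i + b (i - 1))"
        unfolding D1 unfolding D_def by (rule block_D1_D0[OF ctx w'(1)])
      then show "D i w \<in> ideal_vecs I (b i + b (i - 1))"
        by (rule cong[OF Dh w mod_hom_closed[OF Dh1 w'(1)] w'(2)])
    qed
  next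
    fix i f assume f: "f \<in> mod_hom R (F (b (i + 1) + b i)) (self_module R)"
      and fD: "\<forall>w \<in> vecs R (b (i + 1 + 1) + b (i + 1)). f (D (i + 1) w) \<in> I"
    have "\<exists>g \<in> mod_hom R (F (b i + b (i - 1))) (self_module R). \<forall>w \<in> vecs R (b (i + 1) + b i).
        f w \<ominus>\<^bsub>R\<^esub> g (block_map R x (b (i + 1)) (b i) (b (i - 1)) (A i) (A (i - 1)) (s i) w) \<in> I"
    proof (rule block_dual_exact[OF ctx _ f])
      show "f (block_map R x (b (i + 1 + 1)) (b (i + 1)) (b i) (A (i + 1)) (A i) (s (i + 1)) w) \<in> I"
        if "w \<in> vecs R (b (i + 1 + 1) + b (i + 1))" for w using fD that unfolding D1 by blast
      fix f2 assume "f2 \<in> mod_hom R (F (b i)) (self_module R)" "\<And>u. u \<in> vecs R (b (i + 1)) \<Longrightarrow> f2 (A i u) \<in> J"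
      then show "\<exists>g \<in> mod_hom R (F (b (i - 1))) (self_module R). \<forall>v \<in> vecs R (b i). f2 v \<ominus>\<^bsub>R\<^esub> g (A (i - 1) v) \<in> J"
        using T(4)[of f2 "i - 1"] by simp
    qed
    then show "\<exists>g \<in> mod_hom R (F (b i + b (i - 1))) (self_module R). \<forall>w \<in> vecs R (b (i + 1) + b i).
        f w \<ominus>\<^bsub>R\<^esub> g (D i w) \<in> I" unfolding D_def .
  qed
  then show thesis using that exd by blast
qed

end

subsection \<open>Cokernels of totally acyclic complexes\<close>

text \<open>W is the preimage of V under d, so d induces an injection F/W -> G/V; U is V plus the
  image of d, so G/U is its cokernel.\<close>

lemma quot_short_exact:
  assumes F: "module R F" and G: "module R G" and W: "submodule W R F" and V: "submodule V R G" and U: "submodule U R G"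
    and d: "d \<in> mod_hom R F G"
    and dW: "\<And>w. w \<in> carrier F \<Longrightarrow> d w \<in> V \<longleftrightarrow> w \<in> W"
    and dU: "\<And>g. g \<in> carrier G \<Longrightarrow> g \<in> U \<longleftrightarrow> (\<exists>w \<in> carrier F. g \<ominus>\<^bsub>G\<^esub> d w \<in> V)"
  shows "short_exact R (quot_module F W) (quot_module G V) (quot_module G U)"
proof -
  interpret F: module R F by fact
  interpret G: module R G by fact
  have dc: "d w \<in> carrier G" if "w \<in> carrier F" for w by (rule mod_hom_closed[OF d that])
  have "d ` W \<subseteq> V" using dW F.submoduleD(1)[OF W] by blast
  then obtain f where f: "f \<in> mod_hom R (quot_module F W) (quot_module G V)"
    "\<And>w. w \<in> carrier F \<Longrightarrow> f (mod_coset F W w) = mod_coset G V (d w)"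
    by (rule quot_module_hom[OF F W G V d]) (rule that)
  have VU: "V \<subseteq> U"
  proof
    fix v assume v: "v \<in> V"
    then have vc: "v \<in> carrier G" using G.submoduleD(1)[OF V] by blast
    have "v \<ominus>\<^bsub>G\<^esub> d \<zero>\<^bsub>F\<^esub> = v" using mod_hom_zero[OF F G d] vc by (simp add: a_minus_def G.a_inv_zero)
    then show "v \<in> U" using dU[OF vc] v by (metis F.M.zero_closed)
  qed
  then have "(\<lambda>x. x) ` V \<subseteq> U" by simp
  then obtain g where g: "g \<in> mod_hom R (quot_module G V) (quot_module G U)"
    "\<And>w. w \<in> carrier G \<Longrightarrow> g (mod_coset G V w) = mod_coset G U w"
    by (rule quot_module_hom[OF G V G U mod_hom_id]) (rule that)
  note zF = mod_coset_eq_zero_iff[OF F W] and zV = mod_coset_eq_zero_iff[OF G V] and zU = mod_coset_eq_zero_iff[OF G U]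
  have car: "carrier (quot_module M N) = mod_coset M N ` carrier M" for M :: "('a, 'b, 'c) module_scheme" and N
    by (simp add: quot_module_def)
  have carF: "\<exists>w \<in> carrier F. y = mod_coset F W w" if "y \<in> carrier (quot_module F W)" for y
    using that by (auto simp: quot_module_def)
  have carV: "\<exists>w \<in> carrier G. y = mod_coset G V w" if "y \<in> carrier (quot_module G V)" for y
    using that by (auto simp: quot_module_def)
  have carU: "\<exists>w \<in> carrier G. y = mod_coset G U w" if "y \<in> carrier (quot_module G U)" for y
    using that by (auto simp: quot_module_def)
  have clF: "mod_coset F W w \<in> carrier (quot_module F W)" if "w \<in> carrier F" for w
    using that by (auto simp: quot_module_def)
  have clV: "mod_coset G V w \<in> carrier (quot_module G V)" if "w \<in> carrier G" for w
    using that by (auto simp: quot_module_def)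
  have dUm: "d w \<in> U" if "w \<in> carrier F" for w
  proof -
    have "d w \<ominus>\<^bsub>G\<^esub> d w \<in> V" using G.minus_eq_zero_iff[OF dc[OF that] dc[OF that]] G.submoduleD(2)[OF V] by simp
    then show ?thesis using dU[OF dc[OF that]] that by blast
  qed
  show ?thesis
  proof (rule short_exactI[OF f(1) g(1)])
    show "inj_on f (carrier (quot_module F W))"
      unfolding inj_on_iff_kernel[OF quot_module[OF F W] quot_module[OF G V] f(1)]
    proof (intro ballI impI)
      fix y assume "y \<in> carrier (quot_module F W)" and 0: "f y = \<zero>\<^bsub>quot_module G V\<^esub>"
      then obtain w where w: "w \<in> carrier F" "y = mod_coset F W w" using carF by blast
      then show "y = \<zero>\<^bsub>quot_module F W\<^esub>" using 0 f(2)[OF w(1)] zV[OF dc[OF w(1)]] dW[OF w(1)] zF[OF w(1)] by simp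
    qed
    fix y assume "y \<in> carrier (quot_module F W)"
    then obtain w where w: "w \<in> carrier F" "y = mod_coset F W w" using carF by blast
    show "g (f y) = \<zero>\<^bsub>quot_module G U\<^esub>"
      unfolding w(2) f(2)[OF w(1)] g(2)[OF dc[OF w(1)]] using zU[OF dc[OF w(1)]] dUm[OF w(1)] by blast
  next
    fix y assume "y \<in> carrier (quot_module G V)" and 0: "g y = \<zero>\<^bsub>quot_module G U\<^esub>"
    then obtain z where z: "z \<in> carrier G" "y = mod_coset G V z" using carV by blast
    then have "z \<in> U" using 0 g(2)[OF z(1)] zU[OF z(1)] by simp
    then obtain w where w: "w \<in> carrier F" "z \<ominus>\<^bsub>G\<^esub> d w \<in> V" using dU[OF z(1)] by blast
    have "f (mod_coset F W w) = y"
      unfolding f(2)[OF w(1)] z(2) using mod_coset_eq_iff[OF G V z(1) dc[OF w(1)]] w(2) by simp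
    then show "\<exists>x \<in> carrier (quot_module F W). f x = y" using clF[OF w(1)] by blast
  next
    fix y assume "y \<in> carrier (quot_module G U)"
    then obtain z where z: "z \<in> carrier G" "y = mod_coset G U z" using carU by blast
    then show "\<exists>x \<in> carrier (quot_module G V). g x = y" using clV[OF z(1)] g(2)[OF z(1)] by blast
  qed
qed

text \<open>The sum U + V, written as a congruence modulo V because that is the form in which
  members arise.\<close>

definition sum_submodule :: "('a, 'b, 'm) module_scheme \<Rightarrow> 'b set \<Rightarrow> 'b set \<Rightarrow> 'b set" where
  "sum_submodule M U V = {y \<in> carrier M. \<exists>u \<in> U. y \<ominus>\<^bsub>M\<^esub> u \<in> V}"

lemma sum_submodule:
  assumes M: "module R M" and U: "submodule U R M" and V: "submodule V R M"
  shows "submodule (sum_submodule M U V) R M"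
proof -
  interpret M: module R M by fact
  note u = M.submoduleD[OF U] and v = M.submoduleD[OF V]
  show ?thesis
  proof (rule M.submoduleI_minus)
    show "\<zero>\<^bsub>M\<^esub> \<in> sum_submodule M U V"
      using u(2) v(2) by (auto simp: sum_submodule_def a_minus_def M.a_inv_zero intro!: bexI[of _ "\<zero>\<^bsub>M\<^esub>"])
  next
    fix x y assume "x \<in> sum_submodule M U V" "y \<in> sum_submodule M U V"
    then obtain a b where *: "x \<in> carrier M" "y \<in> carrier M" "a \<in> U" "b \<in> U" "x \<ominus>\<^bsub>M\<^esub> a \<in> V" "y \<ominus>\<^bsub>M\<^esub> b \<in> V"
      by (auto simp: sum_submodule_def)
    have c: "a \<in> carrier M" "b \<in> carrier M" using * u(1) by auto
    have "(x \<oplus>\<^bsub>M\<^esub> y) \<ominus>\<^bsub>M\<^esub> (a \<oplus>\<^bsub>M\<^esub> b) = (x \<ominus>\<^bsub>M\<^esub> a) \<oplus>\<^bsub>M\<^esub> (y \<ominus>\<^bsub>M\<^esub> b)" using * c by algebra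
    then show "x \<oplus>\<^bsub>M\<^esub> y \<in> sum_submodule M U V"
      using * u(3) v(3) by (auto simp: sum_submodule_def intro!: bexI[of _ "a \<oplus>\<^bsub>M\<^esub> b"])
  next
    fix r x assume r: "r \<in> carrier R" and "x \<in> sum_submodule M U V"
    then obtain a where *: "x \<in> carrier M" "a \<in> U" "x \<ominus>\<^bsub>M\<^esub> a \<in> V"
      by (auto simp: sum_submodule_def)
    have c: "a \<in> carrier M" using * u(1) by auto
    have "(r \<odot>\<^bsub>M\<^esub> x) \<ominus>\<^bsub>M\<^esub> (r \<odot>\<^bsub>M\<^esub> a) = r \<odot>\<^bsub>M\<^esub> (x \<ominus>\<^bsub>M\<^esub> a)" using * c r by algebra
    then show "r \<odot>\<^bsub>M\<^esub> x \<in> sum_submodule M U V"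
      using * r u(6) v(6) by (auto simp: sum_submodule_def intro!: bexI[of _ "r \<odot>\<^bsub>M\<^esub> a"])
  qed (auto simp: sum_submodule_def)
qed

text \<open>The quotient of R^m by this submodule is the cokernel of A modulo I.\<close>

definition coker_submodule ::
  "('a, 'r) ring_scheme \<Rightarrow> 'a set \<Rightarrow> nat \<Rightarrow> nat \<Rightarrow> ((nat \<Rightarrow> 'a) \<Rightarrow> nat \<Rightarrow> 'a) \<Rightarrow> (nat \<Rightarrow> 'a) set"
where
  "coker_submodule R I n m A = sum_submodule (Free R m) (A ` vecs R n) (ideal_vecs I m)"

lemma coker_submodule_iff:
  "g \<in> vecs R m \<Longrightarrow> g \<in> coker_submodule R I n m A \<longleftrightarrow>
    (\<exists>w \<in> vecs R n. g \<ominus>\<^bsub>Free R m\<^esub> A w \<in> ideal_vecs I m)"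
  by (auto simp: coker_submodule_def sum_submodule_def)

lemma coker_submodule:
  assumes "cring R" "ideal I R" "A \<in> Lin R n m"
  shows "submodule (coker_submodule R I n m A) R (Free R m)" unfolding coker_submodule_def
  by (rule sum_submodule[OF Free[OF assms(1)]
      carrier_image_submodule[OF Free[OF assms(1)] Free[OF assms(1)] assms(3)] ideal_vecs_submodule[OF assms(1,2)]])

text \<open>The row (A i, x) maps onto A i R^n + x R^m, so modulo I its cokernel is the cokernel of
  \<open>A i\<close> modulo J. Its kernel is the image of D (i + 1). Thus the wanted module is the
  cokernel of an injection from a cokernel of the block complex into (R/I)^m.\<close>

lemma (in regular_step) has_ffr_coker_step:
  assumes t: "totally_acyclic R J b A"
    and free: "\<And>n. has_ffr R (quot_module (F n) (ideal_vecs I n))"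
    and IH: "\<And>b A i. totally_acyclic R I b A \<Longrightarrow>
      has_ffr R (quot_module (F (b i)) (coker_submodule R I (b (i + 1)) (b i) (A i)))"
  shows "has_ffr R (quot_module (F (b i)) (coker_submodule R J (b (i + 1)) (b i) (A i)))"
proof -
  note T = totally_acyclicD[OF t]
  obtain D where D: "totally_acyclic R I (\<lambda>i. b i + b (i - 1)) D"
    "\<And>i w. w \<in> vecs R (b (i + 1) + b i) \<Longrightarrow>
      (A i (vec_fst (b (i + 1)) w) \<oplus>\<^bsub>F (b i)\<^esub> x \<odot>\<^bsub>F (b i)\<^esub> vec_snd (b (i + 1)) (b i) w \<in> ideal_vecs I (b i)) \<longleftrightarrow>
      (\<exists>w' \<in> vecs R (b (i + 1 + 1) + b (i + 1)). w \<ominus>\<^bsub>F (b (i + 1) + b i)\<^esub> D (i + 1) w' \<in> ideal_vecs I (b (i + 1) + b i))"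
    by (rule totally_acyclic_block[OF t]) (rule that)
  let ?n = "b (i + 1)" and ?m = "b i"
  have Dh: "D (i + 1) \<in> Lin R (b (i + 1 + 1) + ?n) (?n + ?m)"
    using totally_acyclicD(1)[OF D(1), of "i + 1"] unfolding add_diff_cancel_right' .
  let ?W = "coker_submodule R I (b (i + 1 + 1) + ?n) (?n + ?m) (D (i + 1))"
  have W: "submodule ?W R (F (?n + ?m))" by (rule coker_submodule[OF R I Dh])
  have U: "submodule (coker_submodule R J ?n ?m (A i)) R (F ?m)" by (rule coker_submodule[OF R J T(1)])
  define d where "d w = A i (vec_fst ?n w) \<oplus>\<^bsub>F ?m\<^esub> x \<odot>\<^bsub>F ?m\<^esub> vec_snd ?n ?m w" for w
  have d: "d \<in> Lin R (?n + ?m) ?m" unfolding d_def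
    by (rule mod_hom_plus[OF FM mod_hom_comp[OF vec_fst_hom T(1)] mod_hom_scale[OF FM vec_snd_hom x]])
  have "short_exact R (quot_module (F (?n + ?m)) ?W) (Q ?m) (quot_module (F ?m) (coker_submodule R J ?n ?m (A i)))"
  proof (rule quot_short_exact[OF FM FM W IV U d])
    fix w assume w: "w \<in> vecs R (?n + ?m)"
    show "d w \<in> ideal_vecs I ?m \<longleftrightarrow> w \<in> ?W" unfolding coker_submodule_iff[OF w] d_def by (rule D(2)[OF w])
  next
    fix g assume g: "g \<in> vecs R ?m"
    interpret Fm: module R "F ?m" by (rule FM)
    interpret Qm: module R "Q ?m" by (rule QM)
    have key: "g \<ominus>\<^bsub>F ?m\<^esub> A i u \<in> ideal_vecs J ?m \<longleftrightarrow> (\<exists>v \<in> vecs R ?m. g \<ominus>\<^bsub>F ?m\<^esub> d (vec_join ?n ?m u v) \<in> ideal_vecs I ?m)"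
      if u: "u \<in> vecs R ?n" for u
    proof -
      have Au: "A i u \<in> vecs R ?m" by (rule mod_hom_closed[OF T(1) u])
      have gA: "g \<ominus>\<^bsub>F ?m\<^esub> A i u \<in> vecs R ?m" using g Au by simp
      have "g \<ominus>\<^bsub>F ?m\<^esub> d (vec_join ?n ?m u v) \<in> ideal_vecs I ?m \<longleftrightarrow>
          q ?m (g \<ominus>\<^bsub>F ?m\<^esub> A i u) = x \<odot>\<^bsub>Q ?m\<^esub> q ?m v" if v: "v \<in> vecs R ?m" for v
      proof -
        have xv: "x \<odot>\<^bsub>F ?m\<^esub> v \<in> vecs R ?m" using v x by simp
        have "g \<ominus>\<^bsub>F ?m\<^esub> d (vec_join ?n ?m u v) = (g \<ominus>\<^bsub>F ?m\<^esub> A i u) \<ominus>\<^bsub>F ?m\<^esub> x \<odot>\<^bsub>F ?m\<^esub> v"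
          unfolding d_def vec_fst_join[OF u] vec_snd_join[OF v] using g Au xv by algebra
        then show ?thesis using q_eq[OF gA xv] mod_hom_smult[OF q_hom x v] by simp
      qed
      then show ?thesis using q_J_iff[OF gA] by blast
    qed
    show "g \<in> coker_submodule R J ?n ?m (A i) \<longleftrightarrow> (\<exists>w \<in> vecs R (?n + ?m). g \<ominus>\<^bsub>F ?m\<^esub> d w \<in> ideal_vecs I ?m)"
      unfolding coker_submodule_iff[OF g]
    proof
      assume "\<exists>w \<in> vecs R ?n. g \<ominus>\<^bsub>F ?m\<^esub> A i w \<in> ideal_vecs J ?m"
      then obtain u v where "u \<in> vecs R ?n" "v \<in> vecs R ?m" "g \<ominus>\<^bsub>F ?m\<^esub> d (vec_join ?n ?m u v) \<in> ideal_vecs I ?m"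
        using key by blast
      then show "\<exists>w \<in> vecs R (?n + ?m). g \<ominus>\<^bsub>F ?m\<^esub> d w \<in> ideal_vecs I ?m" using vec_join_closed by blast
    next
      assume "\<exists>w \<in> vecs R (?n + ?m). g \<ominus>\<^bsub>F ?m\<^esub> d w \<in> ideal_vecs I ?m"
      then obtain w where w: "w \<in> vecs R (?n + ?m)" "g \<ominus>\<^bsub>F ?m\<^esub> d w \<in> ideal_vecs I ?m" by blast
      obtain u v where "u \<in> vecs R ?n" "v \<in> vecs R ?m" "w = vec_join ?n ?m u v" by (rule vec_join_surj[OF w(1)])
      then show "\<exists>w \<in> vecs R ?n. g \<ominus>\<^bsub>F ?m\<^esub> A i w \<in> ideal_vecs J ?m" using key w(2) by blast
    qed
  qed
  moreover have "has_ffr R (quot_module (F (?n + ?m)) ?W)"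
    using IH[OF D(1), of "i + 1"] unfolding add_diff_cancel_right' .
  ultimately show ?thesis
    using has_ffr_cokernel[OF quot_module[OF FM W] QM quot_module[OF FM U]] free by blast
qed

subsection \<open>Quotients of local rings\<close>

context ring_quotient begin

lemma vimage_ideal:
  assumes "ideal K S" shows "ideal {r \<in> carrier R. cl r \<in> K} R"
proof -
  interpret T: module S "self_module S" by (rule S.self_mod)
  interpret TR: module R "rs (self_module S)" by (rule restrict_scalars_module[OF S.self_mod])
  have K: "submodule K S (self_module S)" using submodule_self_iff_ideal[OF S] assms by blast
  note k = T.submoduleD[OF K]
  have "submodule K R (rs (self_module S))"
    by (rule TR.submoduleI_minus) (use k(1,2,3) k(6)[OF cl_closed] in auto)
  from vimage_submodule[OF R.self_mod restrict_scalars_module[OF S.self_mod] cl_mod_hom this]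
  show ?thesis using submodule_self_iff_ideal[OF R] by simp
qed

lemma image_ideal:
  assumes "ideal K R" shows "ideal (cl ` K) S"
proof -
  interpret T: module S "self_module S" by (rule S.self_mod)
  interpret TR: module R "rs (self_module S)" by (rule restrict_scalars_module[OF S.self_mod])
  have "submodule K R (self_module R)" using submodule_self_iff_ideal[OF R] assms by blast
  from image_submodule[OF R.self_mod restrict_scalars_module[OF S.self_mod] cl_mod_hom this]
  have K: "submodule (cl ` K) R (rs (self_module S))" .
  note k = TR.submoduleD[OF K]
  have "submodule (cl ` K) S (self_module S)"
  proof (rule T.submoduleI_minus)
    fix s y assume s: "s \<in> carrier S" and y: "y \<in> cl ` K"
    obtain r where "r \<in> carrier R" "s = cl r" by (rule cl_preimage[OF s])
    then show "s \<odot>\<^bsub>self_module S\<^esub> y \<in> cl ` K" using k(6)[OF _ y] by simp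
  qed (use k(1,2,3) in auto)
  then show ?thesis using submodule_self_iff_ideal[OF S] by blast
qed

lemma noetherian_quotient:
  assumes "noetherian_ring R" shows "noetherian_ring S"
proof (rule S.noetherian_ringI)
  fix K assume K: "ideal K S"
  obtain A where A: "A \<subseteq> carrier R" "finite A" "{r \<in> carrier R. cl r \<in> K} = Idl\<^bsub>R\<^esub> A"
    using noetherian_ring.finetely_gen[OF assms vimage_ideal[OF K]] by blast
  have cA: "cl ` A \<subseteq> carrier S" using A(1) cl_closed by blast
  have "K = Idl\<^bsub>S\<^esub> (cl ` A)"
  proof
    have "cl ` A \<subseteq> K" using R.genideal_self[OF A(1)] A(3) by blast
    then show "Idl\<^bsub>S\<^esub> (cl ` A) \<subseteq> K" by (rule S.genideal_minimal[OF K])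
    have "A \<subseteq> {r \<in> carrier R. cl r \<in> Idl\<^bsub>S\<^esub> (cl ` A)}"
      using A(1) S.genideal_self[OF cA] by blast
    from R.genideal_minimal[OF vimage_ideal[OF S.genideal_ideal[OF cA]] this]
    have *: "r \<in> carrier R \<Longrightarrow> cl r \<in> K \<Longrightarrow> cl r \<in> Idl\<^bsub>S\<^esub> (cl ` A)" for r
      unfolding A(3)[symmetric] by blast
    show "K \<subseteq> Idl\<^bsub>S\<^esub> (cl ` A)"
    proof
      fix s assume s: "s \<in> K"
      then have "s \<in> carrier S" using ideal_facts(1)[OF K] by blast
      then obtain r where "r \<in> carrier R" "s = cl r" by (rule cl_preimage)
      then show "s \<in> Idl\<^bsub>S\<^esub> (cl ` A)" using * s by blast
    qed
  qed
  then show "\<exists>A \<subseteq> carrier S. finite A \<and> K = Idl\<^bsub>S\<^esub> A" using cA A(2) by blast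
qed

text \<open>A preimage of an element of a proper ideal of S cannot be a unit, so it lies in the
  maximal ideal of R. Hence every proper ideal of S lies in the image of that ideal.\<close>

lemma local_quotient:
  assumes loc: "local_ring R" and Im: "I \<subseteq> max_ideal R"
  shows "local_ring S" "max_ideal S = cl ` max_ideal R"
proof -
  note m = max_ideal_ideal[OF loc]
  let ?m = "cl ` max_ideal R"
  have mS: "ideal ?m S" by (rule image_ideal[OF m])
  have one: "\<one>\<^bsub>S\<^esub> \<notin> ?m"
  proof
    assume "\<one>\<^bsub>S\<^esub> \<in> ?m"
    then obtain r where r: "r \<in> max_ideal R" "cl \<one>\<^bsub>R\<^esub> = cl r" using cl_one by auto
    have rc: "r \<in> carrier R" using r(1) ideal_facts(1)[OF m] by blast
    have "\<one>\<^bsub>R\<^esub> \<ominus>\<^bsub>R\<^esub> r \<in> max_ideal R" using cl_eq_iff[of "\<one>\<^bsub>R\<^esub>" r] rc r(2) Im by auto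
    then have "(\<one>\<^bsub>R\<^esub> \<ominus>\<^bsub>R\<^esub> r) \<oplus>\<^bsub>R\<^esub> r \<in> max_ideal R" using ideal_facts(3)[OF m] r(1) by blast
    moreover have "(\<one>\<^bsub>R\<^esub> \<ominus>\<^bsub>R\<^esub> r) \<oplus>\<^bsub>R\<^esub> r = \<one>\<^bsub>R\<^esub>" using rc by algebra
    ultimately show False using one_notin_max_ideal[OF loc] by simp
  qed
  have sub: "K \<subseteq> ?m" if K: "ideal K S" "K \<noteq> carrier S" for K
  proof
    fix s assume s: "s \<in> K"
    then have "s \<in> carrier S" using ideal_facts(1)[OF K(1)] by blast
    then obtain r where r: "r \<in> carrier R" "s = cl r" by (rule cl_preimage)
    have "r \<notin> Units R"
    proof
      assume u: "r \<in> Units R"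
      have "cl r \<otimes>\<^bsub>S\<^esub> cl (inv\<^bsub>R\<^esub> r) = \<one>\<^bsub>S\<^esub>" "cl (inv\<^bsub>R\<^esub> r) \<otimes>\<^bsub>S\<^esub> cl r = \<one>\<^bsub>S\<^esub>"
        using u cl_mult[of r "inv\<^bsub>R\<^esub> r"] cl_mult[of "inv\<^bsub>R\<^esub> r" r] cl_one r(1) by simp_all
      then have "s \<in> Units S" using cl_closed[of r] cl_closed[of "inv\<^bsub>R\<^esub> r"] u r by (auto simp: Units_def)
      then show False using S.unit_in_ideal[OF K(1) s] K(2) by blast
    qed
    then show "s \<in> ?m" using nonunit_in_max_ideal[OF loc r(1)] r(2) by blast
  qed
  have mne: "?m \<noteq> carrier S" using one S.one_closed by blast
  have max: "maximalideal ?m S"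
  proof (rule maximalidealI[OF mS])
    show "carrier S \<noteq> ?m" using mne by blast
    fix K assume K: "ideal K S" "?m \<subseteq> K" "K \<subseteq> carrier S"
    show "K = ?m \<or> K = carrier S" using sub[OF K(1)] K(2) by blast
  qed
  have uniq: "K = ?m" if K: "maximalideal K S" for K
  proof -
    have Ki: "ideal K S" "K \<noteq> carrier S" using K maximalideal.axioms(1) maximalideal.I_notcarr by blast+
    have "?m = K \<or> ?m = carrier S"
      using maximalideal.I_maximal[OF K mS sub[OF Ki]] ideal_facts(1)[OF mS] by blast
    then show ?thesis using mne by blast
  qed
  show "local_ring S" unfolding local_ring_def
    using S noetherian_quotient[OF local_ring_noetherian[OF loc]] max uniq by blast
  show "max_ideal S = ?m" unfolding max_ideal_def[of S]
    by (rule the_equality[where P = "\<lambda>K. maximalideal K S", OF max uniq])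
qed

end

subsection \<open>Regular sequences\<close>

locale G_regular_quotient =
  fixes R :: "('a, 'r) ring_scheme" and xs :: "'a list" and S :: "'a set ring"
  assumes loc: "local_ring R" and Greg: "G_regular R" and xm: "set xs \<subseteq> max_ideal R"
    and xreg: "regular_sequence R xs" and S_eq: "S = R Quot (Idl\<^bsub>R\<^esub> (set xs))"
begin

lemma cR: "cring R" by (rule local_ring_cring[OF loc])

sublocale cring R by (rule cR)

text \<open>Indices of \<open>xs\<close> start at 0: \<open>Ik k\<close> is (x_1, ..., x_k), and
  \<open>xs ! k\<close> is the next element x_{k+1}.\<close>

definition Ik :: "nat \<Rightarrow> 'a set" where "Ik k = Idl\<^bsub>R\<^esub> (set (take k xs))"

lemma xc: "set xs \<subseteq> carrier R" using xreg by (simp add: regular_sequence_def)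

lemma xkc: "set (take k xs) \<subseteq> carrier R" using xc set_take_subset by fast

lemma Ik_ideal: "ideal (Ik k) R" unfolding Ik_def by (rule genideal_ideal[OF xkc])

lemma Ik_0: "Ik 0 = {\<zero>\<^bsub>R\<^esub>}"
proof
  show "Ik 0 \<subseteq> {\<zero>\<^bsub>R\<^esub>}" unfolding Ik_def by (rule genideal_minimal[OF zeroideal]) simp
  show "{\<zero>\<^bsub>R\<^esub>} \<subseteq> Ik 0" using ideal_facts(2)[OF Ik_ideal[of 0]] by simp
qed

lemma Ik_length: "Ik (length xs) = Idl\<^bsub>R\<^esub> (set xs)" by (simp add: Ik_def)

lemma Ik_max: "Ik k \<subseteq> max_ideal R"
  unfolding Ik_def
  by (rule genideal_minimal[OF max_ideal_ideal[OF loc]]) (rule subset_trans[OF set_take_subset xm])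

lemma regular_step: "k < length xs \<Longrightarrow> regular_step R (Ik k) (Ik (Suc k)) (xs ! k)"
proof (rule regular_step.intro[OF cR Ik_ideal Ik_ideal])
  assume k: "k < length xs"
  have x: "xs ! k \<in> carrier R" using k xc nth_mem by blast
  show "xs ! k \<in> carrier R" by (rule x)
  have t: "set (take (Suc k) xs) = insert (xs ! k) (set (take k xs))"
    using k by (simp add: take_Suc_conv_app_nth)
  show IJ: "Ik k \<subseteq> Ik (Suc k)" unfolding Ik_def t
    using genideal_self[OF xkc[of "Suc k"]] unfolding t
    by (intro genideal_minimal[OF genideal_ideal]) (use xkc[of k] x in auto)
  show "xs ! k \<in> Ik (Suc k)" unfolding Ik_def using genideal_self[OF xkc[of "Suc k"]] t by blast
  have Q: "ring_quotient R (Ik k) (R Quot (Ik k))" by (rule ring_quotient.intro[OF cR Ik_ideal refl])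
  interpret Q: ring_quotient R "Ik k" "R Quot (Ik k)" by (rule Q)
  interpret T: module R "self_module R" by (rule self_mod)
  have I: "submodule (Ik k) R (self_module R)" using submodule_self_iff_ideal[OF cR] Ik_ideal by blast
  have "(\<lambda>y. xs ! k \<odot>\<^bsub>self_module R\<^esub> y) \<in> mod_hom R (self_module R) (self_module R)"
    by (rule mod_hom_scale[OF self_mod mod_hom_id x])
  from sum_submodule[OF self_mod carrier_image_submodule[OF self_mod self_mod this] I]
  \<comment> \<open>The set of all y congruent to a multiple of x_{k+1} modulo \<open>Ik k\<close>
    is an ideal that contains the generators of \<open>Ik (Suc k)\<close>.\<close>
  have J: "ideal (sum_submodule (self_module R) ((\<lambda>y. xs ! k \<otimes>\<^bsub>R\<^esub> y) ` carrier R) (Ik k)) R"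
    using submodule_self_iff_ideal[OF cR] by simp
  have "set (take (Suc k) xs) \<subseteq> sum_submodule (self_module R) ((\<lambda>y. xs ! k \<otimes>\<^bsub>R\<^esub> y) ` carrier R) (Ik k)"
  proof
    fix a assume a: "a \<in> set (take (Suc k) xs)"
    then have ac: "a \<in> carrier R" using xkc by blast
    show "a \<in> sum_submodule (self_module R) ((\<lambda>y. xs ! k \<otimes>\<^bsub>R\<^esub> y) ` carrier R) (Ik k)"
    proof (cases "a = xs ! k")
      case True
      have "a \<ominus>\<^bsub>R\<^esub> xs ! k \<otimes>\<^bsub>R\<^esub> \<one>\<^bsub>R\<^esub> = \<zero>\<^bsub>R\<^esub>" using True x by (simp add: a_minus_def r_neg)
      then have "a \<ominus>\<^bsub>R\<^esub> xs ! k \<otimes>\<^bsub>R\<^esub> \<one>\<^bsub>R\<^esub> \<in> Ik k" using ideal_facts(2)[OF Ik_ideal] by simp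
      then show ?thesis using ac unfolding sum_submodule_def by (auto intro!: bexI[of _ "\<one>\<^bsub>R\<^esub>"])
    next
      case False
      then have "a \<in> set (take k xs)" using a t by blast
      then have "a \<in> Ik k" unfolding Ik_def using genideal_self[OF xkc[of k]] by blast
      moreover have "a \<ominus>\<^bsub>R\<^esub> xs ! k \<otimes>\<^bsub>R\<^esub> \<zero>\<^bsub>R\<^esub> = a" using ac x by (simp add: a_minus_def)
      ultimately show ?thesis using ac unfolding sum_submodule_def by (auto intro!: bexI[of _ "\<zero>\<^bsub>R\<^esub>"])
    qed
  qed
  from genideal_minimal[OF J this]
  show "\<exists>y \<in> carrier R. r \<ominus>\<^bsub>R\<^esub> xs ! k \<otimes>\<^bsub>R\<^esub> y \<in> Ik k" if "r \<in> Ik (Suc k)" for r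
    using that unfolding Ik_def sum_submodule_def by auto
  have rs: "\<forall>y \<in> carrier (R Quot (Ik k)). Q.cl (xs ! k) \<otimes>\<^bsub>R Quot (Ik k)\<^esub> y = \<zero>\<^bsub>R Quot (Ik k)\<^esub> \<longrightarrow> y = \<zero>\<^bsub>R Quot (Ik k)\<^esub>"
    using xreg k unfolding regular_sequence_def Let_def Ik_def by blast
  fix r assume r: "r \<in> carrier R" "xs ! k \<otimes>\<^bsub>R\<^esub> r \<in> Ik k"
  have "Q.cl (xs ! k) \<otimes>\<^bsub>R Quot (Ik k)\<^esub> Q.cl r = \<zero>\<^bsub>R Quot (Ik k)\<^esub>"
    using Q.cl_mult[OF x r(1)] Q.cl_eq_zero_iff[of "xs ! k \<otimes>\<^bsub>R\<^esub> r"] r x by simp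
  then have "Q.cl r = \<zero>\<^bsub>R Quot (Ik k)\<^esub>" using rs Q.cl_closed[OF r(1)] by blast
  then show "r \<in> Ik k" using Q.cl_eq_zero_iff[OF r(1)] by blast
qed

lemma Ik_mono: "i \<le> k \<Longrightarrow> k \<le> length xs \<Longrightarrow> Ik i \<subseteq> Ik k"
proof (induction k)
  case (Suc k)
  show ?case
  proof (cases "i = Suc k")
    case False
    then have "Ik i \<subseteq> Ik k" using Suc by simp
    moreover have "Ik k \<subseteq> Ik (Suc k)" using regular_step.IJ[OF regular_step] Suc.prems by simp
    ultimately show ?thesis by blast
  qed simp
qed simp

sublocale Q: ring_quotient R "Ik (length xs)" S
  by (rule ring_quotient.intro[OF cR Ik_ideal]) (simp add: S_eq Ik_length)

lemma locS: "local_ring S" and max_ideal_S: "max_ideal S = Q.cl ` max_ideal R"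
  using Q.local_quotient[OF loc Ik_max] by auto

text \<open>Multiplication by x_{k+1} is injective on (R/I_k)^m with cokernel (R/I_{k+1})^m;
  iterating this replaces the Koszul complex.\<close>

lemma has_ffr_free_quotient:
  "k \<le> length xs \<Longrightarrow> has_ffr R (quot_module (Free R m) (ideal_vecs (Ik k) m))"
proof (induction k)
  case 0
  show ?case unfolding Ik_0 ideal_vecs_zero[of R]
    by (rule has_ffr_iso[OF free_mod quot_module[OF free_mod] isomorphic_modulesI[OF quot_zero_iso[OF free_mod]] has_ffr_free[OF cR]])
      (rule module.zero_submodule[OF free_mod])
next
  case (Suc k)
  then have k: "k < length xs" by simp
  interpret st: regular_step R "Ik k" "Ik (Suc k)" "xs ! k" by (rule regular_step[OF k])
  interpret F: module R "Free R m" by (rule free_mod)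
  note J = ideal_vecs_submodule[OF cR Ik_ideal]
  have "short_exact R (st.Q m) (st.Q m) (quot_module (Free R m) (ideal_vecs (Ik (Suc k)) m))"
  proof (rule quot_short_exact[OF free_mod free_mod st.IV st.IV J mod_hom_scale[OF free_mod mod_hom_id st.x]])
    fix w assume w: "w \<in> vecs R m"
    show "xs ! k \<odot>\<^bsub>Free R m\<^esub> w \<in> ideal_vecs (Ik k) m \<longleftrightarrow> w \<in> ideal_vecs (Ik k) m"
      using F.submoduleD(6)[OF st.IV st.x] st.q_reg[OF w] mod_hom_smult[OF st.q_hom st.x w]
        st.q_zero[OF w] st.q_zero[of "xs ! k \<odot>\<^bsub>Free R m\<^esub> w" m] w st.x by auto
    have xv: "xs ! k \<odot>\<^bsub>Free R m\<^esub> v \<in> vecs R m" if "v \<in> vecs R m" for v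
      using that st.x by simp
    show "w \<in> ideal_vecs (Ik (Suc k)) m \<longleftrightarrow> (\<exists>v \<in> vecs R m.
        w \<ominus>\<^bsub>Free R m\<^esub> xs ! k \<odot>\<^bsub>Free R m\<^esub> v \<in> ideal_vecs (Ik k) m)"
      unfolding st.q_J_iff[OF w]
      by (rule bex_cong[OF refl]) (use st.q_eq[OF w xv] mod_hom_smult[OF st.q_hom st.x] in simp)
  qed
  then show ?case using has_ffr_cokernel[OF st.QM st.QM quot_module[OF free_mod J]] Suc by simp
qed

subsection \<open>Finite Gorenstein dimension over the quotient\<close>

lemma totally_acyclic_shift:
  "totally_acyclic R' I b A \<Longrightarrow> totally_acyclic R' I (\<lambda>k. b (k + c)) (\<lambda>k. A (k + c))"
proof -
  assume t: "totally_acyclic R' I b A"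
  have e: "\<And>i::int. i + 1 + c = i + c + 1" by simp
  show ?thesis unfolding totally_acyclic_def e using t unfolding totally_acyclic_def by blast
qed

text \<open>The cokernel of \<open>A i\<close> embeds into the next term as the image of A (i - 1),
  so it is totally reflexive, after a shift that brings this image to position 0. It has G-dimension
  0, and G-regularity of R applies.\<close>

lemma has_ffr_coker_zero:
  assumes t: "totally_acyclic R {\<zero>\<^bsub>R\<^esub>} b A"
  shows "has_ffr R (quot_module (Free R (b i)) (coker_submodule R {\<zero>\<^bsub>R\<^esub>} (b (i + 1)) (b i) (A i)))"
    (is "has_ffr R ?Y")
proof -
  note T = totally_acyclicD[OF t]
  let ?W = "coker_submodule R {\<zero>\<^bsub>R\<^esub>} (b (i + 1)) (b i) (A i)"
  have W: "submodule ?W R (Free R (b i))" by (rule coker_submodule[OF cR zeroideal T(1)])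
  have Y: "module R ?Y" by (rule quot_module[OF free_mod W])
  note p = mod_coset_hom[OF free_mod W] mod_coset_surj[OF free_mod W]
  have Am: "A (i - 1) \<in> Lin R (b i) (b (i - 1))" using T(1)[of "i - 1"] by simp
  have ker: "A (i - 1) u = \<zero>\<^bsub>Free R (b (i - 1))\<^esub> \<longleftrightarrow> u \<in> ?W" if u: "u \<in> vecs R (b i)" for u
  proof -
    have "A (i - 1) u \<in> ideal_vecs {\<zero>\<^bsub>R\<^esub>} (b (i - 1)) \<longleftrightarrow> u \<in> ?W"
      unfolding coker_submodule_iff[OF u] using T(2)[of u "i - 1"] T(3)[of u "i - 1"] u by auto
    then show ?thesis unfolding ideal_vecs_zero[of R] by simp
  qed
  obtain j where j: "j \<in> mod_hom R ?Y (Free R (b (i - 1)))"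
    "\<And>u. u \<in> vecs R (b i) \<Longrightarrow> j (mod_coset (Free R (b i)) ?W u) = A (i - 1) u"
    using mod_hom_factor_surj[OF free_mod Y free_mod p Am] ker mod_coset_eq_zero_iff[OF free_mod W] by blast
  have inj: "inj_on j (carrier ?Y)" unfolding inj_on_iff_kernel[OF Y free_mod j(1)]
  proof (intro ballI impI)
    fix y assume "y \<in> carrier ?Y" and 0: "j y = \<zero>\<^bsub>Free R (b (i - 1))\<^esub>"
    then obtain u where u: "u \<in> vecs R (b i)" "y = mod_coset (Free R (b i)) ?W u" using p(2) by blast
    then show "y = \<zero>\<^bsub>?Y\<^esub>" using 0 j(2)[OF u(1)] ker[OF u(1)] mod_coset_eq_zero_iff[OF free_mod W u(1)] by simp
  qed
  have tr: "totally_reflexive R ?Y"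
  proof (rule totally_reflexive_of_totally_acyclic[OF cR totally_acyclic_shift[OF t, of "i - 1"] Y])
    show "mod_coset (Free R (b i)) ?W \<in> mod_hom R (Free R (b (1 + (i - 1)))) ?Y" using p(1) by simp
    show "mod_coset (Free R (b i)) ?W ` carrier (Free R (b (1 + (i - 1)))) = carrier ?Y" using p(2) by simp
    show "j \<in> mod_hom R ?Y (Free R (b (0 + (i - 1))))" using j(1) by simp
    show "inj_on j (carrier ?Y)" by (rule inj)
    show "j (mod_coset (Free R (b i)) ?W u) = A (0 + (i - 1)) u"
      if "u \<in> carrier (Free R (b (1 + (i - 1))))" for u using j(2)[of u] that by simp
  qed
  then have fg: "fg_module R ?Y" by (simp add: totally_reflexive_def)
  have "has_resolution_of_length R (totally_reflexive R) 0 ?Y"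
    by (rule has_resolution_of_length_0[where C = "totally_reflexive R", OF Y Y tr mod_iso_id])
  then have "G_dim R ?Y < \<infinity>" unfolding G_dim_def resolution_dim_finite_iff by blast
  then have "pd R ?Y < \<infinity>" using Greg fg unfolding G_regular_def by blast
  then show ?thesis by (rule has_ffr_of_finite_pd[OF loc Y])
qed

text \<open>Generalised over the complex and the index, because each step passes to the block
  complex and moves the index by one.\<close>

lemma has_ffr_coker:
  "k \<le> length xs \<Longrightarrow> totally_acyclic R (Ik k) b A \<Longrightarrow>
    has_ffr R (quot_module (Free R (b i)) (coker_submodule R (Ik k) (b (i + 1)) (b i) (A i)))"
proof (induction k arbitrary: b A i)
  case 0
  then show ?case unfolding Ik_0 by (intro has_ffr_coker_zero)
next
  case (Suc k)
  then have k: "k < length xs" by simp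
  interpret st: regular_step R "Ik k" "Ik (Suc k)" "xs ! k" by (rule regular_step[OF k])
  show ?case using st.has_ffr_coker_step[OF Suc.prems(2)] has_ffr_free_quotient Suc.IH k by simp
qed

text \<open>\<open>P\<close> is the cokernel of the differential into R^(b 1) modulo I_N: a vector
  maps to zero in \<open>P\<close> exactly when \<open>B 0\<close> sends it into I_N R^(b 0), and by
  exactness this means that it lies in the image of \<open>B 1\<close> modulo I_N.\<close>

lemma has_ffr_totally_reflexive:
  assumes tr: "totally_reflexive S P" shows "has_ffr R (Q.rs P)"
proof -
  have P: "module S P" using tr fg_module_module by (auto simp: totally_reflexive_def)
  obtain b A p where t: "totally_acyclic S {\<zero>\<^bsub>S\<^esub>} b A" and p: "p \<in> mod_hom S (Free S (b 1)) P"
    "p ` vecs S (b 1) = carrier P"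
    and pA: "\<And>u. u \<in> vecs S (b 1) \<Longrightarrow> p u = \<zero>\<^bsub>P\<^esub> \<longleftrightarrow> A 0 u = \<zero>\<^bsub>Free S (b 0)\<^esub>"
    by (rule totally_acyclic_of_totally_reflexive[OF Q.S tr]) (rule that)
  obtain B where B: "totally_acyclic R (Ik (length xs)) b B"
    "\<And>i u. u \<in> vecs R (b (i + 1)) \<Longrightarrow> Q.vc (b i) (B i u) = A i (Q.vc (b (i + 1)) u)"
    by (rule Q.totally_acyclic_lift[OF t]) (rule that)
  note T = totally_acyclicD[OF B(1)]
  have pR: "p \<in> mod_hom R (Q.rs (Free S (b 1))) (Q.rs P)" using p(1) by (simp add: Q.restrict_scalars_hom)
  let ?W = "coker_submodule R (Ik (length xs)) (b (1 + 1)) (b 1) (B 1)"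
  have W: "submodule ?W R (Free R (b 1))" by (rule coker_submodule[OF cR Ik_ideal T(1)])
  have PR: "module R (Q.rs P)" by (rule Q.restrict_scalars_module[OF P])
  have s: "(\<lambda>u. p (Q.vc (b 1) u)) ` vecs R (b 1) = carrier (Q.rs P)"
    using p(2) Q.vec_class_surj[of "b 1"] by (metis image_image restrict_scalars_simps(1))
  have k: "mod_coset (Free R (b 1)) ?W u = \<zero>\<^bsub>quot_module (Free R (b 1)) ?W\<^esub> \<longleftrightarrow>
      p (Q.vc (b 1) u) = \<zero>\<^bsub>Q.rs P\<^esub>" if u: "u \<in> vecs R (b 1)" for u
  proof -
    have u': "u \<in> vecs R (b (0 + 1))" using u by simp
    have "p (Q.vc (b 1) u) = \<zero>\<^bsub>P\<^esub> \<longleftrightarrow> Q.vc (b 0) (B 0 u) = \<zero>\<^bsub>Free S (b 0)\<^esub>"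
      using pA[OF Q.vec_class_closed[OF u]] B(2)[OF u'] by simp
    also have "\<dots> \<longleftrightarrow> B 0 u \<in> ideal_vecs (Ik (length xs)) (b 0)"
      by (rule Q.vec_class_eq_zero_iff[OF mod_hom_closed[OF T(1) u']])
    also have "\<dots> \<longleftrightarrow> u \<in> ?W" unfolding coker_submodule_iff[OF u] using T(2)[of u 0] T(3)[of u 0] u by auto
    finally show ?thesis using mod_coset_eq_zero_iff[OF free_mod W u] by simp
  qed
  obtain h where "h \<in> mod_iso R (quot_module (Free R (b 1)) ?W) (Q.rs P)"
    by (rule surj_same_kernel_iso[OF free_mod quot_module[OF free_mod W] PR mod_coset_hom[OF free_mod W]
      mod_coset_surj[OF free_mod W] mod_hom_comp[OF Q.vec_class_hom pR] s k])
  then show ?thesis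
    using has_ffr_iso[OF quot_module[OF free_mod W] PR isomorphic_modulesI] has_ffr_coker[OF order_refl B(1), of 1] by blast
qed

lemma has_ffr_finite_G_dim:
  fixes M :: "('a set, 'b, 'm) module_scheme"
  assumes M: "module S M" and G: "G_dim S M < \<infinity>" shows "has_ffr R (Q.rs M)"
proof -
  obtain n where "has_resolution_of_length S (totally_reflexive S) n M"
    using G unfolding G_dim_def resolution_dim_finite_iff by blast
  then obtain P :: "nat \<Rightarrow> 'a set fgmod" and d e where res: "resolution S P d e M"
    and tr: "\<forall>i\<le>n. totally_reflexive S (P i)" and z: "\<forall>i>n. carrier (P i) = {\<zero>\<^bsub>P i\<^esub>}"
    unfolding has_resolution_of_length_def by (elim exE conjE) (rule that)
  have PM: "module S (P i)" for i using res by (simp add: resolution_def)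
  have e: "e \<in> mod_hom S (P 0) M" "e ` carrier (P 0) = carrier M" using res by (auto simp: resolution_def)
  have f: "\<forall>i\<le>n. has_ffr R (Q.rs (P i))" using tr has_ffr_totally_reflexive by blast
  have z': "has_ffr R (Q.rs A)" if "module S A" "carrier A = {\<zero>\<^bsub>A\<^esub>}" for A :: "'a set fgmod"
    by (rule has_ffr_zero[OF Q.restrict_scalars_module[OF that(1)]]) (use that(2) in simp)
  have c': "has_ffr R (Q.rs C)" if "module S A" "module S B" "module S C" "short_exact S A B C"
    "has_ffr R (Q.rs A)" "has_ffr R (Q.rs B)" for A B C :: "'a set fgmod"
    by (rule has_ffr_cokernel[OF that(1-3)[THEN Q.restrict_scalars_module] Q.short_exact_restrict_scalars[OF that(4)] that(5,6)])
  note ind = resolution_kernel_induct[where F = "\<lambda>A. has_ffr R (Q.rs A)", OF M res z f]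
  have "has_ffr R (Q.rs (P 0))" "has_ffr R (Q.rs ((P 0)\<lparr>carrier := a_kernel (P 0) M e\<rparr>))"
    by (rule ind; (erule (1) z' | erule (5) c'))+
  then show ?thesis
    using has_ffr_cokernel[OF Q.restrict_scalars_module[OF kernel_record_module[OF PM M e(1)]] Q.restrict_scalars_module[OF PM]
      Q.restrict_scalars_module[OF M] Q.short_exact_restrict_scalars[OF short_exact_kernel[OF PM M e]]] by blast
qed

end

section \<open>Presentations over R on which the rest of the sequence is regular, and their base
  change to S\<close>

lemma (in module) mem_of_diff:
  "submodule H R M \<Longrightarrow> x \<ominus>\<^bsub>M\<^esub> y \<in> H \<Longrightarrow> y \<in> H \<Longrightarrow> x \<in> carrier M \<Longrightarrow> x \<in> H"
  using submodule_cong[of H x y] submoduleD(1)[of H] by blast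

lemma (in module) sum_submodule_left:
  assumes "submodule U R M" "submodule V R M" "u \<in> U" shows "u \<in> sum_submodule M U V"
proof -
  have u: "u \<in> carrier M" using submoduleD(1)[OF assms(1)] assms(3) by blast
  then have "u \<ominus>\<^bsub>M\<^esub> u = \<zero>\<^bsub>M\<^esub>" using minus_eq_zero_iff by blast
  then show ?thesis using u assms(3) submoduleD(2)[OF assms(2)] by (auto simp: sum_submodule_def intro!: bexI[of _ u])
qed

lemma (in module) sum_submodule_right:
  assumes "submodule U R M" "submodule V R M" "v \<in> V" shows "v \<in> sum_submodule M U V"
proof -
  have v: "v \<in> carrier M" using submoduleD(1)[OF assms(2)] assms(3) by blast
  then have "v \<ominus>\<^bsub>M\<^esub> \<zero>\<^bsub>M\<^esub> = v" by algebra
  then show ?thesis using v assms(3) submoduleD(2)[OF assms(1)] by (auto simp: sum_submodule_def intro!: bexI[of _ "\<zero>\<^bsub>M\<^esub>"])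
qed

lemma sum_submodule_mono: "V \<subseteq> V' \<Longrightarrow> sum_submodule M U V \<subseteq> sum_submodule M U V'"
  by (auto simp: sum_submodule_def)

context G_regular_quotient begin

abbreviation "N \<equiv> length xs"
abbreviation "F \<equiv> Free R"
abbreviation "IV k b \<equiv> ideal_vecs (Ik k) b"
text \<open>R^b / (V + I_k R^b) is R^b / V modulo (x_1, ..., x_k), the module on which x_{k+1} has
  to be regular.\<close>

abbreviation "plus_I b V k \<equiv> sum_submodule (F b) V (IV k b)"

lemma IV_sub: "submodule (IV k b) R (F b)" by (rule ideal_vecs_submodule[OF cR Ik_ideal])

lemma IV_mono: "i \<le> k \<Longrightarrow> k \<le> N \<Longrightarrow> IV i b \<subseteq> IV k b" by (rule ideal_vecs_mono[OF Ik_mono])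

lemma IV_carrier: "u \<in> IV k b \<Longrightarrow> u \<in> vecs R b" using ideal_vecs_subset[OF Ik_ideal] by blast

lemma IV_hom: "h \<in> Lin R n m \<Longrightarrow> u \<in> IV k n \<Longrightarrow> h u \<in> IV k m"
  by (rule ideal_vecs_hom[OF cR Ik_ideal])

lemma xk: "k < N \<Longrightarrow> xs ! k \<in> carrier R" using xc nth_mem by blast

lemma IV_reg:
  assumes "k < N" "u \<in> vecs R b" "xs ! k \<odot>\<^bsub>F b\<^esub> u \<in> IV k b" shows "u \<in> IV k b"
proof -
  interpret st: regular_step R "Ik k" "Ik (Suc k)" "xs ! k" by (rule regular_step[OF assms(1)])
  interpret M: module R "F b" by (rule free_mod)
  show ?thesis
    using st.q_reg[OF assms(2)] mod_hom_smult[OF st.q_hom st.x assms(2)] st.q_zero[OF assms(2)]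
      st.q_zero[OF M.smult_closed[OF st.x assms(2)]] assms(3) by simp
qed

lemma IV_Suc:
  assumes "k < N" "u \<in> IV (Suc k) b"
  obtains w where "w \<in> vecs R b" "u \<ominus>\<^bsub>F b\<^esub> xs ! k \<odot>\<^bsub>F b\<^esub> w \<in> IV k b"
proof -
  interpret st: regular_step R "Ik k" "Ik (Suc k)" "xs ! k" by (rule regular_step[OF assms(1)])
  interpret M: module R "F b" by (rule free_mod)
  have u: "u \<in> vecs R b" by (rule IV_carrier[OF assms(2)])
  obtain w where w: "w \<in> vecs R b" "st.q b u = xs ! k \<odot>\<^bsub>st.Q b\<^esub> st.q b w"
    using st.q_J_iff[OF u] assms(2) by blast
  then have "u \<ominus>\<^bsub>F b\<^esub> xs ! k \<odot>\<^bsub>F b\<^esub> w \<in> IV k b"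
    using st.q_eq[OF u M.smult_closed[OF st.x w(1)]] mod_hom_smult[OF st.q_hom st.x w(1)] by simp
  then show thesis using that w(1) by blast
qed

lemma IV_x: "k < N \<Longrightarrow> u \<in> vecs R b \<Longrightarrow> xs ! k \<odot>\<^bsub>F b\<^esub> u \<in> IV (Suc k) b"
  using regular_step.xJ[OF regular_step] by (intro ideal_vecs_smult[OF cR Ik_ideal])

text \<open>The module \<open>R\<^sup>b / V\<close> is killed by \<open>x\<^sub>1, \<dots>, x\<^sub>j\<close>, the remaining elements form a regular sequence on it
  (in the weak sense, i.e. the last quotient may vanish), and it has a finite free resolution over \<open>R\<close>.\<close>

definition regular_presentation :: "nat \<Rightarrow> nat \<Rightarrow> (nat \<Rightarrow> 'a) set \<Rightarrow> bool" where
  "regular_presentation j b V \<longleftrightarrow> submodule V R (F b) \<and> IV j b \<subseteq> V \<and> V \<subseteq> ideal_vecs (max_ideal R) b \<and>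
     has_ffr R (quot_module (F b) V) \<and>
     (\<forall>k. j \<le> k \<longrightarrow> k < N \<longrightarrow> (\<forall>u \<in> vecs R b. xs ! k \<odot>\<^bsub>F b\<^esub> u \<in> plus_I b V k \<longrightarrow> u \<in> plus_I b V k))"

text \<open>The tensor product of R^b / V with S, given as a quotient of S^b.\<close>

definition base_change :: "nat \<Rightarrow> (nat \<Rightarrow> 'a) set \<Rightarrow> 'a set fgmod" where
  "base_change b V = quot_module (Free S b) (Q.vc b ` V)"

text \<open>The canonical map from R^b onto the base change; its kernel is V + I_N R^b.\<close>

definition class_in :: "nat \<Rightarrow> (nat \<Rightarrow> 'a) set \<Rightarrow> (nat \<Rightarrow> 'a) \<Rightarrow> (nat \<Rightarrow> 'a set) set" where
  "class_in b V u = mod_coset (Free S b) (Q.vc b ` V) (Q.vc b u)"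

lemma vc_image_submodule:
  assumes V: "submodule V R (F b)" shows "submodule (Q.vc b ` V) S (Free S b)"
proof -
  interpret FS: module S "Free S b" by (rule Q.S.free_mod)
  note FSR = Q.restrict_scalars_module[OF Q.S.free_mod, of b]
  interpret FSR: module R "Q.rs (Free S b)" by (rule FSR)
  note v = FSR.submoduleD[OF image_submodule[OF free_mod FSR Q.vec_class_hom V]]
  show ?thesis
  proof (rule FS.submoduleI_minus)
    fix s y assume s: "s \<in> carrier S" and y: "y \<in> Q.vc b ` V"
    obtain r where "r \<in> carrier R" "s = Q.cl r" by (rule Q.cl_preimage[OF s])
    then show "s \<odot>\<^bsub>Free S b\<^esub> y \<in> Q.vc b ` V" using v(6)[OF _ y] by simp
  qed (use v(1,2,3) in auto)
qed

lemma base_change_module: "submodule V R (F b) \<Longrightarrow> module S (base_change b V)"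
  unfolding base_change_def by (rule quot_module[OF Q.S.free_mod vc_image_submodule])

lemma class_in_hom:
  assumes V: "submodule V R (F b)" shows "class_in b V \<in> mod_hom R (F b) (Q.rs (base_change b V))"
proof -
  have "mod_coset (Free S b) (Q.vc b ` V) \<in> mod_hom R (Q.rs (Free S b)) (Q.rs (base_change b V))"
    unfolding Q.restrict_scalars_hom base_change_def by (rule mod_coset_hom[OF Q.S.free_mod vc_image_submodule[OF V]])
  from mod_hom_comp[OF Q.vec_class_hom this] show ?thesis by (simp add: class_in_def[abs_def])
qed

lemma class_in_surj:
  assumes V: "submodule V R (F b)" shows "class_in b V ` vecs R b = carrier (base_change b V)"
proof -
  have "class_in b V ` vecs R b = mod_coset (Free S b) (Q.vc b ` V) ` (Q.vc b ` vecs R b)"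
    by (simp add: image_image class_in_def)
  then show ?thesis unfolding Q.vec_class_surj base_change_def
    using mod_coset_surj[OF Q.S.free_mod vc_image_submodule[OF V]] by simp
qed

lemma class_in_zero_iff:
  assumes V: "submodule V R (F b)" and u: "u \<in> vecs R b"
  shows "class_in b V u = \<zero>\<^bsub>base_change b V\<^esub> \<longleftrightarrow> u \<in> plus_I b V N"
proof -
  have Vc: "v \<in> V \<Longrightarrow> v \<in> vecs R b" for v using module.submoduleD(1)[OF free_mod V] by blast
  have "class_in b V u = \<zero>\<^bsub>base_change b V\<^esub> \<longleftrightarrow> Q.vc b u \<in> Q.vc b ` V"
    unfolding class_in_def base_change_def
    by (rule mod_coset_eq_zero_iff[OF Q.S.free_mod vc_image_submodule[OF V] Q.vec_class_closed[OF u]])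
  also have "\<dots> \<longleftrightarrow> (\<exists>v \<in> V. u \<ominus>\<^bsub>F b\<^esub> v \<in> IV N b)"
    unfolding image_iff by (rule bex_cong[OF refl], rule Q.vec_class_eq_iff[OF u Vc])
  also have "\<dots> \<longleftrightarrow> u \<in> plus_I b V N" using u by (simp add: sum_submodule_def)
  finally show ?thesis .
qed

lemma fg_base_change:
  assumes V: "submodule V R (F b)" shows "fg_module S (base_change b V)"
  using fg_module_surj[OF fg_free_module[OF Q.S] base_change_module[OF V, unfolded base_change_def]
    mod_coset_hom[OF Q.S.free_mod vc_image_submodule[OF V]] mod_coset_surj[OF Q.S.free_mod vc_image_submodule[OF V]]]
  by (simp add: base_change_def)

text \<open>The witness \<open>R\<^bsup>b'\<^esup> / V'\<close> is the first syzygy \<open>V / (x\<^sub>1, \<dots>, x\<^sub>i)R\<^sup>b\<close> of \<open>R\<^sup>b / V\<close> over \<open>R / (x\<^sub>1, \<dots>, x\<^sub>i)\<close>.\<close>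

lemma reducing_step:
  assumes i: "i < N" and pres: "regular_presentation (Suc i) b V"
  obtains b' V' where "regular_presentation i b' V'"
    "short_exact S (base_change b V) (base_change b' V') ((Free S b)\<lparr>carrier := Q.vc b ` V\<rparr>)"
proof -
  let ?x = "xs ! i"
  note P = pres[unfolded regular_presentation_def]
  have V: "submodule V R (F b)" and AV: "IV (Suc i) b \<subseteq> V" and ffr: "has_ffr R (quot_module (F b) V)" using P by blast+
  have reg: "u \<in> plus_I b V k" if "Suc i \<le> k" "k < N" "u \<in> vecs R b" "xs ! k \<odot>\<^bsub>F b\<^esub> u \<in> plus_I b V k" for k u
    using P that by blast
  have x: "?x \<in> carrier R" by (rule xk[OF i])
  interpret Fb: module R "F b" by (rule free_mod)
  note v = Fb.submoduleD[OF V]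
  let ?FV = "(F b)\<lparr>carrier := V\<rparr>"
  have FV: "module R ?FV" by (rule submodule_carrier_module[OF free_mod V])
  have AiV: "IV i b \<subseteq> V" using IV_mono[of i "Suc i" b] i AV by auto
  have A: "submodule (IV i b) R ?FV"
    by (rule module.submoduleI_minus[OF FV]) (use AiV Fb.submoduleD[OF IV_sub[of i b]] in auto)
  \<comment> \<open>The syzygy V / I_i R^b. It is covered minimally over R, which later keeps the
    new relations inside the maximal ideal.\<close>
  let ?N' = "quot_module ?FV (IV i b)"
  have N'M: "module R ?N'" by (rule quot_module[OF FV A])
  note cs = mod_coset_hom[OF FV A] mod_coset_surj[OF FV A] mod_coset_eq_zero_iff[OF FV A]
  obtain m g where g: "g \<in> Lin R m b" "g ` vecs R m = V"
    by (rule noetherian_submodule_generated[OF cR local_ring_noetherian[OF loc] V])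
  have fgV: "fg_module R ?FV"
    by (rule fg_moduleI[OF FV mod_hom_restrict_cod[OF g(1)]]) (use g(2) in auto)
  obtain b' e where e: "e \<in> mod_hom R (F b') ?N'" "e ` vecs R b' = carrier ?N'"
    "a_kernel (F b') ?N' e \<subseteq> ideal_vecs (max_ideal R) b'"
    by (rule minimal_cover_local[OF loc fg_module_surj[OF fgV N'M cs(1,2)]])
  interpret Fb': module R "F b'" by (rule free_mod)
  have "e ` vecs R b' \<subseteq> mod_coset ?FV (IV i b) ` carrier ?FV" unfolding cs(2) e(2) by simp
  \<comment> \<open>Lifts the cover of the syzygy to a map into V itself, so that one can compute
    with vectors: modulo I_i the image of \<open>p\<close> is V.\<close>
  then obtain p where p1: "p \<in> mod_hom R (F b') ?FV"
    and pe: "\<And>u. u \<in> vecs R b' \<Longrightarrow> mod_coset ?FV (IV i b) (p u) = e u"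
    using free_lift[OF FV N'M cs(1) e(1)] by blast
  have p: "p \<in> Lin R b' b" by (rule mod_hom_extend_cod[OF p1 v(1)])
  have pV: "p u \<in> V" if "u \<in> vecs R b'" for u using mod_hom_closed[OF p1 that] by simp
  have pc: "p u \<in> vecs R b" if "u \<in> vecs R b'" for u by (rule mod_hom_closed[OF p that])
  \<comment> \<open>Subtraction in V as a module of its own refers to negation in V; it has to be
    identified with subtraction in R^b.\<close>
  have coset_eq: "a \<ominus>\<^bsub>F b\<^esub> c \<in> IV i b" if "a \<in> V" "c \<in> V" "mod_coset ?FV (IV i b) a = mod_coset ?FV (IV i b) c" for a c
  proof -
    interpret FV: module R ?FV by (rule FV)
    have "a \<ominus>\<^bsub>?FV\<^esub> c \<in> IV i b" using mod_coset_eq_iff[OF FV A, of a c] that by simp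
    moreover have "a \<ominus>\<^bsub>?FV\<^esub> c = a \<ominus>\<^bsub>F b\<^esub> c"
    proof -
      have ac: "a \<in> vecs R b" "c \<in> vecs R b" using that v(1) by auto
      have "(a \<ominus>\<^bsub>?FV\<^esub> c) \<oplus>\<^bsub>?FV\<^esub> c = a" using FV.add_diff_cancel(2)[of a c] that by simp
      then have eq: "(a \<ominus>\<^bsub>?FV\<^esub> c) \<oplus>\<^bsub>F b\<^esub> c = a" by simp
      have d: "a \<ominus>\<^bsub>?FV\<^esub> c \<in> vecs R b" using FV.M.minus_closed[of a c] that v(1) by auto
      have "((a \<ominus>\<^bsub>?FV\<^esub> c) \<oplus>\<^bsub>F b\<^esub> c) \<ominus>\<^bsub>F b\<^esub> c = a \<ominus>\<^bsub>?FV\<^esub> c"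
        using Fb.M.a_assoc[OF d ac(2), of "\<ominus>\<^bsub>F b\<^esub> c"] ac d by (simp add: a_minus_def[of "F b"] Fb.M.r_neg)
      then show ?thesis unfolding eq by simp
    qed
    ultimately show ?thesis by simp
  qed
  define V' where "V' = {u \<in> vecs R b'. p u \<in> IV i b}"
  have V'sub: "submodule V' R (F b')" unfolding V'_def by (rule vimage_submodule[OF free_mod free_mod p IV_sub])
  note v' = Fb'.submoduleD[OF V'sub]
  have V'e: "V' = a_kernel (F b') ?N' e"
    unfolding V'_def a_kernel_eq using pe cs(3)[OF mod_hom_closed[OF p1]] by auto
  have psur: "\<exists>u \<in> vecs R b'. w \<ominus>\<^bsub>F b\<^esub> p u \<in> IV i b" if w: "w \<in> V" for w
  proof -
    have "mod_coset ?FV (IV i b) w \<in> e ` vecs R b'" unfolding e(2) cs(2)[symmetric] using w by simp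
    then obtain u where u: "u \<in> vecs R b'" "mod_coset ?FV (IV i b) w = e u" by blast
    then have "w \<ominus>\<^bsub>F b\<^esub> p u \<in> IV i b" using coset_eq[OF w pV[OF u(1)]] pe[OF u(1)] by simp
    then show ?thesis using u(1) by blast
  qed
  have xV: "?x \<odot>\<^bsub>F b\<^esub> r \<in> V" if "r \<in> vecs R b" for r using IV_x[OF i that] AV by blast
  have sc: "(\<lambda>r. ?x \<odot>\<^bsub>F b\<^esub> r) \<in> mod_hom R (F b) ?FV"
    by (rule mod_hom_restrict_cod[OF mod_hom_scale[OF free_mod mod_hom_id x]]) (use xV in blast)
  have xq: "(\<lambda>r. mod_coset ?FV (IV i b) (?x \<odot>\<^bsub>F b\<^esub> r)) \<in> mod_hom R (F b) ?N'"
    by (rule mod_hom_comp[OF sc cs(1)])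
  have "(\<lambda>r. mod_coset ?FV (IV i b) (?x \<odot>\<^bsub>F b\<^esub> r)) ` vecs R b \<subseteq> e ` vecs R b'"
    unfolding e(2) using mod_hom_closed[OF xq] by blast
  \<comment> \<open>\<open>l\<close> covers multiplication by x_{i+1} from R^b into V / I_i R^b, so
    p(l r) = x_{i+1} r modulo I_i. It induces the left map of the sequence, and \<open>p\<close>
    induces the right one.\<close>
  then obtain l where l: "l \<in> Lin R b b'"
    and le: "\<And>r. r \<in> vecs R b \<Longrightarrow> e (l r) = mod_coset ?FV (IV i b) (?x \<odot>\<^bsub>F b\<^esub> r)"
    using free_lift[OF free_mod N'M e(1) xq] by blast
  have lc: "l r \<in> vecs R b'" if "r \<in> vecs R b" for r by (rule mod_hom_closed[OF l that])
  have pl: "p (l r) \<ominus>\<^bsub>F b\<^esub> ?x \<odot>\<^bsub>F b\<^esub> r \<in> IV i b" if r: "r \<in> vecs R b" for r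
    by (rule coset_eq[OF pV[OF lc[OF r]] xV[OF r]]) (simp add: pe[OF lc[OF r]] le[OF r])
  let ?W = "plus_I b V" and ?W' = "plus_I b' V'"
  have W: "submodule (?W k) R (F b)" for k by (rule sum_submodule[OF free_mod V IV_sub])
  have W': "submodule (?W' k) R (F b')" for k by (rule sum_submodule[OF free_mod V'sub IV_sub])
  note w = Fb.submoduleD[OF W] and w' = Fb'.submoduleD[OF W']
  have VW: "z \<in> V \<Longrightarrow> z \<in> ?W k" for z k by (rule Fb.sum_submodule_left[OF V IV_sub])
  have AW: "z \<in> IV k b \<Longrightarrow> z \<in> ?W k" for z k by (rule Fb.sum_submodule_right[OF V IV_sub])
  have VW': "z \<in> V' \<Longrightarrow> z \<in> ?W' k" for z k by (rule Fb'.sum_submodule_left[OF V'sub IV_sub])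
  have BW': "z \<in> IV k b' \<Longrightarrow> z \<in> ?W' k" for z k by (rule Fb'.sum_submodule_right[OF V'sub IV_sub])
  have Wmono: "z \<in> ?W k \<Longrightarrow> k < N \<Longrightarrow> z \<in> ?W (Suc k)" for z k
    using sum_submodule_mono[OF IV_mono[of k "Suc k" b], of "F b" V] by auto
  have Wmono': "z \<in> ?W' k \<Longrightarrow> k < N \<Longrightarrow> z \<in> ?W' (Suc k)" for z k
    using sum_submodule_mono[OF IV_mono[of k "Suc k" b'], of "F b'" V'] by auto
  note A_in = Fb.submoduleD[OF IV_sub] and B_in = Fb'.submoduleD[OF IV_sub]
  have Ai: "z \<in> IV i b \<Longrightarrow> i \<le> k \<Longrightarrow> k \<le> N \<Longrightarrow> z \<in> IV k b" for z k using IV_mono by blast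
  \<comment> \<open>Exactness in the middle after reduction modulo I_k, for all k > i. For k = i +
    1, a vector u with p u = x_{i+1} r modulo I_i differs from l r by an element of V'.\<close>
  have Esolve: "\<exists>r \<in> vecs R b. u \<ominus>\<^bsub>F b'\<^esub> l r \<in> ?W' k"
    if "Suc i \<le> k" "k \<le> N" "u \<in> vecs R b'" "p u \<in> IV k b" for k u using that
  proof (induction k arbitrary: u rule: dec_induct)
    case base
    note u = base(2)
    obtain r where r: "r \<in> vecs R b" "p u \<ominus>\<^bsub>F b\<^esub> ?x \<odot>\<^bsub>F b\<^esub> r \<in> IV i b" by (rule IV_Suc[OF i base(3)])
    have c: "p u \<in> vecs R b" "p (l r) \<in> vecs R b" "?x \<odot>\<^bsub>F b\<^esub> r \<in> vecs R b"
      using pc[OF u] pc[OF lc[OF r(1)]] r(1) x by auto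
    have "p (u \<ominus>\<^bsub>F b'\<^esub> l r) = (p u \<ominus>\<^bsub>F b\<^esub> ?x \<odot>\<^bsub>F b\<^esub> r) \<ominus>\<^bsub>F b\<^esub> (p (l r) \<ominus>\<^bsub>F b\<^esub> ?x \<odot>\<^bsub>F b\<^esub> r)"
      unfolding mod_hom_minus[OF free_mod free_mod p u lc[OF r(1)]] using c by algebra
    then have "p (u \<ominus>\<^bsub>F b'\<^esub> l r) \<in> IV i b" using A_in(4)[OF r(2) pl[OF r(1)]] by simp
    then have "u \<ominus>\<^bsub>F b'\<^esub> l r \<in> V'" unfolding V'_def using u lc[OF r(1)] by simp
    then show ?case using VW' r(1) by blast
  next
    case (step k)
    note u = step.prems(2)
    have k: "k < N" "k \<le> N" using step.prems(1) by auto
    let ?y = "xs ! k"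
    have y: "?y \<in> carrier R" by (rule xk[OF k(1)])
    \<comment> \<open>As p u lies in V, so does x_{k+1} w1 modulo I_k. Regularity on R^b / V puts w1
      itself into V + I_k R^b, hence w1 = p u2 modulo I_k, and u - x_{k+1} u2 satisfies the
      induction hypothesis.\<close>
    obtain w1 where w1: "w1 \<in> vecs R b" "p u \<ominus>\<^bsub>F b\<^esub> ?y \<odot>\<^bsub>F b\<^esub> w1 \<in> IV k b"
      by (rule IV_Suc[OF k(1) step.prems(3)])
    have yw: "?y \<odot>\<^bsub>F b\<^esub> w1 \<in> vecs R b" using w1(1) y by simp
    have "?y \<odot>\<^bsub>F b\<^esub> w1 = p u \<ominus>\<^bsub>F b\<^esub> (p u \<ominus>\<^bsub>F b\<^esub> ?y \<odot>\<^bsub>F b\<^esub> w1)" using pc[OF u] yw by algebra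
    then have "?y \<odot>\<^bsub>F b\<^esub> w1 \<in> ?W k" using w(4)[OF VW[OF pV[OF u]] AW[OF w1(2)]] by simp
    then have "w1 \<in> ?W k" using reg[OF step.hyps(1) k(1) w1(1)] by blast
    then obtain z where z: "z \<in> V" "w1 \<ominus>\<^bsub>F b\<^esub> z \<in> IV k b" by (auto simp: sum_submodule_def)
    obtain u2 where u2: "u2 \<in> vecs R b'" "z \<ominus>\<^bsub>F b\<^esub> p u2 \<in> IV i b" using psur[OF z(1)] by blast
    have zc: "z \<in> vecs R b" using z(1) v(1) by blast
    have z2: "z \<ominus>\<^bsub>F b\<^esub> p u2 \<in> IV k b" using Ai[OF u2(2)] step.hyps(1) k(2) by simp
    have "w1 \<ominus>\<^bsub>F b\<^esub> p u2 = (w1 \<ominus>\<^bsub>F b\<^esub> z) \<oplus>\<^bsub>F b\<^esub> (z \<ominus>\<^bsub>F b\<^esub> p u2)" using w1(1) zc pc[OF u2(1)] by algebra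
    then have wu: "w1 \<ominus>\<^bsub>F b\<^esub> p u2 \<in> IV k b" using A_in(3)[OF z(2) z2] by simp
    have yu2: "?y \<odot>\<^bsub>F b'\<^esub> u2 \<in> vecs R b'" using u2(1) y by simp
    have "p (u \<ominus>\<^bsub>F b'\<^esub> ?y \<odot>\<^bsub>F b'\<^esub> u2) = (p u \<ominus>\<^bsub>F b\<^esub> ?y \<odot>\<^bsub>F b\<^esub> w1) \<oplus>\<^bsub>F b\<^esub> ?y \<odot>\<^bsub>F b\<^esub> (w1 \<ominus>\<^bsub>F b\<^esub> p u2)"
      unfolding mod_hom_minus[OF free_mod free_mod p u yu2] mod_hom_smult[OF p y u2(1)]
      using pc[OF u] pc[OF u2(1)] w1(1) y by algebra
    then have "p (u \<ominus>\<^bsub>F b'\<^esub> ?y \<odot>\<^bsub>F b'\<^esub> u2) \<in> IV k b" using A_in(3)[OF w1(2) A_in(6)[OF y wu]] by simp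
    then obtain r where r: "r \<in> vecs R b" "(u \<ominus>\<^bsub>F b'\<^esub> ?y \<odot>\<^bsub>F b'\<^esub> u2) \<ominus>\<^bsub>F b'\<^esub> l r \<in> ?W' k"
      using step.IH[OF k(2), of "u \<ominus>\<^bsub>F b'\<^esub> ?y \<odot>\<^bsub>F b'\<^esub> u2"] u yu2 by auto
    have "u \<ominus>\<^bsub>F b'\<^esub> l r = ((u \<ominus>\<^bsub>F b'\<^esub> ?y \<odot>\<^bsub>F b'\<^esub> u2) \<ominus>\<^bsub>F b'\<^esub> l r) \<oplus>\<^bsub>F b'\<^esub> ?y \<odot>\<^bsub>F b'\<^esub> u2"
      using u yu2 lc[OF r(1)] by algebra
    then have "u \<ominus>\<^bsub>F b'\<^esub> l r \<in> ?W' (Suc k)"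
      using w'(3)[OF Wmono'[OF r(2) k(1)] BW'[OF IV_x[OF k(1) u2(1)]]] by simp
    then show ?case using r(1) by blast
  qed
  have pV': "p z \<in> IV i b" if "z \<in> V'" for z using that by (simp add: V'_def)
  have plA: "p (l r) \<in> IV (Suc i) b" if r: "r \<in> vecs R b" for r
    using Fb.mem_of_diff[OF IV_sub Ai[OF pl[OF r], of "Suc i"] IV_x[OF i r] pc[OF lc[OF r]]] i by simp
  \<comment> \<open>Injectivity of the left map after reduction modulo I_k. In the base case,
    applying \<open>p\<close> to the relation for l r and cancelling x_{i+1} shows that r agrees
    with an element p u of V.\<close>
  have inj: "r \<in> ?W k" if "Suc i \<le> k" "k \<le> N" "r \<in> vecs R b" "l r \<in> ?W' k" for k r
    using that
  proof (induction k arbitrary: r rule: dec_induct)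
    case base
    note r = base(2)
    obtain z where z: "z \<in> V'" "l r \<ominus>\<^bsub>F b'\<^esub> z \<in> IV (Suc i) b'" using base(3) by (auto simp: sum_submodule_def)
    have zc: "z \<in> vecs R b'" using z(1) v'(1) by blast
    obtain u where u: "u \<in> vecs R b'" "(l r \<ominus>\<^bsub>F b'\<^esub> z) \<ominus>\<^bsub>F b'\<^esub> ?x \<odot>\<^bsub>F b'\<^esub> u \<in> IV i b'" by (rule IV_Suc[OF i z(2)])
    have xu: "?x \<odot>\<^bsub>F b'\<^esub> u \<in> vecs R b'" using u(1) x by simp
    have lz: "l r \<ominus>\<^bsub>F b'\<^esub> z \<in> vecs R b'" using lc[OF r] zc by simp
    have c: "p (l r) \<in> vecs R b" "p z \<in> vecs R b" "p u \<in> vecs R b" using pc lc[OF r] zc u(1) by auto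
    have 1: "p (l r) \<ominus>\<^bsub>F b\<^esub> p z \<ominus>\<^bsub>F b\<^esub> ?x \<odot>\<^bsub>F b\<^esub> p u \<in> IV i b"
      using IV_hom[OF p u(2)]
      unfolding mod_hom_minus[OF free_mod free_mod p lz xu] mod_hom_minus[OF free_mod free_mod p lc[OF r] zc] mod_hom_smult[OF p x u(1)] .
    have "?x \<odot>\<^bsub>F b\<^esub> (r \<ominus>\<^bsub>F b\<^esub> p u) = ((p (l r) \<ominus>\<^bsub>F b\<^esub> p z \<ominus>\<^bsub>F b\<^esub> ?x \<odot>\<^bsub>F b\<^esub> p u) \<oplus>\<^bsub>F b\<^esub> p z) \<ominus>\<^bsub>F b\<^esub> (p (l r) \<ominus>\<^bsub>F b\<^esub> ?x \<odot>\<^bsub>F b\<^esub> r)"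
      using c r x by algebra
    then have "?x \<odot>\<^bsub>F b\<^esub> (r \<ominus>\<^bsub>F b\<^esub> p u) \<in> IV i b" using A_in(4)[OF A_in(3)[OF 1 pV'[OF z(1)]] pl[OF r]] by simp
    then have "r \<ominus>\<^bsub>F b\<^esub> p u \<in> IV i b" by (rule IV_reg[OF i, rotated]) (use r c in simp)
    then have "r \<ominus>\<^bsub>F b\<^esub> p u \<in> V" using AiV by blast
    then have "r \<in> V" using Fb.mem_of_diff[OF V _ pV[OF u(1)] r] by blast
    then show ?case by (rule VW)
  next
    case (step k)
    note r = step.prems(2)
    have k: "k < N" "k \<le> N" "i \<le> k" using step.prems(1) step.hyps(1) by auto
    let ?y = "xs ! k"
    have y: "?y \<in> carrier R" by (rule xk[OF k(1)])
    obtain z where z: "z \<in> V'" "l r \<ominus>\<^bsub>F b'\<^esub> z \<in> IV (Suc k) b'" using step.prems(3) by (auto simp: sum_submodule_def)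
    have zc: "z \<in> vecs R b'" using z(1) v'(1) by blast
    obtain u where u: "u \<in> vecs R b'" "(l r \<ominus>\<^bsub>F b'\<^esub> z) \<ominus>\<^bsub>F b'\<^esub> ?y \<odot>\<^bsub>F b'\<^esub> u \<in> IV k b'" by (rule IV_Suc[OF k(1) z(2)])
    have yu: "?y \<odot>\<^bsub>F b'\<^esub> u \<in> vecs R b'" using u(1) y by simp
    have lz: "l r \<ominus>\<^bsub>F b'\<^esub> z \<in> vecs R b'" using lc[OF r] zc by simp
    have c: "p (l r) \<in> vecs R b" "p z \<in> vecs R b" "p u \<in> vecs R b" using pc lc[OF r] zc u(1) by auto
    have 1: "p (l r) \<ominus>\<^bsub>F b\<^esub> p z \<ominus>\<^bsub>F b\<^esub> ?y \<odot>\<^bsub>F b\<^esub> p u \<in> IV k b"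
      using IV_hom[OF p u(2)]
      unfolding mod_hom_minus[OF free_mod free_mod p lz yu] mod_hom_minus[OF free_mod free_mod p lc[OF r] zc] mod_hom_smult[OF p y u(1)] .
    have "p (l r) \<in> IV k b" using plA[OF r] IV_mono[of "Suc i" k b] step.hyps(1) k(2) by blast
    then have 2: "p (l r) \<ominus>\<^bsub>F b\<^esub> p z \<in> IV k b" using A_in(4) Ai[OF pV'[OF z(1)] k(3,2)] by blast
    have "?y \<odot>\<^bsub>F b\<^esub> p u = (p (l r) \<ominus>\<^bsub>F b\<^esub> p z) \<ominus>\<^bsub>F b\<^esub> (p (l r) \<ominus>\<^bsub>F b\<^esub> p z \<ominus>\<^bsub>F b\<^esub> ?y \<odot>\<^bsub>F b\<^esub> p u)"
      using c y by algebra
    then have "?y \<odot>\<^bsub>F b\<^esub> p u \<in> IV k b" using A_in(4)[OF 2 1] by simp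
    then have "p u \<in> IV k b" by (rule IV_reg[OF k(1) c(3)])
    \<comment> \<open>Applying \<open>p\<close> and cancelling x_{k+1} shows that p u lies in I_k
      R^b. So u is congruent to some l r' by exactness in the middle, and r - x_{k+1} r' falls under
      the induction hypothesis.\<close>
    then obtain r' where r': "r' \<in> vecs R b" "u \<ominus>\<^bsub>F b'\<^esub> l r' \<in> ?W' k"
      using Esolve[OF step.hyps(1) k(2) u(1)] by blast
    have yr: "?y \<odot>\<^bsub>F b\<^esub> r' \<in> vecs R b" using r'(1) y by simp
    have "l (r \<ominus>\<^bsub>F b\<^esub> ?y \<odot>\<^bsub>F b\<^esub> r') = ((l r \<ominus>\<^bsub>F b'\<^esub> z) \<ominus>\<^bsub>F b'\<^esub> ?y \<odot>\<^bsub>F b'\<^esub> u) \<oplus>\<^bsub>F b'\<^esub> (z \<oplus>\<^bsub>F b'\<^esub> ?y \<odot>\<^bsub>F b'\<^esub> (u \<ominus>\<^bsub>F b'\<^esub> l r'))"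
      unfolding mod_hom_minus[OF free_mod free_mod l r yr] mod_hom_smult[OF l y r'(1)]
      using lc[OF r] lc[OF r'(1)] zc u(1) y by algebra
    then have "l (r \<ominus>\<^bsub>F b\<^esub> ?y \<odot>\<^bsub>F b\<^esub> r') \<in> ?W' k"
      using w'(3)[OF BW'[OF u(2)] w'(3)[OF VW'[OF z(1)] w'(6)[OF y r'(2)]]] by simp
    then have "r \<ominus>\<^bsub>F b\<^esub> ?y \<odot>\<^bsub>F b\<^esub> r' \<in> ?W k" using step.IH[OF k(2), of "r \<ominus>\<^bsub>F b\<^esub> ?y \<odot>\<^bsub>F b\<^esub> r'"] r yr by simp
    then show ?case using Fb.mem_of_diff[OF W Wmono[OF _ k(1)] AW[OF IV_x[OF k(1) r'(1)]] r] by blast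
  qed
  \<comment> \<open>The left map is well defined: for z = p u modulo I_i, l z and x_{i+1} u have the
    same image under \<open>p\<close> modulo I_i, so they differ by an element of V'.\<close>
  have lW: "l r \<in> ?W' k" if k: "Suc i \<le> k" "k \<le> N" and rW: "r \<in> ?W k" for k r
  proof -
    obtain z where z: "z \<in> V" "r \<ominus>\<^bsub>F b\<^esub> z \<in> IV k b" and r: "r \<in> vecs R b" using rW by (auto simp: sum_submodule_def)
    have zc: "z \<in> vecs R b" using z(1) v(1) by blast
    obtain u where u: "u \<in> vecs R b'" "z \<ominus>\<^bsub>F b\<^esub> p u \<in> IV i b" using psur[OF z(1)] by blast
    have xu: "?x \<odot>\<^bsub>F b'\<^esub> u \<in> vecs R b'" using u(1) x by simp
    have c: "p (l z) \<in> vecs R b" "p u \<in> vecs R b" using pc lc[OF zc] u(1) by auto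
    have "p (l z \<ominus>\<^bsub>F b'\<^esub> ?x \<odot>\<^bsub>F b'\<^esub> u) = (p (l z) \<ominus>\<^bsub>F b\<^esub> ?x \<odot>\<^bsub>F b\<^esub> z) \<oplus>\<^bsub>F b\<^esub> ?x \<odot>\<^bsub>F b\<^esub> (z \<ominus>\<^bsub>F b\<^esub> p u)"
      unfolding mod_hom_minus[OF free_mod free_mod p lc[OF zc] xu] mod_hom_smult[OF p x u(1)] using c zc x by algebra
    then have "p (l z \<ominus>\<^bsub>F b'\<^esub> ?x \<odot>\<^bsub>F b'\<^esub> u) \<in> IV i b" using A_in(3)[OF pl[OF zc] A_in(6)[OF x u(2)]] by simp
    then have 1: "l z \<ominus>\<^bsub>F b'\<^esub> ?x \<odot>\<^bsub>F b'\<^esub> u \<in> V'" unfolding V'_def using lc[OF zc] xu by simp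
    have 2: "?x \<odot>\<^bsub>F b'\<^esub> u \<in> IV k b'" using IV_x[OF i u(1)] IV_mono[of "Suc i" k b'] k by blast
    have 3: "l r \<ominus>\<^bsub>F b'\<^esub> l z \<in> IV k b'" using IV_hom[OF l z(2)] mod_hom_minus[OF free_mod free_mod l r zc] by simp
    have "l z \<in> ?W' k" using Fb'.mem_of_diff[OF W' VW'[OF 1] BW'[OF 2] lc[OF zc]] .
    then show ?thesis using Fb'.mem_of_diff[OF W' BW'[OF 3] _ lc[OF r]] by blast
  qed
  \<comment> \<open>For k = i the new module embeds into (R/I_i)^b, where x_{i+1} is regular. For k
    > i the element x_{k+1} is regular on (R/I_k)^b and, by hypothesis, on the left term of the
    reduced sequence, hence on the middle one.\<close>
  have reg': "u \<in> ?W' k" if k: "i \<le> k" "k < N" and u: "u \<in> vecs R b'" and yu: "xs ! k \<odot>\<^bsub>F b'\<^esub> u \<in> ?W' k" for k u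
  proof -
    let ?y = "xs ! k"
    have y: "?y \<in> carrier R" by (rule xk[OF k(2)])
    obtain z where z: "z \<in> V'" "?y \<odot>\<^bsub>F b'\<^esub> u \<ominus>\<^bsub>F b'\<^esub> z \<in> IV k b'" using yu by (auto simp: sum_submodule_def)
    have zc: "z \<in> vecs R b'" using z(1) v'(1) by blast
    have yuc: "?y \<odot>\<^bsub>F b'\<^esub> u \<in> vecs R b'" using u y by simp
    have "?y \<odot>\<^bsub>F b\<^esub> p u \<ominus>\<^bsub>F b\<^esub> p z \<in> IV k b"
      using IV_hom[OF p z(2)] mod_hom_minus[OF free_mod free_mod p yuc zc] mod_hom_smult[OF p y u] by simp
    moreover have "p z \<in> IV k b" using Ai[OF pV'[OF z(1)]] k by simp
    ultimately have "?y \<odot>\<^bsub>F b\<^esub> p u \<in> IV k b" using Fb.mem_of_diff[OF IV_sub] pc[OF u] y by simp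
    then have pu: "p u \<in> IV k b" by (rule IV_reg[OF k(2) pc[OF u]])
    show ?thesis
    proof (cases "k = i")
      case True
      then have "u \<in> V'" unfolding V'_def using u pu by simp
      then show ?thesis by (rule VW')
    next
      case False
      then have k': "Suc i \<le> k" "k \<le> N" using k by auto
      obtain r where r: "r \<in> vecs R b" "u \<ominus>\<^bsub>F b'\<^esub> l r \<in> ?W' k" using Esolve[OF k' u pu] by blast
      have yr: "?y \<odot>\<^bsub>F b\<^esub> r \<in> vecs R b" using r(1) y by simp
      have "l (?y \<odot>\<^bsub>F b\<^esub> r) = ?y \<odot>\<^bsub>F b'\<^esub> u \<ominus>\<^bsub>F b'\<^esub> ?y \<odot>\<^bsub>F b'\<^esub> (u \<ominus>\<^bsub>F b'\<^esub> l r)"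
        unfolding mod_hom_smult[OF l y r(1)] using u lc[OF r(1)] y by algebra
      then have "l (?y \<odot>\<^bsub>F b\<^esub> r) \<in> ?W' k" using w'(4)[OF yu w'(6)[OF y r(2)]] by simp
      then have "?y \<odot>\<^bsub>F b\<^esub> r \<in> ?W k" by (rule inj[OF k' yr])
      then have "r \<in> ?W k" using reg[OF k'(1) k(2) r(1)] by blast
      then have "l r \<in> ?W' k" by (rule lW[OF k'])
      then show ?thesis using Fb'.mem_of_diff[OF W' r(2) _ u] by blast
    qed
  qed
  have dW: "p w \<in> IV i b \<longleftrightarrow> w \<in> V'" if "w \<in> vecs R b'" for w using that by (simp add: V'_def)
  have dU: "g \<in> V \<longleftrightarrow> (\<exists>w \<in> vecs R b'. g \<ominus>\<^bsub>F b\<^esub> p w \<in> IV i b)" if g: "g \<in> vecs R b" for g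
  proof
    assume "g \<in> V" then show "\<exists>w \<in> vecs R b'. g \<ominus>\<^bsub>F b\<^esub> p w \<in> IV i b" by (rule psur)
  next
    assume "\<exists>w \<in> vecs R b'. g \<ominus>\<^bsub>F b\<^esub> p w \<in> IV i b"
    then obtain w where "w \<in> vecs R b'" "g \<ominus>\<^bsub>F b\<^esub> p w \<in> V" using AiV by blast
    then show "g \<in> V" using Fb.mem_of_diff[OF V _ pV g] by blast
  qed
  have "short_exact R (quot_module (F b') V') (quot_module (F b) (IV i b)) (quot_module (F b) V)"
    by (rule quot_short_exact[OF free_mod free_mod V'sub IV_sub V p dW dU])
  then have ffr': "has_ffr R (quot_module (F b') V')"
    using has_ffr_kernel[OF quot_module[OF free_mod V'sub] quot_module[OF free_mod IV_sub] quot_module[OF free_mod V]]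
      has_ffr_free_quotient[of i b] i ffr by simp
  have BV': "IV i b' \<subseteq> V'" unfolding V'_def using IV_hom[OF p] IV_carrier by blast
  have pres': "regular_presentation i b' V'"
    unfolding regular_presentation_def using V'sub BV' e(3) ffr' reg' V'e by auto
  let ?K = "base_change b V" and ?K' = "base_change b' V'" and ?L = "(Free S b)\<lparr>carrier := Q.vc b ` V\<rparr>"
  note KM = base_change_module[OF V] and KM' = base_change_module[OF V'sub]
  note KR = Q.restrict_scalars_module[OF KM] and KR' = Q.restrict_scalars_module[OF KM']
  have LM: "module S ?L" by (rule submodule_carrier_module[OF Q.S.free_mod vc_image_submodule[OF V]])
  note LR = Q.restrict_scalars_module[OF LM]
  note ka = class_in_hom[OF V] class_in_surj[OF V] class_in_zero_iff[OF V]
    and ka' = class_in_hom[OF V'sub] class_in_surj[OF V'sub] class_in_zero_iff[OF V'sub]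
  have iN: "Suc i \<le> N" using i by simp
  have s1: "class_in b V ` vecs R b = carrier (Q.rs ?K)" using ka(2) by simp
  have s2: "class_in b' V' ` vecs R b' = carrier (Q.rs ?K')" using ka'(2) by simp
  have k1: "class_in b' V' (l r) = \<zero>\<^bsub>Q.rs ?K'\<^esub>" if "r \<in> vecs R b" "class_in b V r = \<zero>\<^bsub>Q.rs ?K\<^esub>" for r
    using ka(3)[OF that(1)] that(2) ka'(3)[OF lc[OF that(1)]] lW[OF iN order_refl] by simp
  \<comment> \<open>The instance k = N of the preceding facts, now read over S.\<close>
  obtain f where f: "f \<in> mod_hom R (Q.rs ?K) (Q.rs ?K')"
    and fl: "\<And>r. r \<in> vecs R b \<Longrightarrow> f (class_in b V r) = class_in b' V' (l r)"
    using mod_hom_factor_surj[OF free_mod KR KR' ka(1) s1 mod_hom_comp[OF l ka'(1)] k1] by blast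
  have vp: "(\<lambda>u. Q.vc b (p u)) \<in> mod_hom R (F b') (Q.rs ?L)" unfolding restrict_scalars_sub
    by (rule mod_hom_restrict_cod[OF mod_hom_comp[OF p Q.vec_class_hom]]) (use pV in blast)
  have vp0: "Q.vc b (p u) = \<zero>\<^bsub>Free S b\<^esub> \<longleftrightarrow> p u \<in> IV N b" if "u \<in> vecs R b'" for u
    by (rule Q.vec_class_eq_zero_iff[OF pc[OF that]])
  have pW': "p u \<in> IV N b" if uW: "u \<in> ?W' N" for u
  proof -
    obtain z where z: "z \<in> V'" "u \<ominus>\<^bsub>F b'\<^esub> z \<in> IV N b'" and u: "u \<in> vecs R b'" using uW by (auto simp: sum_submodule_def)
    have zc: "z \<in> vecs R b'" using z(1) v'(1) by blast
    have "p u \<ominus>\<^bsub>F b\<^esub> p z \<in> IV N b" using IV_hom[OF p z(2)] mod_hom_minus[OF free_mod free_mod p u zc] by simp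
    moreover have "p z \<in> IV N b" using Ai[OF pV'[OF z(1)]] i by simp
    ultimately show ?thesis using Fb.mem_of_diff[OF IV_sub _ _ pc[OF u]] by blast
  qed
  have k2: "Q.vc b (p u) = \<zero>\<^bsub>Q.rs ?L\<^esub>" if "u \<in> vecs R b'" "class_in b' V' u = \<zero>\<^bsub>Q.rs ?K'\<^esub>" for u
    using ka'(3)[OF that(1)] that(2) vp0[OF that(1)] pW' by simp
  obtain h where h: "h \<in> mod_hom R (Q.rs ?K') (Q.rs ?L)"
    and hp: "\<And>u. u \<in> vecs R b' \<Longrightarrow> h (class_in b' V' u) = Q.vc b (p u)"
    using mod_hom_factor_surj[OF free_mod KR' LR ka'(1) s2 vp k2] by blast
  have "short_exact S ?K ?K' ?L"
  proof (rule short_exactI)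
    show fS: "f \<in> mod_hom S ?K ?K'" using f by (simp add: Q.restrict_scalars_hom)
    show "h \<in> mod_hom S ?K' ?L" using h by (simp add: Q.restrict_scalars_hom)
    show "inj_on f (carrier ?K)" unfolding inj_on_iff_kernel[OF KM KM' fS]
    proof (intro ballI impI)
      fix y assume "y \<in> carrier ?K" and 0: "f y = \<zero>\<^bsub>?K'\<^esub>"
      then obtain r where r: "r \<in> vecs R b" "y = class_in b V r" using ka(2) by blast
      then have "l r \<in> ?W' N" using 0 fl[OF r(1)] ka'(3)[OF lc[OF r(1)]] by simp
      then have "r \<in> ?W N" by (rule inj[OF iN order_refl r(1)])
      then show "y = \<zero>\<^bsub>?K\<^esub>" using ka(3)[OF r(1)] r(2) by simp
    qed
    show "h (f y) = \<zero>\<^bsub>?L\<^esub>" if y: "y \<in> carrier ?K" for y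
    proof -
      obtain r where r: "r \<in> vecs R b" "y = class_in b V r" using ka(2) y by blast
      have "p (l r) \<in> IV N b" using plA[OF r(1)] IV_mono[OF iN order_refl] by blast
      then show ?thesis using fl[OF r(1)] hp[OF lc[OF r(1)]] vp0[OF lc[OF r(1)]] r(2) by simp
    qed
    show "\<exists>x \<in> carrier ?K. f x = y" if y: "y \<in> carrier ?K'" "h y = \<zero>\<^bsub>?L\<^esub>" for y
    proof -
      obtain u where u: "u \<in> vecs R b'" "y = class_in b' V' u" using ka'(2) y(1) by blast
      have "p u \<in> IV N b" using y(2) hp[OF u(1)] vp0[OF u(1)] u(2) by simp
      then obtain r where r: "r \<in> vecs R b" "u \<ominus>\<^bsub>F b'\<^esub> l r \<in> ?W' N" using Esolve[OF iN order_refl u(1)] by blast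
      have "class_in b' V' (u \<ominus>\<^bsub>F b'\<^esub> l r) = \<zero>\<^bsub>?K'\<^esub>"
        using ka'(3)[of "u \<ominus>\<^bsub>F b'\<^esub> l r"] r(2) u(1) lc[OF r(1)] by simp
      then have "class_in b' V' u = class_in b' V' (l r)"
        using mod_hom_eq_iff[OF free_mod KR' ka'(1) u(1) lc[OF r(1)]] by simp
      then have "f (class_in b V r) = y" using fl[OF r(1)] u(2) by simp
      then show ?thesis using ka(2) r(1) by blast
    qed
    show "\<exists>y \<in> carrier ?K'. h y = z" if z: "z \<in> carrier ?L" for z
    proof -
      obtain w where w: "w \<in> V" "z = Q.vc b w" using z by auto
      obtain u where u: "u \<in> vecs R b'" "w \<ominus>\<^bsub>F b\<^esub> p u \<in> IV i b" using psur[OF w(1)] by blast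
      have wc: "w \<in> vecs R b" using w(1) v(1) by blast
      have "w \<ominus>\<^bsub>F b\<^esub> p u \<in> IV N b" using Ai[OF u(2)] i by simp
      then have "Q.vc b w = Q.vc b (p u)" using Q.vec_class_eq_iff[OF wc pc[OF u(1)]] by blast
      then have "h (class_in b' V' u) = z" using hp[OF u(1)] w(2) by simp
      then show ?thesis using ka'(2) u(1) by blast
    qed
  qed
  then show thesis using that pres' by blast
qed

end

section \<open>Finite free resolutions under base change along a regular sequence\<close>

context G_regular_quotient begin

lemma plus_I_cases:
  assumes "u \<in> plus_I b V k"
  obtains z where "z \<in> V" "u \<ominus>\<^bsub>F b\<^esub> z \<in> IV k b" "u \<in> vecs R b"
  using assms by (auto simp: sum_submodule_def)

lemma vc_mem_image_iff:
  assumes V: "submodule V R (F b)" and u: "u \<in> vecs R b"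
  shows "Q.vc b u \<in> Q.vc b ` V \<longleftrightarrow> u \<in> plus_I b V N"
proof -
  have "class_in b V u = \<zero>\<^bsub>base_change b V\<^esub> \<longleftrightarrow> Q.vc b u \<in> Q.vc b ` V"
    unfolding class_in_def base_change_def
    by (rule mod_coset_eq_zero_iff[OF Q.S.free_mod vc_image_submodule[OF V] Q.vec_class_closed[OF u]])
  then show ?thesis using class_in_zero_iff[OF V u] by simp
qed

lemma IV_0: "IV 0 b = {\<zero>\<^bsub>F b\<^esub>}" by (simp add: Ik_0 ideal_vecs_zero)

text \<open>This says that W meets I_k R^d in I_k W, which is the vanishing of Tor_1 of R^d / W and
  R / I_k. In the step, e u = x_{k+1} w modulo I_k. Regularity moves w into W up to I_k R^d, and a
  multiple of x_{k+1} is removed from u.\<close>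

lemma kernel_plus_I:
  assumes W: "submodule W R (F d)" and e: "e \<in> Lin R n d" "e ` vecs R n = W"
    and reg: "\<forall>k<N. \<forall>u \<in> vecs R d. xs ! k \<odot>\<^bsub>F d\<^esub> u \<in> plus_I d W k \<longrightarrow> u \<in> plus_I d W k"
  shows "k \<le> N \<Longrightarrow> u \<in> vecs R n \<Longrightarrow> e u \<in> IV k d \<Longrightarrow> u \<in> plus_I n (a_kernel (F n) (F d) e) k"
proof (induction k arbitrary: u)
  let ?U = "a_kernel (F n) (F d) e"
  interpret A: module R "F n" by (rule free_mod)
  interpret B: module R "F d" by (rule free_mod)
  have U: "submodule ?U R (F n)" by (rule kernel_submodule[OF free_mod free_mod e(1)])
  {
    case 0
    then have "u \<in> ?U" by (simp add: IV_0 a_kernel_eq)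
    then show ?case by (rule A.sum_submodule_left[OF U IV_sub])
  next
    case (Suc k)
    note k = Suc_le_lessD[OF Suc.prems(1)] and u = Suc.prems(2)
    let ?x = "xs ! k"
    have x: "?x \<in> carrier R" by (rule xk[OF k])
    have eu: "e u \<in> vecs R d" by (rule mod_hom_closed[OF e(1) u])
    obtain w where w: "w \<in> vecs R d" "e u \<ominus>\<^bsub>F d\<^esub> ?x \<odot>\<^bsub>F d\<^esub> w \<in> IV k d" by (rule IV_Suc[OF k Suc.prems(3)])
    have "?x \<odot>\<^bsub>F d\<^esub> w \<ominus>\<^bsub>F d\<^esub> e u = \<ominus>\<^bsub>F d\<^esub> (e u \<ominus>\<^bsub>F d\<^esub> ?x \<odot>\<^bsub>F d\<^esub> w)" using eu w(1) x by algebra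
    then have "?x \<odot>\<^bsub>F d\<^esub> w \<ominus>\<^bsub>F d\<^esub> e u \<in> IV k d" using B.submoduleD(5)[OF IV_sub w(2)] by simp
    then have "?x \<odot>\<^bsub>F d\<^esub> w \<in> plus_I d W k" using e(2) u w(1) x by (auto simp: sum_submodule_def)
    then have "w \<in> plus_I d W k" using reg k w(1) by blast
    then obtain z where z: "z \<in> W" "w \<ominus>\<^bsub>F d\<^esub> z \<in> IV k d" by (rule plus_I_cases)
    then obtain v where v: "v \<in> vecs R n" "z = e v" using e(2) by blast
    have ev: "e v \<in> vecs R d" by (rule mod_hom_closed[OF e(1) v(1)])
    have xv: "?x \<odot>\<^bsub>F n\<^esub> v \<in> vecs R n" using v(1) x by simp
    have "e (u \<ominus>\<^bsub>F n\<^esub> ?x \<odot>\<^bsub>F n\<^esub> v) = (e u \<ominus>\<^bsub>F d\<^esub> ?x \<odot>\<^bsub>F d\<^esub> w) \<oplus>\<^bsub>F d\<^esub> ?x \<odot>\<^bsub>F d\<^esub> (w \<ominus>\<^bsub>F d\<^esub> e v)"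
      unfolding mod_hom_minus[OF free_mod free_mod e(1) u xv] mod_hom_smult[OF e(1) x v(1)]
      using eu ev w(1) x by algebra
    also have "\<dots> \<in> IV k d"
      using B.submoduleD(3)[OF IV_sub w(2) B.submoduleD(6)[OF IV_sub x z(2)]] v(2) by simp
    finally have "u \<ominus>\<^bsub>F n\<^esub> ?x \<odot>\<^bsub>F n\<^esub> v \<in> plus_I n ?U k"
      using Suc.IH[of "u \<ominus>\<^bsub>F n\<^esub> ?x \<odot>\<^bsub>F n\<^esub> v"] k u xv by simp
    then have 1: "u \<ominus>\<^bsub>F n\<^esub> ?x \<odot>\<^bsub>F n\<^esub> v \<in> plus_I n ?U (Suc k)"
      using sum_submodule_mono[OF IV_mono[of k "Suc k" n]] Suc.prems(1) by auto
    have 2: "?x \<odot>\<^bsub>F n\<^esub> v \<in> plus_I n ?U (Suc k)"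
      by (rule A.sum_submodule_right[OF U IV_sub IV_x[OF k v(1)]])
    show ?case by (rule A.mem_of_diff[OF sum_submodule[OF free_mod U IV_sub] 1 2 u])
  }
qed

text \<open>Reduction preserves the kernel of each differential by \<open>kernel_plus_I\<close>, so
  the resolution reduces to one over S.\<close>

lemma ffr_sub_base_change:
  assumes "submodule W R (F d)" "ffr_sub R n d W"
    "\<forall>k<N. \<forall>u \<in> vecs R d. xs ! k \<odot>\<^bsub>F d\<^esub> u \<in> plus_I d W k \<longrightarrow> u \<in> plus_I d W k"
  shows "ffr_sub S n d (Q.vc d ` W)" using assms
proof (induction n arbitrary: d W)
  case 0
  then show ?case using mod_hom_zero[OF free_mod Q.restrict_scalars_module[OF Q.S.free_mod] Q.vec_class_hom] by simp
next
  case (Suc n)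
  note W = Suc.prems(1) and reg = Suc.prems(3)
  obtain c e where e: "e \<in> Lin R c d" "e ` vecs R c = W" and f: "ffr_sub R n c (a_kernel (F c) (F d) e)"
    using Suc.prems(2) by auto
  let ?U = "a_kernel (F c) (F d) e"
  have U: "submodule ?U R (F c)" by (rule kernel_submodule[OF free_mod free_mod e(1)])
  note C = kernel_plus_I[OF W e reg]
  interpret B: module R "F d" by (rule free_mod)
  interpret A: module R "F c" by (rule free_mod)
  have e0: "e u \<in> IV k d" if "u \<in> plus_I c ?U k" for u k using that
  proof (rule plus_I_cases)
    fix z assume z: "z \<in> ?U" "u \<ominus>\<^bsub>F c\<^esub> z \<in> IV k c" and u: "u \<in> vecs R c"
    have zc: "z \<in> vecs R c" and ez: "e z \<in> IV k d" using z(1) B.submoduleD(2)[OF IV_sub] by (auto simp: a_kernel_eq)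
    have "e u \<ominus>\<^bsub>F d\<^esub> e z \<in> IV k d" using IV_hom[OF e(1) z(2)] mod_hom_minus[OF free_mod free_mod e(1) u zc] by simp
    then show ?thesis using B.mem_of_diff[OF IV_sub _ ez mod_hom_closed[OF e(1) u]] by simp
  qed
  \<comment> \<open>The sequence is regular on R^c / U, because \<open>e\<close> detects membership
    in U + I_k R^c and x_{k+1} is regular on (R/I_k)^d.\<close>
  have "\<forall>k<N. \<forall>u \<in> vecs R c. xs ! k \<odot>\<^bsub>F c\<^esub> u \<in> plus_I c ?U k \<longrightarrow> u \<in> plus_I c ?U k"
  proof (intro allI impI ballI)
    fix k u assume k: "k < N" and u: "u \<in> vecs R c" and xu: "xs ! k \<odot>\<^bsub>F c\<^esub> u \<in> plus_I c ?U k"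
    have "xs ! k \<odot>\<^bsub>F d\<^esub> e u \<in> IV k d" using e0[OF xu] mod_hom_smult[OF e(1) xk[OF k] u] by simp
    then have "e u \<in> IV k d" by (rule IV_reg[OF k mod_hom_closed[OF e(1) u]])
    then show "u \<in> plus_I c ?U k" using C[of k u] k u by simp
  qed
  then have f': "ffr_sub S n c (Q.vc c ` ?U)" using Suc.IH[OF U f] by blast
  obtain h where h: "h \<in> Lin S c d"
    and hv: "\<And>u. u \<in> vecs R c \<Longrightarrow> h (Q.vc c u) = Q.vc d (e u)"
    using Q.descend_hom[OF Q.S.free_mod mod_hom_comp[OF e(1) Q.vec_class_hom]] by blast
  have "h ` vecs S c = (\<lambda>u. h (Q.vc c u)) ` vecs R c"
    unfolding Q.vec_class_surj[symmetric] image_image ..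
  also have "\<dots> = Q.vc d ` (e ` vecs R c)" unfolding image_image by (rule image_cong[OF refl hv])
  finally have im: "h ` vecs S c = Q.vc d ` W" by (simp add: e(2))
  have "a_kernel (Free S c) (Free S d) h = Q.vc c ` ?U"
  proof (rule Set.set_eqI)
    fix y
    show "y \<in> a_kernel (Free S c) (Free S d) h \<longleftrightarrow> y \<in> Q.vc c ` ?U"
    proof (cases "y \<in> vecs S c")
      case True
      then obtain u where u: "u \<in> vecs R c" "y = Q.vc c u" by (rule Q.vec_class_preimage)
      have "h y = \<zero>\<^bsub>Free S d\<^esub> \<longleftrightarrow> e u \<in> IV N d"
        using hv[OF u(1)] u(2) Q.vec_class_eq_zero_iff[OF mod_hom_closed[OF e(1) u(1)]] by simp
      also have "\<dots> \<longleftrightarrow> u \<in> plus_I c ?U N" using C[OF order_refl u(1)] e0 by blast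
      finally show ?thesis using vc_mem_image_iff[OF U u(1)] True u(2) by (simp add: a_kernel_eq)
    next
      case False
      then show ?thesis using Q.vec_class_closed A.submoduleD(1)[OF U] by (auto simp: a_kernel_eq)
    qed
  qed
  then show ?case unfolding ffr_sub.simps using h im f' by metis
qed

text \<open>The finite resolution need not begin with the given presentation. Its cover R^d -> R^b /
  V is lifted to a map \<open>a\<close> into R^b, along which regularity and the reductions modulo
  I_k are compared.\<close>

lemma has_ffr_base_change:
  assumes pres: "regular_presentation 0 b V" shows "has_ffr S (base_change b V)"
proof -
  note P = pres[unfolded regular_presentation_def]
  have V: "submodule V R (F b)" and ffr: "has_ffr R (quot_module (F b) V)" using P by blast+
  have reg: "u \<in> plus_I b V k" if "k < N" "u \<in> vecs R b" "xs ! k \<odot>\<^bsub>F b\<^esub> u \<in> plus_I b V k" for k u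
    using P that by blast
  let ?Q = "quot_module (F b) V"
  note QM = quot_module[OF free_mod V]
  obtain n d e where e: "e \<in> mod_hom R (F d) ?Q" "e ` vecs R d = carrier ?Q"
    and f: "ffr_sub R n d (a_kernel (F d) ?Q e)" using ffr unfolding has_ffr_def ffr_def by blast
  let ?W = "a_kernel (F d) ?Q e"
  have W: "submodule ?W R (F d)" by (rule kernel_submodule[OF free_mod QM e(1)])
  have "e ` vecs R d \<subseteq> mod_coset (F b) V ` vecs R b" unfolding e(2) mod_coset_surj[OF free_mod V] ..
  then obtain a where a: "a \<in> Lin R d b" "\<And>u. u \<in> vecs R d \<Longrightarrow> mod_coset (F b) V (a u) = e u"
    using free_lift[OF free_mod QM mod_coset_hom[OF free_mod V] e(1)] by blast
  interpret Fb: module R "F b" by (rule free_mod)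
  interpret Fd: module R "F d" by (rule free_mod)
  have ac: "u \<in> vecs R d \<Longrightarrow> a u \<in> vecs R b" for u by (rule mod_hom_closed[OF a(1)])
  have aW: "u \<in> ?W \<longleftrightarrow> a u \<in> V" if "u \<in> vecs R d" for u
    using a(2)[OF that] mod_coset_eq_zero_iff[OF free_mod V ac[OF that]] that by (simp add: a_kernel_eq)
  have cover: "\<exists>u \<in> vecs R d. w \<ominus>\<^bsub>F b\<^esub> a u \<in> V" if w: "w \<in> vecs R b" for w
  proof -
    have "mod_coset (F b) V w \<in> e ` vecs R d" unfolding e(2) by (rule mod_hom_closed[OF mod_coset_hom[OF free_mod V] w])
    then obtain u where u: "u \<in> vecs R d" "mod_coset (F b) V w = e u" by blast
    then have "w \<ominus>\<^bsub>F b\<^esub> a u \<in> V" using mod_coset_eq_iff[OF free_mod V w ac[OF u(1)]] a(2)[OF u(1)] by simp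
    then show ?thesis using u(1) by blast
  qed
  note v = Fb.submoduleD[OF V]
  \<comment> \<open>The unit vectors of R^b lie in the image of \<open>a\<close> up to V;
    multiplying by scalars from I_k gives the claim for I_k R^b.\<close>
  have IVcover: "\<exists>z \<in> IV k d. y \<ominus>\<^bsub>F b\<^esub> a z \<in> V" if y: "y \<in> IV k b" for k y
  proof -
    let ?H = "sum_submodule (F b) (a ` IV k d) V"
    note aIV = image_submodule[OF free_mod free_mod a(1) IV_sub]
    have "y \<in> ?H"
    proof (rule ideal_vecs_hom_mem[OF free_mod Ik_ideal mod_hom_id sum_submodule[OF free_mod aIV V] _ y])
      fix c i assume c: "c \<in> Ik k"
      then have c': "c \<in> carrier R" using ideal_facts(1)[OF Ik_ideal] by blast
      let ?u = "unit_vec R b i"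
      have u: "?u \<in> vecs R b" by (rule unit_vec_closed[OF cR])
      obtain w where w: "w \<in> vecs R d" "?u \<ominus>\<^bsub>F b\<^esub> a w \<in> V" using cover[OF u] by blast
      have "c \<odot>\<^bsub>F b\<^esub> ?u \<ominus>\<^bsub>F b\<^esub> a (c \<odot>\<^bsub>F d\<^esub> w) = c \<odot>\<^bsub>F b\<^esub> (?u \<ominus>\<^bsub>F b\<^esub> a w)"
        unfolding mod_hom_smult[OF a(1) c' w(1)] using u ac[OF w(1)] c' by algebra
      also have "\<dots> \<in> V" by (rule v(6)[OF c' w(2)])
      finally show "c \<odot>\<^bsub>F b\<^esub> ?u \<in> ?H"
        using ideal_vecs_smult[OF cR Ik_ideal c w(1)] u c' by (auto simp: sum_submodule_def)
    qed
    then show ?thesis by (auto simp: sum_submodule_def)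
  qed
  have aplus: "u \<in> plus_I d ?W k \<longleftrightarrow> a u \<in> plus_I b V k" if u: "u \<in> vecs R d" for u k
  proof
    assume "u \<in> plus_I d ?W k"
    then obtain z where z: "z \<in> ?W" "u \<ominus>\<^bsub>F d\<^esub> z \<in> IV k d" by (rule plus_I_cases)
    have zc: "z \<in> vecs R d" using z(1) by (simp add: a_kernel_eq)
    have "a u \<ominus>\<^bsub>F b\<^esub> a z \<in> IV k b" using IV_hom[OF a(1) z(2)] mod_hom_minus[OF free_mod free_mod a(1) u zc] by simp
    then show "a u \<in> plus_I b V k" using aW[OF zc] z(1) ac[OF u] by (auto simp: sum_submodule_def)
  next
    assume "a u \<in> plus_I b V k"
    then obtain z where z: "z \<in> V" "a u \<ominus>\<^bsub>F b\<^esub> z \<in> IV k b" by (rule plus_I_cases)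
    have zc: "z \<in> vecs R b" using z(1) v(1) by blast
    obtain y where y: "y \<in> IV k d" "(a u \<ominus>\<^bsub>F b\<^esub> z) \<ominus>\<^bsub>F b\<^esub> a y \<in> V" using IVcover[OF z(2)] by blast
    have yc: "y \<in> vecs R d" by (rule IV_carrier[OF y(1)])
    have "a (u \<ominus>\<^bsub>F d\<^esub> y) = ((a u \<ominus>\<^bsub>F b\<^esub> z) \<ominus>\<^bsub>F b\<^esub> a y) \<oplus>\<^bsub>F b\<^esub> z"
      unfolding mod_hom_minus[OF free_mod free_mod a(1) u yc] using ac[OF u] ac[OF yc] zc by algebra
    also have "\<dots> \<in> V" by (rule v(3)[OF y(2) z(1)])
    finally have uy: "u \<ominus>\<^bsub>F d\<^esub> y \<in> ?W" using aW[of "u \<ominus>\<^bsub>F d\<^esub> y"] u yc by simp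
    have "u \<ominus>\<^bsub>F d\<^esub> (u \<ominus>\<^bsub>F d\<^esub> y) = y" using u yc by algebra
    then show "u \<in> plus_I d ?W k" using uy y(1) u by (force simp: sum_submodule_def)
  qed
  have "\<forall>k<N. \<forall>u \<in> vecs R d. xs ! k \<odot>\<^bsub>F d\<^esub> u \<in> plus_I d ?W k \<longrightarrow> u \<in> plus_I d ?W k"
  proof (intro allI impI ballI)
    fix k u assume k: "k < N" and u: "u \<in> vecs R d" and xu: "xs ! k \<odot>\<^bsub>F d\<^esub> u \<in> plus_I d ?W k"
    have "xs ! k \<odot>\<^bsub>F d\<^esub> u \<in> vecs R d" using u xk[OF k] by simp
    then have "xs ! k \<odot>\<^bsub>F b\<^esub> a u \<in> plus_I b V k" using aplus xu mod_hom_smult[OF a(1) xk[OF k] u] by metis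
    then show "u \<in> plus_I d ?W k" using reg[OF k ac[OF u]] aplus[OF u] by blast
  qed
  then have f': "ffr_sub S n d (Q.vc d ` ?W)" by (rule ffr_sub_base_change[OF W f])
  note KM = base_change_module[OF V]
  obtain h where h: "h \<in> mod_hom S (Free S d) (base_change b V)"
    and hv: "\<And>u. u \<in> vecs R d \<Longrightarrow> h (Q.vc d u) = class_in b V (a u)"
    using Q.descend_hom[OF KM mod_hom_comp[OF a(1) class_in_hom[OF V]]] by blast
  have "h ` vecs S d = carrier (base_change b V)"
  proof
    show "h ` vecs S d \<subseteq> carrier (base_change b V)" using h by (auto simp: mod_hom_def)
    show "carrier (base_change b V) \<subseteq> h ` vecs S d"
    proof
      fix y assume "y \<in> carrier (base_change b V)"
      then obtain w where w: "w \<in> vecs R b" "y = class_in b V w" unfolding class_in_surj[OF V, symmetric] by blast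
      obtain u where u: "u \<in> vecs R d" "w \<ominus>\<^bsub>F b\<^esub> a u \<in> V" using cover[OF w(1)] by blast
      have "w \<ominus>\<^bsub>F b\<^esub> a u \<in> plus_I b V N" by (rule Fb.sum_submodule_left[OF V IV_sub u(2)])
      then have "class_in b V (w \<ominus>\<^bsub>F b\<^esub> a u) = \<zero>\<^bsub>base_change b V\<^esub>" using class_in_zero_iff[OF V] w(1) ac[OF u(1)] by simp
      then have "class_in b V w = class_in b V (a u)"
        using mod_hom_eq_iff[OF free_mod Q.restrict_scalars_module[OF KM] class_in_hom[OF V] w(1) ac[OF u(1)]] by simp
      then show "y \<in> h ` vecs S d" using hv[OF u(1)] w(2) Q.vec_class_closed[OF u(1)] by force
    qed
  qed
  moreover have "a_kernel (Free S d) (base_change b V) h = Q.vc d ` ?W"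
  proof (rule Set.set_eqI)
    fix y
    show "y \<in> a_kernel (Free S d) (base_change b V) h \<longleftrightarrow> y \<in> Q.vc d ` ?W"
    proof (cases "y \<in> vecs S d")
      case True
      then obtain u where u: "u \<in> vecs R d" "y = Q.vc d u" by (rule Q.vec_class_preimage)
      have "h y = \<zero>\<^bsub>base_change b V\<^esub> \<longleftrightarrow> u \<in> plus_I d ?W N"
        using hv[OF u(1)] u(2) class_in_zero_iff[OF V ac[OF u(1)]] aplus[OF u(1)] by simp
      then show ?thesis using vc_mem_image_iff[OF W u(1)] True u(2) by (simp add: a_kernel_eq)
    next
      case False
      then show ?thesis using Q.vec_class_closed Fd.submoduleD(1)[OF W] by (auto simp: a_kernel_eq)
    qed
  qed
  ultimately show ?thesis unfolding has_ffr_def ffr_def using h f' by metis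
qed

text \<open>A minimal cover of the S-module over R. The relations contain I_N R^b because I_N kills
  the module, and for j = N the regularity condition is empty.\<close>

lemma initial_presentation:
  assumes fg: "fg_module S M" and ffr: "has_ffr R (Q.rs M)"
  obtains b V where "regular_presentation N b V" "isomorphic_modules S (base_change b V) M"
proof -
  have M: "module S M" by (rule fg_module_module[OF fg])
  note MR = Q.restrict_scalars_module[OF M]
  obtain n e where e: "e \<in> mod_hom S (Free S n) M" "e ` vecs S n = carrier M"
    by (rule fg_moduleE[OF fg])
  have "(\<lambda>u. e (Q.vc n u)) \<in> mod_hom R (F n) (Q.rs M)"
    by (rule mod_hom_comp[OF Q.vec_class_hom]) (use e(1) in \<open>simp add: Q.restrict_scalars_hom\<close>)
  moreover have "(\<lambda>u. e (Q.vc n u)) ` vecs R n = carrier (Q.rs M)"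
    unfolding image_image[symmetric] Q.vec_class_surj e(2) by simp
  ultimately have fgR: "fg_module R (Q.rs M)" by (rule fg_moduleI[OF MR])
  obtain b p where p: "p \<in> mod_hom R (F b) (Q.rs M)" "p ` vecs R b = carrier (Q.rs M)"
    "a_kernel (F b) (Q.rs M) p \<subseteq> ideal_vecs (max_ideal R) b"
    by (rule minimal_cover_local[OF loc fgR])
  let ?V = "a_kernel (F b) (Q.rs M) p"
  have V: "submodule ?V R (F b)" by (rule kernel_submodule[OF free_mod MR p(1)])
  interpret Fb: module R "F b" by (rule free_mod)
  obtain h where h: "h \<in> mod_hom S (Free S b) M" "\<And>u. u \<in> vecs R b \<Longrightarrow> h (Q.vc b u) = p u"
    using Q.descend_hom[OF M p(1)] by blast
  have IV: "IV N b \<subseteq> ?V"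
  proof
    fix u assume u: "u \<in> IV N b"
    have uc: "u \<in> vecs R b" by (rule IV_carrier[OF u])
    have "p u = h \<zero>\<^bsub>Free S b\<^esub>" using h(2)[OF uc] Q.vec_class_eq_zero_iff[OF uc] u by simp
    then show "u \<in> ?V" using mod_hom_zero[OF Q.S.free_mod M h(1)] uc by (simp add: a_kernel_eq)
  qed
  have ker: "p u = \<zero>\<^bsub>Q.rs M\<^esub> \<longleftrightarrow> mod_coset (F b) ?V u = \<zero>\<^bsub>quot_module (F b) ?V\<^esub>" if "u \<in> vecs R b" for u
    using mod_coset_eq_zero_iff[OF free_mod V that] that by (simp add: a_kernel_eq)
  obtain q where "q \<in> mod_iso R (Q.rs M) (quot_module (F b) ?V)"
  proof (rule surj_same_kernel_iso[OF free_mod MR quot_module[OF free_mod V] p(1,2) mod_coset_hom[OF free_mod V] mod_coset_surj[OF free_mod V]])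
  qed (rule ker, assumption, rule that)
  then have "isomorphic_modules R (Q.rs M) (quot_module (F b) ?V)" by (rule isomorphic_modulesI)
  then have "has_ffr R (quot_module (F b) ?V)" by (rule has_ffr_iso[OF MR quot_module[OF free_mod V] _ ffr])
  then have pres: "regular_presentation N b ?V" using V IV p(3) by (simp add: regular_presentation_def)
  have plus: "u \<in> plus_I b ?V N \<longleftrightarrow> u \<in> ?V" for u
  proof
    assume "u \<in> plus_I b ?V N"
    then show "u \<in> ?V" by (rule plus_I_cases) (use Fb.mem_of_diff[OF V] IV in blast)
  qed (rule Fb.sum_submodule_left[OF V IV_sub])
  note KM = base_change_module[OF V]
  have s: "class_in b ?V ` vecs R b = carrier (Q.rs (base_change b ?V))" using class_in_surj[OF V] by simp
  have k: "class_in b ?V u = \<zero>\<^bsub>Q.rs (base_change b ?V)\<^esub> \<longleftrightarrow> p u = \<zero>\<^bsub>Q.rs M\<^esub>" if "u \<in> vecs R b" for u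
    using class_in_zero_iff[OF V that] plus that by (simp add: a_kernel_eq)
  obtain f where "f \<in> mod_iso R (Q.rs (base_change b ?V)) (Q.rs M)"
    using surj_same_kernel_iso[OF free_mod Q.restrict_scalars_module[OF KM] MR class_in_hom[OF V] s p(1,2) k] by blast
  then have "f \<in> mod_iso S (base_change b ?V) M" by (simp add: mod_iso_def Q.restrict_scalars_hom)
  then show thesis using that[OF pres] isomorphic_modulesI by blast
qed

end

subsection \<open>Minimal free resolutions\<close>

lemma submodule_minimal_cover:
  assumes R: "local_ring R" and U: "submodule U R (Free R c)"
  obtains m f where "f \<in> Lin R m c" "f ` vecs R m = U"
    "a_kernel (Free R m) (Free R c) f \<subseteq> ideal_vecs (max_ideal R) m"
proof -
  have cR: "cring R" and nR: "noetherian_ring R" using R by (auto simp: local_ring_def)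
  note FM = Free[OF cR]
  let ?U = "(Free R c)\<lparr>carrier := U\<rparr>"
  have UM: "module R ?U" by (rule submodule_carrier_module[OF FM U])
  obtain n g where g: "g \<in> Lin R n c" "g ` vecs R n = U"
    by (rule noetherian_submodule_generated[OF cR nR U])
  have "fg_module R ?U" by (rule fg_moduleI[OF UM mod_hom_restrict_cod[OF g(1)]]) (use g(2) in auto)
  then obtain m f where f: "f \<in> mod_hom R (Free R m) ?U" "f ` vecs R m = carrier ?U"
    "a_kernel (Free R m) ?U f \<subseteq> ideal_vecs (max_ideal R) m" by (rule minimal_cover_local[OF R])
  have "f \<in> Lin R m c"
    by (rule mod_hom_extend_cod[OF f(1)]) (rule module.submoduleD(1)[OF FM U])
  then show thesis using that f(2,3) by (simp add: a_kernel_restrict_cod)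
qed

text \<open>Continues a given minimal first cover, choosing at each stage a minimal cover of the
  current kernel.\<close>

lemma minimal_free_resolution_exists:
  assumes R: "local_ring R" and M: "module R M"
    and e: "e \<in> mod_hom R (Free R n) M" "e ` vecs R n = carrier M"
    and min: "a_kernel (Free R n) M e \<subseteq> ideal_vecs (max_ideal R) n"
  obtains \<beta> d where "minimal_free_resolution R \<beta> d e M" "\<beta> 0 = n"
    "d 0 ` vecs R (\<beta> 1) = a_kernel (Free R n) M e"
proof -
  have cR: "cring R" using R by (auto simp: local_ring_def)
  note FM = Free[OF cR]
  let ?K = "a_kernel (Free R n) M e" and ?m = "max_ideal R"
  \<comment> \<open>The state (c, m, f) is one differential f : R^m -> R^c; \<open>T\<close> demands
    that the next one have the kernel of f as its image.\<close>
  define P where "P i s = (case s of (c, m, f) \<Rightarrow> f \<in> Lin R m c \<and>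
      a_kernel (Free R m) (Free R c) f \<subseteq> ideal_vecs ?m m \<and>
      (i = 0 \<longrightarrow> c = n \<and> f ` vecs R m = ?K))" for i :: nat and s :: "nat \<times> nat \<times> ((nat \<Rightarrow> 'a) \<Rightarrow> nat \<Rightarrow> 'a)"
  define T where "T s t = (case (s, t) of ((c, m, f), (c', m', f')) \<Rightarrow> c' = m \<and>
      f' ` vecs R m' = a_kernel (Free R m) (Free R c) f)"
    for s t :: "nat \<times> nat \<times> ((nat \<Rightarrow> 'a) \<Rightarrow> nat \<Rightarrow> 'a)"
  have "\<exists>s. \<forall>i. P i (s i) \<and> T (s i) (s (Suc i))"
  proof (rule dependent_nat_choice)
    obtain m f where "f \<in> Lin R m n" "f ` vecs R m = ?K"
      "a_kernel (Free R m) (Free R n) f \<subseteq> ideal_vecs ?m m"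
      by (rule submodule_minimal_cover[OF R kernel_submodule[OF FM M e(1)]])
    then have "P 0 (n, m, f)" by (simp add: P_def)
    then show "\<exists>s. P 0 s" by blast
  next
    fix s i assume s: "P i s"
    obtain c m f where s': "s = (c, m, f)" by (cases s) auto
    have f: "f \<in> Lin R m c" using s by (simp add: P_def s')
    obtain m' f' where "f' \<in> Lin R m' m"
      "f' ` vecs R m' = a_kernel (Free R m) (Free R c) f"
      "a_kernel (Free R m') (Free R m) f' \<subseteq> ideal_vecs ?m m'"
      by (rule submodule_minimal_cover[OF R kernel_submodule[OF FM FM f]])
    then have "P (Suc i) (m, m', f') \<and> T s (m, m', f')" by (simp add: P_def T_def s')
    then show "\<exists>t. P (Suc i) t \<and> T s t" by blast
  qed
  then obtain s where s: "\<And>i. P i (s i)" "\<And>i. T (s i) (s (Suc i))" by blast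
  define \<beta> where "\<beta> i = fst (s i)" for i
  define d where "d i = snd (snd (s i))" for i
  have m: "fst (snd (s i)) = \<beta> (Suc i)" for i using s(2)[of i] by (auto simp: T_def \<beta>_def split: prod.splits)
  have \<beta>0: "\<beta> 0 = n" using s(1)[of 0] by (auto simp: P_def \<beta>_def split: prod.splits)
  have si: "s i = (\<beta> i, \<beta> (Suc i), d i)" for i by (simp add: \<beta>_def d_def m[unfolded \<beta>_def, symmetric])
  have d: "d i \<in> Lin R (\<beta> (Suc i)) (\<beta> i)"
    "a_kernel (Free R (\<beta> (Suc i))) (Free R (\<beta> i)) (d i) \<subseteq> ideal_vecs ?m (\<beta> (Suc i))" for i
    using s(1)[of i] unfolding si P_def by auto
  have d0: "d 0 ` vecs R (\<beta> 1) = ?K" using s(1)[of 0] unfolding si P_def by auto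
  have dS: "d (Suc i) ` carrier (Free R (\<beta> (Suc (Suc i)))) = a_kernel (Free R (\<beta> (Suc i))) (Free R (\<beta> i)) (d i)" for i
    using s(2)[of i] unfolding si T_def by auto
  have mR: "ideal ?m R" using R by (rule max_ideal_ideal)
  have "d i ` vecs R (\<beta> (Suc i)) \<subseteq> ideal_vecs ?m (\<beta> i)" for i
    using d0 \<beta>0 min dS d(2) by (cases i) auto
  then have "d i ` vecs R (\<beta> (Suc i)) \<subseteq> ideal_times_module R ?m (Free R (\<beta> i))" for i
    using ideal_times_module_free[OF cR mR] by blast
  then have "minimal_free_resolution R \<beta> d e M"
    unfolding minimal_free_resolution_def free_resolution_def resolution_def
    using FM e d(1) dS d0 \<beta>0 by auto
  then show thesis using that \<beta>0 d0 by blast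
qed

lemma is_syzygy_1:
  assumes R: "local_ring R" and M: "module R M"
    and e: "e \<in> mod_hom R (Free R n) M" "e ` vecs R n = carrier M"
    and min: "a_kernel (Free R n) M e \<subseteq> ideal_vecs (max_ideal R) n"
    and L: "fg_module R L" "isomorphic_modules R L ((Free R n)\<lparr>carrier := a_kernel (Free R n) M e\<rparr>)"
  shows "is_syzygy R 1 M L"
proof -
  obtain \<beta> d where "minimal_free_resolution R \<beta> d e M" "\<beta> 0 = n"
    "d 0 ` vecs R (\<beta> 1) = a_kernel (Free R n) M e"
    by (rule minimal_free_resolution_exists[OF R M e min])
  then show ?thesis unfolding is_syzygy_def using L by (auto intro!: exI[of _ \<beta>] exI[of _ d] exI[of _ e])
qed

lemma mod_power_1_iso:
  assumes "module R M" shows "isomorphic_modules R (mod_power M 1) M"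
proof -
  have "(\<lambda>f. f 0) \<in> mod_hom R (mod_power M 1) M" by (rule mod_homI) (auto simp: mod_power_simps)
  moreover have "inj_on (\<lambda>f. f 0) (carrier (mod_power M 1))"
    by (rule inj_onI, rule PiE_ext[of _ "{..<1}" "\<lambda>_. carrier M"]) (auto simp: mod_power_simps)
  moreover have "(\<lambda>f. f 0) ` carrier (mod_power M 1) = carrier M"
  proof
    show "carrier M \<subseteq> (\<lambda>f. f 0) ` carrier (mod_power M 1)"
    proof
      fix x assume "x \<in> carrier M"
      then have "(\<lambda>i\<in>{..<1::nat}. x) \<in> carrier (mod_power M 1)" by (auto simp: mod_power_simps)
      from imageI[OF this, of "\<lambda>f. f 0"] show "x \<in> (\<lambda>f. f 0) ` carrier (mod_power M 1)" by simp
    qed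
  qed (auto simp: mod_power_simps)
  ultimately show ?thesis by (intro isomorphic_modulesI[OF mod_isoI])
qed

lemma short_exact_iso_middle:
  assumes "short_exact R A B C" "isomorphic_modules R B B'" "module R A" "module R B" "module R C" "module R B'"
  shows "short_exact R A B' C"
proof -
  from assms(1) obtain f g where f: "f \<in> mod_hom R A B" "inj_on f (carrier A)" and g: "g \<in> mod_hom R B C"
    and gf: "\<And>x. x \<in> carrier A \<Longrightarrow> g (f x) = \<zero>\<^bsub>C\<^esub>"
    and ex: "\<And>y. y \<in> carrier B \<Longrightarrow> g y = \<zero>\<^bsub>C\<^esub> \<Longrightarrow> \<exists>x \<in> carrier A. f x = y"
    and sj: "\<And>z. z \<in> carrier C \<Longrightarrow> \<exists>y \<in> carrier B. g y = z"
    by (rule short_exactE) blast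
  obtain h where h: "h \<in> mod_iso R B B'" using assms(2) by (auto simp: isomorphic_modules_def)
  note hD = mod_isoD[OF h]
  note kD = mod_isoD[OF mod_iso_inv[OF h assms(4,6)]]
  let ?k = "inv_into (carrier B) h"
  have kh: "?k (h y) = y" if "y \<in> carrier B" for y by (rule inv_into_f_f[OF hD(2) that])
  have hk: "h (?k y) = y" if "y \<in> carrier B'" for y by (rule f_inv_into_f) (use that hD(3) in simp)
  have kc: "?k y \<in> carrier B" if "y \<in> carrier B'" for y by (rule mod_hom_closed[OF kD(1) that])
  have fc: "f x \<in> carrier B" if "x \<in> carrier A" for x by (rule mod_hom_closed[OF f(1) that])
  have hc: "h x \<in> carrier B'" if "x \<in> carrier B" for x by (rule mod_hom_closed[OF hD(1) that])
  show ?thesis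
  proof (rule short_exactI[OF mod_hom_comp[OF f(1) hD(1)] mod_hom_comp[OF kD(1) g]])
    show "inj_on (\<lambda>x. h (f x)) (carrier A)" using f(2) hD(2) fc unfolding inj_on_def by blast
    show "g (?k (h (f x))) = \<zero>\<^bsub>C\<^esub>" if x: "x \<in> carrier A" for x using gf[OF x] kh[OF fc[OF x]] by simp
    show "\<exists>x \<in> carrier A. h (f x) = y" if y: "y \<in> carrier B'" "g (?k y) = \<zero>\<^bsub>C\<^esub>" for y
      using ex[OF kc[OF y(1)] y(2)] hk[OF y(1)] by metis
    show "\<exists>y \<in> carrier B'. g (?k y) = z" if z: "z \<in> carrier C" for z
      using sj[OF z] kh hc by metis
  qed
qed

subsection \<open>Projective modules over a local ring are totally reflexive\<close>

text \<open>R^n is the image in the contractible complex whose maps are alternately the identity and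
  zero, with the identity in even degrees so that it stands at index 0.\<close>

lemma totally_reflexive_free:
  assumes R: "cring R" and Y: "module R Y" and h: "h \<in> mod_iso R (Free R n) Y"
  shows "totally_reflexive R Y"
proof -
  note FM = Free[OF R]
  interpret F: module R "Free R n" by (rule FM)
  interpret T: module R "self_module R" by (rule self_module[OF R])
  define A where "A i = (if even i then (\<lambda>u. u) else (\<lambda>u. \<zero>\<^bsub>Free R n\<^esub>))" for i :: int
  have A: "A i \<in> Lin R n n" for i
    unfolding A_def by (auto intro: mod_hom_id mod_homI)
  have E: "A i u = \<zero>\<^bsub>Free R n\<^esub> \<longleftrightarrow> (\<exists>w \<in> vecs R n. u = A (i + 1) w)"
    if "u \<in> vecs R n" for i u unfolding A_def using that by auto
  have D: "\<exists>g \<in> mod_hom R (Free R n) (self_module R). \<forall>u \<in> vecs R n. f u = g (A i u)"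
    if f: "f \<in> mod_hom R (Free R n) (self_module R)"
      and 0: "\<forall>w \<in> vecs R n. f (A (i + 1) w) = \<zero>\<^bsub>R\<^esub>" for i f
  proof (rule bexI[OF _ f])
    show "\<forall>u \<in> vecs R n. f u = f (A i u)"
      using 0 mod_hom_zero[OF FM self_module[OF R] f] unfolding A_def by (auto split: if_splits)
  qed
  have t: "totally_acyclic R {\<zero>\<^bsub>R\<^esub>} (\<lambda>_. n) A"
    unfolding totally_acyclic_zero_iff[OF R] using A E D by blast
  note hD = mod_isoD[OF h]
  note kD = mod_isoD[OF mod_iso_inv[OF h FM Y]]
  show ?thesis
  proof (rule totally_reflexive_of_totally_acyclic[OF R t Y hD(1,3) kD(1,2)])
    fix u assume "u \<in> vecs R n"
    then show "inv_into (vecs R n) h (h u) = A 0 u" using inv_into_f_f[OF hD(2)] by (simp add: A_def)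
  qed
qed

lemma finite_G_dim_of_finite_pd:
  fixes R :: "('a, 'r) ring_scheme"
  assumes R: "local_ring R" and pd: "pd R M < \<infinity>" shows "G_dim R M < \<infinity>"
proof -
  have tr: "totally_reflexive R P" if P: "projective_module R P" for P :: "'a fgmod"
  proof -
    obtain n where "isomorphic_modules R (Free R n) P" by (rule projective_imp_free[OF R P])
    then obtain h where "h \<in> mod_iso R (Free R n) P" by (auto simp: isomorphic_modules_def)
    moreover have "module R P" using P by (simp add: projective_module_def fg_module_module)
    ultimately show ?thesis by (intro totally_reflexive_free[OF local_ring_cring[OF R]])
  qed
  obtain n where "has_resolution_of_length R (projective_module R) n M"
    using pd unfolding pd_def resolution_dim_finite_iff by blast
  then obtain P :: "nat \<Rightarrow> 'a fgmod" and d e where "resolution R P d e M"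
    "\<forall>i\<le>n. projective_module R (P i)" "\<forall>i>n. carrier (P i) = {\<zero>\<^bsub>P i\<^esub>}"
    unfolding has_resolution_of_length_def by (elim exE conjE)
  moreover from this(2) have "\<forall>i\<le>n. totally_reflexive R (P i)" using tr by simp
  ultimately have "has_resolution_of_length R (totally_reflexive R) n M"
    unfolding has_resolution_of_length_def by (intro exI conjI)
  then show ?thesis unfolding G_dim_def resolution_dim_finite_iff by blast
qed

subsection \<open>Reducing sequences\<close>

definition reduces_to :: "('a, 'r) ring_scheme \<Rightarrow> 'a fgmod \<Rightarrow> 'a fgmod \<Rightarrow> bool" where
  "reduces_to R K K' \<longleftrightarrow> (\<exists>a\<ge>1. \<exists>b\<ge>1. \<exists>n. \<exists>L :: 'a fgmod. is_syzygy R n K L \<and>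
     short_exact R (mod_power K a) K' (mod_power L b))"

text \<open>Unlike a reducing sequence it may have length 0, which gives the induction its
  start.\<close>

definition reducing_chain ::
  "('a, 'r) ring_scheme \<Rightarrow> ('a fgmod \<Rightarrow> enat) \<Rightarrow> nat \<Rightarrow> (nat \<Rightarrow> 'a fgmod) \<Rightarrow> bool"
where
  "reducing_chain R I r K \<longleftrightarrow> (\<forall>i\<le>r. fg_module R (K i)) \<and> I (K r) < \<infinity> \<and> (\<forall>i<r. reduces_to R (K i) (K (Suc i)))"

lemma reducing_sequence_iff: "reducing_sequence R I r K \<longleftrightarrow> 1 \<le> r \<and> reducing_chain R I r K"
proof -
  have "(\<forall>i\<in>{1..r}. P (i - 1) i) \<longleftrightarrow> (\<forall>i<r. P i (Suc i))" for P
  proof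
    assume P: "\<forall>i<r. P i (Suc i)"
    show "\<forall>i\<in>{1..r}. P (i - 1) i"
    proof
      fix i assume "i \<in> {1..r}"
      then show "P (i - 1) i" using P[rule_format, of "i - 1"] by (cases i) auto
    qed
  qed force
  from this[of "\<lambda>i j. reduces_to R (K i) (K j)"]
  show ?thesis unfolding reducing_sequence_def reducing_chain_def reduces_to_def by auto
qed

lemma reduces_to_iso:
  assumes "reduces_to R K K'" "isomorphic_modules R K' K''" "module R K" "module R K'" "module R K''"
  shows "reduces_to R K K''"
proof -
  obtain a b n and L :: "'a fgmod" where *: "a \<ge> 1" "b \<ge> 1" "is_syzygy R n K L" "short_exact R (mod_power K a) K' (mod_power L b)"
    using assms(1) unfolding reduces_to_def by blast
  have "module R L" using *(3) by (simp add: is_syzygy_def fg_module_module)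
  then have "short_exact R (mod_power K a) K'' (mod_power L b)"
    by (intro short_exact_iso_middle[OF *(4) assms(2)] mod_power_module assms(3-5))
  then show ?thesis unfolding reduces_to_def using *(1-3) by blast
qed

text \<open>The term K r is replaced by the isomorphic K' 0, which only affects the middle of the
  last exact sequence of the first part. Since r is at least 1, the initial term stays K 0.\<close>

lemma reducing_chain_append:
  assumes K: "\<forall>i\<le>r. fg_module R (K i)" "\<forall>i<r. reduces_to R (K i) (K (Suc i))"
    and K': "reducing_chain R I n K'" and iso: "isomorphic_modules R (K r) (K' 0)" and r: "1 \<le> r"
  obtains K'' where "reducing_chain R I (r + n) K''" "K'' 0 = K 0"
proof -
  define K'' where "K'' i = (if i < r then K i else K' (i - r))" for i
  have fg: "fg_module R (K'' i)" if "i \<le> r + n" for i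
    using that K(1) K' by (auto simp: K''_def reducing_chain_def)
  have step: "reduces_to R (K'' i) (K'' (Suc i))" if i: "i < r + n" for i
  proof (cases "Suc i = r")
    case True
    then have 1: "reduces_to R (K i) (K r)" using K(2) by auto
    have m: "module R (K i)" "module R (K r)" "module R (K' 0)"
      using True K(1) K' by (auto simp: reducing_chain_def intro!: fg_module_module)
    show ?thesis using reduces_to_iso[OF 1 iso m] True by (simp add: K''_def)
  next
    case False
    show ?thesis
    proof (cases "i < r")
      case True
      then show ?thesis using False K(2) by (simp add: K''_def)
    next
      case ir: False
      then have "i - r < n" using i by simp
      then have "reduces_to R (K' (i - r)) (K' (Suc (i - r)))" using K' by (simp add: reducing_chain_def)
      then show ?thesis using ir by (simp add: K''_def Suc_diff_le)
    qed
  qed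
  have "I (K'' (r + n)) < \<infinity>" using K' by (simp add: K''_def reducing_chain_def)
  then have "reducing_chain R I (r + n) K''" unfolding reducing_chain_def using fg step by blast
  then show thesis using that r by (simp add: K''_def)
qed

section \<open>Comparison of the two reducing dimensions over S\<close>

context G_regular_quotient begin

text \<open>One copy of each module and the first syzygy. As V lies in m R^b, its image lies in the
  maximal ideal of S times S^b; so S^b is a minimal cover of the base change, with the image of V as
  syzygy.\<close>

lemma reduces_to_base_change:
  assumes V: "submodule V R (F b)" "V \<subseteq> ideal_vecs (max_ideal R) b" and K: "module S K"
    and ex: "short_exact S (base_change b V) K ((Free S b)\<lparr>carrier := Q.vc b ` V\<rparr>)"
  shows "reduces_to S (base_change b V) K"
proof -
  let ?U = "Q.vc b ` V" let ?B = "base_change b V" let ?U' = "(Free S b)\<lparr>carrier := ?U\<rparr>"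
  have U: "submodule ?U S (Free S b)" by (rule vc_image_submodule[OF V(1)])
  have UM: "module S ?U'" by (rule submodule_carrier_module[OF Q.S.free_mod U])
  have BM: "module S ?B" by (rule base_change_module[OF V(1)])
  define L :: "'a set fgmod" where "L = quot_module ?U' {\<zero>\<^bsub>?U'\<^esub>}"
  have iso: "isomorphic_modules S ?U' L" unfolding L_def by (rule isomorphic_modulesI[OF quot_zero_iso[OF UM]])
  have LM: "module S L" unfolding L_def by (rule quot_module[OF UM module.zero_submodule[OF UM]])
  have nS: "noetherian_ring S" using locS by (simp add: local_ring_def)
  obtain m g where g: "g \<in> Lin S m b" "g ` vecs S m = ?U"
    by (rule noetherian_submodule_generated[OF Q.S nS U])
  have "fg_module S ?U'" by (rule fg_moduleI[OF UM mod_hom_restrict_cod[OF g(1)]]) (use g(2) in auto)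
  then have fgL: "fg_module S L" by (rule fg_module_iso[OF _ LM iso])
  note e = mod_coset_hom[OF Q.S.free_mod U] mod_coset_surj[OF Q.S.free_mod U] mod_coset_kernel[OF Q.S.free_mod U]
  have "?U \<subseteq> ideal_vecs (max_ideal S) b"
  proof
    fix y assume "y \<in> ?U"
    then obtain v where v: "v \<in> ideal_vecs (max_ideal R) b" "y = Q.vc b v" using V(2) by blast
    show "y \<in> ideal_vecs (max_ideal S) b"
      using v(1) unfolding v(2) max_ideal_S by (auto simp: ideal_vecs_def vec_class_def)
  qed
  then have "is_syzygy S 1 ?B L"
    using is_syzygy_1[OF locS quot_module[OF Q.S.free_mod U] e(1,2) _ fgL] isomorphic_modules_sym[OF UM LM iso]
    unfolding e(3) base_change_def by simp
  moreover have "short_exact S (mod_power ?B 1) K (mod_power L 1)"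
  proof (rule short_exact_iso[OF ex mod_power_1_iso[OF BM] _ BM mod_power_module[OF BM] K UM mod_power_module[OF LM]])
    show "isomorphic_modules S ?U' (mod_power L 1)"
      using isomorphic_modules_trans[OF iso isomorphic_modules_sym[OF mod_power_module[OF LM] LM mod_power_1_iso[OF LM]]] .
  qed
  ultimately show ?thesis unfolding reduces_to_def by blast
qed

lemma chain_of_presentation:
  "j \<le> N \<Longrightarrow> regular_presentation j b V \<Longrightarrow> \<exists>K. reducing_chain S (pd S) j K \<and> K 0 = base_change b V"
proof (induction j arbitrary: b V)
  case 0
  have V: "submodule V R (F b)" using 0(2) by (simp add: regular_presentation_def)
  have "pd S (base_change b V) < \<infinity>"
    by (rule finite_pd_of_has_ffr[OF base_change_module[OF V] has_ffr_base_change[OF 0(2)]])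
  then have "reducing_chain S (pd S) 0 (\<lambda>_. base_change b V)"
    using fg_base_change[OF V] by (simp add: reducing_chain_def)
  then show ?case by blast
next
  case (Suc j)
  have V: "submodule V R (F b)" "V \<subseteq> ideal_vecs (max_ideal R) b"
    using Suc.prems(2) by (auto simp: regular_presentation_def)
  obtain b' V' where pres: "regular_presentation j b' V'"
    and ex: "short_exact S (base_change b V) (base_change b' V') ((Free S b)\<lparr>carrier := Q.vc b ` V\<rparr>)"
    by (rule reducing_step[OF Suc_le_lessD[OF Suc.prems(1)] Suc.prems(2)])
  have V': "submodule V' R (F b')" using pres by (simp add: regular_presentation_def)
  obtain K where K: "reducing_chain S (pd S) j K" "K 0 = base_change b' V'" using Suc.IH[OF _ pres] Suc.prems(1) by auto
  have 1: "reduces_to S (base_change b V) (K 0)"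
    unfolding K(2) by (rule reduces_to_base_change[OF V base_change_module[OF V'] ex])
  have "reducing_chain S (pd S) (Suc j) (case_nat (base_change b V) K)"
    using K(1) fg_base_change[OF V(1)] 1 unfolding reducing_chain_def by (auto split: nat.splits)
  then show ?case by (intro exI[of _ "case_nat (base_change b V) K"]) simp
qed

lemma chain_of_finite_G_dim:
  fixes M :: "('a set, 'b, 'm) module_scheme"
  assumes fg: "fg_module S M" and G: "G_dim S M < \<infinity>"
  obtains K where "reducing_chain S (pd S) N K" "isomorphic_modules S (K 0) M"
proof -
  obtain b V where "regular_presentation N b V" "isomorphic_modules S (base_change b V) M"
    by (rule initial_presentation[OF fg has_ffr_finite_G_dim[OF fg_module_module[OF fg] G]])
  then show thesis using chain_of_presentation[OF order_refl] that by metis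
qed

lemma reducing_length_le:
  "reducing_chain S I r K \<Longrightarrow> 1 \<le> r \<Longrightarrow> isomorphic_modules S (K 0) M \<Longrightarrow> reducing_length S I M \<le> enat r"
  unfolding reducing_length_def reducing_sequence_iff by (rule Inf_lower) blast

text \<open>A shortest reducing sequence for G-dimension ends in a module of finite G-dimension; N
  further steps lead from there to finite projective dimension.\<close>

lemma red_pd_le_red_G_dim_add:
  fixes M :: "('a set, 'b, 'm) module_scheme"
  assumes fg: "fg_module S M" shows "red_pd S M \<le> red_G_dim S M + enat N"
proof (cases "pd S M < \<infinity>")
  case pd: False
  have M: "module S M" by (rule fg_module_module[OF fg])
  have red: "red_pd S M = reducing_length S (pd S) M" using pd by (simp add: red_pd_def)
  show ?thesis
  proof (cases "G_dim S M < \<infinity>")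
    case True
    obtain K where K: "reducing_chain S (pd S) N K" "isomorphic_modules S (K 0) M"
      by (rule chain_of_finite_G_dim[OF fg True])
    \<comment> \<open>A chain of length 0 is not a reducing sequence; here it would give
      \<open>M\<close> finite projective dimension, which is excluded in this case.\<close>
    have "N \<noteq> 0"
    proof
      assume "N = 0"
      then have K0: "fg_module S (K 0)" "pd S (K 0) < \<infinity>" using K(1) by (auto simp: reducing_chain_def)
      then obtain n where n: "has_resolution_of_length S (projective_module S) n (K 0)"
        unfolding pd_def resolution_dim_finite_iff by blast
      have "has_resolution_of_length S (projective_module S) n M"
        by (rule has_resolution_of_length_iso[OF fg_module_module[OF K0(1)] M K(2) n])
      then show False using pd unfolding pd_def resolution_dim_finite_iff by blast
    qed
    then have "1 \<le> N" by linarith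
    then have "red_pd S M \<le> enat N" unfolding red by (rule reducing_length_le[OF K(1) _ K(2)])
    then show ?thesis using True by (simp add: red_G_dim_def zero_enat_def)
  next
    case False
    then have redG: "red_G_dim S M = reducing_length S (G_dim S) M" by (simp add: red_G_dim_def)
    let ?A = "{enat r |r. \<exists>K. reducing_sequence S (G_dim S) r K \<and> isomorphic_modules S (K 0) M}"
    show ?thesis
    proof (cases "?A = {}")
      case True
      then show ?thesis unfolding redG reducing_length_def by (simp add: Inf_enat_def)
    next
      case ne: False
      then obtain x where "x \<in> ?A" by blast
      \<comment> \<open>The infimum of a nonempty set of extended naturals is attained.\<close>
      then have "(LEAST x. x \<in> ?A) \<in> ?A" by (rule LeastI)
      then have "Inf ?A \<in> ?A" using ne unfolding Inf_enat_def by simp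
      then obtain r K where r: "red_G_dim S M = enat r" and K: "reducing_sequence S (G_dim S) r K"
        and iso: "isomorphic_modules S (K 0) M" unfolding redG reducing_length_def by blast
      have K': "1 \<le> r" "\<forall>i\<le>r. fg_module S (K i)" "\<forall>i<r. reduces_to S (K i) (K (Suc i))" "G_dim S (K r) < \<infinity>"
        using K by (auto simp: reducing_sequence_iff reducing_chain_def)
      obtain L where L: "reducing_chain S (pd S) N L" "isomorphic_modules S (L 0) (K r)"
        by (rule chain_of_finite_G_dim[OF _ K'(4)]) (use K'(2) in blast)
      have "module S (L 0)" "module S (K r)" using L(1) K'(2) fg_module_module by (auto simp: reducing_chain_def)
      then have "isomorphic_modules S (K r) (L 0)" using isomorphic_modules_sym L(2) by blast
      then obtain K'' where K'': "reducing_chain S (pd S) (r + N) K''" "K'' 0 = K 0"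
        by (rule reducing_chain_append[OF K'(2,3) L(1) _ K'(1)])
      have "red_pd S M \<le> enat (r + N)"
        unfolding red by (rule reducing_length_le[OF K''(1)]) (use K'(1) K''(2) iso in auto)
      then show ?thesis by (simp add: r)
    qed
  qed
qed (simp add: red_pd_def)

lemma red_G_dim_le_red_pd: "red_G_dim S M \<le> red_pd S M"
proof (cases "G_dim S M < \<infinity>")
  case False
  then have pd: "\<not> pd S M < \<infinity>" using finite_G_dim_of_finite_pd[OF locS] by blast
  have "reducing_sequence S (G_dim S) r K" if "reducing_sequence S (pd S) r K" for r K
    using that finite_G_dim_of_finite_pd[OF locS] unfolding reducing_sequence_def by blast
  then have "reducing_length S (G_dim S) M \<le> reducing_length S (pd S) M"
    unfolding reducing_length_def by (intro Inf_superset_mono) blast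
  then show ?thesis using False pd by (simp add: red_G_dim_def red_pd_def)
qed (simp add: red_G_dim_def)

lemma red_pd_finite_iff:
  assumes "fg_module S M" shows "red_pd S M < \<infinity> \<longleftrightarrow> red_G_dim S M < \<infinity>"
proof
  assume "red_pd S M < \<infinity>" then show "red_G_dim S M < \<infinity>" by (rule le_less_trans[OF red_G_dim_le_red_pd])
next
  assume "red_G_dim S M < \<infinity>"
  then have "red_G_dim S M + enat N < \<infinity>" by (cases "red_G_dim S M") auto
  then show "red_pd S M < \<infinity>" by (rule le_less_trans[OF red_pd_le_red_G_dim_add[OF assms]])
qed

end

theorem proposition3p19:
  fixes R :: "('a, 'r) ring_scheme"
    and S :: "'a set ring"
    and xs :: "'a list"
    and M :: "('a set, 'b) module"
  assumes "local_ring R"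
    and "G_regular R"
    and "set xs \<subseteq> max_ideal R"
    and "regular_sequence R xs"
    and "S = R Quot (Idl\<^bsub>R\<^esub> (set xs))"
    and "fg_module S M"
  shows "red_G_dim S M \<le> red_pd S M
    \<and> red_pd S M \<le> red_G_dim S M + enat (length xs)
    \<and> (\<forall>N :: ('a set, 'c) module. fg_module S N \<longrightarrow> (red_pd S N < \<infinity> \<longleftrightarrow> red_G_dim S N < \<infinity>))"
proof -
  interpret G_regular_quotient R xs S by (rule G_regular_quotient.intro[OF assms(1-5)])
  show ?thesis using red_G_dim_le_red_pd red_pd_le_red_G_dim_add[OF assms(6)] red_pd_finite_iff by blast
qed
end
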